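(* Let $\alpha:=\nu+\nu_m-|\nu-\nu_m|>0$. For $j=1,\dots,J$ let $(v_j,w_j,q_j,r_j)$ satisfy the Elsässer MHD system given in the context, with the regularity assumptions $v_j,w_j\in L^\infty(0,T;H^m(\Omega)^d)$ for $m=\max\{2,k+1\}$, $v_{j,tt},w_{j,tt}\in L^\infty(0,T;H^1(\Omega)^d)$ and $v_{j,ttt},w_{j,ttt}\in L^\infty(0,T;L^2(\Omega)^d)$. Then the ensemble solution $(\langle v_h\rangle,\langle w_h\rangle)$ of the fully discrete scheme given in the context converges to the true ensemble solution: for any $$\Delta t\le \frac{\alpha h^2}{9C_i^2(\nu-\nu_m)^2+9C_i^2C_*^2\max\limits_{1\le j\le J}\big\{\|\nabla v_{j,h}^{'n}\|,\|\nabla w_{j,h}^{'n}\|\big\}}$$ (for all time levels $n=1,\dots,M-1$), one has $$\big\|\langle v\rangle^T-\langle v_h\rangle^M\big\|^2+\alpha\Delta t\sum_{n=2}^{M}\big\|\nabla\big(\langle v\rangle(t^n)-\langle v_h\rangle^n\big)\big\|^2\le\frac{2^{J+2}C}{J^2\alpha}\,e^{\frac{9TC}{\alpha}}\Big((\nu^2+\nu_m^2+1)h^{2k}+\big((\nu-\nu_m)^2+1\big)\Delta t^4\Big).$$ Here $\langle\cdot\rangle$ is the ensemble mean defined in the context: $\langle v_h\rangle^n=\frac1J\sum_{j=1}^J(2v_{j,h}^n-v_{j,h}^{n-1})$, $\langle v\rangle(t^n)=\frac1J\sum_{j=1}^J\big(2v_j(t^n)-v_j(t^{n-1})\big)$,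 and $\langle v\rangle^T=\langle v\rangle(t^M)$ with $t^M=T$. $C_i$ is the constant of the inverse inequality, $C_*$ is the constant of the trilinear-form bound, and $C$ is a generic positive constant independent of $h$ and $\Delta t$.
   Context: $\Omega\subset\mathbb{R}^d$ ($d=2,3$) is a convex polygonal or polyhedral domain, $T>0$ is the end time, $\nu$ is the kinematic viscosity and $\nu_m$ the magnetic resistivity. $\|\cdot\|$ and $(\cdot,\cdot)$ are the $L^2(\Omega)$ norm and inner product (or the duality pairing when the first argument lies in $H^{-1}$). $X:=H_0^1(\Omega)^d$, $Q:=L_0^2(\Omega)$. $C_*=C_*(\Omega)$ is a constant with $|(u\cdot\nabla v,w)|\le C_*\|\nabla u\|\|\nabla v\|\|\nabla w\|$ for all $u,v,w\in X$. Elsässer MHD system, for each ensemble member $j=1,\dots,J$, on $\Omega\times(0,T)$: $$v_{j,t}+w_j\cdot\nabla v_j+\nabla q_j-\tfrac{\nu+\nu_m}{2}\Delta v_j-\tfrac{\nu-\nu_m}{2}\Delta w_j=f_{1,j},$$ $$w_{j,t}+v_j\cdot\nabla w_j+\nabla r_j-\tfrac{\nu+\nu_m}{2}\Delta w_j-\tfrac{\nu-\nu_m}{2}\Delta v_j=f_{2,j},\qquad \nabla\cdot v_j=\nabla\cdot w_j=0,$$ together with initial conditions and homogeneous Dirichlet boundary conditions for $v_j,w_j$, where $f_{1,j},f_{2,j}\in L^\infty(0,T;H^{-1}(\Omega)^d)$. Ensemble mean and fluctuation: for a family $(u_j^n)$, $j=1,\dots,J$, $$\langle u\rangle^n:=\frac1J\sum_{j=1}^J(2u_j^n-u_j^{n-1}),\qquad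 u_j^{'n}:=2u_j^n-u_j^{n-1}-\langle u\rangle^n .$$ Finite elements: $X_h\subset X$ and $Q_h\subset Q$ are the conforming $(P_k,P_{k-1})$ velocity-pressure spaces ($k\ge d$) on a regular triangulation of mesh size $h$, satisfying the discrete inf-sup condition $\inf_{q_h\in Q_h}\sup_{v_h\in X_h}\frac{(q_h,\nabla\cdot v_h)}{\|q_h\|\|\nabla v_h\|}\ge\beta>0$ with $\beta$ independent of $h$. $V_h:=\{v_h\in X_h:(\nabla\cdot v_h,q_h)=0\ \forall q_h\in Q_h\}$; the elements are taken to be divergence-free, i.e. $\nabla\cdot v_h=0$ for $v_h\in V_h$. The mesh is sufficiently regular for the inverse inequality $\|\nabla u_h\|\le C_ih^{-1}\|u_h\|$ on $X_h$ to hold, and the following approximation properties hold: $\inf_{v_h\in X_h}\|u-v_h\|\le Ch^{k+1}|u|_{k+1}$, $\inf_{v_h\in X_h}\|\nabla(u-v_h)\|\le Ch^k|u|_{k+1}$, $\inf_{q_h\in Q_h}\|p-q_h\|\le Ch^k|p|_k$, $\|\nabla(u-P_{V_h}u)\|\le Ch^k|u|_{k+1}$ and $\inf_{v_h\in V_h}\|\nabla(u-v_h)\|\le Ch^k|u|_{k+1}$, where $|\cdot|_r$ is the $H^r$ seminorm and $P_{V_h}$ is the $L^2$ projection onto $V_h$. Scheme: let $\Delta t>0$, $M=T/\Delta t$, $t^n=n\Delta t$. Given initial conditions $v_{j,h}^0,w_{j,h}^0,v_{j,h}^1,w_{j,h}^1\in V_h$, for $n=1,\dots,M-1$ and $j=1,\dots,J$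 find $v_{j,h}^{n+1},w_{j,h}^{n+1}\in V_h$ such that for all $\chi_h,l_h\in V_h$ $$\Big(\tfrac{3v_{j,h}^{n+1}-4v_{j,h}^n+v_{j,h}^{n-1}}{2\Delta t},\chi_h\Big)+\tfrac{\nu+\nu_m}{2}(\nabla v_{j,h}^{n+1},\nabla\chi_h)+\tfrac{\nu-\nu_m}{2}(\nabla(2w_{j,h}^n-w_{j,h}^{n-1}),\nabla\chi_h)+(\langle w_h\rangle^n\cdot\nabla v_{j,h}^{n+1},\chi_h)+(w_{j,h}^{'n}\cdot\nabla(2v_{j,h}^n-v_{j,h}^{n-1}),\chi_h)=(f_{1,j}(t^{n+1}),\chi_h),$$ $$\Big(\tfrac{3w_{j,h}^{n+1}-4w_{j,h}^n+w_{j,h}^{n-1}}{2\Delta t},l_h\Big)+\tfrac{\nu+\nu_m}{2}(\nabla w_{j,h}^{n+1},\nabla l_h)+\tfrac{\nu-\nu_m}{2}(\nabla(2v_{j,h}^n-v_{j,h}^{n-1}),\nabla l_h)+(\langle v_h\rangle^n\cdot\nabla w_{j,h}^{n+1},l_h)+(v_{j,h}^{'n}\cdot\nabla(2w_{j,h}^n-w_{j,h}^{n-1}),l_h)=(f_{2,j}(t^{n+1}),l_h).$$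
   Formalization: The initial data at levels 0 and 1 are assumed accurate for every v_j, w_j: ‖e‖² + αΔt‖∇e‖² ≤ C₀(h^{2k}+Δt⁴), with C₀ arbitrary and C depending on C₀; for arbitrary initial data in V_h the bound fails. *)

theory Defs
  imports "HOL-Analysis.Analysis"
begin

section \<open>Function spaces on an open set\<close>

text \<open>
  Elements of Lebesgue and Sobolev spaces are represented by functions on the whole space, of which
  only the values almost everywhere on \<open>\<Omega>\<close> matter.  Derivatives are indexed by lists of basis
  vectors: \<open>[b\<^sub>1, \<dots>, b\<^sub>m]\<close> stands for the derivative of order \<open>m\<close> in these
  directions.  Accordingly the Sobolev (semi)norms below sum over all \<open>m\<close>-tuples of directions,
  i.e. they use the Frobenius norm of the tensor of derivatives.
\<close>

fun iter_deriv :: "'a list \<Rightarrow> ('a::euclidean_space \<Rightarrow> 'b::real_normed_vector) \<Rightarrow> 'a \<Rightarrow> 'b" where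
  "iter_deriv [] f = f"
| "iter_deriv (b # bs) f = (\<lambda>x. frechet_derivative (iter_deriv bs f) (at x) b)"

definition smooth :: "('a::euclidean_space \<Rightarrow> 'b::real_normed_vector) \<Rightarrow> bool" where
  "smooth f \<longleftrightarrow> (\<forall>bs x. set bs \<subseteq> Basis \<longrightarrow> iter_deriv bs f differentiable (at x))"

definition test_functions :: "'a::euclidean_space set \<Rightarrow> ('a \<Rightarrow> 'b::real_normed_vector) set" where
  "test_functions \<Omega> =
     {\<phi>. smooth \<phi> \<and> compact (closure {x. \<phi> x \<noteq> 0}) \<and> closure {x. \<phi> x \<noteq> 0} \<subseteq> \<Omega>}"

definition L2_space :: "'a::euclidean_space set \<Rightarrow> ('a \<Rightarrow> 'b::euclidean_space) set" where
  "L2_space \<Omega> = {f. f \<in> borel_measurable (lebesgue_on \<Omega>) \<and>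
                    integrable (lebesgue_on \<Omega>) (\<lambda>x. (norm (f x))\<^sup>2)}"

definition L2_inner ::
    "'a::euclidean_space set \<Rightarrow> ('a \<Rightarrow> 'b::euclidean_space) \<Rightarrow> ('a \<Rightarrow> 'b) \<Rightarrow> real" where
  "L2_inner \<Omega> f g = (LINT x|lebesgue_on \<Omega>. f x \<bullet> g x)"

definition L2_norm :: "'a::euclidean_space set \<Rightarrow> ('a \<Rightarrow> 'b::euclidean_space) \<Rightarrow> real" where
  "L2_norm \<Omega> f = sqrt (LINT x|lebesgue_on \<Omega>. (norm (f x))\<^sup>2)"

definition locally_integrable :: "'a::euclidean_space set \<Rightarrow> ('a \<Rightarrow> 'b::euclidean_space) \<Rightarrow> bool" where
  "locally_integrable \<Omega> f \<longleftrightarrow> (\<forall>K. compact K \<and> K \<subseteq> \<Omega> \<longrightarrow> f absolutely_integrable_on K)"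

definition is_weak_deriv ::
    "'a::euclidean_space set \<Rightarrow> 'a list \<Rightarrow> ('a \<Rightarrow> 'b::euclidean_space) \<Rightarrow> ('a \<Rightarrow> 'b) \<Rightarrow> bool" where
  "is_weak_deriv \<Omega> bs f g \<longleftrightarrow>
     locally_integrable \<Omega> f \<and> locally_integrable \<Omega> g \<and>
     (\<forall>\<phi> \<in> test_functions \<Omega>.
        (LINT x|lebesgue_on \<Omega>. (iter_deriv bs \<phi> x :: real) *\<^sub>R f x) =
        (-1) ^ length bs *\<^sub>R (LINT x|lebesgue_on \<Omega>. \<phi> x *\<^sub>R g x))"

text \<open>Unique up to null sets whenever a weak derivative exists.\<close>

definition weak_deriv ::
    "'a::euclidean_space set \<Rightarrow> 'a list \<Rightarrow> ('a \<Rightarrow> 'b::euclidean_space) \<Rightarrow> 'a \<Rightarrow> 'b" where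
  "weak_deriv \<Omega> bs f = (SOME g. is_weak_deriv \<Omega> bs f g)"

definition dir_lists :: "nat \<Rightarrow> 'a::euclidean_space list set" where
  "dir_lists m = {bs. set bs \<subseteq> Basis \<and> length bs = m}"

definition Sobolev :: "'a::euclidean_space set \<Rightarrow> nat \<Rightarrow> ('a \<Rightarrow> 'b::euclidean_space) set" where
  "Sobolev \<Omega> m = {u \<in> L2_space \<Omega>. \<forall>i\<le>m. \<forall>bs \<in> dir_lists i. \<exists>g \<in> L2_space \<Omega>. is_weak_deriv \<Omega> bs u g}"

definition Sobolev_seminorm ::
    "'a::euclidean_space set \<Rightarrow> nat \<Rightarrow> ('a \<Rightarrow> 'b::euclidean_space) \<Rightarrow> real" where
  "Sobolev_seminorm \<Omega> m u = sqrt (\<Sum>bs \<in> dir_lists m. (L2_norm \<Omega> (weak_deriv \<Omega> bs u))\<^sup>2)"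

definition Sobolev_norm ::
    "'a::euclidean_space set \<Rightarrow> nat \<Rightarrow> ('a \<Rightarrow> 'b::euclidean_space) \<Rightarrow> real" where
  "Sobolev_norm \<Omega> m u = sqrt (\<Sum>i\<le>m. (Sobolev_seminorm \<Omega> i u)\<^sup>2)"

type_synonym 'd scalar_field = "real ^ 'd \<Rightarrow> real"
type_synonym 'd vector_field = "real ^ 'd \<Rightarrow> real ^ 'd"

text \<open>Row \<open>i\<close> of the gradient is the partial derivative in the \<open>i\<close>-th coordinate direction.\<close>

definition grad :: "(real ^ 'd) set \<Rightarrow> (real ^ 'd \<Rightarrow> 'b::euclidean_space) \<Rightarrow> real ^ 'd \<Rightarrow> 'b ^ 'd" where
  "grad \<Omega> u x = (\<chi> i. weak_deriv \<Omega> [axis i 1] u x)"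

definition divergence :: "(real ^ 'd) set \<Rightarrow> 'd vector_field \<Rightarrow> 'd scalar_field" where
  "divergence \<Omega> u x = (\<Sum>i\<in>UNIV. grad \<Omega> u x $ i $ i)"

definition div_free :: "(real ^ 'd) set \<Rightarrow> 'd vector_field \<Rightarrow> bool" where
  "div_free \<Omega> u \<longleftrightarrow> (AE x in lebesgue_on \<Omega>. divergence \<Omega> u x = 0)"

text \<open>\<open>trilinear \<Omega> u v w\<close> is \<open>(u \<cdot> \<nabla>v, w)\<close>.\<close>

definition trilinear ::
    "(real ^ 'd) set \<Rightarrow> 'd vector_field \<Rightarrow> 'd vector_field \<Rightarrow> 'd vector_field \<Rightarrow> real" where
  "trilinear \<Omega> u v w = L2_inner \<Omega> (\<lambda>x. \<Sum>i\<in>UNIV. (u x $ i) *\<^sub>R (grad \<Omega> v x $ i)) w"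

definition H10 :: "(real ^ 'd) set \<Rightarrow> 'd vector_field set" where
  "H10 \<Omega> = {u \<in> Sobolev \<Omega> 1. \<exists>\<phi>. (\<forall>n. \<phi> n \<in> test_functions \<Omega>) \<and>
               (\<lambda>n. Sobolev_norm \<Omega> 1 (\<lambda>x. u x - \<phi> n x)) \<longlonglongrightarrow> 0}"

definition L20 :: "(real ^ 'd) set \<Rightarrow> 'd scalar_field set" where
  "L20 \<Omega> = {q \<in> L2_space \<Omega>. (LINT x|lebesgue_on \<Omega>. q x) = 0}"

text \<open>The dual of \<open>H10\<close>; boundedness makes the functionals insensitive to null sets.\<close>

definition Hm1 :: "(real ^ 'd) set \<Rightarrow> ('d vector_field \<Rightarrow> real) set" where
  "Hm1 \<Omega> = {F. (\<forall>u \<in> H10 \<Omega>. \<forall>w \<in> H10 \<Omega>. F (\<lambda>x. u x + w x) = F u + F w) \<and>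
               (\<forall>c. \<forall>u \<in> H10 \<Omega>. F (\<lambda>x. c *\<^sub>R u x) = c * F u) \<and>
               (\<exists>B. \<forall>u \<in> H10 \<Omega>. \<bar>F u\<bar> \<le> B * L2_norm \<Omega> (grad \<Omega> u))}"

definition Hm1_norm :: "(real ^ 'd) set \<Rightarrow> ('d vector_field \<Rightarrow> real) \<Rightarrow> real" where
  "Hm1_norm \<Omega> F = (SUP u \<in> {u \<in> H10 \<Omega>. L2_norm \<Omega> (grad \<Omega> u) \<le> 1}. \<bar>F u\<bar>)"


section \<open>Functions of time\<close>

text \<open>\<open>L\<^sup>\<infinity>(0,T;S)\<close> for a space \<open>S\<close> with norm \<open>N\<close>, with Bochner (strong) measurability.\<close>

definition Linf_time :: "real \<Rightarrow> 'b::minus set \<Rightarrow> ('b \<Rightarrow> real) \<Rightarrow> (real \<Rightarrow> 'b) \<Rightarrow> bool" where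
  "Linf_time T S N u \<longleftrightarrow>
     (AE t in lebesgue_on {0<..<T}. u t \<in> S) \<and>
     (\<exists>s. (\<forall>n. finite (s n ` {0<..<T}) \<and> s n ` {0<..<T} \<subseteq> S \<and>
               (\<forall>y. {t \<in> {0<..<T}. s n t = y} \<in> sets lebesgue)) \<and>
          (AE t in lebesgue_on {0<..<T}. (\<lambda>n::nat. N (u t - s n t)) \<longlonglongrightarrow> 0)) \<and>
     (\<exists>B. AE t in lebesgue_on {0<..<T}. N (u t) \<le> B)"

definition continuous_time_L2 ::
    "'a::euclidean_space set \<Rightarrow> real \<Rightarrow> (real \<Rightarrow> 'a \<Rightarrow> 'b::euclidean_space) \<Rightarrow> bool" where
  "continuous_time_L2 \<Omega> T u \<longleftrightarrow>
     (\<forall>t \<in> {0..T}. u t \<in> L2_space \<Omega> \<and>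
        ((\<lambda>s. L2_norm \<Omega> (\<lambda>x. u s x - u t x)) \<longlongrightarrow> 0) (at t within {0..T}))"

text \<open>
  \<open>g\<close> is the weak time derivative of \<open>u\<close>; the identity between \<open>L\<^sup>2\<close>-valued Bochner
  integrals is tested against all elements of \<open>L\<^sup>2\<close>.
\<close>

definition weak_time_deriv ::
    "'a::euclidean_space set \<Rightarrow> real \<Rightarrow> (real \<Rightarrow> 'a \<Rightarrow> 'b::euclidean_space) \<Rightarrow>
     (real \<Rightarrow> 'a \<Rightarrow> 'b) \<Rightarrow> bool" where
  "weak_time_deriv \<Omega> T u g \<longleftrightarrow>
     (\<forall>\<psi> \<in> test_functions {0<..<T}. \<forall>\<phi> \<in> L2_space \<Omega>.
        (LINT t|lebesgue_on {0<..<T}. deriv \<psi> t * L2_inner \<Omega> (u t) \<phi>) =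
        - (LINT t|lebesgue_on {0<..<T}. \<psi> t * L2_inner \<Omega> (g t) \<phi>))"


section \<open>The continuous problem\<close>

definition convex_polytopal_domain :: "'a::euclidean_space set \<Rightarrow> bool" where
  "convex_polytopal_domain \<Omega> \<longleftrightarrow> \<Omega> \<noteq> {} \<and> (\<exists>P. polytope P \<and> \<Omega> = interior P)"

text \<open>
  The momentum equation for \<open>v\<close> at one time, as an identity in the dual of \<open>H10\<close>;
  the equation for \<open>w\<close> is the same with \<open>v\<close> and \<open>w\<close> exchanged.
\<close>

definition elsasser_momentum ::
    "(real ^ 'd) set \<Rightarrow> real \<Rightarrow> real \<Rightarrow> ('d vector_field \<Rightarrow> real) \<Rightarrow> 'd vector_field \<Rightarrow>
     'd vector_field \<Rightarrow> 'd vector_field \<Rightarrow> 'd scalar_field \<Rightarrow> bool" where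
  "elsasser_momentum \<Omega> \<nu> \<nu>\<^sub>m F v\<^sub>t v w q \<longleftrightarrow>
     (\<forall>\<eta> \<in> H10 \<Omega>.
        L2_inner \<Omega> v\<^sub>t \<eta> + trilinear \<Omega> w v \<eta> - L2_inner \<Omega> q (divergence \<Omega> \<eta>)
        + (\<nu> + \<nu>\<^sub>m) / 2 * L2_inner \<Omega> (grad \<Omega> v) (grad \<Omega> \<eta>)
        + (\<nu> - \<nu>\<^sub>m) / 2 * L2_inner \<Omega> (grad \<Omega> w) (grad \<Omega> \<eta>) = F \<eta>)"

text \<open>
  \<open>v, w\<close> and their time derivatives \<open>v\<^sub>t, w\<^sub>t\<close> are the representatives that are
  continuous in time, so that point values in time make sense.  Since the scheme evaluates the
  forcing at the grid points \<open>t \<le> T\<close>, the equations are imposed at every \<open>t \<in> (0,T]\<close>.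
\<close>

definition elsasser_solution ::
    "(real ^ 'd) set \<Rightarrow> real \<Rightarrow> real \<Rightarrow> real \<Rightarrow> (real \<Rightarrow> 'd vector_field \<Rightarrow> real) \<Rightarrow>
     (real \<Rightarrow> 'd vector_field \<Rightarrow> real) \<Rightarrow> 'd vector_field \<Rightarrow> 'd vector_field \<Rightarrow>
     (real \<Rightarrow> 'd vector_field) \<Rightarrow> (real \<Rightarrow> 'd vector_field) \<Rightarrow>
     (real \<Rightarrow> 'd vector_field) \<Rightarrow> (real \<Rightarrow> 'd vector_field) \<Rightarrow>
     (real \<Rightarrow> 'd scalar_field) \<Rightarrow> (real \<Rightarrow> 'd scalar_field) \<Rightarrow> bool" where
  "elsasser_solution \<Omega> T \<nu> \<nu>\<^sub>m f\<^sub>1 f\<^sub>2 v\<^sub>0 w\<^sub>0 v w v\<^sub>t w\<^sub>t q r \<longleftrightarrow>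
     (\<forall>t \<in> {0..T}. v t \<in> H10 \<Omega> \<and> w t \<in> H10 \<Omega> \<and> div_free \<Omega> (v t) \<and> div_free \<Omega> (w t)) \<and>
     continuous_time_L2 \<Omega> T v \<and> continuous_time_L2 \<Omega> T w \<and>
     continuous_time_L2 \<Omega> T v\<^sub>t \<and> continuous_time_L2 \<Omega> T w\<^sub>t \<and>
     weak_time_deriv \<Omega> T v v\<^sub>t \<and> weak_time_deriv \<Omega> T w w\<^sub>t \<and>
     (\<forall>t \<in> {0<..T}. q t \<in> L20 \<Omega> \<and> r t \<in> L20 \<Omega> \<and>
        elsasser_momentum \<Omega> \<nu> \<nu>\<^sub>m (f\<^sub>1 t) (v\<^sub>t t) (v t) (w t) (q t) \<and>
        elsasser_momentum \<Omega> \<nu> \<nu>\<^sub>m (f\<^sub>2 t) (w\<^sub>t t) (w t) (v t) (r t)) \<and>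
     (AE x in lebesgue_on \<Omega>. v 0 x = v\<^sub>0 x) \<and> (AE x in lebesgue_on \<Omega>. w 0 x = w\<^sub>0 x)"

definition regular_solution ::
    "(real ^ 'd) set \<Rightarrow> real \<Rightarrow> nat \<Rightarrow> (real \<Rightarrow> 'd vector_field) \<Rightarrow> (real \<Rightarrow> 'd vector_field) \<Rightarrow> bool" where
  "regular_solution \<Omega> T m u u\<^sub>t \<longleftrightarrow>
     Linf_time T (Sobolev \<Omega> m) (Sobolev_norm \<Omega> m) u \<and>
     (\<exists>u\<^sub>t\<^sub>t u\<^sub>t\<^sub>t\<^sub>t. weak_time_deriv \<Omega> T u\<^sub>t u\<^sub>t\<^sub>t \<and> weak_time_deriv \<Omega> T u\<^sub>t\<^sub>t u\<^sub>t\<^sub>t\<^sub>t \<and>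
        Linf_time T (Sobolev \<Omega> 1) (Sobolev_norm \<Omega> 1) u\<^sub>t\<^sub>t \<and>
        Linf_time T (L2_space \<Omega>) (L2_norm \<Omega>) u\<^sub>t\<^sub>t\<^sub>t)"


section \<open>Finite elements\<close>

definition polys :: "nat \<Rightarrow> 'd::finite scalar_field set" where
  "polys k = {p. \<exists>c :: ('d \<Rightarrow> nat) \<Rightarrow> real.
                 \<forall>x. p x = (\<Sum>a | sum a UNIV \<le> k. c a * (\<Prod>i\<in>UNIV. (x $ i) ^ a i))}"

text \<open>Conforming simplicial triangulation, shape regular with constant \<open>\<sigma>\<close>.\<close>

definition regular_triangulation :: "(real ^ 'd::finite) set \<Rightarrow> real \<Rightarrow> (real ^ 'd) set set \<Rightarrow> bool" where
  "regular_triangulation \<Omega> \<sigma> \<T> \<longleftrightarrow>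
     triangulation \<T> \<and> \<Union>\<T> = closure \<Omega> \<and>
     (\<forall>K \<in> \<T>. int CARD('d) simplex K \<and>
        (\<exists>x \<rho>. 0 < \<rho> \<and> cball x \<rho> \<subseteq> K \<and> diameter K \<le> \<sigma> * \<rho>))"

definition mesh_size :: "(real ^ 'd) set set \<Rightarrow> real" where
  "mesh_size \<T> = Max (diameter ` \<T>)"

definition Xh :: "(real ^ 'd) set \<Rightarrow> nat \<Rightarrow> (real ^ 'd) set set \<Rightarrow> 'd vector_field set" where
  "Xh \<Omega> k \<T> = {u \<in> H10 \<Omega>. continuous_on (closure \<Omega>) u \<and>
                 (\<forall>K \<in> \<T>. \<forall>i. \<exists>p \<in> polys k. \<forall>x \<in> K. u x $ i = p x)}"

definition Qh_disc :: "(real ^ 'd) set \<Rightarrow> nat \<Rightarrow> (real ^ 'd) set set \<Rightarrow> 'd scalar_field set" where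
  "Qh_disc \<Omega> k \<T> = {q \<in> L20 \<Omega>. \<forall>K \<in> \<T>. \<exists>p \<in> polys (k - 1). \<forall>x \<in> interior K. q x = p x}"

definition Qh_cont :: "(real ^ 'd) set \<Rightarrow> nat \<Rightarrow> (real ^ 'd) set set \<Rightarrow> 'd scalar_field set" where
  "Qh_cont \<Omega> k \<T> = {q \<in> Qh_disc \<Omega> k \<T>. continuous_on (closure \<Omega>) q}"

definition Vh :: "(real ^ 'd) set \<Rightarrow> 'd vector_field set \<Rightarrow> 'd scalar_field set \<Rightarrow> 'd vector_field set" where
  "Vh \<Omega> X Q = {v \<in> X. \<forall>q \<in> Q. L2_inner \<Omega> (divergence \<Omega> v) q = 0}"

definition L2_proj :: "(real ^ 'd) set \<Rightarrow> 'd vector_field set \<Rightarrow> 'd vector_field \<Rightarrow> 'd vector_field" where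
  "L2_proj \<Omega> V u = (SOME p. p \<in> V \<and> (\<forall>\<eta> \<in> V. L2_inner \<Omega> (\<lambda>x. u x - p x) \<eta> = 0))"

text \<open>
  The quotient is \<open>0\<close> when \<open>v\<close> vanishes, so such \<open>v\<close> need not be excluded from the
  supremum.
\<close>

definition inf_sup ::
    "(real ^ 'd) set \<Rightarrow> real \<Rightarrow> 'd vector_field set \<Rightarrow> 'd scalar_field set \<Rightarrow> bool" where
  "inf_sup \<Omega> \<beta> X Q \<longleftrightarrow>
     (INF q \<in> {q \<in> Q. L2_norm \<Omega> q \<noteq> 0}. SUP v \<in> X.
        L2_inner \<Omega> q (divergence \<Omega> v) / (L2_norm \<Omega> q * L2_norm \<Omega> (grad \<Omega> v))) \<ge> \<beta>"

definition inverse_inequality ::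
    "(real ^ 'd) set \<Rightarrow> real \<Rightarrow> real \<Rightarrow> 'd vector_field set \<Rightarrow> bool" where
  "inverse_inequality \<Omega> C\<^sub>i h X \<longleftrightarrow>
     (\<forall>u \<in> X. L2_norm \<Omega> (grad \<Omega> u) \<le> C\<^sub>i * inverse h * L2_norm \<Omega> u)"

text \<open>
  The last two estimates concern divergence-free fields only: the fields in \<open>V\<close> are
  divergence-free and so cannot approximate other ones.
\<close>

definition approximation_properties ::
    "(real ^ 'd) set \<Rightarrow> nat \<Rightarrow> real \<Rightarrow> real \<Rightarrow> 'd vector_field set \<Rightarrow> 'd scalar_field set \<Rightarrow> bool" where
  "approximation_properties \<Omega> k c h X Q \<longleftrightarrow>
     (\<forall>u \<in> H10 \<Omega> \<inter> Sobolev \<Omega> (k + 1).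
        (INF v \<in> X. L2_norm \<Omega> (\<lambda>x. u x - v x)) \<le> c * h ^ (k + 1) * Sobolev_seminorm \<Omega> (k + 1) u \<and>
        (INF v \<in> X. L2_norm \<Omega> (grad \<Omega> (\<lambda>x. u x - v x)))
          \<le> c * h ^ k * Sobolev_seminorm \<Omega> (k + 1) u) \<and>
     (\<forall>p \<in> L20 \<Omega> \<inter> Sobolev \<Omega> k.
        (INF q \<in> Q. L2_norm \<Omega> (\<lambda>x. p x - q x)) \<le> c * h ^ k * Sobolev_seminorm \<Omega> k p) \<and>
     (\<forall>u \<in> H10 \<Omega> \<inter> Sobolev \<Omega> (k + 1). div_free \<Omega> u \<longrightarrow>
        L2_norm \<Omega> (grad \<Omega> (\<lambda>x. u x - L2_proj \<Omega> (Vh \<Omega> X Q) u x))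
          \<le> c * h ^ k * Sobolev_seminorm \<Omega> (k + 1) u \<and>
        (INF v \<in> Vh \<Omega> X Q. L2_norm \<Omega> (grad \<Omega> (\<lambda>x. u x - v x)))
          \<le> c * h ^ k * Sobolev_seminorm \<Omega> (k + 1) u)"

text \<open>
  A set of meshes with a choice of pressure space on each mesh; all constants are uniform over the
  set.  Both piecewise polynomial pressure spaces of degree \<open>k - 1\<close> are admitted, as long as the
  resulting elements are divergence-free.
\<close>

definition fe_family ::
    "(real ^ 'd) set \<Rightarrow> nat \<Rightarrow> real \<Rightarrow> real \<Rightarrow> real \<Rightarrow> real \<Rightarrow> (real ^ 'd) set set set \<Rightarrow>
     ((real ^ 'd) set set \<Rightarrow> 'd scalar_field set) \<Rightarrow> bool" where
  "fe_family \<Omega> k \<sigma> \<beta> C\<^sub>i c Mesh Qh \<longleftrightarrow>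
     (\<forall>\<T> \<in> Mesh.
        regular_triangulation \<Omega> \<sigma> \<T> \<and>
        (Qh \<T> = Qh_disc \<Omega> k \<T> \<or> Qh \<T> = Qh_cont \<Omega> k \<T>) \<and>
        inf_sup \<Omega> \<beta> (Xh \<Omega> k \<T>) (Qh \<T>) \<and>
        (\<forall>v \<in> Vh \<Omega> (Xh \<Omega> k \<T>) (Qh \<T>). div_free \<Omega> v) \<and>
        inverse_inequality \<Omega> C\<^sub>i (mesh_size \<T>) (Xh \<Omega> k \<T>) \<and>
        approximation_properties \<Omega> k c (mesh_size \<T>) (Xh \<Omega> k \<T>) (Qh \<T>))"


section \<open>Ensemble scheme\<close>

text \<open>A sequence \<open>u j n\<close> is indexed by the ensemble member \<open>j\<close> and the time level \<open>n\<close>.\<close>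

definition extrapolation :: "(nat \<Rightarrow> 'd::finite vector_field) \<Rightarrow> nat \<Rightarrow> 'd vector_field" where
  "extrapolation u n x = 2 *\<^sub>R u n x - u (n - 1) x"

definition ens_mean :: "nat \<Rightarrow> (nat \<Rightarrow> nat \<Rightarrow> 'd::finite vector_field) \<Rightarrow> nat \<Rightarrow> 'd vector_field" where
  "ens_mean J u n x = (1 / real J) *\<^sub>R (\<Sum>j=1..J. extrapolation (u j) n x)"

definition fluctuation :: "nat \<Rightarrow> (nat \<Rightarrow> nat \<Rightarrow> 'd::finite vector_field) \<Rightarrow> nat \<Rightarrow> nat \<Rightarrow> 'd vector_field" where
  "fluctuation J u j n x = extrapolation (u j) n x - ens_mean J u n x"

text \<open>
  One time step for \<open>v\<close>; the step for \<open>w\<close> is the same with \<open>v\<close> and \<open>w\<close> exchanged.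
\<close>

definition scheme_step ::
    "(real ^ 'd) set \<Rightarrow> real \<Rightarrow> real \<Rightarrow> real \<Rightarrow> nat \<Rightarrow> 'd vector_field set \<Rightarrow>
     ('d vector_field \<Rightarrow> real) \<Rightarrow> (nat \<Rightarrow> nat \<Rightarrow> 'd vector_field) \<Rightarrow>
     (nat \<Rightarrow> nat \<Rightarrow> 'd vector_field) \<Rightarrow> nat \<Rightarrow> nat \<Rightarrow> bool" where
  "scheme_step \<Omega> \<nu> \<nu>\<^sub>m \<Delta>t J V F v w j n \<longleftrightarrow>
     (\<forall>\<eta> \<in> V.
        L2_inner \<Omega> (\<lambda>x. (1 / (2 * \<Delta>t)) *\<^sub>R
            (3 *\<^sub>R v j (n + 1) x - 4 *\<^sub>R v j n x + v j (n - 1) x)) \<eta>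
        + (\<nu> + \<nu>\<^sub>m) / 2 * L2_inner \<Omega> (grad \<Omega> (v j (n + 1))) (grad \<Omega> \<eta>)
        + (\<nu> - \<nu>\<^sub>m) / 2 * L2_inner \<Omega> (grad \<Omega> (extrapolation (w j) n)) (grad \<Omega> \<eta>)
        + trilinear \<Omega> (ens_mean J w n) (v j (n + 1)) \<eta>
        + trilinear \<Omega> (fluctuation J w j n) (extrapolation (v j) n) \<eta>
        = F \<eta>)"

definition scheme_solution ::
    "(real ^ 'd) set \<Rightarrow> real \<Rightarrow> real \<Rightarrow> real \<Rightarrow> nat \<Rightarrow> nat \<Rightarrow> 'd vector_field set \<Rightarrow>
     (nat \<Rightarrow> real \<Rightarrow> 'd vector_field \<Rightarrow> real) \<Rightarrow> (nat \<Rightarrow> real \<Rightarrow> 'd vector_field \<Rightarrow> real) \<Rightarrow>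
     (nat \<Rightarrow> nat \<Rightarrow> 'd vector_field) \<Rightarrow> (nat \<Rightarrow> nat \<Rightarrow> 'd vector_field) \<Rightarrow> bool" where
  "scheme_solution \<Omega> \<nu> \<nu>\<^sub>m \<Delta>t M J V f\<^sub>1 f\<^sub>2 v w \<longleftrightarrow>
     (\<forall>j \<in> {1..J}. \<forall>n \<le> max 1 M. v j n \<in> V \<and> w j n \<in> V) \<and>
     (\<forall>j \<in> {1..J}. \<forall>n \<in> {1..<M}.
        scheme_step \<Omega> \<nu> \<nu>\<^sub>m \<Delta>t J V (f\<^sub>1 j (real (n + 1) * \<Delta>t)) v w j n \<and>
        scheme_step \<Omega> \<nu> \<nu>\<^sub>m \<Delta>t J V (f\<^sub>2 j (real (n + 1) * \<Delta>t)) w v j n)"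

text \<open>
  The initial data at the two starting levels approximate the solution to the order of the method,
  in the same norm in which the error is estimated.
\<close>

definition initial_accuracy ::
    "(real ^ 'd) set \<Rightarrow> real \<Rightarrow> real \<Rightarrow> nat \<Rightarrow> real \<Rightarrow> real \<Rightarrow> nat \<Rightarrow>
     (nat \<Rightarrow> real \<Rightarrow> 'd vector_field) \<Rightarrow> (nat \<Rightarrow> nat \<Rightarrow> 'd vector_field) \<Rightarrow> bool" where
  "initial_accuracy \<Omega> \<alpha> c k h \<Delta>t J u u\<^sub>h \<longleftrightarrow>
     (\<forall>j \<in> {1..J}. \<forall>n \<in> {0, 1}.
        (L2_norm \<Omega> (\<lambda>x. u j (real n * \<Delta>t) x - u\<^sub>h j n x))\<^sup>2
        + \<alpha> * \<Delta>t * (L2_norm \<Omega> (grad \<Omega> (\<lambda>x. u j (real n * \<Delta>t) x - u\<^sub>h j n x)))\<^sup>2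
        \<le> c * (h ^ (2 * k) + \<Delta>t ^ 4))"

definition time_step_denominator ::
    "(real ^ 'd) set \<Rightarrow> real \<Rightarrow> real \<Rightarrow> real \<Rightarrow> real \<Rightarrow> nat \<Rightarrow>
     (nat \<Rightarrow> nat \<Rightarrow> 'd vector_field) \<Rightarrow> (nat \<Rightarrow> nat \<Rightarrow> 'd vector_field) \<Rightarrow> nat \<Rightarrow> real" where
  "time_step_denominator \<Omega> \<nu> \<nu>\<^sub>m C\<^sub>i C\<^sub>s J v w n =
     9 * C\<^sub>i\<^sup>2 * (\<nu> - \<nu>\<^sub>m)\<^sup>2
     + 9 * C\<^sub>i\<^sup>2 * C\<^sub>s\<^sup>2 *
         Max (\<Union>j \<in> {1..J}. {L2_norm \<Omega> (grad \<Omega> (fluctuation J v j n)),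
                             L2_norm \<Omega> (grad \<Omega> (fluctuation J w j n))})"

text \<open>
  A vanishing denominator (e.g. \<open>J = 1\<close> and \<open>\<nu> = \<nu>\<^sub>m\<close>) imposes no restriction; division
  by zero in HOL would yield \<open>0\<close> instead.
\<close>

definition time_step_condition ::
    "(real ^ 'd) set \<Rightarrow> real \<Rightarrow> real \<Rightarrow> real \<Rightarrow> real \<Rightarrow> real \<Rightarrow> real \<Rightarrow> real \<Rightarrow> nat \<Rightarrow> nat \<Rightarrow>
     (nat \<Rightarrow> nat \<Rightarrow> 'd vector_field) \<Rightarrow> (nat \<Rightarrow> nat \<Rightarrow> 'd vector_field) \<Rightarrow> bool" where
  "time_step_condition \<Omega> \<alpha> \<nu> \<nu>\<^sub>m C\<^sub>i C\<^sub>s h \<Delta>t M J v w \<longleftrightarrow>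
     (\<forall>n \<in> {1..<M}. time_step_denominator \<Omega> \<nu> \<nu>\<^sub>m C\<^sub>i C\<^sub>s J v w n = 0 \<or>
        \<Delta>t \<le> \<alpha> * h\<^sup>2 / time_step_denominator \<Omega> \<nu> \<nu>\<^sub>m C\<^sub>i C\<^sub>s J v w n)"

end

theory Submission
  imports Defs "HOL-Library.Function_Algebras"
begin

text \<open>
  The constant \<open>C\<close> is generic, so it suffices to bound the error by \<open>K (h\<^sup>2\<^sup>k + \<Delta>t\<^sup>4)\<close> with \<open>K\<close>
  independent of the mesh and of \<open>\<Delta>t\<close>.  Let \<open>\<phi> = u\<^sub>h - P u\<close> with the \<open>L\<^sup>2\<close> projection \<open>P\<close> onto \<open>V\<close>.
  The energy identity of BDF2 controls \<open>\<phi>\<close> and leaves its second time difference as numerical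
  dissipation.  By skew symmetry and the inverse inequality, the convection of \<open>\<phi>\<close> by the fluctuation
  is absorbed into this dissipation if \<open>\<Delta>t X\<^sup>2 \<le> c h\<^sup>2\<close>, where \<open>X\<close> is the \<open>H\<^sup>1\<close> seminorm of the
  fluctuation.  The step size restriction only provides \<open>\<Delta>t X \<le> c h\<^sup>2\<close>, which is enough for \<open>X \<le> 1\<close>.
  If \<open>X > 1\<close>, then \<open>\<Delta>t \<le> c h\<^sup>2\<close>; the fluctuation of \<open>u\<^sub>h\<close> is split into those of \<open>P u\<close> and of \<open>\<phi>\<close>, and the
  latter is at most of the order \<open>h\<^sup>-\<^sup>1 (h\<^sup>k + \<Delta>t\<^sup>2)\<close> by the bound already established at the previous
  levels, so that it is absorbed for all \<open>\<Delta>t\<close> below a fixed threshold.  Above the threshold \<open>X / h\<close> is bounded.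

  No Sobolev embedding is needed: in the terms with the exact solution, the solution is replaced by a
  smooth function that is close to it in \<open>H\<^sup>1\<close>, uniformly in time.  Its regularity in time is
  deduced from that of the scalar functions \<open>t \<mapsto> (v(t), f)\<close>.
\<close>

section \<open>Semi-inner product spaces\<close>

text \<open>The obstacle that shapes the set-up is that the integral of a non-integrable function is
  0 by convention. So \<open>trilinear\<close> is additive only where its integrands are integrable,
  and the bound with the constant \<open>Cs\<close> does not provide this. Integrability is certain
  when the third argument is bounded almost everywhere. Finite element fields are bounded, hence
  every test field of the error argument is of this kind, and the exact solution occurs only in the
  other two slots. The error recursion therefore runs in an abstract vector space with three classes
  of fields: all, bounded, divergence-free. The forms are only semidefinite because elements are
  functions and not classes modulo null sets.

  A second obstacle is that the first time derivative is known only in L2, while H1 control is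
  assumed for the second one. The H1 estimates in time come from three-point combinations of values
  in which the first derivative cancels. They are obtained by pairing with Laplacians of test
  functions.\<close>

locale semi_inner =
  fixes H :: "'v::real_vector set" and ip :: "'v \<Rightarrow> 'v \<Rightarrow> real"
  assumes subspace_H: "subspace H"
    and add_left: "x \<in> H \<Longrightarrow> y \<in> H \<Longrightarrow> z \<in> H \<Longrightarrow> ip (x + y) z = ip x z + ip y z"
    and scale_left: "x \<in> H \<Longrightarrow> z \<in> H \<Longrightarrow> ip (c *\<^sub>R x) z = c * ip x z"
    and sym: "x \<in> H \<Longrightarrow> y \<in> H \<Longrightarrow> ip x y = ip y x"
    and nonneg: "x \<in> H \<Longrightarrow> 0 \<le> ip x x"
begin

definition nrm :: "'v \<Rightarrow> real" where "nrm x = sqrt (ip x x)"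

lemma H_add [simp, intro]: "x \<in> H \<Longrightarrow> y \<in> H \<Longrightarrow> x + y \<in> H"
  and H_scale [simp, intro]: "x \<in> H \<Longrightarrow> c *\<^sub>R x \<in> H"
  and H_diff [simp, intro]: "x \<in> H \<Longrightarrow> y \<in> H \<Longrightarrow> x - y \<in> H"
  and H_0 [simp, intro]: "0 \<in> H"
  using subspace_H by (auto intro: subspace_add subspace_scale subspace_diff subspace_0)

lemma H_minus [simp, intro]: "x \<in> H \<Longrightarrow> - x \<in> H"
  using H_scale[of x "-1"] by simp

lemma diff_left: "x \<in> H \<Longrightarrow> y \<in> H \<Longrightarrow> z \<in> H \<Longrightarrow> ip (x - y) z = ip x z - ip y z"
  using add_left[of x "(-1) *\<^sub>R y" z] scale_left[of y z "-1"] by simp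

lemma add_right: "x \<in> H \<Longrightarrow> y \<in> H \<Longrightarrow> z \<in> H \<Longrightarrow> ip z (x + y) = ip z x + ip z y"
  and diff_right: "x \<in> H \<Longrightarrow> y \<in> H \<Longrightarrow> z \<in> H \<Longrightarrow> ip z (x - y) = ip z x - ip z y"
  and scale_right: "x \<in> H \<Longrightarrow> z \<in> H \<Longrightarrow> ip z (c *\<^sub>R x) = c * ip z x"
  using sym[of z] add_left[of x y z] diff_left[of x y z] scale_left[of x z c] by simp_all

lemmas ip_lin = add_left diff_left scale_left add_right diff_right scale_right

lemma nrm_ge_0 [simp]: "x \<in> H \<Longrightarrow> 0 \<le> nrm x"
  by (simp add: nrm_def nonneg)

lemma nrm_sq: "x \<in> H \<Longrightarrow> (nrm x)\<^sup>2 = ip x x"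
  by (simp add: nrm_def nonneg)

lemma Cauchy_Schwarz_sq:
  assumes x: "x \<in> H" and y: "y \<in> H"
  shows "(ip x y)\<^sup>2 \<le> ip x x * ip y y"
proof -
  have q: "0 \<le> ip x x - 2 * t * ip x y + t\<^sup>2 * ip y y" for t
    using nonneg[of "x - t *\<^sub>R y"] x y sym[OF y x]
    by (simp add: ip_lin algebra_simps power2_eq_square)
  show ?thesis
  proof (cases "ip y y = 0")
    case True
    have "ip x y = 0"
    proof (rule ccontr)
      assume "ip x y \<noteq> 0"
      \<comment> \<open>In the degenerate case the quadratic in t is affine, and at this t it takes
        the value -1.\<close>
      then show False
        using q[of "(ip x x + 1) / (2 * ip x y)"] True by simp
    qed
    then show ?thesis using True by simp
  next
    case False
    then have "0 < ip y y" using nonneg[OF y] by simp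
    have "0 \<le> ip x x - 2 * (ip x y / ip y y) * ip x y + (ip x y / ip y y)\<^sup>2 * ip y y"
      by (rule q)
    also have "\<dots> = ip x x - (ip x y)\<^sup>2 / ip y y"
      using \<open>0 < ip y y\<close> by (simp add: power2_eq_square)
    finally show ?thesis using \<open>0 < ip y y\<close> by (simp add: pos_divide_le_eq)
  qed
qed

lemma Cauchy_Schwarz: "x \<in> H \<Longrightarrow> y \<in> H \<Longrightarrow> \<bar>ip x y\<bar> \<le> nrm x * nrm y"
  using real_sqrt_le_mono[OF Cauchy_Schwarz_sq[of x y]] unfolding nrm_def
  by (simp add: real_sqrt_mult)

lemma nrm_triangle:
  assumes x: "x \<in> H" and y: "y \<in> H"
  shows "nrm (x + y) \<le> nrm x + nrm y"
proof -
  have "(nrm (x + y))\<^sup>2 = (nrm x)\<^sup>2 + 2 * ip x y + (nrm y)\<^sup>2"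
    using x y sym[OF y x] by (simp add: nrm_sq ip_lin)
  also have "\<dots> \<le> (nrm x + nrm y)\<^sup>2"
    using Cauchy_Schwarz[OF x y] by (simp add: power2_sum)
  finally show ?thesis by (rule power2_le_imp_le) (use x y in simp)
qed

lemma nrm_scale: "x \<in> H \<Longrightarrow> nrm (c *\<^sub>R x) = \<bar>c\<bar> * nrm x"
  unfolding nrm_def by (simp add: ip_lin real_sqrt_mult mult.assoc[symmetric])

lemma nrm_0 [simp]: "nrm 0 = 0"
  using nrm_scale[of 0 0] by simp

lemma nrm_minus_commute:
  assumes "x \<in> H" "y \<in> H" shows "nrm (x - y) = nrm (y - x)"
  using nrm_scale[of "y - x" "-1"] assms by (simp add: algebra_simps)

lemma nrm_triangle_diff: "x \<in> H \<Longrightarrow> y \<in> H \<Longrightarrow> nrm (x - y) \<le> nrm x + nrm y"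
  using nrm_triangle[of x "(-1) *\<^sub>R y"] nrm_scale[of y "-1"] by simp

lemma nrm_triangle_rev: "x \<in> H \<Longrightarrow> y \<in> H \<Longrightarrow> nrm x \<le> nrm (x - y) + nrm y"
  using nrm_triangle[of "x - y" y] by simp

lemma nrm_sum: "finite A \<Longrightarrow> (\<And>a. a \<in> A \<Longrightarrow> f a \<in> H) \<Longrightarrow> nrm (\<Sum>a\<in>A. f a) \<le> (\<Sum>a\<in>A. nrm (f a))"
proof (induction A rule: finite_induct)
  case (insert a A)
  have "(\<Sum>a\<in>A. f a) \<in> H" using insert by (intro subspace_sum[OF subspace_H]) auto
  then show ?case using insert nrm_triangle[of "f a" "\<Sum>a\<in>A. f a"] by fastforce
qed simp

text \<open>G-stability of BDF2, with \<open>a\<close>, \<open>b\<close>, \<open>c\<close> the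
  values at the levels n + 1, n, n - 1: a telescoping energy plus the square of the second
  difference. That square is the numerical dissipation which later absorbs the explicit viscous
  coupling and the explicit fluctuation term.\<close>

lemma bdf2_identity:
  assumes "a \<in> H" "b \<in> H" "c \<in> H"
  shows "2 * (3 * ip a a - 4 * ip b a + ip c a) =
    (nrm a)\<^sup>2 + (nrm (2 *\<^sub>R a - b))\<^sup>2 - (nrm b)\<^sup>2 - (nrm (2 *\<^sub>R b - c))\<^sup>2
    + (nrm (a - 2 *\<^sub>R b + c))\<^sup>2"
  using assms by (simp add: nrm_sq ip_lin sym[of b a] sym[of c a] sym[of c b])

end

section \<open>Extrapolation, ensemble mean and fluctuation in a vector space\<close>

definition ext :: "(nat \<Rightarrow> 'v::real_vector) \<Rightarrow> nat \<Rightarrow> 'v" where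
  "ext u n = 2 *\<^sub>R u n - u (n - 1)"

definition emean :: "nat \<Rightarrow> (nat \<Rightarrow> nat \<Rightarrow> 'v::real_vector) \<Rightarrow> nat \<Rightarrow> 'v" where
  "emean J u n = (1 / real J) *\<^sub>R (\<Sum>j=1..J. ext (u j) n)"

definition fluc :: "nat \<Rightarrow> (nat \<Rightarrow> nat \<Rightarrow> 'v::real_vector) \<Rightarrow> nat \<Rightarrow> nat \<Rightarrow> 'v" where
  "fluc J u j n = ext (u j) n - emean J u n"

lemma ext_diff: "ext (\<lambda>n. u n - v n) n = ext u n - ext v n"
  by (simp add: ext_def algebra_simps)

lemma emean_diff: "emean J (\<lambda>j n. u j n - v j n) n = emean J u n - emean J v n"
  by (simp add: emean_def ext_diff sum_subtractf algebra_simps)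

lemma fluc_diff: "fluc J (\<lambda>j n. u j n - v j n) j n = fluc J u j n - fluc J v j n"
  by (simp add: fluc_def ext_diff emean_diff algebra_simps)

context semi_inner
begin

lemma ext_in [simp]: "u n \<in> H \<Longrightarrow> u (n - 1) \<in> H \<Longrightarrow> ext u n \<in> H"
  by (simp add: ext_def)

lemma emean_in [simp]:
  assumes "\<And>j. j \<in> {1..J} \<Longrightarrow> u j n \<in> H \<and> u j (n - 1) \<in> H"
  shows "emean J u n \<in> H"
  unfolding emean_def using assms by (intro H_scale subspace_sum[OF subspace_H]) auto

lemma nrm_ext_le: "u n \<in> H \<Longrightarrow> u (n - 1) \<in> H \<Longrightarrow> nrm (ext u n) \<le> 2 * nrm (u n) + nrm (u (n - 1))"
  unfolding ext_def using nrm_triangle_diff[of "2 *\<^sub>R u n" "u (n - 1)"] by (simp add: nrm_scale)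

lemma nrm_emean_le:
  assumes "\<And>j. j \<in> {1..J} \<Longrightarrow> u j n \<in> H \<and> u j (n - 1) \<in> H"
  shows "nrm (emean J u n) \<le> (1 / real J) * (\<Sum>j=1..J. 2 * nrm (u j n) + nrm (u j (n - 1)))"
proof -
  have "nrm (\<Sum>j=1..J. ext (u j) n) \<le> (\<Sum>j=1..J. nrm (ext (u j) n))"
    using assms by (intro nrm_sum) auto
  also have "\<dots> \<le> (\<Sum>j=1..J. 2 * nrm (u j n) + nrm (u j (n - 1)))"
    using assms by (intro sum_mono nrm_ext_le) auto
  finally have le: "nrm (\<Sum>j=1..J. ext (u j) n) \<le> (\<Sum>j=1..J. 2 * nrm (u j n) + nrm (u j (n - 1)))" .
  have "(\<Sum>j=1..J. ext (u j) n) \<in> H"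
    using assms by (intro subspace_sum[OF subspace_H]) auto
  from nrm_scale[OF this, of "1 / real J"] show ?thesis
    unfolding emean_def using mult_left_mono[OF le, of "1 / real J"] by simp
qed

end

section \<open>The error recursion\<close>

text \<open>\<open>H\<close> stands for H10, \<open>Hb\<close> for its almost everywhere bounded
  fields and \<open>Hd\<close> for its divergence-free ones. Linearity of \<open>tri\<close> asks
  for a third argument in \<open>Hb\<close>; since \<open>tri_skew\<close> exchanges the last two
  arguments, it asks this of both. \<open>gp\<close> is the inner product of gradients.\<close>

locale elsasser_forms = L: semi_inner H ip + G: semi_inner H gp
  for H :: "'v::real_vector set" and ip gp :: "'v \<Rightarrow> 'v \<Rightarrow> real" +
  fixes Hb Hd :: "'v set" and tri :: "'v \<Rightarrow> 'v \<Rightarrow> 'v \<Rightarrow> real" and Cs CP :: real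
  assumes Hb_sub: "Hb \<subseteq> H" and Hd_sub: "Hd \<subseteq> H"
    and tri_add1: "\<And>x y z w. x \<in> H \<Longrightarrow> y \<in> H \<Longrightarrow> z \<in> H \<Longrightarrow> w \<in> Hb \<Longrightarrow> tri (x + y) z w = tri x z w + tri y z w"
    and tri_scale1: "\<And>x z w c. x \<in> H \<Longrightarrow> z \<in> H \<Longrightarrow> w \<in> Hb \<Longrightarrow> tri (c *\<^sub>R x) z w = c * tri x z w"
    and tri_add2: "\<And>x y z w. x \<in> H \<Longrightarrow> y \<in> H \<Longrightarrow> z \<in> H \<Longrightarrow> w \<in> Hb \<Longrightarrow> tri z (x + y) w = tri z x w + tri z y w"
    and tri_scale2: "\<And>x z w c. x \<in> H \<Longrightarrow> z \<in> H \<Longrightarrow> w \<in> Hb \<Longrightarrow> tri z (c *\<^sub>R x) w = c * tri z x w"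
    and tri_bound: "\<And>x y z. x \<in> H \<Longrightarrow> y \<in> H \<Longrightarrow> z \<in> Hb \<Longrightarrow> \<bar>tri x y z\<bar> \<le> Cs * G.nrm x * G.nrm y * G.nrm z"
    and tri_skew: "\<And>x y z. x \<in> Hd \<Longrightarrow> y \<in> Hb \<Longrightarrow> z \<in> Hb \<Longrightarrow> tri x y z = - tri x z y"
    and poincare: "\<And>x. x \<in> H \<Longrightarrow> L.nrm x \<le> CP * G.nrm x"
    and Cs_pos: "0 < Cs" and CP_nonneg: "0 \<le> CP"
begin

abbreviation l2 :: "'v \<Rightarrow> real" where "l2 \<equiv> L.nrm"
abbreviation h1 :: "'v \<Rightarrow> real" where "h1 \<equiv> G.nrm"

lemma tri_diff1: "x \<in> H \<Longrightarrow> y \<in> H \<Longrightarrow> z \<in> H \<Longrightarrow> w \<in> Hb \<Longrightarrow> tri (x - y) z w = tri x z w - tri y z w"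
  using tri_add1[of x "- y" z w] tri_scale1[of y z w "-1"] by simp

lemma tri_diff2: "x \<in> H \<Longrightarrow> y \<in> H \<Longrightarrow> z \<in> H \<Longrightarrow> w \<in> Hb \<Longrightarrow> tri z (x - y) w = tri z x w - tri z y w"
  using tri_add2[of x "- y" z w] tri_scale2[of y z w "-1"] by simp

lemmas tri_lin = tri_add1 tri_scale1 tri_diff1 tri_add2 tri_scale2 tri_diff2

lemma tri_self: "x \<in> Hd \<Longrightarrow> y \<in> Hb \<Longrightarrow> tri x y y = 0"
  using tri_skew[of x y y] by simp

lemma tri_sum1:
  assumes "finite A" "\<And>a. a \<in> A \<Longrightarrow> f a \<in> H" "z \<in> H" "w \<in> Hb"
  shows "tri (\<Sum>a\<in>A. f a) z w = (\<Sum>a\<in>A. tri (f a) z w)"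
  using assms(1,2)
proof (induction A rule: finite_induct)
  case empty
  then show ?case using tri_scale1[of 0 z w 0] assms by simp
next
  case (insert a A)
  have "(\<Sum>a\<in>A. f a) \<in> H" using insert by (intro subspace_sum[OF G.subspace_H]) auto
  then show ?case using insert assms by (simp add: tri_add1)
qed

lemma tri_bound':
  assumes "x \<in> H" "y \<in> H" "z \<in> Hb" "h1 x \<le> a" "h1 y \<le> b"
  shows "\<bar>tri x y z\<bar> \<le> Cs * a * b * h1 z"
proof -
  have z: "z \<in> H" using assms Hb_sub by auto
  have "0 \<le> a" using assms G.nrm_ge_0[of x] by linarith
  then have "Cs * h1 x * h1 y * h1 z \<le> Cs * a * b * h1 z"
    using assms z Cs_pos by (intro mult_right_mono mult_mono) auto
  with tri_bound[OF assms(1-3)] show ?thesis by linarith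
qed

lemma tri_ext_bound:
  assumes "u n \<in> H" "u (n - 1) \<in> H" "z \<in> H" "w \<in> Hb"
    "\<bar>tri (u n) z w\<bar> \<le> c" "\<bar>tri (u (n - 1)) z w\<bar> \<le> c"
  shows "\<bar>tri (ext u n) z w\<bar> \<le> 3 * c"
  unfolding ext_def using assms by (simp add: tri_lin)

lemma tri_ext2_bound:
  assumes "u n \<in> H" "u (n - 1) \<in> H" "z \<in> H" "w \<in> Hb"
    "\<bar>tri z (u n) w\<bar> \<le> c" "\<bar>tri z (u (n - 1)) w\<bar> \<le> c"
  shows "\<bar>tri z (ext u n) w\<bar> \<le> 3 * c"
  unfolding ext_def using assms by (simp add: tri_lin)

text \<open>The 6 is 3 + 3: the extrapolation of one member and the ensemble mean have the absolute
  weights 2 and 1 each.\<close>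

lemma tri_fluc_bound:
  assumes J: "1 \<le> J" and j: "j \<in> {1..J}"
    and u: "\<And>j. j \<in> {1..J} \<Longrightarrow> u j n \<in> H \<and> u j (n - 1) \<in> H" and z: "z \<in> H" "w \<in> Hb"
    and c: "\<And>j. j \<in> {1..J} \<Longrightarrow> \<bar>tri (u j n) z w\<bar> \<le> c \<and> \<bar>tri (u j (n - 1)) z w\<bar> \<le> c"
  shows "\<bar>tri (fluc J u j n) z w\<bar> \<le> 6 * c"
proof -
  have e: "\<bar>tri (ext (u j) n) z w\<bar> \<le> 3 * c" if "j \<in> {1..J}" for j
    using tri_ext_bound[of "u j" n z w c] u[OF that] c[OF that] z by simp
  have S: "(\<Sum>j=1..J. ext (u j) n) \<in> H"
    using u by (intro subspace_sum[OF G.subspace_H]) auto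
  have "\<bar>\<Sum>j=1..J. tri (ext (u j) n) z w\<bar> \<le> (\<Sum>j=1..J. 3 * c)"
    by (rule order_trans[OF sum_abs]) (intro sum_mono e, simp)
  then have "\<bar>tri (\<Sum>j=1..J. ext (u j) n) z w\<bar> \<le> real J * (3 * c)"
    using u z by (subst tri_sum1) auto
  then have m: "\<bar>tri (emean J u n) z w\<bar> \<le> 3 * c"
    using S z J by (simp add: emean_def tri_scale1 abs_mult field_simps)
  have "tri (fluc J u j n) z w = tri (ext (u j) n) z w - tri (emean J u n) z w"
    unfolding fluc_def using u j z by (intro tri_diff1 G.ext_in G.emean_in) auto
  with e[OF j] m show ?thesis by linarith
qed

end

text \<open>The Boolean index selects the field, \<open>True\<close> for v and \<open>False\<close>
  for w. The system is invariant under their exchange, so \<open>\<not> s\<close> is the field that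
  convects \<open>s\<close>, and every estimate is made once for both. One constant \<open>B\<close>
  carries the regularity of the exact solution, \<open>C1\<close> the projection error and
  \<open>C0\<close> the initial error; \<open>D\<close> bounds the mesh size. In \<open>Q1\<close>
  and \<open>Q2\<close>, \<open>Lq \<epsilon>\<close> is the price for a factor \<epsilon> at the H1
  norm. The time derivative \<open>ut\<close> is a functional because it occurs only in
  pairings.\<close>

locale elsasser_data = elsasser_forms H ip gp Hb Hd tri Cs CP
  for H :: "'v::real_vector set" and ip gp :: "'v \<Rightarrow> 'v \<Rightarrow> real" and Hb Hd tri Cs CP +
  fixes \<nu> \<nu>m \<alpha> T B C1 D Ci C0 :: real and J k :: nat
    and u :: "bool \<Rightarrow> nat \<Rightarrow> real \<Rightarrow> 'v" and ut F :: "bool \<Rightarrow> nat \<Rightarrow> real \<Rightarrow> 'v \<Rightarrow> real"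
    and Lq :: "real \<Rightarrow> real"
  assumes T_pos: "0 < T" and J_pos: "1 \<le> J" and k_ge: "2 \<le> k"
    and \<alpha>_def: "\<alpha> = \<nu> + \<nu>m - \<bar>\<nu> - \<nu>m\<bar>" and \<alpha>_pos: "0 < \<alpha>"
    and B_nonneg: "0 \<le> B" and C1_nonneg: "0 \<le> C1" and D_pos: "0 < D" and Ci_pos: "0 < Ci"
    and C0_nonneg: "0 \<le> C0"
    and Lq_nonneg: "\<And>\<epsilon>. 0 \<le> Lq \<epsilon>"
    and uH: "\<And>s j t. j \<in> {1..J} \<Longrightarrow> t \<in> {0..T} \<Longrightarrow> u s j t \<in> H \<inter> Hd"
    and uB: "\<And>s j t. j \<in> {1..J} \<Longrightarrow> t \<in> {0..T} \<Longrightarrow> h1 (u s j t) \<le> B"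
    and u2: "\<And>s j t d. j \<in> {1..J} \<Longrightarrow> 0 < d \<Longrightarrow> 0 \<le> t - d \<Longrightarrow> t + d \<le> T \<Longrightarrow>
               h1 (u s j (t + d) - 2 *\<^sub>R u s j t + u s j (t - d)) \<le> B * d\<^sup>2"
    and u3: "\<And>s j t d w. j \<in> {1..J} \<Longrightarrow> 0 < d \<Longrightarrow> 0 \<le> t - d \<Longrightarrow> t + d \<le> T \<Longrightarrow> w \<in> Hb \<Longrightarrow>
               \<bar>ut s j (t + d) w - (3 * ip (u s j (t + d)) w - 4 * ip (u s j t) w + ip (u s j (t - d)) w) / (2 * d)\<bar>
                 \<le> B * d\<^sup>2 * l2 w"
    and momentum: "\<And>s j t w. j \<in> {1..J} \<Longrightarrow> t \<in> {0<..T} \<Longrightarrow> w \<in> Hb \<inter> Hd \<Longrightarrow>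
               ut s j t w + tri (u (\<not> s) j t) (u s j t) w + (\<nu> + \<nu>m) / 2 * gp (u s j t) w
               + (\<nu> - \<nu>m) / 2 * gp (u (\<not> s) j t) w = F s j t w"
    and Q1: "\<And>\<epsilon> s j t \<xi> w. 0 < \<epsilon> \<Longrightarrow> j \<in> {1..J} \<Longrightarrow> t \<in> {0..T} \<Longrightarrow> \<xi> \<in> Hb \<Longrightarrow> w \<in> Hb \<Longrightarrow>
               \<bar>tri \<xi> (u s j t) w\<bar> \<le> (\<epsilon> * h1 \<xi> + Lq \<epsilon> * l2 \<xi>) * h1 w"
    and Q2: "\<And>\<epsilon> s j t \<xi> w. 0 < \<epsilon> \<Longrightarrow> j \<in> {1..J} \<Longrightarrow> t \<in> {0..T} \<Longrightarrow> \<xi> \<in> Hb \<Longrightarrow> w \<in> Hb \<Longrightarrow>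
               \<bar>tri (u s j t) \<xi> w\<bar> \<le> (\<epsilon> * h1 \<xi> + Lq \<epsilon> * l2 \<xi>) * h1 w"
begin

definition "B1 = B + C1 * D ^ k"

text \<open>Small enough for \<open>energy_step\<close>: after Young's inequality and summation over
  2 J fields the contribution of \<open>GG\<close> has a coefficient of about 0.065 \<alpha>, below
  the \<alpha> / 8 that the weights in \<open>SA\<close> can carry.\<close>

definition "\<epsilon>0 = \<alpha> / (2000 * real J)"

text \<open>The price for the projected solution: that of the exact solution at
  \<open>\<epsilon>0\<close>, plus the projection error, for which the inverse inequality trades one
  power of the mesh size for an L2 norm.\<close>

definition "Lp = Lq \<epsilon>0 + Cs * C1 * Ci * D ^ (k - 1)"

text \<open>Consistency constant per unit of \<open>rho\<close>. In this order: three nonlinear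
  residuals, the truncation error of BDF2, and the two viscous residuals.\<close>

definition "A0 = Cs * (B + 3 * C1) * B1 + Cs * B * C1 + Cs * (6 * B1) * (B + 4 * C1) + B * CP
  + \<bar>\<nu> + \<nu>m\<bar> / 2 * C1 + \<bar>\<nu> - \<nu>m\<bar> / 2 * (B + 3 * C1)"

definition tot :: "(bool \<Rightarrow> nat \<Rightarrow> real) \<Rightarrow> real" where
  "tot f = (\<Sum>j=1..J. f True j + f False j)"

lemma tot_mono: "(\<And>s j. j \<in> {1..J} \<Longrightarrow> f s j \<le> g s j) \<Longrightarrow> tot f \<le> tot g"
  unfolding tot_def by (intro sum_mono add_mono) auto

lemma tot_nonneg: "(\<And>s j. j \<in> {1..J} \<Longrightarrow> 0 \<le> f s j) \<Longrightarrow> 0 \<le> tot f"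
  unfolding tot_def by (intro sum_nonneg add_nonneg_nonneg) auto

lemma tot_add: "tot (\<lambda>s j. f s j + g s j) = tot f + tot g"
  and tot_diff: "tot (\<lambda>s j. f s j - g s j) = tot f - tot g"
  and tot_cmult: "tot (\<lambda>s j. c * f s j) = c * tot f"
  and tot_swap: "tot (\<lambda>s j. f (\<not> s) j) = tot f"
  and tot_const: "tot (\<lambda>s j. c) = 2 * real J * c"
  by (simp_all add: tot_def sum.distrib sum_subtractf sum_distrib_left algebra_simps)

lemma tot_ge:
  assumes "\<And>s j. j \<in> {1..J} \<Longrightarrow> 0 \<le> f s j" "j \<in> {1..J}"
  shows "f s j \<le> tot f" and "(\<Sum>j=1..J. f s j) \<le> tot f"
proof -
  have 1: "(\<Sum>j=1..J. f s j) \<le> tot f" for s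
    unfolding tot_def using assms by (cases s) (auto intro!: sum_mono)
  have "f s j \<le> (\<Sum>j=1..J. f s j)"
    using assms by (intro member_le_sum) auto
  with 1 show "f s j \<le> tot f" and "(\<Sum>j=1..J. f s j) \<le> tot f"
    using order_trans by blast+
qed

lemma tot_square_le: "(tot f)\<^sup>2 \<le> 2 * real J * tot (\<lambda>s j. (f s j)\<^sup>2)"
proof -
  have "(tot f)\<^sup>2 \<le> real (card {1..J}) * (\<Sum>j=1..J. (f True j + f False j)\<^sup>2)"
    unfolding tot_def using sum_squared_le_sum_of_squares[of "\<lambda>j. f True j + f False j" "{1..J}"] by (simp add: mult.commute)
  also have "\<dots> \<le> real J * (\<Sum>j=1..J. 2 * ((f True j)\<^sup>2 + (f False j)\<^sup>2))"
  proof -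
    have "(a + b)\<^sup>2 \<le> 2 * (a\<^sup>2 + b\<^sup>2)" for a b :: real
      using zero_le_power2[of "a - b"] by (simp add: power2_eq_square algebra_simps)
    then show ?thesis by (simp add: mult_left_mono sum_mono)
  qed
  finally show ?thesis by (simp add: tot_def sum_distrib_left algebra_simps)
qed

lemma B1_nonneg: "0 \<le> B1" and \<epsilon>0_pos: "0 < \<epsilon>0" and Lp_nonneg: "0 \<le> Lp" and A0_nonneg: "0 \<le> A0"
proof -
  show b: "0 \<le> B1" unfolding B1_def using B_nonneg C1_nonneg D_pos by simp
  show "0 < \<epsilon>0" unfolding \<epsilon>0_def using \<alpha>_pos J_pos by simp
  show "0 \<le> Lp" unfolding Lp_def using Lq_nonneg Cs_pos C1_nonneg Ci_pos D_pos by simp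
  show "0 \<le> A0" unfolding A0_def using b B_nonneg C1_nonneg Cs_pos CP_nonneg by simp
qed

end

text \<open>\<open>p\<close> is the L2 projection of the exact solution onto \<open>V\<close>. The
  restriction \<open>step_size\<close> is multiplied out and stated with an upper bound
  \<open>X\<close>, so a vanishing denominator is no special case. The inclusion of \<open>V\<close>
  in \<open>Hd\<close> is where divergence-free elements enter: discrete fields convect
  skew-symmetrically.\<close>

locale elsasser_discrete = elsasser_data H ip gp Hb Hd tri Cs CP \<nu> \<nu>m \<alpha> T B C1 D Ci C0 J k u ut F Lq
  for H :: "'v::real_vector set" and ip gp :: "'v \<Rightarrow> 'v \<Rightarrow> real" and Hb Hd tri Cs CP
    \<nu> \<nu>m \<alpha> T B C1 D Ci C0 J k u ut F Lq +
  fixes V :: "'v set" and h dt :: real and M :: nat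
    and p :: "bool \<Rightarrow> nat \<Rightarrow> real \<Rightarrow> 'v" and uh :: "bool \<Rightarrow> nat \<Rightarrow> nat \<Rightarrow> 'v"
  assumes V: "subspace V" and V_Hb: "V \<subseteq> Hb" and V_Hd: "V \<subseteq> Hd"
    and h_pos: "0 < h" and h_le: "h \<le> D" and inverse: "\<And>x. x \<in> V \<Longrightarrow> h1 x \<le> Ci / h * l2 x"
    and dt_pos: "0 < dt" and M_dt: "real M * dt = T"
    and pV: "\<And>s j t. j \<in> {1..J} \<Longrightarrow> t \<in> {0..T} \<Longrightarrow> p s j t \<in> V"
    and p_orth: "\<And>s j t w. j \<in> {1..J} \<Longrightarrow> t \<in> {0..T} \<Longrightarrow> w \<in> V \<Longrightarrow> ip (u s j t - p s j t) w = 0"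
    and p_approx: "\<And>s j t. j \<in> {1..J} \<Longrightarrow> t \<in> {0..T} \<Longrightarrow> h1 (u s j t - p s j t) \<le> C1 * h ^ k"
    and uhV: "\<And>s j n. j \<in> {1..J} \<Longrightarrow> n \<le> max 1 M \<Longrightarrow> uh s j n \<in> V"
    and scheme: "\<And>s j n w. j \<in> {1..J} \<Longrightarrow> n \<in> {1..<M} \<Longrightarrow> w \<in> V \<Longrightarrow>
        (3 * ip (uh s j (n + 1)) w - 4 * ip (uh s j n) w + ip (uh s j (n - 1)) w) / (2 * dt)
        + (\<nu> + \<nu>m) / 2 * gp (uh s j (n + 1)) w
        + (\<nu> - \<nu>m) / 2 * gp (ext (uh (\<not> s) j) n) w
        + tri (emean J (uh (\<not> s)) n) (uh s j (n + 1)) w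
        + tri (fluc J (uh (\<not> s)) j n) (ext (uh s j) n) w
        = F s j (real (n + 1) * dt) w"
    and init: "\<And>s j n. j \<in> {1..J} \<Longrightarrow> n \<in> {0, 1} \<Longrightarrow>
        (l2 (u s j (real n * dt) - uh s j n))\<^sup>2 + \<alpha> * dt * (h1 (u s j (real n * dt) - uh s j n))\<^sup>2
        \<le> C0 * (h ^ (2 * k) + dt ^ 4)"
    and step_size: "\<And>n. n \<in> {1..<M} \<Longrightarrow> \<exists>X. (\<forall>s. \<forall>j\<in>{1..J}. h1 (fluc J (uh s) j n) \<le> X) \<and>
        dt * (9 * Ci\<^sup>2 * (\<nu> - \<nu>m)\<^sup>2 + 9 * Ci\<^sup>2 * Cs\<^sup>2 * X) \<le> \<alpha> * h\<^sup>2"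
begin

definition "U s j n = u s j (real n * dt)"
definition "P s j n = p s j (real n * dt)"
text \<open>The signs are such that the error \<open>U - uh\<close> equals \<open>eta - phi\<close>.
  The part \<open>phi\<close> lies in \<open>V\<close> and serves as the test field.\<close>

definition "eta s j n = U s j n - P s j n"
definition "phi s j n = uh s j n - P s j n"
text \<open>Comparable to the square root of \<open>h ^ (2 * k) + dt ^ 4\<close> by
  \<open>rho_sq\<close> and \<open>rho_sq_ge\<close>; a single number keeps the estimates before
  squaring short.\<close>

definition "rho = h ^ k + dt\<^sup>2"
definition "x2 s j n = l2 (phi s j (n + 1) - 2 *\<^sub>R phi s j n + phi s j (n - 1))"
definition "GG n = tot (\<lambda>s j. h1 (phi s j n) + h1 (phi s j (n - 1)))"
definition "SS n = tot (\<lambda>s j. l2 (phi s j n) + l2 (phi s j (n - 1)))"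
text \<open>The telescoping energy of \<open>bdf2_identity\<close>, added up over both fields and
  all members.\<close>

definition "En n = tot (\<lambda>s j. (l2 (phi s j n))\<^sup>2 + (l2 (ext (phi s j) n))\<^sup>2)"
definition "Dn n = tot (\<lambda>s j. (h1 (phi s j n))\<^sup>2)"

lemma V_H: "V \<subseteq> H" using V_Hb Hb_sub by auto

lemma V_sub: "x \<in> V \<Longrightarrow> x \<in> H" "x \<in> V \<Longrightarrow> x \<in> Hb" "x \<in> V \<Longrightarrow> x \<in> Hd"
  using V_Hb V_H V_Hd by auto

lemma V_ext: "f n \<in> V \<Longrightarrow> f (n - 1) \<in> V \<Longrightarrow> ext f n \<in> V"
  unfolding ext_def using V by (intro subspace_diff subspace_scale)

lemma V_emean: "(\<And>j. j \<in> {1..J} \<Longrightarrow> f j n \<in> V \<and> f j (n - 1) \<in> V) \<Longrightarrow> emean J f n \<in> V"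
  unfolding emean_def using V by (intro subspace_scale subspace_sum V_ext) auto

lemma V_fluc: "(\<And>j. j \<in> {1..J} \<Longrightarrow> f j n \<in> V \<and> f j (n - 1) \<in> V) \<Longrightarrow> j \<in> {1..J} \<Longrightarrow> fluc J f j n \<in> V"
  unfolding fluc_def using V by (intro subspace_diff V_ext V_emean) auto

lemma time_in: "n \<le> M \<Longrightarrow> real n * dt \<in> {0..T}"
  using M_dt dt_pos by (auto intro: mult_right_mono simp flip: M_dt)

lemma M_ge: "1 \<le> M"
  using M_dt T_pos by (cases M) auto

lemma rho_ge: "0 \<le> rho" "h ^ k \<le> rho" "dt\<^sup>2 \<le> rho"
  unfolding rho_def using h_pos by auto

lemma rho_sq: "rho\<^sup>2 \<le> 2 * (h ^ (2 * k) + dt ^ 4)"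
proof -
  have "(a + b)\<^sup>2 \<le> 2 * (a\<^sup>2 + b\<^sup>2)" for a b :: real
    using zero_le_power2[of "a - b"] by (simp add: power2_eq_square algebra_simps)
  from this[of "h ^ k" "dt\<^sup>2"] show ?thesis
    unfolding rho_def by (simp add: power_mult[symmetric] mult.commute)
qed

lemma rho_sq_ge: "h ^ (2 * k) + dt ^ 4 \<le> rho\<^sup>2"
proof -
  have "rho\<^sup>2 = h ^ (2 * k) + dt ^ 4 + 2 * h ^ k * dt\<^sup>2"
    unfolding rho_def by (simp add: power2_sum power_mult[symmetric] mult.commute)
  then show ?thesis using h_pos by simp
qed

context
  fixes s :: bool and j n :: nat
  assumes j: "j \<in> {1..J}" and n: "n \<le> M"
begin

lemma U_in: "U s j n \<in> H" "U s j n \<in> Hd"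
  unfolding U_def using uH[OF j time_in[OF n], of s] by auto

lemma P_in: "P s j n \<in> V"
  unfolding P_def by (rule pV[OF j time_in[OF n]])

lemma uh_in: "uh s j n \<in> V"
  by (rule uhV[OF j]) (use n in auto)

lemma phi_in: "phi s j n \<in> V"
  unfolding phi_def using V uh_in P_in by (rule subspace_diff)

lemma eta_in: "eta s j n \<in> H"
  unfolding eta_def using U_in P_in V_sub by auto

lemma eta_le: "h1 (eta s j n) \<le> C1 * h ^ k"
  unfolding eta_def U_def P_def by (rule p_approx[OF j time_in[OF n]])

lemma U_le: "h1 (U s j n) \<le> B"
  unfolding U_def by (rule uB[OF j time_in[OF n]])

lemma P_le: "h1 (P s j n) \<le> B1"
proof -
  have "P s j n = U s j n - eta s j n" by (simp add: eta_def)
  then have "h1 (P s j n) \<le> B + C1 * h ^ k"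
    using G.nrm_triangle_diff[OF U_in(1) eta_in] U_le eta_le by simp
  also have "\<dots> \<le> B1" unfolding B1_def
    using h_le h_pos C1_nonneg by (simp add: mult_left_mono power_mono)
  finally show ?thesis .
qed

text \<open>The inverse inequality costs 1 / h on \<open>x\<close>, and one power of h from the
  projection error pays for it. Hence convection that involves the projection error needs only the
  L2 norm of \<open>x\<close>, which the Gronwall argument can take.\<close>

lemma eta_conv_bound:
  assumes "x \<in> V" "w \<in> V"
  shows "Cs * h1 x * h1 (eta s j n) * h1 w \<le> Cs * C1 * Ci * D ^ (k - 1) * l2 x * h1 w"
proof -
  have hk: "h ^ k = h * h ^ (k - 1)" using k_ge by (cases k) auto
  have "h1 x * h1 (eta s j n) \<le> (Ci / h * l2 x) * (C1 * h ^ k)"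
    using assms V_sub inverse[of x] eta_le eta_in h_pos Ci_pos by (intro mult_mono) auto
  also have "\<dots> = C1 * Ci * h ^ (k - 1) * l2 x" using h_pos by (simp add: hk)
  also have "\<dots> \<le> C1 * Ci * D ^ (k - 1) * l2 x"
    using assms V_sub h_pos h_le C1_nonneg Ci_pos
    by (intro mult_right_mono mult_left_mono power_mono) auto
  finally have "Cs * (h1 x * h1 (eta s j n)) * h1 w \<le> Cs * (C1 * Ci * D ^ (k - 1) * l2 x) * h1 w"
    using Cs_pos assms V_sub by (intro mult_right_mono mult_left_mono) auto
  then show ?thesis by (simp add: mult.assoc)
qed

text \<open>With P written as U - eta, the exact solution is treated by \<open>Q1\<close> and the
  projection error by \<open>eta_conv_bound\<close>. A direct use of \<open>tri_bound\<close> would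
  leave a factor at the H1 norm of \<open>x\<close> that is not small.\<close>

lemma P_conv1:
  assumes x: "x \<in> V" and w: "w \<in> V"
  shows "\<bar>tri x (P s j n) w\<bar> \<le> (\<epsilon>0 * h1 x + Lp * l2 x) * h1 w"
proof -
  have "tri x (P s j n) w = tri x (U s j n) w - tri x (eta s j n) w"
    using x w V_sub U_in eta_in P_in by (simp add: eta_def tri_lin)
  moreover have "\<bar>tri x (U s j n) w\<bar> \<le> (\<epsilon>0 * h1 x + Lq \<epsilon>0 * l2 x) * h1 w"
    unfolding U_def using Q1[OF \<epsilon>0_pos j time_in[OF n]] x w V_sub by auto
  moreover have "\<bar>tri x (eta s j n) w\<bar> \<le> Cs * C1 * Ci * D ^ (k - 1) * l2 x * h1 w"
    using tri_bound[of x "eta s j n" w] eta_conv_bound[OF x w] x w V_sub eta_in by force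
  ultimately show ?thesis unfolding Lp_def by (simp add: algebra_simps)
qed

lemma P_conv2:
  assumes x: "x \<in> V" and w: "w \<in> V"
  shows "\<bar>tri (P s j n) x w\<bar> \<le> (\<epsilon>0 * h1 x + Lp * l2 x) * h1 w"
proof -
  have "tri (P s j n) x w = tri (U s j n) x w - tri (eta s j n) x w"
    using x w V_sub U_in eta_in P_in by (simp add: eta_def tri_lin)
  moreover have "\<bar>tri (U s j n) x w\<bar> \<le> (\<epsilon>0 * h1 x + Lq \<epsilon>0 * l2 x) * h1 w"
    unfolding U_def using Q2[OF \<epsilon>0_pos j time_in[OF n]] x w V_sub by auto
  moreover have "\<bar>tri (eta s j n) x w\<bar> \<le> Cs * C1 * Ci * D ^ (k - 1) * l2 x * h1 w"
  proof -
    have "Cs * h1 (eta s j n) * h1 x * h1 w = Cs * h1 x * h1 (eta s j n) * h1 w" by simp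
    then show ?thesis
      using tri_bound[OF eta_in V_sub(1)[OF x] V_sub(2)[OF w]] eta_conv_bound[OF x w] by linarith
  qed
  ultimately show ?thesis unfolding Lp_def by (simp add: algebra_simps)
qed

end

lemma h1_ext_le: "f n \<in> H \<Longrightarrow> f (n - 1) \<in> H \<Longrightarrow> h1 (f n) \<le> c \<Longrightarrow> h1 (f (n - 1)) \<le> c \<Longrightarrow> h1 (ext f n) \<le> 3 * c"
  using G.nrm_ext_le[of f n] by linarith

lemma h1_fluc_le:
  assumes "\<And>j. j \<in> {1..J} \<Longrightarrow> f j n \<in> H \<and> f j (n - 1) \<in> H"
    and "\<And>j. j \<in> {1..J} \<Longrightarrow> h1 (f j n) \<le> c \<and> h1 (f j (n - 1)) \<le> c" and j: "j \<in> {1..J}"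
  shows "h1 (fluc J f j n) \<le> 6 * c"
proof -
  have "h1 (emean J f n) \<le> 1 / real J * (\<Sum>j=1..J. 2 * h1 (f j n) + h1 (f j (n - 1)))"
    using assms by (intro G.nrm_emean_le) auto
  also have "\<dots> \<le> 1 / real J * (\<Sum>j=1..J. 3 * c)"
  proof (intro mult_left_mono sum_mono)
    fix i assume "i \<in> {1..J}"
    then show "2 * h1 (f i n) + h1 (f i (n - 1)) \<le> 3 * c" using assms(2)[of i] by auto
  qed simp
  finally have "h1 (emean J f n) \<le> 3 * c" using J_pos by simp
  moreover have "h1 (ext (f j) n) \<le> 3 * c"
    using assms by (intro h1_ext_le) auto
  moreover have "h1 (fluc J f j n) \<le> h1 (ext (f j) n) + h1 (emean J f n)"
    unfolding fluc_def using assms by (intro G.nrm_triangle_diff G.ext_in G.emean_in) auto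
  ultimately show ?thesis by linarith
qed

lemma tot_phi_ge:
  assumes j: "j \<in> {1..J}" and n: "n \<le> M"
  shows "h1 (phi s j n) + h1 (phi s j (n - 1)) \<le> GG n"
    and "l2 (phi s j n) + l2 (phi s j (n - 1)) \<le> SS n"
    and "(\<Sum>j=1..J. h1 (phi s j n) + h1 (phi s j (n - 1))) \<le> GG n"
    and "(\<Sum>j=1..J. l2 (phi s j n) + l2 (phi s j (n - 1))) \<le> SS n"
proof -
  have in_H: "phi s j n \<in> H" "phi s j (n - 1) \<in> H" if "j \<in> {1..J}" for s j
    using that n phi_in V_sub by auto
  have 1: "0 \<le> h1 (phi s j n) + h1 (phi s j (n - 1))" "0 \<le> l2 (phi s j n) + l2 (phi s j (n - 1))"
    if "j \<in> {1..J}" for s j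
    using in_H[OF that] by simp_all
  show "h1 (phi s j n) + h1 (phi s j (n - 1)) \<le> GG n"
       "(\<Sum>j=1..J. h1 (phi s j n) + h1 (phi s j (n - 1))) \<le> GG n"
    unfolding GG_def using tot_ge[OF 1(1) j] by auto
  show "l2 (phi s j n) + l2 (phi s j (n - 1)) \<le> SS n"
       "(\<Sum>j=1..J. l2 (phi s j n) + l2 (phi s j (n - 1))) \<le> SS n"
    unfolding SS_def using tot_ge[OF 1(2) j] by auto
qed

lemma phi_ext_le:
  assumes j: "j \<in> {1..J}" and n: "n \<le> M"
  shows "h1 (ext (phi s j) n) \<le> 2 * GG n" "l2 (ext (phi s j) n) \<le> 2 * SS n"
    "h1 (emean J (phi s) n) \<le> 2 * GG n" "l2 (emean J (phi s) n) \<le> 2 * SS n"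
    "h1 (fluc J (phi s) j n) \<le> 4 * GG n" "l2 (fluc J (phi s) j n) \<le> 4 * SS n"
proof -
  have in_H: "phi s j n \<in> H" "phi s j (n - 1) \<in> H" if "j \<in> {1..J}" for j
    using that n phi_in V_sub by auto
  have nn: "0 \<le> h1 (phi s j n)" "0 \<le> h1 (phi s j (n - 1))" "0 \<le> l2 (phi s j n)" "0 \<le> l2 (phi s j (n - 1))"
    if "j \<in> {1..J}" for j
    using in_H[OF that] by simp_all
  show e: "h1 (ext (phi s j) n) \<le> 2 * GG n" "l2 (ext (phi s j) n) \<le> 2 * SS n"
    using G.nrm_ext_le[OF in_H[OF j]] L.nrm_ext_le[OF in_H[OF j]] tot_phi_ge(1,2)[OF j n, of s] nn[OF j] by linarith+
  have ge: "0 \<le> GG n" "0 \<le> SS n" using tot_phi_ge(1,2)[OF j n, of s] nn[OF j] by linarith+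
  have J1: "1 / real J * x \<le> x" if "0 \<le> x" for x
    using J_pos that mult_right_mono[of "1 / real J" 1 x] by simp
  have "h1 (emean J (phi s) n) \<le> 1 / real J * (\<Sum>j=1..J. 2 * h1 (phi s j n) + h1 (phi s j (n - 1)))"
    using in_H by (intro G.nrm_emean_le) auto
  also have "\<dots> \<le> 1 / real J * (\<Sum>j=1..J. 2 * (h1 (phi s j n) + h1 (phi s j (n - 1))))"
    using nn by (intro mult_left_mono sum_mono) auto
  also have "\<dots> \<le> 1 / real J * (2 * GG n)"
    unfolding sum_distrib_left[symmetric] using tot_phi_ge(3)[OF j n, of s] by (intro mult_left_mono) auto
  also have "\<dots> \<le> 2 * GG n" using ge by (intro J1) auto
  finally show m1: "h1 (emean J (phi s) n) \<le> 2 * GG n" .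
  have "l2 (emean J (phi s) n) \<le> 1 / real J * (\<Sum>j=1..J. 2 * l2 (phi s j n) + l2 (phi s j (n - 1)))"
    using in_H by (intro L.nrm_emean_le) auto
  also have "\<dots> \<le> 1 / real J * (\<Sum>j=1..J. 2 * (l2 (phi s j n) + l2 (phi s j (n - 1))))"
    using nn by (intro mult_left_mono sum_mono) auto
  also have "\<dots> \<le> 1 / real J * (2 * SS n)"
    unfolding sum_distrib_left[symmetric] using tot_phi_ge(4)[OF j n, of s] by (intro mult_left_mono) auto
  also have "\<dots> \<le> 2 * SS n" using ge by (intro J1) auto
  finally show m2: "l2 (emean J (phi s) n) \<le> 2 * SS n" .
  have "h1 (fluc J (phi s) j n) \<le> h1 (ext (phi s j) n) + h1 (emean J (phi s) n)"
    unfolding fluc_def using in_H j by (intro G.nrm_triangle_diff G.ext_in G.emean_in) auto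
  then show "h1 (fluc J (phi s) j n) \<le> 4 * GG n" using e m1 by linarith
  have "l2 (fluc J (phi s) j n) \<le> l2 (ext (phi s j) n) + l2 (emean J (phi s) n)"
    unfolding fluc_def using in_H j by (intro L.nrm_triangle_diff L.ext_in L.emean_in) auto
  then show "l2 (fluc J (phi s) j n) \<le> 4 * SS n" using e m2 by linarith
qed

section \<open>Consistency residuals\<close>

lemma time_steps:
  assumes "n \<in> {1..<M}"
  shows "real (n + 1) * dt = real n * dt + dt" "real (n - 1) * dt = real n * dt - dt"
  using assms by (auto simp: algebra_simps of_nat_diff)

lemma delta2_U:
  assumes j: "j \<in> {1..J}" and n: "n \<in> {1..<M}"
  shows "h1 (U s j (n + 1) - ext (U s j) n) \<le> B * dt\<^sup>2"
proof -
  have "U s j (n + 1) - ext (U s j) n =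
      u s j (real n * dt + dt) - 2 *\<^sub>R u s j (real n * dt) + u s j (real n * dt - dt)"
    using time_steps[OF n] by (simp add: U_def ext_def)
  moreover have "real n * dt + dt \<le> T"
    using time_in[of "n + 1"] n time_steps[OF n] by auto
  moreover have "0 \<le> real n * dt - dt"
    using time_in[of "n - 1"] n time_steps[OF n] by auto
  ultimately show ?thesis using u2[OF j dt_pos] by simp
qed

text \<open>The difference \<open>U (n + 1) - ext P\<close> is the second difference of U, of order
  dt^2, plus the extrapolated projection error; subtracting one more projection error gives the
  bound for P.\<close>

lemma residual_bounds:
  assumes j: "j \<in> {1..J}" and n: "n \<in> {1..<M}"
  shows "h1 (U s j (n + 1) - ext (P s j) n) \<le> (B + 3 * C1) * rho"
    and "h1 (P s j (n + 1) - ext (P s j) n) \<le> (B + 4 * C1) * rho"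
    and "h1 (eta s j (n + 1)) \<le> C1 * rho"
proof -
  have in_H: "U s j m \<in> H" "P s j m \<in> H" "eta s j m \<in> H" if "m \<le> M" for m
    using that j U_in P_in V_sub eta_in by auto
  have m: "n + 1 \<le> M" "n \<le> M" "n - 1 \<le> M" using n by auto
  have B: "B * dt\<^sup>2 \<le> B * rho" "C1 * h ^ k \<le> C1 * rho"
    using rho_ge B_nonneg C1_nonneg by (auto intro: mult_left_mono)
  have eta: "h1 (eta s j i) \<le> C1 * rho" if "i \<le> M" for i
    using eta_le[OF j that, of s] B by linarith
  show 3: "h1 (eta s j (n + 1)) \<le> C1 * rho" using eta m by blast
  have ext_eta: "h1 (ext (eta s j) n) \<le> 3 * (C1 * rho)"
    using in_H m eta by (intro h1_ext_le) auto
  have e: "ext (eta s j) n = ext (U s j) n - ext (P s j) n"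
    by (simp add: ext_def eta_def algebra_simps)
  have "h1 (U s j (n + 1) - ext (P s j) n) = h1 ((U s j (n + 1) - ext (U s j) n) + ext (eta s j) n)"
    by (simp add: e)
  also have "\<dots> \<le> B * rho + 3 * (C1 * rho)"
    using G.nrm_triangle[of "U s j (n + 1) - ext (U s j) n" "ext (eta s j) n"] in_H m
      delta2_U[OF j n, of s] ext_eta B by (force simp: ext_def)
  finally show 1: "h1 (U s j (n + 1) - ext (P s j) n) \<le> (B + 3 * C1) * rho"
    by (simp add: algebra_simps)
  have "h1 (P s j (n + 1) - ext (P s j) n) = h1 ((U s j (n + 1) - ext (P s j) n) - eta s j (n + 1))"
    by (simp add: eta_def)
  also have "\<dots> \<le> (B + 3 * C1) * rho + C1 * rho"
    using G.nrm_triangle_diff[of "U s j (n + 1) - ext (P s j) n" "eta s j (n + 1)"] in_H m 1 3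
    by (force simp: ext_def)
  finally show "h1 (P s j (n + 1) - ext (P s j) n) \<le> (B + 4 * C1) * rho"
    by (simp add: algebra_simps)
qed

text \<open>Mean plus fluctuation is the extrapolation of member \<open>j\<close>. Treating the
  fluctuation explicitly therefore costs only its action on the second difference
  \<open>P (n + 1) - ext P\<close>, which is of order \<open>rho\<close>. The \<open>phi\<close>
  parts of the convecting fields are covered by \<open>P_conv1\<close>; their constant 14 is 2 for
  the mean plus 3 times 4 for the fluctuation acting on an extrapolation.\<close>

lemma nonlinear_residual:
  assumes j: "j \<in> {1..J}" and n: "n \<in> {1..<M}" and w: "w \<in> V"
  shows "\<bar>tri (emean J (uh (\<not> s)) n) (P s j (n + 1)) w + tri (fluc J (uh (\<not> s)) j n) (ext (P s j) n) w
      - tri (U (\<not> s) j (n + 1)) (U s j (n + 1)) w\<bar>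
    \<le> ((Cs * (B + 3 * C1) * B1 + Cs * B * C1 + Cs * (6 * B1) * (B + 4 * C1)) * rho
       + 14 * (\<epsilon>0 * GG n + Lp * SS n)) * h1 w"
proof -
  let ?s = "\<not> s"
  have m: "n + 1 \<le> M" "n \<le> M" "n - 1 \<le> M" using n by auto
  have V': "phi s j i \<in> V" "P s j i \<in> V" "uh s j i \<in> V" "U s j i \<in> H" "eta s j i \<in> H" if "i \<le> M" "j \<in> {1..J}" for s j i
    using that phi_in P_in uh_in U_in eta_in by auto
  have H': "phi s j i \<in> H" "P s j i \<in> H" "uh s j i \<in> H" if "i \<le> M" "j \<in> {1..J}" for s j i
    using V'[OF that] V_sub by auto
  have wH: "w \<in> H" "w \<in> Hb" using w V_sub by auto
  define PR where "PR = ext (P ?s j) n"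
  have PR: "PR \<in> H" "emean J (P ?s) n \<in> H" "fluc J (P ?s) j n \<in> H" "ext (P s j) n \<in> V"
      "emean J (phi ?s) n \<in> V" "fluc J (phi ?s) j n \<in> V"
    unfolding PR_def using V' H' m j V_sub by (auto intro!: V_ext V_emean V_fluc G.ext_in G.emean_in V_sub(1))
  have split: "emean J (uh ?s) n = emean J (P ?s) n + emean J (phi ?s) n"
      "fluc J (uh ?s) j n = fluc J (P ?s) j n + fluc J (phi ?s) j n"
    using emean_diff[of J "uh ?s" "P ?s" n] fluc_diff[of J "uh ?s" "P ?s" j n] by (auto simp: phi_def[abs_def])
  have PRs: "emean J (P ?s) n = PR - fluc J (P ?s) j n" by (simp add: PR_def fluc_def)
  have "tri (emean J (uh ?s) n) (P s j (n + 1)) w + tri (fluc J (uh ?s) j n) (ext (P s j) n) w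
      - tri (U ?s j (n + 1)) (U s j (n + 1)) w
    = - tri (U ?s j (n + 1) - PR) (P s j (n + 1)) w - tri (U ?s j (n + 1)) (eta s j (n + 1)) w
      - tri (fluc J (P ?s) j n) (P s j (n + 1) - ext (P s j) n) w
      + tri (emean J (phi ?s) n) (P s j (n + 1)) w + tri (fluc J (phi ?s) j n) (ext (P s j) n) w"
    unfolding split unfolding PRs eta_def
    using V' H' PR wH V_sub m j by (simp add: tri_lin)
  moreover have "\<bar>tri (U ?s j (n + 1) - PR) (P s j (n + 1)) w\<bar> \<le> Cs * ((B + 3 * C1) * rho) * B1 * h1 w"
    unfolding PR_def using residual_bounds(1)[OF j n, of ?s] P_le[OF j m(1), of s] V' H' PR m j wH
    by (intro tri_bound') (auto simp: PR_def)
  moreover have "\<bar>tri (U ?s j (n + 1)) (eta s j (n + 1)) w\<bar> \<le> Cs * B * (C1 * rho) * h1 w"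
    using residual_bounds(3)[OF j n, of s] U_le[OF j m(1), of ?s] V' m j wH
    by (intro tri_bound') auto
  moreover have "\<bar>tri (fluc J (P ?s) j n) (P s j (n + 1) - ext (P s j) n) w\<bar>
      \<le> Cs * (6 * B1) * ((B + 4 * C1) * rho) * h1 w"
  proof (intro tri_bound' PR wH h1_fluc_le residual_bounds j n)
    show "P s j (n + 1) - ext (P s j) n \<in> H" using PR H' m j V_sub by auto
  qed (use H' P_le m in auto)
  moreover have "\<bar>tri (emean J (phi ?s) n) (P s j (n + 1)) w\<bar> \<le> (2 * (\<epsilon>0 * GG n + Lp * SS n)) * h1 w"
  proof -
    have "(\<epsilon>0 * h1 (emean J (phi ?s) n) + Lp * l2 (emean J (phi ?s) n)) \<le> \<epsilon>0 * (2 * GG n) + Lp * (2 * SS n)"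
      using phi_ext_le[OF j m(2), of ?s] \<epsilon>0_pos Lp_nonneg by (intro add_mono mult_left_mono) auto
    then have "(\<epsilon>0 * h1 (emean J (phi ?s) n) + Lp * l2 (emean J (phi ?s) n)) * h1 w
        \<le> (2 * (\<epsilon>0 * GG n + Lp * SS n)) * h1 w"
      using wH by (intro mult_right_mono) (auto simp: algebra_simps)
    with P_conv1[OF j m(1) PR(5) w] show ?thesis by (rule order_trans)
  qed
  moreover have "\<bar>tri (fluc J (phi ?s) j n) (ext (P s j) n) w\<bar> \<le> 3 * (4 * (\<epsilon>0 * GG n + Lp * SS n) * h1 w)"
  proof (rule tri_ext2_bound)
    have "(\<epsilon>0 * h1 (fluc J (phi ?s) j n) + Lp * l2 (fluc J (phi ?s) j n)) \<le> \<epsilon>0 * (4 * GG n) + Lp * (4 * SS n)"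
      using phi_ext_le[OF j m(2), of ?s] \<epsilon>0_pos Lp_nonneg by (intro add_mono mult_left_mono) auto
    then have le: "(\<epsilon>0 * h1 (fluc J (phi ?s) j n) + Lp * l2 (fluc J (phi ?s) j n)) * h1 w
        \<le> 4 * (\<epsilon>0 * GG n + Lp * SS n) * h1 w"
      using wH by (intro mult_right_mono) (auto simp: algebra_simps)
    show "\<bar>tri (fluc J (phi ?s) j n) (P s j n) w\<bar> \<le> 4 * (\<epsilon>0 * GG n + Lp * SS n) * h1 w"
      by (rule order_trans[OF P_conv1[OF j m(2) PR(6) w] le])
    show "\<bar>tri (fluc J (phi ?s) j n) (P s j (n - 1)) w\<bar> \<le> 4 * (\<epsilon>0 * GG n + Lp * SS n) * h1 w"
      by (rule order_trans[OF P_conv1[OF j m(3) PR(6) w] le])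
  qed (use H' PR V_sub m j wH in auto)
  ultimately show ?thesis by (simp add: algebra_simps)
qed

end

section \<open>Error equation and energy inequality of one step\<close>

context elsasser_discrete
begin

text \<open>Error equation tested with \<open>phi\<close> at the new level. The projection error in
  the time difference and the convection of \<open>phi\<close> by the mean vanish for structural
  reasons. The explicit viscous coupling and the fluctuation acting on the extrapolated
  \<open>phi\<close> are kept on the left, to be paid later by numerical dissipation.\<close>

lemma phi_equation:
  fixes s :: bool and j n :: nat
  assumes j: "j \<in> {1..J}" and n: "n \<in> {1..<M}"
  defines "c \<equiv> phi s j (n + 1)"
  shows "\<bar>(3 * ip c c - 4 * ip (phi s j n) c + ip (phi s j (n - 1)) c) / (2 * dt)
      + (\<nu> + \<nu>m) / 2 * (h1 c)\<^sup>2 + (\<nu> - \<nu>m) / 2 * gp (ext (phi (\<not> s) j) n) c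
      + tri (fluc J (uh (\<not> s)) j n) (ext (phi s j) n) c\<bar>
    \<le> (A0 * rho + 14 * (\<epsilon>0 * GG n + Lp * SS n)) * h1 c"
proof -
  let ?s = "\<not> s"
  have m: "n + 1 \<le> M" "n \<le> M" "n - 1 \<le> M" using n by auto
  have V': "phi s j i \<in> V" "P s j i \<in> V" "uh s j i \<in> V" "U s j i \<in> H" "eta s j i \<in> H" if "i \<le> M" "j \<in> {1..J}" for s j i
    using that phi_in P_in uh_in U_in eta_in by auto
  have H': "phi s j i \<in> H" "P s j i \<in> H" "uh s j i \<in> H" if "i \<le> M" "j \<in> {1..J}" for s j i
    using V'[OF that] V_sub by auto
  have cV: "c \<in> V" and c: "c \<in> H" "c \<in> Hb" "c \<in> Hd"
    unfolding c_def using V'(1)[OF m(1) j] V_sub by auto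
  have uhs: "uh s j i = P s j i + phi s j i" for s j i by (simp add: phi_def)
  \<comment> \<open>Pairing with \<open>V\<close> does not see the error of the L2 projection, so no
    time difference of \<open>eta\<close> arises.\<close>
  have ipuh: "ip (uh s j i) c = ip (U s j i) c + ip (phi s j i) c" if "i \<le> M" for i
  proof -
    have "ip (U s j i - P s j i) c = 0"
      unfolding U_def P_def using p_orth[OF j time_in[OF that] cV] by simp
    moreover have "ip (U s j i - P s j i) c = ip (U s j i) c - ip (P s j i) c"
      using that V'(4) H'(2) j c by (intro L.diff_left) auto
    moreover have "ip (uh s j i) c = ip (P s j i) c + ip (phi s j i) c"
      unfolding uhs[of s j i] using that H' j c by (intro L.add_left) auto
    ultimately show ?thesis by linarith
  qed
  have t: "real (n + 1) * dt = real n * dt + dt" "real (n - 1) * dt = real n * dt - dt"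
    using time_steps[OF n] by auto
  have T: "real n * dt + dt \<le> T" "0 \<le> real n * dt - dt" "real (n + 1) * dt \<in> {0<..T}"
  proof -
    show "real n * dt + dt \<le> T" using time_in[OF m(1)] unfolding t by auto
    show "0 \<le> real n * dt - dt" using time_in[OF m(3)] unfolding t by auto
    have "0 < real (n + 1) * dt" using dt_pos by simp
    then show "real (n + 1) * dt \<in> {0<..T}" using time_in[OF m(1)] by auto
  qed
  define R1 where "R1 = ut s j (real (n + 1) * dt) c
    - (3 * ip (U s j (n + 1)) c - 4 * ip (U s j n) c + ip (U s j (n - 1)) c) / (2 * dt)"
  have R1: "\<bar>R1\<bar> \<le> B * CP * rho * h1 c"
  proof -
    have "\<bar>R1\<bar> \<le> B * dt\<^sup>2 * l2 c"
      unfolding R1_def U_def t using u3[OF j dt_pos T(2,1) c(2)] by simp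
    also have "\<dots> \<le> B * rho * (CP * h1 c)"
      using B_nonneg rho_ge c poincare by (intro mult_mono) auto
    finally show ?thesis by (simp add: algebra_simps)
  qed
  define R2 where "R2 = (\<nu> + \<nu>m) / 2 * gp (eta s j (n + 1)) c"
  have R2: "\<bar>R2\<bar> \<le> \<bar>\<nu> + \<nu>m\<bar> / 2 * (C1 * rho * h1 c)"
  proof -
    have "\<bar>gp (eta s j (n + 1)) c\<bar> \<le> h1 (eta s j (n + 1)) * h1 c"
      using G.Cauchy_Schwarz V' j m c by auto
    also have "\<dots> \<le> C1 * rho * h1 c"
      using residual_bounds(3)[OF j n, of s] c by (intro mult_right_mono) auto
    finally show ?thesis unfolding R2_def by (simp add: abs_mult mult_left_mono)
  qed
  define E where "E = U ?s j (n + 1) - ext (P ?s j) n"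
  have E: "E \<in> H" unfolding E_def using V' H' j m by auto
  define R3 where "R3 = (\<nu> - \<nu>m) / 2 * gp E c"
  have R3: "\<bar>R3\<bar> \<le> \<bar>\<nu> - \<nu>m\<bar> / 2 * ((B + 3 * C1) * rho * h1 c)"
  proof -
    have "\<bar>gp E c\<bar> \<le> h1 E * h1 c"
      using G.Cauchy_Schwarz E c by auto
    also have "\<dots> \<le> (B + 3 * C1) * rho * h1 c"
      unfolding E_def using residual_bounds(1)[OF j n, of ?s] c by (intro mult_right_mono) auto
    finally show ?thesis unfolding R3_def by (simp add: abs_mult mult_left_mono)
  qed
  define N where "N = tri (emean J (uh ?s) n) (P s j (n + 1)) c + tri (fluc J (uh ?s) j n) (ext (P s j) n) c
      - tri (U ?s j (n + 1)) (U s j (n + 1)) c"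
  note N = nonlinear_residual[OF j n cV, of s, folded N_def]
  have FV: "emean J (uh ?s) n \<in> V" "fluc J (uh ?s) j n \<in> V"
    using V' m j by (auto intro!: V_emean V_fluc)
  have F_H: "emean J (uh ?s) n \<in> H" "fluc J (uh ?s) j n \<in> H" "emean J (uh ?s) n \<in> Hd"
    "ext (P s j) n \<in> H" "ext (phi s j) n \<in> H" "ext (P ?s j) n \<in> H" "ext (phi ?s j) n \<in> H"
    using FV V_sub H' m j by auto
  have exts: "ext (uh s j) n = ext (P s j) n + ext (phi s j) n" for s
    by (simp add: ext_def phi_def algebra_simps)
  \<comment> \<open>The discrete mean is divergence-free, so its convection of \<open>phi\<close> at
    the new level, tested with the same field, is 0 by skew symmetry.\<close>
  have t1: "tri (emean J (uh ?s) n) (uh s j (n + 1)) c = tri (emean J (uh ?s) n) (P s j (n + 1)) c"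
    unfolding uhs[of s j "n + 1"] using tri_self[OF F_H(3) c(2)] F_H H'[OF m(1) j] c
    by (simp add: tri_lin c_def)
  have t2: "tri (fluc J (uh ?s) j n) (ext (uh s j) n) c
      = tri (fluc J (uh ?s) j n) (ext (P s j) n) c + tri (fluc J (uh ?s) j n) (ext (phi s j) n) c"
    unfolding exts using F_H c by (simp add: tri_lin)
  have g1: "gp (uh s j (n + 1)) c = gp (U s j (n + 1)) c - gp (eta s j (n + 1)) c + (h1 c)\<^sup>2"
    unfolding uhs[of s j "n + 1"] eta_def[of s j "n + 1"] using V' H' c m j by (simp add: G.ip_lin G.nrm_sq c_def)
  have g2: "gp (ext (uh ?s j) n) c = gp (U ?s j (n + 1)) c - gp E c + gp (ext (phi ?s j) n) c"
    unfolding exts E_def using V' F_H c m j by (simp add: G.ip_lin)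
  have mom: "ut s j (real (n + 1) * dt) c + tri (U ?s j (n + 1)) (U s j (n + 1)) c
      + (\<nu> + \<nu>m) / 2 * gp (U s j (n + 1)) c + (\<nu> - \<nu>m) / 2 * gp (U ?s j (n + 1)) c
      = F s j (real (n + 1) * dt) c"
    unfolding U_def using momentum[OF j T(3)] c by auto
  have i1: "(3 * ip (uh s j (n + 1)) c - 4 * ip (uh s j n) c + ip (uh s j (n - 1)) c) / (2 * dt)
     = (3 * ip (U s j (n + 1)) c - 4 * ip (U s j n) c + ip (U s j (n - 1)) c) / (2 * dt)
       + (3 * ip c c - 4 * ip (phi s j n) c + ip (phi s j (n - 1)) c) / (2 * dt)"
    unfolding ipuh[OF m(1)] ipuh[OF m(2)] ipuh[OF m(3)] c_def[symmetric]
    by (simp add: algebra_simps flip: add_divide_distrib)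
  have "(3 * ip c c - 4 * ip (phi s j n) c + ip (phi s j (n - 1)) c) / (2 * dt)
      + (\<nu> + \<nu>m) / 2 * (h1 c)\<^sup>2 + (\<nu> - \<nu>m) / 2 * gp (ext (phi ?s j) n) c
      + tri (fluc J (uh ?s) j n) (ext (phi s j) n) c = R1 + R2 + R3 - N"
    using scheme[OF j n cV, of s] mom
    unfolding R1_def R2_def R3_def N_def t1 t2 g1 g2 i1 by (simp add: algebra_simps)
  also have "\<bar>\<dots>\<bar> \<le> (A0 * rho + 14 * (\<epsilon>0 * GG n + Lp * SS n)) * h1 c"
  proof -
    have "\<bar>R1 + R2 + R3 - N\<bar> \<le> \<bar>R1\<bar> + \<bar>R2\<bar> + \<bar>R3\<bar> + \<bar>N\<bar>" by linarith
    also have "\<dots> \<le> B * CP * rho * h1 c + \<bar>\<nu> + \<nu>m\<bar> / 2 * (C1 * rho * h1 c)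
        + \<bar>\<nu> - \<nu>m\<bar> / 2 * ((B + 3 * C1) * rho * h1 c)
        + ((Cs * (B + 3 * C1) * B1 + Cs * B * C1 + Cs * (6 * B1) * (B + 4 * C1)) * rho
           + 14 * (\<epsilon>0 * GG n + Lp * SS n)) * h1 c"
      using R1 R2 R3 N by (intro add_mono)
    also have "\<dots> = (A0 * rho + 14 * (\<epsilon>0 * GG n + Lp * SS n)) * h1 c"
      unfolding A0_def by (simp add: algebra_simps add_divide_distrib)
    finally show ?thesis .
  qed
  finally show ?thesis .
qed

text \<open>The only part of the nonlinearity for which the time step restriction is needed; \<open>L\<close>
  is the constant that enters the Gronwall argument.\<close>

definition fluct_bound :: "nat \<Rightarrow> real \<Rightarrow> bool" where
  "fluct_bound n L \<longleftrightarrow> (\<forall>s. \<forall>j\<in>{1..J}.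
     \<bar>tri (fluc J (uh (\<not> s)) j n) (ext (phi s j) n) (phi s j (n + 1))\<bar>
     \<le> (12 * \<epsilon>0 * GG n + L * SS n + 1 / 3 * sqrt (\<alpha> / dt) * x2 s j n) * h1 (phi s j (n + 1)))"

lemma young: "0 < a \<Longrightarrow> x * y \<le> a * x\<^sup>2 + y\<^sup>2 / (4 * a)" for a x y :: real
proof -
  assume a: "0 < a"
  have "0 \<le> (2 * a * x - y)\<^sup>2 / (4 * a)" using a by simp
  also have "\<dots> = a * x\<^sup>2 + y\<^sup>2 / (4 * a) - x * y"
    using a by (simp add: power2_eq_square field_simps)
  finally show ?thesis by simp
qed

lemma delta2_phi:
  assumes "j \<in> {1..J}" and n: "n \<in> {1..<M}"
  shows "phi s j (n + 1) - 2 *\<^sub>R phi s j n + phi s j (n - 1) \<in> V"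
    and "x2 s j n = l2 (phi s j (n + 1) - ext (phi s j) n)"
    and "phi s j (n + 1) - ext (phi s j) n \<in> V"
proof -
  have V': "phi s j (n + 1) \<in> V" "phi s j n \<in> V" "phi s j (n - 1) \<in> V"
    using assms phi_in by auto
  then show "phi s j (n + 1) - 2 *\<^sub>R phi s j n + phi s j (n - 1) \<in> V"
    using V by (intro subspace_diff subspace_scale subspace_add)
  then show "phi s j (n + 1) - ext (phi s j) n \<in> V"
    by (simp add: ext_def algebra_simps)
  show "x2 s j n = l2 (phi s j (n + 1) - ext (phi s j) n)"
    by (simp add: x2_def ext_def algebra_simps)
qed

text \<open>The explicit coupling is split by writing \<open>ext phi\<close> as \<open>phi\<close>
  at the new level minus the second difference. The first part is paid by the viscosity, which is
  how \<alpha> arises. The second part costs 1 / h by the inverse inequality and is paid by the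
  dissipation of \<open>bdf2_identity\<close>, as is the fluctuation term. The coupling takes half
  of the squared second difference of the other field, the fluctuation half of that of the same
  field.\<close>

lemma energy_single:
  assumes fb: "fluct_bound n L" and L: "0 \<le> L" and j: "j \<in> {1..J}" and n: "n \<in> {1..<M}"
  shows "(l2 (phi s j (n + 1)))\<^sup>2 + (l2 (ext (phi s j) (n + 1)))\<^sup>2 - (l2 (phi s j n))\<^sup>2
      - (l2 (ext (phi s j) n))\<^sup>2 + (x2 s j n)\<^sup>2
      + 4 * dt * ((\<nu> + \<nu>m) / 2 * (h1 (phi s j (n + 1)))\<^sup>2
          - \<bar>\<nu> - \<nu>m\<bar> / 4 * ((h1 (phi s j (n + 1)))\<^sup>2 + (h1 (phi (\<not> s) j (n + 1)))\<^sup>2))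
    \<le> (x2 s j n)\<^sup>2 / 2 + (x2 (\<not> s) j n)\<^sup>2 / 2 + (10 / 9 + 1 / 4) * \<alpha> * dt * (h1 (phi s j (n + 1)))\<^sup>2
      + 48 / \<alpha> * dt * (A0\<^sup>2 * rho\<^sup>2 + 676 * \<epsilon>0\<^sup>2 * (GG n)\<^sup>2 + (14 * Lp + L)\<^sup>2 * (SS n)\<^sup>2)"
proof -
  let ?s = "\<not> s"
  define c where "c = phi s j (n + 1)"
  define y where "y = h1 c"
  define y' where "y' = h1 (phi ?s j (n + 1))"
  define x where "x = x2 s j n"
  define z where "z = x2 ?s j n"
  define r where "r = sqrt (\<alpha> / dt)"
  have m: "n + 1 \<le> M" "n \<le> M" "n - 1 \<le> M" using n by auto
  have V': "phi s j i \<in> V" if "i \<le> M" for s i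
    using that j phi_in by auto
  have H': "phi s j i \<in> H" if "i \<le> M" for s i
    using V'[OF that] V_sub by auto
  have c: "c \<in> V" "c \<in> H" unfolding c_def using V' H' m by auto
  have y: "0 \<le> y" "0 \<le> y'" "0 \<le> x" "0 \<le> z"
    unfolding y_def y'_def x_def z_def using c H' m delta2_phi(1)[OF j n] V_sub by (auto simp: x2_def)
  have r: "0 < r" "dt * r\<^sup>2 = \<alpha>"
    unfolding r_def using dt_pos \<alpha>_pos by auto
  have extH: "ext (phi s j) n \<in> H" for s using H' m by auto
  \<comment> \<open>The summand with \<nu> - \<nu>m in the step size denominator gives \<open>3 *
    \<bar>\<nu> - \<nu>m\<bar> * (Ci / h) \<le> sqrt (\<alpha> / dt)\<close>.\<close>
  have gpz: "\<bar>\<nu> - \<nu>m\<bar> / 2 * \<bar>gp (phi ?s j (n + 1) - ext (phi ?s j) n) c\<bar> \<le> 1 / 6 * r * z * y"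
  proof -
    obtain X where X: "\<forall>s. \<forall>j\<in>{1..J}. h1 (fluc J (uh s) j n) \<le> X"
      "dt * (9 * Ci\<^sup>2 * (\<nu> - \<nu>m)\<^sup>2 + 9 * Ci\<^sup>2 * Cs\<^sup>2 * X) \<le> \<alpha> * h\<^sup>2"
      using step_size[OF n] by auto
    have "fluc J (uh s) j n \<in> V" using uh_in j m by (intro V_fluc) auto
    then have "0 \<le> X" using X(1) j G.nrm_ge_0[of "fluc J (uh s) j n"] V_sub order_trans by blast
    then have "dt * (9 * Ci\<^sup>2 * (\<nu> - \<nu>m)\<^sup>2) \<le> dt * (9 * Ci\<^sup>2 * (\<nu> - \<nu>m)\<^sup>2 + 9 * Ci\<^sup>2 * Cs\<^sup>2 * X)"
      using dt_pos by (intro mult_left_mono) auto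
    then have "dt * (9 * Ci\<^sup>2 * (\<nu> - \<nu>m)\<^sup>2) \<le> \<alpha> * h\<^sup>2" using X(2) by linarith
    then have "(3 * (\<bar>\<nu> - \<nu>m\<bar> * (Ci / h)))\<^sup>2 \<le> \<alpha> / dt"
      using dt_pos h_pos by (simp add: power_mult_distrib power_divide field_simps)
    then have le: "3 * (\<bar>\<nu> - \<nu>m\<bar> * (Ci / h)) \<le> r"
      unfolding r_def by (intro real_le_rsqrt)
    have "\<bar>gp (phi ?s j (n + 1) - ext (phi ?s j) n) c\<bar> \<le> h1 (phi ?s j (n + 1) - ext (phi ?s j) n) * y"
      unfolding y_def using c H' m extH by (intro G.Cauchy_Schwarz) auto
    also have "\<dots> \<le> (Ci / h * z) * y"
      unfolding z_def delta2_phi(2)[OF j n] using inverse[OF delta2_phi(3)[OF j n]] y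
      by (intro mult_right_mono) auto
    finally have "\<bar>\<nu> - \<nu>m\<bar> / 2 * \<bar>gp (phi ?s j (n + 1) - ext (phi ?s j) n) c\<bar>
        \<le> \<bar>\<nu> - \<nu>m\<bar> / 2 * ((Ci / h * z) * y)" by (intro mult_left_mono) auto
    also have "\<dots> = 1 / 6 * (3 * (\<bar>\<nu> - \<nu>m\<bar> * (Ci / h))) * (z * y)" by simp
    also have "\<dots> \<le> 1 / 6 * r * (z * y)"
      using le y by (intro mult_right_mono mult_left_mono) auto
    finally show ?thesis by simp
  qed
  have gpy: "\<bar>\<nu> - \<nu>m\<bar> / 2 * \<bar>gp (phi ?s j (n + 1)) c\<bar> \<le> \<bar>\<nu> - \<nu>m\<bar> / 4 * (y\<^sup>2 + y'\<^sup>2)"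
  proof -
    have "\<bar>gp (phi ?s j (n + 1)) c\<bar> \<le> y' * y"
      unfolding y_def y'_def using c H' m by (intro G.Cauchy_Schwarz) auto
    also have "\<dots> \<le> (y\<^sup>2 + y'\<^sup>2) / 2"
      using zero_le_power2[of "y - y'"] by (simp add: power2_eq_square algebra_simps)
    finally have "\<bar>\<nu> - \<nu>m\<bar> / 2 * \<bar>gp (phi ?s j (n + 1)) c\<bar> \<le> \<bar>\<nu> - \<nu>m\<bar> / 2 * ((y\<^sup>2 + y'\<^sup>2) / 2)"
      by (intro mult_left_mono) auto
    then show ?thesis by simp
  qed
  \<comment> \<open>The 26 is 14 from \<open>phi_equation\<close> plus 12 from
    \<open>fluct_bound\<close>.\<close>
  define W where "W = A0 * rho + 26 * \<epsilon>0 * GG n + (14 * Lp + L) * SS n"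
  define b where "b = (3 * ip c c - 4 * ip (phi s j n) c + ip (phi s j (n - 1)) c) / (2 * dt)"
  have gps: "(\<nu> - \<nu>m) / 2 * gp (ext (phi ?s j) n) c =
      (\<nu> - \<nu>m) / 2 * gp (phi ?s j (n + 1)) c - (\<nu> - \<nu>m) / 2 * gp (phi ?s j (n + 1) - ext (phi ?s j) n) c"
    using H' m extH c by (simp add: G.ip_lin algebra_simps)
  have absl: "\<bar>(\<nu> - \<nu>m) / 2 * g\<bar> = \<bar>\<nu> - \<nu>m\<bar> / 2 * \<bar>g\<bar>" for g by (simp add: abs_mult)
  have eq: "\<bar>b + (\<nu> + \<nu>m) / 2 * y\<^sup>2 + (\<nu> - \<nu>m) / 2 * gp (ext (phi ?s j) n) c
      + tri (fluc J (uh ?s) j n) (ext (phi s j) n) c\<bar>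
    \<le> (A0 * rho + 14 * (\<epsilon>0 * GG n + Lp * SS n)) * y"
    using phi_equation[OF j n, of s] unfolding b_def y_def c_def .
  have fb': "\<bar>tri (fluc J (uh ?s) j n) (ext (phi s j) n) c\<bar>
      \<le> (12 * \<epsilon>0 * GG n + L * SS n + 1 / 3 * r * x) * y"
    using fb j unfolding fluct_bound_def c_def y_def r_def x_def by blast
  have main: "b + (\<nu> + \<nu>m) / 2 * y\<^sup>2 - \<bar>\<nu> - \<nu>m\<bar> / 4 * (y\<^sup>2 + y'\<^sup>2)
      \<le> W * y + 1 / 6 * r * z * y + 1 / 3 * r * x * y"
  proof -
    define g0 where "g0 = (\<nu> - \<nu>m) / 2 * gp (ext (phi ?s j) n) c"
    define g1 where "g1 = (\<nu> - \<nu>m) / 2 * gp (phi ?s j (n + 1)) c"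
    define g2 where "g2 = (\<nu> - \<nu>m) / 2 * gp (phi ?s j (n + 1) - ext (phi ?s j) n) c"
    have "\<bar>g1\<bar> \<le> \<bar>\<nu> - \<nu>m\<bar> / 4 * (y\<^sup>2 + y'\<^sup>2)" "\<bar>g2\<bar> \<le> 1 / 6 * r * z * y" "g0 = g1 - g2"
      using gpy gpz gps unfolding g0_def g1_def g2_def absl by auto
    moreover have "W * y + 1 / 3 * r * x * y = (A0 * rho + 14 * (\<epsilon>0 * GG n + Lp * SS n)) * y
        + (12 * \<epsilon>0 * GG n + L * SS n + 1 / 3 * r * x) * y"
      unfolding W_def by (simp add: algebra_simps)
    ultimately show ?thesis using eq fb' unfolding g0_def[symmetric] by linarith
  qed
  have "4 * dt * b = 2 * (3 * ip c c - 4 * ip (phi s j n) c + ip (phi s j (n - 1)) c)"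
    unfolding b_def using dt_pos by simp
  also have "\<dots> = (l2 c)\<^sup>2 + (l2 (2 *\<^sub>R c - phi s j n))\<^sup>2 - (l2 (phi s j n))\<^sup>2
      - (l2 (2 *\<^sub>R phi s j n - phi s j (n - 1)))\<^sup>2
      + (l2 (c - 2 *\<^sub>R phi s j n + phi s j (n - 1)))\<^sup>2"
    using c H' m by (intro L.bdf2_identity) auto
  also have "\<dots> = (l2 c)\<^sup>2 + (l2 (ext (phi s j) (n + 1)))\<^sup>2 - (l2 (phi s j n))\<^sup>2
      - (l2 (ext (phi s j) n))\<^sup>2 + x\<^sup>2"
    by (simp add: x_def x2_def c_def ext_def)
  finally have bdf: "4 * dt * b = (l2 c)\<^sup>2 + (l2 (ext (phi s j) (n + 1)))\<^sup>2 - (l2 (phi s j n))\<^sup>2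
      - (l2 (ext (phi s j) n))\<^sup>2 + x\<^sup>2" .
  \<comment> \<open>Young's inequality with weight 1/2 on the second difference; since
    \<open>dt * r\<^sup>2 = \<alpha>\<close>, what remains is a multiple of the viscous term.
    \<open>Y1\<close> and \<open>Y2\<close> take 2/9 + 8/9 = 10/9 and \<open>Y3\<close> takes 1/4;
    the total 49/36 stays below the factor 2 that is available after summation over the
    fields.\<close>
  have Y1: "4 * dt * (1 / 6 * r * z * y) \<le> z\<^sup>2 / 2 + 2 / 9 * \<alpha> * dt * y\<^sup>2"
  proof -
    have "z * (2 / 3 * dt * r * y) \<le> 1 / 2 * z\<^sup>2 + (2 / 3 * dt * r * y)\<^sup>2 / (4 * (1 / 2))"
      by (rule young) simp
    also have "(2 / 3 * dt * r * y)\<^sup>2 = 4 / 9 * \<alpha> * dt * y\<^sup>2"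
      unfolding r(2)[symmetric] by (simp add: power2_eq_square)
    finally show ?thesis by (simp add: algebra_simps)
  qed
  have Y2: "4 * dt * (1 / 3 * r * x * y) \<le> x\<^sup>2 / 2 + 8 / 9 * \<alpha> * dt * y\<^sup>2"
  proof -
    have "x * (4 / 3 * dt * r * y) \<le> 1 / 2 * x\<^sup>2 + (4 / 3 * dt * r * y)\<^sup>2 / (4 * (1 / 2))"
      by (rule young) simp
    also have "(4 / 3 * dt * r * y)\<^sup>2 = 16 / 9 * \<alpha> * dt * y\<^sup>2"
      unfolding r(2)[symmetric] by (simp add: power2_eq_square)
    finally show ?thesis by (simp add: algebra_simps)
  qed
  have Y3: "4 * dt * (W * y) \<le> 1 / 4 * \<alpha> * dt * y\<^sup>2
      + 48 / \<alpha> * dt * (A0\<^sup>2 * rho\<^sup>2 + 676 * \<epsilon>0\<^sup>2 * (GG n)\<^sup>2 + (14 * Lp + L)\<^sup>2 * (SS n)\<^sup>2)"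
  proof -
    have "y * (4 * W) \<le> \<alpha> / 4 * y\<^sup>2 + (4 * W)\<^sup>2 / (4 * (\<alpha> / 4))"
      using \<alpha>_pos by (intro young) simp
    then have 1: "4 * W * y \<le> \<alpha> / 4 * y\<^sup>2 + 16 / \<alpha> * W\<^sup>2"
      by (simp add: power_mult_distrib mult.commute)
    have 2: "(a + b + c)\<^sup>2 \<le> 3 * (a\<^sup>2 + b\<^sup>2 + c\<^sup>2)" for a b c :: real
      using zero_le_power2[of "a - b"] zero_le_power2[of "a - c"] zero_le_power2[of "b - c"]
      by (simp add: power2_eq_square algebra_simps)
    have "W\<^sup>2 \<le> 3 * (A0\<^sup>2 * rho\<^sup>2 + 676 * \<epsilon>0\<^sup>2 * (GG n)\<^sup>2 + (14 * Lp + L)\<^sup>2 * (SS n)\<^sup>2)"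
      using 2[of "A0 * rho" "26 * \<epsilon>0 * GG n" "(14 * Lp + L) * SS n"]
      by (simp add: W_def power_mult_distrib)
    then have "16 / \<alpha> * W\<^sup>2 \<le> 16 / \<alpha> * (3 * (A0\<^sup>2 * rho\<^sup>2 + 676 * \<epsilon>0\<^sup>2 * (GG n)\<^sup>2 + (14 * Lp + L)\<^sup>2 * (SS n)\<^sup>2))"
      using \<alpha>_pos by (intro mult_left_mono) auto
    with 1 have "4 * W * y \<le> \<alpha> / 4 * y\<^sup>2
        + 48 / \<alpha> * (A0\<^sup>2 * rho\<^sup>2 + 676 * \<epsilon>0\<^sup>2 * (GG n)\<^sup>2 + (14 * Lp + L)\<^sup>2 * (SS n)\<^sup>2)" by simp
    from mult_left_mono[OF this, of dt] show ?thesis using dt_pos by (simp add: algebra_simps)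
  qed
  have "4 * dt * (b + (\<nu> + \<nu>m) / 2 * y\<^sup>2 - \<bar>\<nu> - \<nu>m\<bar> / 4 * (y\<^sup>2 + y'\<^sup>2))
      \<le> 4 * dt * (W * y + 1 / 6 * r * z * y + 1 / 3 * r * x * y)"
    using main dt_pos by (intro mult_left_mono) auto
  also have "\<dots> = 4 * dt * (W * y) + 4 * dt * (1 / 6 * r * z * y) + 4 * dt * (1 / 3 * r * x * y)"
    by (simp add: algebra_simps)
  finally have "4 * dt * b + 4 * dt * ((\<nu> + \<nu>m) / 2 * y\<^sup>2 - \<bar>\<nu> - \<nu>m\<bar> / 4 * (y\<^sup>2 + y'\<^sup>2))
      \<le> 4 * dt * (W * y) + 4 * dt * (1 / 6 * r * z * y) + 4 * dt * (1 / 3 * r * x * y)"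
    by (simp add: right_diff_distrib distrib_left)
  with Y1 Y2 Y3 bdf show ?thesis
    unfolding c_def[symmetric] y_def[symmetric] y'_def[symmetric] x_def[symmetric] z_def[symmetric]
    by (simp add: distrib_right)
qed

end

section \<open>Constants of the Gronwall argument\<close>

context elsasser_data
begin

text \<open>\<open>rho \<le> cst * h\<^sup>2\<close> at the levels where the fluctuation exceeds \<open>1\<close>; below the step size
  \<open>dt0\<close> the induction hypothesis absorbs the fluctuation of \<open>phi\<close>.\<close>

definition "KK L = 96 * real J / \<alpha> * (A0\<^sup>2 + 36 * real J * (14 * Lp + L)\<^sup>2)"
definition "Kinit = 44 * real J * (CP\<^sup>2 * C1\<^sup>2 + C0) + 2 * real J * (\<alpha> * T * C1\<^sup>2 + C0)"
text \<open>The bound that discrete Gronwall gives for \<open>SA n\<close> in units of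
  \<open>rho\<^sup>2\<close>, when the fluctuation term contributes the constant \<open>L\<close> at
  \<open>SS\<close>.\<close>

definition "Kst L = exp (KK L * T) * (Kinit + KK L * T)"
definition "cst = D ^ (k - 2) + \<alpha> / (9 * Ci\<^sup>2 * Cs\<^sup>2) * T"
text \<open>Solved from the condition of \<open>fluct_absorb\<close>, with the fluctuation of
  \<open>phi\<close> bounded through \<open>Kst\<close> and through
  \<open>rho \<le> cst * h\<^sup>2\<close>. The 576 is 16 times 36, from the 4 in the bound on the
  fluctuation and from \<open>SS_sq\<close>. The + 1 keeps the denominator positive.\<close>

definition "dt0 = \<alpha> / (9 * (Cs * Ci\<^sup>2 * cst)\<^sup>2 * (576 * real J * Kst (12 * Lp)) + 1)"
text \<open>When dt is at least \<open>dt0\<close>, the step size restriction bounds X / h; this is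
  the factor at \<open>SS\<close> that results in \<open>fluct_crude\<close>.\<close>

definition "L3 = 2 * \<alpha> * D / (9 * Ci * Cs * dt0)"
definition "K1 = Kst (12 * Lp) + Kst L3"
definition "Kfinal = 2 * (18 * CP\<^sup>2 * C1\<^sup>2 + 288 * real J * K1 + 18 * \<alpha> * T * C1\<^sup>2 + 384 * real J * K1)"

lemma KK_nonneg: "0 \<le> KK L"
  unfolding KK_def using \<alpha>_pos by simp

lemma Kinit_nonneg: "0 \<le> Kinit"
  unfolding Kinit_def using \<alpha>_pos T_pos C0_nonneg by simp

lemma Kst_nonneg: "0 \<le> Kst L"
  unfolding Kst_def using KK_nonneg[of L] Kinit_nonneg T_pos by simp

lemma dt0_pos: "0 < dt0"
  unfolding dt0_def using \<alpha>_pos Kst_nonneg by (intro divide_pos_pos add_nonneg_pos) auto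

lemma dt0_le: "9 * (Cs * Ci\<^sup>2 * cst)\<^sup>2 * (576 * real J * Kst (12 * Lp)) * dt0 \<le> \<alpha>"
proof -
  define x where "x = 9 * (Cs * Ci\<^sup>2 * cst)\<^sup>2 * (576 * real J * Kst (12 * Lp))"
  have "0 \<le> x" unfolding x_def using Kst_nonneg by simp
  then have "x * (\<alpha> / (x + 1)) \<le> \<alpha>" using \<alpha>_pos by (simp add: field_simps)
  then show ?thesis unfolding dt0_def x_def by simp
qed

lemma L3_nonneg: "0 \<le> L3"
  unfolding L3_def using \<alpha>_pos D_pos Ci_pos Cs_pos dt0_pos by simp

end

context elsasser_discrete
begin

lemma sum_sq_le: "(a + b)\<^sup>2 \<le> 2 * a\<^sup>2 + 2 * b\<^sup>2" for a b :: real
  using zero_le_power2[of "a - b"] by (simp add: power2_eq_square algebra_simps)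

lemma GG_sq: "(GG n)\<^sup>2 \<le> 4 * real J * (Dn n + Dn (n - 1))"
proof -
  have "tot (\<lambda>s j. (h1 (phi s j n) + h1 (phi s j (n - 1)))\<^sup>2)
      \<le> tot (\<lambda>s j. 2 * (h1 (phi s j n))\<^sup>2 + 2 * (h1 (phi s j (n - 1)))\<^sup>2)"
    by (intro tot_mono sum_sq_le)
  also have "\<dots> = 2 * (Dn n + Dn (n - 1))" by (simp add: tot_add tot_cmult Dn_def)
  finally have "2 * real J * tot (\<lambda>s j. (h1 (phi s j n) + h1 (phi s j (n - 1)))\<^sup>2)
      \<le> 2 * real J * (2 * (Dn n + Dn (n - 1)))" by (intro mult_left_mono) auto
  from order_trans[OF tot_square_le this] show ?thesis
    unfolding GG_def by (simp add: algebra_simps)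
qed

text \<open>\<open>En n\<close> holds no norm at level n - 1. That field is recovered as twice
  \<open>phi\<close> at level n minus the extrapolation, which \<open>SS_sq\<close> needs.\<close>

lemma l2_prev:
  assumes "j \<in> {1..J}" "n \<le> M"
  shows "l2 (phi s j (n - 1)) \<le> 2 * l2 (phi s j n) + l2 (ext (phi s j) n)"
proof -
  have H: "phi s j n \<in> H" "phi s j (n - 1) \<in> H" using assms phi_in V_sub by auto
  then have "ext (phi s j) n \<in> H" by simp
  from L.nrm_triangle_diff[OF L.H_scale[OF H(1), of 2] this]
  show ?thesis using L.nrm_scale[OF H(1), of 2] by (simp add: ext_def)
qed

lemma SS_sq:
  assumes n: "n \<le> M"
  shows "(SS n)\<^sup>2 \<le> 36 * real J * En n"
proof -
  have "tot (\<lambda>s j. (l2 (phi s j n) + l2 (phi s j (n - 1)))\<^sup>2)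
      \<le> tot (\<lambda>s j. 18 * ((l2 (phi s j n))\<^sup>2 + (l2 (ext (phi s j) n))\<^sup>2))"
  proof (rule tot_mono)
    fix s j assume j: "j \<in> {1..J}"
    have H: "phi s j n \<in> H" "phi s j (n - 1) \<in> H" using j n phi_in V_sub by auto
    have "(l2 (phi s j n) + l2 (phi s j (n - 1)))\<^sup>2 \<le> (3 * l2 (phi s j n) + l2 (ext (phi s j) n))\<^sup>2"
      using l2_prev[OF j n, of s] H by (intro power_mono) auto
    also have "\<dots> \<le> 2 * (3 * l2 (phi s j n))\<^sup>2 + 2 * (l2 (ext (phi s j) n))\<^sup>2"
      by (rule sum_sq_le)
    also have "\<dots> \<le> 18 * ((l2 (phi s j n))\<^sup>2 + (l2 (ext (phi s j) n))\<^sup>2)"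
      by (simp add: power_mult_distrib)
    finally show "(l2 (phi s j n) + l2 (phi s j (n - 1)))\<^sup>2
      \<le> 18 * ((l2 (phi s j n))\<^sup>2 + (l2 (ext (phi s j) n))\<^sup>2)" .
  qed
  also have "\<dots> = 18 * En n" by (simp only: tot_cmult En_def)
  finally have "2 * real J * tot (\<lambda>s j. (l2 (phi s j n) + l2 (phi s j (n - 1)))\<^sup>2)
      \<le> 2 * real J * (18 * En n)" by (intro mult_left_mono) auto
  from order_trans[OF tot_square_le this] show ?thesis
    unfolding SS_def by (simp add: algebra_simps)
qed

lemma En_nonneg: "0 \<le> En n" and Dn_nonneg: "0 \<le> Dn n"
  unfolding En_def Dn_def by (auto intro: tot_nonneg)

text \<open>Both fields have to be added: by the symmetry of \<open>tot\<close> under their exchange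
  the two halves of squared second differences sum up to exactly the dissipation on the left, and
  the viscous terms combine to twice \<nu> + \<nu>m minus twice the modulus of \<nu> - \<nu>m, which
  is 2 \<alpha>.\<close>

lemma energy_step:
  assumes fb: "fluct_bound n L" and L: "0 \<le> L" and n: "n \<in> {1..<M}"
  shows "En (n + 1) + \<alpha> / 2 * dt * Dn (n + 1)
    \<le> (1 + KK L * dt) * En n + KK L * dt * rho\<^sup>2 + \<alpha> / 8 * dt * (Dn n + Dn (n - 1))"
proof -
  define Xn where "Xn = tot (\<lambda>s j. (x2 s j n)\<^sup>2)"
  define W where "W = A0\<^sup>2 * rho\<^sup>2 + 676 * \<epsilon>0\<^sup>2 * (GG n)\<^sup>2 + (14 * Lp + L)\<^sup>2 * (SS n)\<^sup>2"
  have "tot (\<lambda>s j. ((l2 (phi s j (n + 1)))\<^sup>2 + (l2 (ext (phi s j) (n + 1)))\<^sup>2) - ((l2 (phi s j n))\<^sup>2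
      + (l2 (ext (phi s j) n))\<^sup>2) + (x2 s j n)\<^sup>2
      + (2 * dt * (\<nu> + \<nu>m) * (h1 (phi s j (n + 1)))\<^sup>2
          - dt * \<bar>\<nu> - \<nu>m\<bar> * ((h1 (phi s j (n + 1)))\<^sup>2 + (h1 (phi (\<not> s) j (n + 1)))\<^sup>2)))
    \<le> tot (\<lambda>s j. 1 / 2 * (x2 s j n)\<^sup>2 + 1 / 2 * (x2 (\<not> s) j n)\<^sup>2
      + (10 / 9 + 1 / 4) * \<alpha> * dt * (h1 (phi s j (n + 1)))\<^sup>2 + 48 / \<alpha> * dt * W)"
    (is "tot ?l \<le> tot ?r")
  proof (rule tot_mono)
    fix s j assume "j \<in> {1..J}"
    have "4 * dt * ((\<nu> + \<nu>m) / 2 * a - \<bar>\<nu> - \<nu>m\<bar> / 4 * b) = 2 * dt * (\<nu> + \<nu>m) * a - dt * \<bar>\<nu> - \<nu>m\<bar> * b" for a b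
      by (simp add: algebra_simps add_divide_distrib)
    with energy_single[OF fb L \<open>j \<in> {1..J}\<close> n, of s] show "?l s j \<le> ?r s j"
      unfolding W_def[symmetric] by simp
  qed
  also have "tot ?r = 1 / 2 * Xn + 1 / 2 * Xn + (10 / 9 + 1 / 4) * \<alpha> * dt * Dn (n + 1)
      + 2 * real J * (48 / \<alpha> * dt * W)"
    unfolding tot_add tot_cmult tot_const Xn_def Dn_def
    using tot_swap[of "\<lambda>s j. (x2 s j n)\<^sup>2"] by (simp only: mult_ac)
  also have "tot ?l = En (n + 1) - En n + Xn + (2 * dt * (\<nu> + \<nu>m) * Dn (n + 1)
      - dt * \<bar>\<nu> - \<nu>m\<bar> * (Dn (n + 1) + Dn (n + 1)))"
    unfolding tot_add tot_diff tot_cmult Xn_def Dn_def En_def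
    using tot_swap[of "\<lambda>s j. (h1 (phi s j (n + 1)))\<^sup>2"] by (simp only:)
  also have "\<dots> = En (n + 1) - En n + Xn + 2 * \<alpha> * dt * Dn (n + 1)"
    unfolding \<alpha>_def by (simp add: algebra_simps)
  finally have 1: "En (n + 1) + (2 - 49 / 36) * (\<alpha> * dt * Dn (n + 1)) \<le> En n + 96 * real J / \<alpha> * dt * W"
    by (simp add: algebra_simps)
  have "0 \<le> \<alpha> * dt * Dn (n + 1)" using \<alpha>_pos dt_pos Dn_nonneg by simp
  with 1 have 2: "En (n + 1) + \<alpha> / 2 * dt * Dn (n + 1) \<le> En n + 96 * real J / \<alpha> * dt * W"
    by simp
  have W1: "W \<le> A0\<^sup>2 * rho\<^sup>2 + 676 * \<epsilon>0\<^sup>2 * (4 * real J * (Dn n + Dn (n - 1))) + (14 * Lp + L)\<^sup>2 * (36 * real J * En n)"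
    unfolding W_def using GG_sq[of n] SS_sq[of n] n by (intro add_mono mult_left_mono) auto
  have "96 * real J / \<alpha> * dt * W \<le> 96 * real J / \<alpha> * dt * (A0\<^sup>2 * rho\<^sup>2
      + 676 * \<epsilon>0\<^sup>2 * (4 * real J * (Dn n + Dn (n - 1))) + (14 * Lp + L)\<^sup>2 * (36 * real J * En n))"
    using dt_pos \<alpha>_pos by (intro mult_left_mono[OF W1]) auto
  also have "\<dots> = dt * (96 * real J / \<alpha> * A0\<^sup>2) * rho\<^sup>2
      + dt * (96 * real J / \<alpha> * (36 * real J * (14 * Lp + L)\<^sup>2)) * En n
      + (96 * real J / \<alpha> * 676 * \<epsilon>0\<^sup>2 * 4 * real J) * (dt * (Dn n + Dn (n - 1)))"
    by (simp add: algebra_simps add_divide_distrib)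
  also have "96 * real J / \<alpha> * 676 * \<epsilon>0\<^sup>2 * 4 * real J = 259584 / 4000000 * \<alpha>"
    unfolding \<epsilon>0_def using J_pos \<alpha>_pos by (simp add: power2_eq_square field_simps)
  also have "dt * (96 * real J / \<alpha> * A0\<^sup>2) * rho\<^sup>2
      + dt * (96 * real J / \<alpha> * (36 * real J * (14 * Lp + L)\<^sup>2)) * En n
      + 259584 / 4000000 * \<alpha> * (dt * (Dn n + Dn (n - 1)))
    \<le> dt * KK L * rho\<^sup>2 + dt * KK L * En n + 1 / 8 * \<alpha> * (dt * (Dn n + Dn (n - 1)))"
  proof (intro add_mono mult_right_mono mult_left_mono)
    show "96 * real J / \<alpha> * A0\<^sup>2 \<le> KK L" "96 * real J / \<alpha> * (36 * real J * (14 * Lp + L)\<^sup>2) \<le> KK L"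
      unfolding KK_def by (rule mult_left_mono; use \<alpha>_pos in simp)+
  qed (use dt_pos \<alpha>_pos En_nonneg Dn_nonneg in auto)
  finally have "96 * real J / \<alpha> * dt * W
    \<le> dt * KK L * rho\<^sup>2 + dt * KK L * En n + 1 / 8 * \<alpha> * (dt * (Dn n + Dn (n - 1)))" .
  with 2 show ?thesis by (simp add: algebra_simps)
qed

text \<open>The weights make the older dissipation telescope. In \<open>energy_step\<close> the
  levels n and n - 1 appear on the right with \<alpha> / 8 each, and level n + 1 on the left with
  \<alpha> / 2. One half of the latter is carried along as the \<alpha> / 4 term, the other half
  enters the sum.\<close>

definition "SA n = En n + \<alpha> / 4 * dt * Dn n + \<alpha> / 8 * dt * Dn (n - 1) + \<alpha> / 4 * dt * (\<Sum>i=2..n. Dn i)"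

lemma SA_step:
  assumes fb: "fluct_bound n L" and L: "0 \<le> L" and n: "n \<in> {1..<M}"
  shows "SA (n + 1) \<le> (1 + KK L * dt) * SA n + KK L * dt * rho\<^sup>2"
proof -
  have s: "(\<Sum>i=2..n+1. Dn i) = (\<Sum>i=2..n. Dn i) + Dn (n + 1)"
    using n by (simp add: sum.nat_ivl_Suc')
  define R where "R = \<alpha> / 4 * dt * Dn n + \<alpha> / 8 * dt * Dn (n - 1) + \<alpha> / 4 * dt * (\<Sum>i=2..n. Dn i)"
  have SA: "SA n = En n + R" by (simp add: SA_def R_def)
  have "0 \<le> R" unfolding R_def using \<alpha>_pos dt_pos Dn_nonneg by (intro add_nonneg_nonneg mult_nonneg_nonneg sum_nonneg) auto
  then have "0 \<le> KK L * dt * R" using KK_nonneg[of L] dt_pos by simp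
  then show ?thesis using energy_step[OF fb L n]
    unfolding SA unfolding SA_def s R_def by (simp add: algebra_simps add_divide_distrib)
qed

lemma dt_le_T: "dt \<le> T"
  using M_ge dt_pos mult_right_mono[of 1 "real M" dt] by (simp add: M_dt)

text \<open>\<open>phi\<close> is \<open>eta\<close> minus the initial error, and the latter is
  given in the step-weighted norm. For the projection error the factor \<open>dt\<close> in front of
  the H1 norm is bounded by \<open>T\<close>.\<close>

lemma initial_bounds:
  assumes j: "j \<in> {1..J}" and n: "n \<in> {0, 1}"
  shows "(l2 (phi s j n))\<^sup>2 \<le> 2 * (CP\<^sup>2 * C1\<^sup>2 + C0) * rho\<^sup>2"
    and "\<alpha> * dt * (h1 (phi s j n))\<^sup>2 \<le> 2 * (\<alpha> * T * C1\<^sup>2 + C0) * rho\<^sup>2"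
proof -
  have m: "n \<le> M" using M_ge n by auto
  define e where "e = U s j n - uh s j n"
  have in_H: "e \<in> H" "eta s j n \<in> H" "phi s j n \<in> H"
    unfolding e_def using U_in[OF j m] uh_in[OF j m] eta_in[OF j m] phi_in[OF j m] V_sub by auto
  have phi: "phi s j n = eta s j n - e" by (simp add: phi_def e_def eta_def)
  have e: "(l2 e)\<^sup>2 + \<alpha> * dt * (h1 e)\<^sup>2 \<le> C0 * rho\<^sup>2"
    using init[OF j n, of s] mult_left_mono[OF rho_sq_ge C0_nonneg] unfolding e_def U_def by linarith
  have pos: "0 \<le> (l2 e)\<^sup>2" "0 \<le> \<alpha> * dt * (h1 e)\<^sup>2" using \<alpha>_pos dt_pos by auto
  have e2: "\<alpha> * dt * (h1 e)\<^sup>2 \<le> C0 * rho\<^sup>2" using e pos by linarith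
  have eta1: "h1 (eta s j n) \<le> C1 * rho"
    using eta_le[OF j m, of s] mult_left_mono[OF rho_ge(2) C1_nonneg] by linarith
  have eta0: "l2 (eta s j n) \<le> CP * (C1 * rho)"
    using poincare[OF in_H(2)] mult_left_mono[OF eta1 CP_nonneg] by linarith
  have "(l2 (phi s j n))\<^sup>2 \<le> (CP * (C1 * rho) + l2 e)\<^sup>2"
    unfolding phi using L.nrm_triangle_diff[OF in_H(2,1)] eta0 in_H by (intro power_mono) auto
  also have "\<dots> \<le> 2 * (CP * (C1 * rho))\<^sup>2 + 2 * (l2 e)\<^sup>2" by (rule sum_sq_le)
  also have "\<dots> \<le> 2 * (CP * (C1 * rho))\<^sup>2 + 2 * (C0 * rho\<^sup>2)" using e pos by linarith
  finally show "(l2 (phi s j n))\<^sup>2 \<le> 2 * (CP\<^sup>2 * C1\<^sup>2 + C0) * rho\<^sup>2"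
    by (simp add: algebra_simps)
  have "(h1 (phi s j n))\<^sup>2 \<le> (C1 * rho + h1 e)\<^sup>2"
    unfolding phi using G.nrm_triangle_diff[OF in_H(2,1)] eta1 in_H by (intro power_mono) auto
  also have "\<dots> \<le> 2 * (C1 * rho)\<^sup>2 + 2 * (h1 e)\<^sup>2" by (rule sum_sq_le)
  finally have "\<alpha> * dt * (h1 (phi s j n))\<^sup>2 \<le> \<alpha> * dt * (2 * (C1 * rho)\<^sup>2 + 2 * (h1 e)\<^sup>2)"
    using \<alpha>_pos dt_pos by (intro mult_left_mono) auto
  also have "\<dots> = 2 * (\<alpha> * (C1 * rho)\<^sup>2) * dt + 2 * (\<alpha> * dt * (h1 e)\<^sup>2)" by (simp add: algebra_simps)
  also have "\<dots> \<le> 2 * (\<alpha> * (C1 * rho)\<^sup>2) * T + 2 * (C0 * rho\<^sup>2)"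
    using e2 dt_le_T \<alpha>_pos by (intro add_mono mult_left_mono) auto
  finally show "\<alpha> * dt * (h1 (phi s j n))\<^sup>2 \<le> 2 * (\<alpha> * T * C1\<^sup>2 + C0) * rho\<^sup>2"
    by (simp add: algebra_simps)
qed

lemma SA_init: "SA 1 \<le> Kinit * rho\<^sup>2"
proof -
  define a where "a = 2 * (CP\<^sup>2 * C1\<^sup>2 + C0) * rho\<^sup>2"
  define b where "b = 2 * (\<alpha> * T * C1\<^sup>2 + C0) * rho\<^sup>2"
  \<comment> \<open>The 11 is 1 + 8 + 2, the last two from (2 x + y)^2 being at most 8 x^2 + 2
    y^2.\<close>
  have "En 1 \<le> tot (\<lambda>s j. 11 * a)"
    unfolding En_def
  proof (rule tot_mono)
    fix s j assume j: "j \<in> {1..J}"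
    have H: "phi s j 1 \<in> H" "phi s j 0 \<in> H" using j M_ge phi_in V_sub by auto
    have "(l2 (ext (phi s j) 1))\<^sup>2 \<le> (2 * l2 (phi s j 1) + l2 (phi s j 0))\<^sup>2"
      using L.nrm_ext_le[of "phi s j" 1] H by (intro power_mono) auto
    also have "\<dots> \<le> 8 * (l2 (phi s j 1))\<^sup>2 + 2 * (l2 (phi s j 0))\<^sup>2"
      using sum_sq_le[of "2 * l2 (phi s j 1)" "l2 (phi s j 0)"] by (simp add: power_mult_distrib)
    finally show "(l2 (phi s j 1))\<^sup>2 + (l2 (ext (phi s j) 1))\<^sup>2 \<le> 11 * a"
      using initial_bounds(1)[OF j, of 1 s] initial_bounds(1)[OF j, of 0 s] unfolding a_def[symmetric] by simp
  qed
  then have E: "En 1 \<le> 22 * real J * a" by (simp add: tot_const)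
  have D: "\<alpha> * dt * Dn n \<le> 2 * real J * b" if "n \<in> {0, 1}" for n
  proof -
    have "tot (\<lambda>s j. \<alpha> * dt * (h1 (phi s j n))\<^sup>2) \<le> tot (\<lambda>s j. b)"
      unfolding b_def using initial_bounds(2) that by (intro tot_mono) auto
    then show ?thesis by (simp add: tot_cmult tot_const Dn_def)
  qed
  have b: "0 \<le> real J * b" unfolding b_def using \<alpha>_pos T_pos C0_nonneg by simp
  have "SA 1 = En 1 + 1 / 4 * (\<alpha> * dt * Dn 1) + 1 / 8 * (\<alpha> * dt * Dn 0)"
    by (simp add: SA_def)
  also have "\<dots> \<le> 22 * real J * a + real J * b"
    using E D[of 0] D[of 1] b by simp
  also have "\<dots> = Kinit * rho\<^sup>2" unfolding a_def b_def Kinit_def by (simp add: algebra_simps)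
  finally show ?thesis .
qed

text \<open>The premise \<open>fb\<close> may use the error bound at its own level, which the
  induction has just established: this is the bootstrap for the fluctuation of \<open>phi\<close>.
  The induction carries the product of (1 + q)^m and Kinit + m q, and \<open>le\<close> compares it
  with \<open>Kst L\<close> at each level.\<close>

lemma gronwall:
  assumes L: "0 \<le> L"
    and fb: "\<And>n. n \<in> {1..<M} \<Longrightarrow> SA n \<le> Kst L * rho\<^sup>2 \<Longrightarrow> fluct_bound n L"
    and n: "n \<in> {1..M}"
  shows "SA n \<le> Kst L * rho\<^sup>2"
proof -
  define q where "q = KK L * dt"
  have q: "0 \<le> q" unfolding q_def using KK_nonneg dt_pos by simp
  have le: "(1 + q) ^ m * (Kinit + real m * q) * rho\<^sup>2 \<le> Kst L * rho\<^sup>2" if "m \<le> M" for m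
  proof -
    have mq: "real m * q \<le> KK L * T"
      using time_in[OF that] KK_nonneg[of L] mult_left_mono[of "real m * dt" T "KK L"]
      by (simp add: q_def mult_ac)
    have "(1 + q) ^ m \<le> exp q ^ m" using q by (intro power_mono exp_ge_add_one_self) auto
    also have "\<dots> = exp (real m * q)" by (simp add: exp_of_nat_mult)
    also have "\<dots> \<le> exp (KK L * T)" using mq by simp
    finally show ?thesis unfolding Kst_def
      using mq q Kinit_nonneg by (intro mult_right_mono mult_mono) auto
  qed
  have "SA (Suc m) \<le> (1 + q) ^ m * (Kinit + real m * q) * rho\<^sup>2" if "Suc m \<le> M" for m
    using that
  proof (induction m)
    case 0
    then show ?case using SA_init by simp
  next
    case (Suc m)
    then have IH: "SA (Suc m) \<le> (1 + q) ^ m * (Kinit + real m * q) * rho\<^sup>2" by simp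
    have "fluct_bound (Suc m) L"
      using Suc.prems le[of m] IH by (intro fb) auto
    then have "SA (Suc m + 1) \<le> (1 + q) * SA (Suc m) + q * rho\<^sup>2"
      unfolding q_def using Suc.prems by (intro SA_step L) auto
    also have "\<dots> \<le> (1 + q) * ((1 + q) ^ m * (Kinit + real m * q) * rho\<^sup>2) + (1 + q) ^ Suc m * q * rho\<^sup>2"
    proof (intro add_mono mult_left_mono IH mult_right_mono)
      show "q \<le> (1 + q) ^ Suc m * q"
        using mult_right_mono[OF one_le_power[of "1 + q" "Suc m"] q] q by simp
    qed (use q in auto)
    also have "\<dots> = (1 + q) ^ Suc m * (Kinit + real (Suc m) * q) * rho\<^sup>2"
      by (simp add: algebra_simps)
    finally show ?case by simp
  qed
  from this[of "n - 1"] le[of "n - 1"] n show ?thesis by fastforce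
qed

end

section \<open>Control of the fluctuation term and the abstract error bound\<close>

context elsasser_discrete
begin

lemma step_size_X:
  assumes n: "n \<in> {1..<M}"
  obtains X where "0 \<le> X" "\<And>s j. j \<in> {1..J} \<Longrightarrow> h1 (fluc J (uh s) j n) \<le> X"
    "dt * (9 * Ci\<^sup>2 * Cs\<^sup>2 * X) \<le> \<alpha> * h\<^sup>2"
proof -
  obtain X where X: "\<forall>s. \<forall>j\<in>{1..J}. h1 (fluc J (uh s) j n) \<le> X"
      "dt * (9 * Ci\<^sup>2 * (\<nu> - \<nu>m)\<^sup>2 + 9 * Ci\<^sup>2 * Cs\<^sup>2 * X) \<le> \<alpha> * h\<^sup>2"
    using step_size[OF n] by auto
  have "fluc J (uh True) 1 n \<in> H" using uh_in J_pos n by (intro V_sub(1) V_fluc) auto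
  then have "0 \<le> X" using X(1) J_pos G.nrm_ge_0[of "fluc J (uh True) 1 n"]
    by (meson atLeastAtMost_iff order_refl order_trans)
  moreover have "dt * (9 * Ci\<^sup>2 * Cs\<^sup>2 * X) \<le> dt * (9 * Ci\<^sup>2 * (\<nu> - \<nu>m)\<^sup>2 + 9 * Ci\<^sup>2 * Cs\<^sup>2 * X)"
    using dt_pos by (intro mult_left_mono) auto
  ultimately show ?thesis using that X by fastforce
qed

lemma phi_nonneg:
  assumes "j \<in> {1..J}" "n \<in> {1..<M}"
  shows "0 \<le> h1 (phi s j (n + 1))" "0 \<le> x2 s j n" "0 \<le> GG n" "0 \<le> SS n"
proof -
  have H: "phi s j i \<in> H" if "i \<le> M" "j \<in> {1..J}" for s j i using that phi_in V_sub by auto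
  show "0 \<le> h1 (phi s j (n + 1))" using H assms by auto
  show "0 \<le> x2 s j n" using delta2_phi(1)[OF assms] V_sub unfolding x2_def by auto
  show "0 \<le> GG n" "0 \<le> SS n" unfolding GG_def SS_def
    using H assms by (auto intro!: tot_nonneg add_nonneg_nonneg)
qed

text \<open>As \<open>x\<close> is divergence-free, subtracting the test field from the convected
  one changes nothing, and what is then convected is a second difference. The inverse inequality
  bounds it by \<open>Ci / h * x2\<close>, and \<open>Y\<close> is the condition under which the
  resulting factor is at most a third of \<open>sqrt (\<alpha> / dt)\<close>.\<close>

lemma fluct_absorb:
  assumes j: "j \<in> {1..J}" and n: "n \<in> {1..<M}" and x: "x \<in> V" and xle: "h1 x \<le> Y"
    and Y: "dt * (9 * Cs\<^sup>2 * Ci\<^sup>2 * Y\<^sup>2) \<le> \<alpha> * h\<^sup>2"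
  shows "\<bar>tri x (ext (phi s j) n) (phi s j (n + 1))\<bar>
    \<le> 1 / 3 * sqrt (\<alpha> / dt) * x2 s j n * h1 (phi s j (n + 1))"
proof -
  let ?c = "phi s j (n + 1)" and ?e = "ext (phi s j) n"
  have V': "?c \<in> V" "?e \<in> V" using j n phi_in by (auto intro!: V_ext)
  have Y0: "0 \<le> Y" using xle x V_sub G.nrm_ge_0[of x] by (meson order_trans)
  have "tri x (?c - ?e) ?c = - tri x ?e ?c"
    using V' x V_sub tri_self[of x ?c] by (simp add: tri_lin)
  then have "\<bar>tri x ?e ?c\<bar> = \<bar>tri x (?c - ?e) ?c\<bar>" by simp
  also have "\<dots> \<le> Cs * Y * (Ci / h * x2 s j n) * h1 ?c"
  proof (rule tri_bound')
    show "h1 (?c - ?e) \<le> Ci / h * x2 s j n"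
      unfolding delta2_phi(2)[OF j n] by (rule inverse[OF delta2_phi(3)[OF j n]])
  qed (use V' x V_sub xle delta2_phi(3)[OF j n] in auto)
  also have "\<dots> = 1 / 3 * (3 * (Cs * Y * (Ci / h))) * x2 s j n * h1 ?c" by simp
  also have "\<dots> \<le> 1 / 3 * sqrt (\<alpha> / dt) * x2 s j n * h1 ?c"
  proof (intro mult_right_mono mult_left_mono real_le_rsqrt)
    show "(3 * (Cs * Y * (Ci / h)))\<^sup>2 \<le> \<alpha> / dt"
      using Y dt_pos h_pos by (simp add: power_mult_distrib power_divide field_simps)
  qed (use phi_nonneg[OF j n] in auto)
  finally show ?thesis .
qed

lemma fluct_small:
  assumes n: "n \<in> {1..<M}" and X: "\<And>s j. j \<in> {1..J} \<Longrightarrow> h1 (fluc J (uh s) j n) \<le> X"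
    "0 \<le> X" "X \<le> 1" "dt * (9 * Ci\<^sup>2 * Cs\<^sup>2 * X) \<le> \<alpha> * h\<^sup>2" and L: "0 \<le> L"
  shows "fluct_bound n L"
  unfolding fluct_bound_def
proof (intro allI ballI)
  fix s j assume j: "j \<in> {1..J}"
  have "X\<^sup>2 \<le> X" using X mult_left_mono[of X 1 X] by (simp add: power2_eq_square)
  then have "dt * (9 * Cs\<^sup>2 * Ci\<^sup>2 * X\<^sup>2) \<le> dt * (9 * Cs\<^sup>2 * Ci\<^sup>2 * X)"
    using dt_pos by (intro mult_left_mono) auto
  then have Y: "dt * (9 * Cs\<^sup>2 * Ci\<^sup>2 * X\<^sup>2) \<le> \<alpha> * h\<^sup>2" using X(4) by (simp add: mult_ac)
  have "fluc J (uh (\<not> s)) j n \<in> V" using uh_in n j by (intro V_fluc) auto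
  note fluct_absorb[OF j n this X(1)[OF j] Y, of s]
  also have "1 / 3 * sqrt (\<alpha> / dt) * x2 s j n * h1 (phi s j (n + 1))
      \<le> (12 * \<epsilon>0 * GG n + L * SS n + 1 / 3 * sqrt (\<alpha> / dt) * x2 s j n) * h1 (phi s j (n + 1))"
    using phi_nonneg[OF j n] L \<epsilon>0_pos by (intro mult_right_mono) auto
  finally show "\<bar>tri (fluc J (uh (\<not> s)) j n) (ext (phi s j) n) (phi s j (n + 1))\<bar> \<le> \<dots>" .
qed

text \<open>Only the fluctuation of \<open>phi\<close> is left to the dissipation. The fluctuation
  of the projected solution is smooth enough for \<open>P_conv2\<close>; the 12 is 6 from
  \<open>tri_fluc_bound\<close> times 2 from \<open>phi_ext_le\<close>.\<close>

lemma fluct_split: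
  assumes n: "n \<in> {1..<M}" and Y: "\<And>s j. j \<in> {1..J} \<Longrightarrow> h1 (fluc J (phi s) j n) \<le> Y"
    "dt * (9 * Cs\<^sup>2 * Ci\<^sup>2 * Y\<^sup>2) \<le> \<alpha> * h\<^sup>2"
  shows "fluct_bound n (12 * Lp)"
  unfolding fluct_bound_def
proof (intro allI ballI)
  fix s j assume j: "j \<in> {1..J}"
  let ?s = "\<not> s" and ?c = "phi s j (n + 1)" and ?e = "ext (phi s j) n"
  have V': "phi s j i \<in> V" "P s j i \<in> V" "phi s j i \<in> H" "P s j i \<in> H" if "i \<le> M" "j \<in> {1..J}" for s j i
    using that phi_in P_in V_sub by auto
  have ce: "?c \<in> V" "?e \<in> V" using j n V' by (auto intro!: V_ext)
  have F: "fluc J (phi ?s) j n \<in> V" "fluc J (P ?s) j n \<in> V" using V' n j by (auto intro!: V_fluc)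
  have split: "fluc J (uh ?s) j n = fluc J (P ?s) j n + fluc J (phi ?s) j n"
    using fluc_diff[of J "uh ?s" "P ?s" j n] by (simp add: phi_def[abs_def])
  have "\<bar>tri (fluc J (P ?s) j n) ?e ?c\<bar> \<le> 6 * ((2 * (\<epsilon>0 * GG n + Lp * SS n)) * h1 ?c)"
  proof (rule tri_fluc_bound[OF J_pos j])
    have le: "(\<epsilon>0 * h1 ?e + Lp * l2 ?e) * h1 ?c \<le> (2 * (\<epsilon>0 * GG n + Lp * SS n)) * h1 ?c"
    proof (rule mult_right_mono)
      have "\<epsilon>0 * h1 ?e + Lp * l2 ?e \<le> \<epsilon>0 * (2 * GG n) + Lp * (2 * SS n)"
        using phi_ext_le[OF j, of n s] n \<epsilon>0_pos Lp_nonneg by (intro add_mono mult_left_mono) auto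
      then show "\<epsilon>0 * h1 ?e + Lp * l2 ?e \<le> 2 * (\<epsilon>0 * GG n + Lp * SS n)" by simp
    qed (rule phi_nonneg[OF j n])
    fix i assume i: "i \<in> {1..J}"
    show "\<bar>tri (P ?s i n) ?e ?c\<bar> \<le> (2 * (\<epsilon>0 * GG n + Lp * SS n)) * h1 ?c \<and>
      \<bar>tri (P ?s i (n - 1)) ?e ?c\<bar> \<le> (2 * (\<epsilon>0 * GG n + Lp * SS n)) * h1 ?c"
      using P_conv2[OF i _ ce(2,1), of n ?s] P_conv2[OF i _ ce(2,1), of "n - 1" ?s] n le by fastforce
  qed (use V' ce n V_sub in auto)
  moreover have "\<bar>tri (fluc J (phi ?s) j n) ?e ?c\<bar> \<le> 1 / 3 * sqrt (\<alpha> / dt) * x2 s j n * h1 ?c"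
    by (rule fluct_absorb[OF j n F(1) Y(1)[OF j] Y(2)])
  moreover have "tri (fluc J (uh ?s) j n) ?e ?c = tri (fluc J (P ?s) j n) ?e ?c + tri (fluc J (phi ?s) j n) ?e ?c"
    unfolding split using F ce V_sub by (simp add: tri_lin)
  moreover have "(12 * \<epsilon>0 * GG n + 12 * Lp * SS n + 1 / 3 * sqrt (\<alpha> / dt) * x2 s j n) * h1 ?c
    = 6 * ((2 * (\<epsilon>0 * GG n + Lp * SS n)) * h1 ?c) + 1 / 3 * sqrt (\<alpha> / dt) * x2 s j n * h1 ?c"
    by (simp add: algebra_simps)
  ultimately show "\<bar>tri (fluc J (uh ?s) j n) ?e ?c\<bar>
      \<le> (12 * \<epsilon>0 * GG n + 12 * Lp * SS n + 1 / 3 * sqrt (\<alpha> / dt) * x2 s j n) * h1 ?c"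
    by linarith
qed

text \<open>Nothing is absorbed here. The inverse inequality turns the H1 norm of the extrapolated
  \<open>phi\<close> into an L2 norm over h, and X / h is bounded because dt stays away from 0; the
  whole term is left to Gronwall.\<close>

lemma fluct_crude:
  assumes n: "n \<in> {1..<M}" and X: "\<And>s j. j \<in> {1..J} \<Longrightarrow> h1 (fluc J (uh s) j n) \<le> X"
    "0 \<le> X" "dt * (9 * Ci\<^sup>2 * Cs\<^sup>2 * X) \<le> \<alpha> * h\<^sup>2" and dt: "dt0 \<le> dt"
  shows "fluct_bound n L3"
  unfolding fluct_bound_def
proof (intro allI ballI)
  fix s j assume j: "j \<in> {1..J}"
  let ?s = "\<not> s" and ?c = "phi s j (n + 1)" and ?e = "ext (phi s j) n"
  have V': "?c \<in> V" "?e \<in> V" using j n phi_in by (auto intro!: V_ext)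
  have F: "fluc J (uh ?s) j n \<in> V" using uh_in n j by (intro V_fluc) auto
  have e: "h1 ?e \<le> Ci / h * (2 * SS n)"
    using inverse[OF V'(2)] mult_left_mono[OF phi_ext_le(2)[OF j, of n s], of "Ci / h"] n Ci_pos h_pos
    by force
  have "\<bar>tri (fluc J (uh ?s) j n) ?e ?c\<bar> \<le> Cs * X * (Ci / h * (2 * SS n)) * h1 ?c"
    using F V' V_sub X(1)[OF j, of ?s] e by (intro tri_bound') auto
  also have "\<dots> \<le> L3 * SS n * h1 ?c"
  proof (rule mult_right_mono)
    have "9 * Ci * Cs * dt * (Cs * X * (Ci / h)) = dt * (9 * Ci\<^sup>2 * Cs\<^sup>2 * X) / h"
      by (simp add: power2_eq_square)
    also have "\<dots> \<le> \<alpha> * h" using X(3) h_pos by (simp add: field_simps power2_eq_square)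
    also have "\<dots> \<le> \<alpha> * D" using h_le \<alpha>_pos by simp
    finally have "Cs * X * (Ci / h) \<le> \<alpha> * D / (9 * Ci * Cs * dt)"
      using Ci_pos Cs_pos dt_pos by (simp add: field_simps)
    also have "\<dots> \<le> \<alpha> * D / (9 * Ci * Cs * dt0)"
      using Ci_pos Cs_pos dt0_pos dt \<alpha>_pos D_pos by (intro divide_left_mono mult_left_mono mult_pos_pos) auto
    finally have "Cs * X * (Ci / h) * (2 * SS n) \<le> \<alpha> * D / (9 * Ci * Cs * dt0) * (2 * SS n)"
      using phi_nonneg[OF j n] by (intro mult_right_mono) auto
    then show "Cs * X * (Ci / h * (2 * SS n)) \<le> L3 * SS n" unfolding L3_def by (simp add: mult_ac)
  qed (rule phi_nonneg[OF j n])
  also have "\<dots> \<le> (12 * \<epsilon>0 * GG n + L3 * SS n + 1 / 3 * sqrt (\<alpha> / dt) * x2 s j n) * h1 ?c"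
    using phi_nonneg[OF j n] \<epsilon>0_pos \<alpha>_pos dt_pos by (intro mult_right_mono) auto
  finally show "\<bar>tri (fluc J (uh ?s) j n) ?e ?c\<bar> \<le> \<dots>" .
qed

lemma SA_bound:
  assumes n: "n \<in> {1..M}"
  shows "SA n \<le> K1 * rho\<^sup>2"
proof (cases "dt \<le> dt0")
  case False
  have "SA n \<le> Kst L3 * rho\<^sup>2"
  proof (rule gronwall[OF L3_nonneg _ n])
    fix n assume n: "n \<in> {1..<M}"
    obtain X where "0 \<le> X" "\<And>s j. j \<in> {1..J} \<Longrightarrow> h1 (fluc J (uh s) j n) \<le> X"
      "dt * (9 * Ci\<^sup>2 * Cs\<^sup>2 * X) \<le> \<alpha> * h\<^sup>2" using step_size_X[OF n] by blast
    then show "fluct_bound n L3" using False by (intro fluct_crude[OF n]) auto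
  qed
  also have "\<dots> \<le> K1 * rho\<^sup>2" unfolding K1_def using Kst_nonneg by (intro mult_right_mono) auto
  finally show ?thesis .
next
  case True
  have "SA n \<le> Kst (12 * Lp) * rho\<^sup>2"
  proof (rule gronwall[OF _ _ n])
    show "0 \<le> 12 * Lp" using Lp_nonneg by simp
    fix n assume n: "n \<in> {1..<M}" and SA: "SA n \<le> Kst (12 * Lp) * rho\<^sup>2"
    obtain X where X: "0 \<le> X" "\<And>s j. j \<in> {1..J} \<Longrightarrow> h1 (fluc J (uh s) j n) \<le> X"
      "dt * (9 * Ci\<^sup>2 * Cs\<^sup>2 * X) \<le> \<alpha> * h\<^sup>2" using step_size_X[OF n] by blast
    show "fluct_bound n (12 * Lp)"
    proof (cases "X \<le> 1")
      case True
      then show ?thesis using X Lp_nonneg by (intro fluct_small[OF n]) auto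
    next
      case False
      have "dt * (9 * Ci\<^sup>2 * Cs\<^sup>2) \<le> dt * (9 * Ci\<^sup>2 * Cs\<^sup>2 * X)"
        using False dt_pos mult_left_mono[of 1 X "9 * Ci\<^sup>2 * Cs\<^sup>2"] by (intro mult_left_mono) auto
      then have dth: "dt * (9 * Ci\<^sup>2 * Cs\<^sup>2) \<le> \<alpha> * h\<^sup>2" using X(3) by linarith
      then have "dt \<le> \<alpha> / (9 * Ci\<^sup>2 * Cs\<^sup>2) * h\<^sup>2" using Ci_pos Cs_pos by (simp add: field_simps)
      \<comment> \<open>One factor \<open>dt\<close> is bounded by a multiple of h^2, the other by
        \<open>T\<close>. With k at least 2 for the term \<open>h ^ k\<close>, both parts of
        \<open>rho\<close> are of order h^2.\<close>
      then have "dt * dt \<le> \<alpha> / (9 * Ci\<^sup>2 * Cs\<^sup>2) * h\<^sup>2 * T"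
        using dt_le_T dt_pos \<alpha>_pos by (intro mult_mono) auto
      moreover have "h ^ k = h ^ (k - 2) * h\<^sup>2"
        using power_add[of h "k - 2" 2] le_add_diff_inverse2[OF k_ge] by metis
      moreover have "h ^ (k - 2) * h\<^sup>2 \<le> D ^ (k - 2) * h\<^sup>2"
        using h_pos h_le by (intro mult_right_mono power_mono) auto
      ultimately have rho: "rho \<le> cst * h\<^sup>2"
        unfolding rho_def cst_def by (simp add: power2_eq_square algebra_simps)
      define Y where "Y = Ci / h * (4 * SS n)"
      have "h1 (fluc J (phi s) j n) \<le> Y" if j: "j \<in> {1..J}" for s j
      proof -
        have "fluc J (phi s) j n \<in> V" using phi_in n j by (intro V_fluc) auto
        from inverse[OF this] show ?thesis unfolding Y_def
          using mult_left_mono[OF phi_ext_le(6)[OF j, of n s], of "Ci / h"] n Ci_pos h_pos by force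
      qed
      \<comment> \<open>By the induction hypothesis \<open>SS n\<close> is of order
        \<open>rho\<close>, hence of order h^2, so \<open>Y\<close> is of order h. The left-hand
        side is then of order dt h^2, and \<open>dt0\<close> is the threshold below which it is at
        most \<alpha> h^2.\<close>
      moreover have "dt * (9 * Cs\<^sup>2 * Ci\<^sup>2 * Y\<^sup>2) \<le> \<alpha> * h\<^sup>2"
      proof -
        have "0 \<le> SA n - En n" unfolding SA_def
          using \<alpha>_pos dt_pos Dn_nonneg by (auto intro!: add_nonneg_nonneg mult_nonneg_nonneg sum_nonneg)
        then have "En n \<le> Kst (12 * Lp) * rho\<^sup>2" using SA by linarith
        also have "\<dots> \<le> Kst (12 * Lp) * (cst * h\<^sup>2)\<^sup>2"
          using rho rho_ge Kst_nonneg by (intro mult_left_mono power_mono) auto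
        finally have "36 * real J * En n \<le> 36 * real J * (Kst (12 * Lp) * (cst * h\<^sup>2)\<^sup>2)"
          by (intro mult_left_mono) auto
        then have S: "(SS n)\<^sup>2 \<le> 36 * real J * (Kst (12 * Lp) * (cst * h\<^sup>2)\<^sup>2)"
          using SS_sq[of n] n by auto
        have "dt * (9 * Cs\<^sup>2 * Ci\<^sup>2 * Y\<^sup>2) = dt * (9 * Cs\<^sup>2 * Ci\<^sup>2 * (Ci / h)\<^sup>2 * 16) * (SS n)\<^sup>2"
          unfolding Y_def by (simp add: power_mult_distrib power_divide)
        also have "\<dots> \<le> dt * (9 * Cs\<^sup>2 * Ci\<^sup>2 * (Ci / h)\<^sup>2 * 16) * (36 * real J * (Kst (12 * Lp) * (cst * h\<^sup>2)\<^sup>2))"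
          using S dt_pos by (intro mult_left_mono) auto
        also have "\<dots> = (9 * (Cs * Ci\<^sup>2 * cst)\<^sup>2 * (576 * real J * Kst (12 * Lp))) * dt * h\<^sup>2"
          using h_pos by (simp add: power_mult_distrib power2_eq_square)
        also have "\<dots> \<le> (9 * (Cs * Ci\<^sup>2 * cst)\<^sup>2 * (576 * real J * Kst (12 * Lp))) * dt0 * h\<^sup>2"
          using \<open>dt \<le> dt0\<close> Kst_nonneg by (intro mult_right_mono mult_left_mono) auto
        also have "\<dots> \<le> \<alpha> * h\<^sup>2" by (intro mult_right_mono dt0_le) auto
        finally show ?thesis .
      qed
      ultimately show ?thesis by (intro fluct_split[OF n]) auto
    qed
  qed
  also have "\<dots> \<le> K1 * rho\<^sup>2" unfolding K1_def using Kst_nonneg by (intro mult_right_mono) auto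
  finally show ?thesis .
qed

theorem convergence:
  "(l2 (emean J (U s) M - emean J (uh s) M))\<^sup>2
    + \<alpha> * dt * (\<Sum>n=2..M. (h1 (emean J (U s) n - emean J (uh s) n))\<^sup>2)
    \<le> Kfinal * (h ^ (2 * k) + dt ^ 4)"
proof -
  have K1: "0 \<le> K1" unfolding K1_def using Kst_nonneg by simp
  have in_H: "eta s j i \<in> H" "phi s j i \<in> H" if "i \<le> M" "j \<in> {1..J}" for j i
    using that eta_in phi_in V_sub by auto
  have diff: "emean J (U s) n - emean J (uh s) n = emean J (eta s) n - emean J (phi s) n" for n
    using emean_diff[of J "U s" "P s" n] emean_diff[of J "uh s" "P s" n]
    by (simp add: eta_def[abs_def] phi_def[abs_def])
  have mH: "emean J (eta s) n \<in> H" "emean J (phi s) n \<in> H" if "n \<le> M" for n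
    using in_H that by (auto intro!: G.emean_in)
  have J1: "1 \<in> {1..J}" using J_pos by simp
  have eta: "h1 (emean J (eta s) n) \<le> 3 * (C1 * rho)" if n: "n \<le> M" for n
  proof -
    have e: "h1 (eta s j i) \<le> C1 * rho" if "i \<le> M" "j \<in> {1..J}" for i j
      using eta_le[OF that(2,1), of s] mult_left_mono[OF rho_ge(2) C1_nonneg] by linarith
    have "h1 (emean J (eta s) n) \<le> 1 / real J * (\<Sum>j=1..J. 2 * h1 (eta s j n) + h1 (eta s j (n - 1)))"
      using in_H n by (intro G.nrm_emean_le) auto
    also have "\<dots> \<le> 1 / real J * (\<Sum>j=1..J. 3 * (C1 * rho))"
    proof (intro mult_left_mono sum_mono)
      fix j assume j: "j \<in> {1..J}"
      have "n - 1 \<le> M" using n by simp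
      from e[OF n j] e[OF this j] show "2 * h1 (eta s j n) + h1 (eta s j (n - 1)) \<le> 3 * (C1 * rho)"
        by linarith
    qed simp
    finally show ?thesis using J_pos by simp
  qed
  have SA_ge: "0 \<le> \<alpha> / 4 * dt * Dn n" "0 \<le> \<alpha> / 8 * dt * Dn n" "0 \<le> \<alpha> / 4 * dt * (\<Sum>i=2..n. Dn i)" for n
    using \<alpha>_pos dt_pos Dn_nonneg by (auto intro!: mult_nonneg_nonneg sum_nonneg)
  have "En M \<le> K1 * rho\<^sup>2"
    using SA_bound[of M] M_ge SA_ge(1)[of M] SA_ge(2)[of "M - 1"] SA_ge(3)[of M] unfolding SA_def by auto
  then have "36 * real J * En M \<le> 36 * real J * (K1 * rho\<^sup>2)" by (intro mult_left_mono) auto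
  then have S: "(SS M)\<^sup>2 \<le> 36 * real J * (K1 * rho\<^sup>2)" using SS_sq[of M] by auto
  have sumD: "\<alpha> * dt * (\<Sum>i=2..M. Dn i) \<le> 4 * (K1 * rho\<^sup>2)"
    using SA_bound[of M] M_ge SA_ge(1)[of M] SA_ge(2)[of "M - 1"] En_nonneg[of M] unfolding SA_def by auto
  \<comment> \<open>The mean at n = 2 contains \<open>phi\<close> at level 1, which the sum from 2
    misses. It is bounded through \<open>SA 1\<close>, where that sum is empty.\<close>
  have D1: "\<alpha> * dt * Dn 1 \<le> 4 * (K1 * rho\<^sup>2)"
    using SA_bound[of 1] M_ge SA_ge(3)[of 1] SA_ge(2)[of 0] En_nonneg[of 1] unfolding SA_def by auto
  have A: "(l2 (emean J (U s) M - emean J (uh s) M))\<^sup>2 \<le> (18 * CP\<^sup>2 * C1\<^sup>2 + 288 * real J * K1) * rho\<^sup>2"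
  proof -
    have "l2 (emean J (eta s) M) \<le> CP * (3 * (C1 * rho))"
      using poincare[OF mH(1)[of M]] mult_left_mono[OF eta[of M] CP_nonneg] by simp
    then have "l2 (emean J (U s) M - emean J (uh s) M) \<le> CP * (3 * (C1 * rho)) + 2 * SS M"
      unfolding diff using L.nrm_triangle_diff[OF mH(1)[of M] mH(2)[of M]] phi_ext_le(4)[OF J1, of M s] by simp
    then have "(l2 (emean J (U s) M - emean J (uh s) M))\<^sup>2 \<le> (CP * (3 * (C1 * rho)) + 2 * SS M)\<^sup>2"
      unfolding diff using mH[of M] by (intro power_mono) auto
    also have "\<dots> \<le> 2 * (CP * (3 * (C1 * rho)))\<^sup>2 + 2 * (2 * SS M)\<^sup>2" by (rule sum_sq_le)
    also have "\<dots> = 18 * CP\<^sup>2 * C1\<^sup>2 * rho\<^sup>2 + 8 * (SS M)\<^sup>2" by (simp add: power_mult_distrib)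
    also have "\<dots> \<le> 18 * CP\<^sup>2 * C1\<^sup>2 * rho\<^sup>2 + 8 * (36 * real J * (K1 * rho\<^sup>2))"
      by (intro add_left_mono mult_left_mono S) simp
    finally show ?thesis by (simp add: algebra_simps)
  qed
  have B: "\<alpha> * dt * (\<Sum>n=2..M. (h1 (emean J (U s) n - emean J (uh s) n))\<^sup>2)
    \<le> (18 * \<alpha> * T * C1\<^sup>2 + 384 * real J * K1) * rho\<^sup>2"
  proof -
    have "(h1 (emean J (U s) n - emean J (uh s) n))\<^sup>2 \<le> 18 * C1\<^sup>2 * rho\<^sup>2 + 32 * real J * (Dn n + Dn (n - 1))"
      if n: "n \<in> {2..M}" for n
    proof -
      have "h1 (emean J (U s) n - emean J (uh s) n) \<le> 3 * (C1 * rho) + 2 * GG n"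
        unfolding diff using G.nrm_triangle_diff[OF mH(1)[of n] mH(2)[of n]] phi_ext_le(3)[OF J1, of n s]
          eta[of n] n by simp
      then have "(h1 (emean J (U s) n - emean J (uh s) n))\<^sup>2 \<le> (3 * (C1 * rho) + 2 * GG n)\<^sup>2"
        unfolding diff using mH[of n] n by (intro power_mono) auto
      also have "\<dots> \<le> 2 * (3 * (C1 * rho))\<^sup>2 + 2 * (2 * GG n)\<^sup>2" by (rule sum_sq_le)
      also have "\<dots> = 18 * C1\<^sup>2 * rho\<^sup>2 + 8 * (GG n)\<^sup>2" by (simp add: power_mult_distrib)
      also have "\<dots> \<le> 18 * C1\<^sup>2 * rho\<^sup>2 + 8 * (4 * real J * (Dn n + Dn (n - 1)))"
        using GG_sq[of n] by simp
      finally show ?thesis by (simp add: algebra_simps)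
    qed
    then have "(\<Sum>n=2..M. (h1 (emean J (U s) n - emean J (uh s) n))\<^sup>2)
      \<le> (\<Sum>n=2..M. 18 * C1\<^sup>2 * rho\<^sup>2 + 32 * real J * (Dn n + Dn (n - 1)))" by (rule sum_mono)
    also have "\<dots> = real (card {2..M}) * (18 * C1\<^sup>2 * rho\<^sup>2)
        + 32 * real J * ((\<Sum>n=2..M. Dn n) + (\<Sum>n=2..M. Dn (n - 1)))"
      by (simp add: sum.distrib flip: sum_distrib_left)
    also have "\<dots> \<le> real M * (18 * C1\<^sup>2 * rho\<^sup>2)
        + 32 * real J * ((\<Sum>n=2..M. Dn n) + (Dn 1 + (\<Sum>n=2..M. Dn n)))"
    proof (intro add_mono mult_right_mono mult_left_mono order_refl)
      show "(\<Sum>n=2..M. Dn (n - 1)) \<le> Dn 1 + (\<Sum>n=2..M. Dn n)"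
      proof -
        have "(\<Sum>n=2..M. Dn (n - 1)) = sum Dn ((\<lambda>n. n - 1) ` {2..M})"
          by (subst sum.reindex) (auto simp: inj_on_def)
        also have "\<dots> \<le> sum Dn (insert 1 {2..M})"
          using Dn_nonneg by (intro sum_mono2) auto
        finally show ?thesis by simp
      qed
    qed auto
    finally have "\<alpha> * dt * (\<Sum>n=2..M. (h1 (emean J (U s) n - emean J (uh s) n))\<^sup>2)
      \<le> \<alpha> * dt * (real M * (18 * C1\<^sup>2 * rho\<^sup>2)
        + 32 * real J * ((\<Sum>n=2..M. Dn n) + (Dn 1 + (\<Sum>n=2..M. Dn n))))"
      using \<alpha>_pos dt_pos by (intro mult_left_mono) auto
    also have "\<dots> = 18 * \<alpha> * (real M * dt) * C1\<^sup>2 * rho\<^sup>2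
        + 32 * real J * (2 * (\<alpha> * dt * (\<Sum>n=2..M. Dn n)) + \<alpha> * dt * Dn 1)"
      by (simp add: algebra_simps)
    also have "\<dots> \<le> 18 * \<alpha> * (real M * dt) * C1\<^sup>2 * rho\<^sup>2
        + 32 * real J * (2 * (4 * (K1 * rho\<^sup>2)) + 4 * (K1 * rho\<^sup>2))"
      using sumD D1 \<alpha>_pos dt_pos by (intro add_mono mult_left_mono) auto
    finally show ?thesis unfolding M_dt by (simp add: algebra_simps)
  qed
  have "(18 * CP\<^sup>2 * C1\<^sup>2 + 288 * real J * K1 + (18 * \<alpha> * T * C1\<^sup>2 + 384 * real J * K1)) * rho\<^sup>2
    \<le> (18 * CP\<^sup>2 * C1\<^sup>2 + 288 * real J * K1 + (18 * \<alpha> * T * C1\<^sup>2 + 384 * real J * K1)) * (2 * (h ^ (2 * k) + dt ^ 4))"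
    using rho_sq K1 \<alpha>_pos T_pos by (intro mult_left_mono) auto
  with A B show ?thesis unfolding Kfinal_def by (simp add: algebra_simps)
qed

end

section \<open>Lebesgue spaces and test functions\<close>

text \<open>Pointwise operations turn fields into elements of a real vector space, which
  \<open>semi_inner\<close> asks of its carrier type.\<close>

instantiation "fun" :: (type, real_vector) real_vector
begin

definition scaleR_fun :: "real \<Rightarrow> ('a \<Rightarrow> 'b) \<Rightarrow> 'a \<Rightarrow> 'b" where
  "scaleR_fun c f = (\<lambda>x. c *\<^sub>R f x)"

instance
  by standard (simp_all add: scaleR_fun_def fun_eq_iff algebra_simps)

end

lemma scaleR_fun_apply [simp]: "(c *\<^sub>R f) x = c *\<^sub>R f x"
  for f :: "'a \<Rightarrow> 'b::real_vector"
  by (simp add: scaleR_fun_def)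

lemma sum_fun_apply: "(\<Sum>a\<in>A. f a) x = (\<Sum>a\<in>A. f a x)"
  for f :: "'c \<Rightarrow> 'a \<Rightarrow> 'b::comm_monoid_add"
  by (induction A rule: infinite_finite_induct) auto

lemma L2_measurable [measurable_dest]: "f \<in> L2_space \<Omega> \<Longrightarrow> f \<in> borel_measurable (lebesgue_on \<Omega>)"
  and L2_sq_integrable: "f \<in> L2_space \<Omega> \<Longrightarrow> integrable (lebesgue_on \<Omega>) (\<lambda>x. (norm (f x))\<^sup>2)"
  by (auto simp: L2_space_def)

lemma L2_spaceI_bound:
  assumes "g \<in> borel_measurable (lebesgue_on \<Omega>)" "integrable (lebesgue_on \<Omega>) h"
    "AE x in lebesgue_on \<Omega>. (norm (g x))\<^sup>2 \<le> h x"
  shows "g \<in> L2_space \<Omega>"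
  unfolding L2_space_def
  using assms by (auto intro!: Bochner_Integration.integrable_bound[OF assms(2)] elim!: AE_mp)

lemma L2_prod_integrable:
  fixes f :: "'a::euclidean_space \<Rightarrow> 'b::euclidean_space" and g :: "'a \<Rightarrow> 'c::euclidean_space"
  assumes f: "f \<in> L2_space \<Omega>" and g: "g \<in> L2_space \<Omega>"
  shows "integrable (lebesgue_on \<Omega>) (\<lambda>x. norm (f x) * norm (g x))"
proof (rule Bochner_Integration.integrable_bound)
  show "integrable (lebesgue_on \<Omega>) (\<lambda>x. (norm (f x))\<^sup>2 + (norm (g x))\<^sup>2)"
    using f g by (intro Bochner_Integration.integrable_add L2_sq_integrable)
  show "(\<lambda>x. norm (f x) * norm (g x)) \<in> borel_measurable (lebesgue_on \<Omega>)"
    using L2_measurable[OF f] L2_measurable[OF g] by measurable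
  have "a * b \<le> a\<^sup>2 + b\<^sup>2" if "0 \<le> a" "0 \<le> b" for a b :: real
  proof -
    have "0 \<le> a * b" using that by simp
    then show ?thesis using zero_le_power2[of "a - b"] by (simp add: power2_diff)
  qed
  then show "AE x in lebesgue_on \<Omega>. norm (norm (f x) * norm (g x)) \<le> norm ((norm (f x))\<^sup>2 + (norm (g x))\<^sup>2)"
    by simp
qed

lemma L2_inner_integrable:
  assumes "f \<in> L2_space \<Omega>" "g \<in> L2_space \<Omega>"
  shows "integrable (lebesgue_on \<Omega>) (\<lambda>x. f x \<bullet> g x)"
  using L2_measurable[OF assms(1)] L2_measurable[OF assms(2)]
  by (intro Bochner_Integration.integrable_bound[OF L2_prod_integrable[OF assms]])
     (auto simp: Cauchy_Schwarz_ineq2)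

lemma subspace_L2: "subspace (L2_space \<Omega> :: ('a::euclidean_space \<Rightarrow> 'b::euclidean_space) set)"
proof (unfold subspace_def, intro conjI ballI allI)
  show "0 \<in> (L2_space \<Omega> :: ('a \<Rightarrow> 'b) set)" by (auto simp: L2_space_def zero_fun_def)
next
  fix f g :: "'a \<Rightarrow> 'b" assume f: "f \<in> L2_space \<Omega>" and g: "g \<in> L2_space \<Omega>"
  show "f + g \<in> L2_space \<Omega>"
  proof (rule L2_spaceI_bound)
    show "f + g \<in> borel_measurable (lebesgue_on \<Omega>)"
      using L2_measurable[OF f] L2_measurable[OF g] unfolding plus_fun_def by measurable
    show "integrable (lebesgue_on \<Omega>) (\<lambda>x. 2 * (norm (f x))\<^sup>2 + 2 * (norm (g x))\<^sup>2)"
      using L2_sq_integrable[OF f] L2_sq_integrable[OF g] by auto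
    have "(norm (a + b))\<^sup>2 \<le> 2 * (norm a)\<^sup>2 + 2 * (norm b)\<^sup>2" for a b :: 'b
    proof -
      have "(norm (a + b))\<^sup>2 \<le> (norm a + norm b)\<^sup>2" by (intro power_mono norm_triangle_ineq) simp
      also have "\<dots> \<le> 2 * (norm a)\<^sup>2 + 2 * (norm b)\<^sup>2"
        using zero_le_power2[of "norm a - norm b"] by (simp add: power2_eq_square algebra_simps)
      finally show ?thesis .
    qed
    then show "AE x in lebesgue_on \<Omega>. (norm ((f + g) x))\<^sup>2 \<le> 2 * (norm (f x))\<^sup>2 + 2 * (norm (g x))\<^sup>2"
      by simp
  qed
next
  fix c :: real and f :: "'a \<Rightarrow> 'b" assume f: "f \<in> L2_space \<Omega>"
  show "c *\<^sub>R f \<in> L2_space \<Omega>"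
    using L2_measurable[OF f] L2_sq_integrable[OF f]
    by (auto simp: L2_space_def scaleR_fun_def power_mult_distrib)
qed

interpretation L2: semi_inner "L2_space \<Omega> :: ('a::euclidean_space \<Rightarrow> 'b::euclidean_space) set" "L2_inner \<Omega>"
  rewrites "semi_inner.nrm (L2_inner \<Omega>) = L2_norm \<Omega>"
proof -
  show si: "semi_inner (L2_space \<Omega> :: ('a \<Rightarrow> 'b) set) (L2_inner \<Omega>)"
    by standard (auto simp: subspace_L2 L2_inner_def inner_add_left L2_inner_integrable
        intro!: Bochner_Integration.integral_cong inner_commute)
  show "semi_inner.nrm (L2_inner \<Omega>) = (L2_norm \<Omega> :: ('a \<Rightarrow> 'b) \<Rightarrow> real)"
    by (simp add: semi_inner.nrm_def[OF si] L2_norm_def L2_inner_def fun_eq_iff power2_norm_eq_inner)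
qed

lemma L2_cong_AE:
  assumes f: "f \<in> L2_space \<Omega>" and g: "g \<in> borel_measurable (lebesgue_on \<Omega>)"
    and eq: "AE x in lebesgue_on \<Omega>. f x = g x"
  shows "g \<in> L2_space \<Omega>"
proof (rule L2_spaceI_bound[OF g L2_sq_integrable[OF f]])
  show "AE x in lebesgue_on \<Omega>. (norm (g x))\<^sup>2 \<le> (norm (f x))\<^sup>2"
    using eq by eventually_elim simp
qed

lemma L2_inner_cong_AE:
  assumes "f \<in> borel_measurable (lebesgue_on \<Omega>)" "f' \<in> borel_measurable (lebesgue_on \<Omega>)"
    "g \<in> borel_measurable (lebesgue_on \<Omega>)" "g' \<in> borel_measurable (lebesgue_on \<Omega>)"
    "AE x in lebesgue_on \<Omega>. f x = f' x" "AE x in lebesgue_on \<Omega>. g x = g' x"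
  shows "L2_inner \<Omega> f g = L2_inner \<Omega> f' g'"
  unfolding L2_inner_def
proof (rule integral_cong_AE)
  show "AE x in lebesgue_on \<Omega>. f x \<bullet> g x = f' x \<bullet> g' x"
    using assms(5,6) by eventually_elim simp
qed (use assms in measurable)

lemma L2_norm_cong_AE:
  assumes "f \<in> borel_measurable (lebesgue_on \<Omega>)" "f' \<in> borel_measurable (lebesgue_on \<Omega>)"
    "AE x in lebesgue_on \<Omega>. f x = f' x"
  shows "L2_norm \<Omega> f = L2_norm \<Omega> f'"
  unfolding L2_norm_def
  by (intro arg_cong[of _ _ sqrt] integral_cong_AE) (use assms in \<open>auto elim!: AE_mp\<close>)

lemma L2_bounded_scale:
  fixes f :: "'a::euclidean_space \<Rightarrow> 'b::euclidean_space" and g :: "'a \<Rightarrow> 'c::euclidean_space"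
  assumes f: "f \<in> L2_space \<Omega>" and g: "g \<in> borel_measurable (lebesgue_on \<Omega>)" and C: "0 \<le> C"
    and le: "AE x in lebesgue_on \<Omega>. norm (g x) \<le> C * norm (f x)"
  shows "g \<in> L2_space \<Omega>" "L2_norm \<Omega> g \<le> C * L2_norm \<Omega> f"
proof -
  have sq: "AE x in lebesgue_on \<Omega>. (norm (g x))\<^sup>2 \<le> C\<^sup>2 * (norm (f x))\<^sup>2"
    using le by eventually_elim (metis norm_ge_zero power_mono power_mult_distrib)
  have i: "integrable (lebesgue_on \<Omega>) (\<lambda>x. C\<^sup>2 * (norm (f x))\<^sup>2)"
    using L2_sq_integrable[OF f] by simp
  show g2: "g \<in> L2_space \<Omega>" by (rule L2_spaceI_bound[OF g i sq])
  have "(LINT x|lebesgue_on \<Omega>. (norm (g x))\<^sup>2) \<le> (LINT x|lebesgue_on \<Omega>. C\<^sup>2 * (norm (f x))\<^sup>2)"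
    by (rule integral_mono_AE[OF L2_sq_integrable[OF g2] i sq])
  then have "L2_norm \<Omega> g \<le> sqrt (C\<^sup>2 * (LINT x|lebesgue_on \<Omega>. (norm (f x))\<^sup>2))"
    unfolding L2_norm_def by simp
  then show "L2_norm \<Omega> g \<le> C * L2_norm \<Omega> f"
    using C by (simp add: L2_norm_def real_sqrt_mult)
qed

section \<open>Calculus of smooth functions\<close>

abbreviation pd :: "'a \<Rightarrow> ('a::euclidean_space \<Rightarrow> 'b::real_normed_vector) \<Rightarrow> 'a \<Rightarrow> 'b" where
  "pd b f \<equiv> (\<lambda>x. frechet_derivative f (at x) b)"

text \<open>\<open>iter_deriv\<close> unfolds the outermost derivative; closure of
  \<open>smooth\<close> under \<open>pd\<close> needs the innermost one.\<close>

lemma iter_deriv_snoc: "iter_deriv (bs @ [b]) f = iter_deriv bs (pd b f)"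
  by (induction bs) auto

lemma smooth_differentiable: "smooth f \<Longrightarrow> f differentiable (at x)"
  unfolding smooth_def by (metis empty_subsetI iter_deriv.simps(1) list.set(1))

lemma smooth_pd: "smooth f \<Longrightarrow> b \<in> Basis \<Longrightarrow> smooth (pd b f)"
  unfolding smooth_def by (simp flip: iter_deriv_snoc)

lemma smooth_has_derivative: "smooth f \<Longrightarrow> (f has_derivative frechet_derivative f (at x)) (at x)"
  using smooth_differentiable frechet_derivative_works by blast

lemma smooth_continuous: "smooth f \<Longrightarrow> continuous_on S f"
  by (simp add: continuous_at_imp_continuous_on differentiable_imp_continuous_within smooth_differentiable)

text \<open>Every iterated derivative stays in \<open>S\<close>, by induction on the list of
  directions. Smoothness proofs then only have to exhibit a class that is closed under partial
  derivatives.\<close>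

lemma smooth_coinduct:
  assumes "f \<in> S" and S: "\<And>g x. g \<in> S \<Longrightarrow> g differentiable (at x)"
    "\<And>g b. g \<in> S \<Longrightarrow> b \<in> Basis \<Longrightarrow> pd b g \<in> S"
  shows "smooth f"
proof -
  have "set bs \<subseteq> Basis \<Longrightarrow> iter_deriv bs f \<in> S" for bs
    by (induction bs) (auto simp: assms)
  then show ?thesis unfolding smooth_def using S(1) by blast
qed

lemma pd_eqI:
  assumes "\<And>x. (f has_derivative f' x) (at x)"
  shows "pd b f = (\<lambda>x. f' x b)"
  using frechet_derivative_at[OF assms] by metis

lemma smooth_const: "smooth (\<lambda>x. c)"
proof (rule smooth_coinduct[of _ "range (\<lambda>c x. c)"])
  fix g :: "'a \<Rightarrow> 'b" and b :: 'a assume "g \<in> range (\<lambda>c x. c)"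
  then show "pd b g \<in> range (\<lambda>c x. c)" by (auto simp: frechet_derivative_const)
qed auto

lemma smooth_bounded_linear:
  fixes f :: "'a::euclidean_space \<Rightarrow> 'b::real_normed_vector" and L :: "'b \<Rightarrow> 'c::real_normed_vector"
  assumes L: "bounded_linear L" and f: "smooth f"
  shows "smooth (\<lambda>x. L (f x))"
proof (rule smooth_coinduct[of _ "{\<lambda>x. L (g x) | g. smooth g}"])
  fix h :: "'a \<Rightarrow> 'c" and b :: 'a and x assume "h \<in> {\<lambda>x. L (g x) | g. smooth g}"
  then obtain g where h: "h = (\<lambda>x. L (g x))" and g: "smooth g" by auto
  have d: "(h has_derivative (\<lambda>y. L (frechet_derivative g (at x) y))) (at x)" for x
    unfolding h by (rule bounded_linear.has_derivative[OF L smooth_has_derivative[OF g]])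
  then show "h differentiable at x" unfolding differentiable_def by blast
  assume "b \<in> Basis"
  then show "pd b h \<in> {\<lambda>x. L (g x) | g. smooth g}"
    using pd_eqI[OF d] smooth_pd[OF g] by fastforce
qed (use f in auto)

lemma pd_bounded_linear:
  assumes "bounded_linear L" "smooth f"
  shows "pd b (\<lambda>x. L (f x)) = (\<lambda>x. L (pd b f x))"
  by (rule pd_eqI) (rule bounded_linear.has_derivative[OF assms(1) smooth_has_derivative[OF assms(2)]])

lemma smooth_add:
  assumes "smooth f" "smooth g"
  shows "smooth (\<lambda>x. f x + g x)"
proof (rule smooth_coinduct[of _ "{\<lambda>x. f x + g x | f g. smooth f \<and> smooth g}"])
  fix h :: "'a \<Rightarrow> 'b" and b :: 'a and x assume "h \<in> {\<lambda>x. f x + g x | f g. smooth f \<and> smooth g}"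
  then obtain f g where h: "h = (\<lambda>x. f x + g x)" and g: "smooth f" "smooth g" by auto
  have d: "(h has_derivative (\<lambda>y. frechet_derivative f (at x) y + frechet_derivative g (at x) y)) (at x)" for x
    unfolding h using g by (intro has_derivative_add smooth_has_derivative)
  then show "h differentiable at x" unfolding differentiable_def by blast
  assume "b \<in> Basis"
  then show "pd b h \<in> {\<lambda>x. f x + g x | f g. smooth f \<and> smooth g}"
    using pd_eqI[OF d] smooth_pd[OF g(1)] smooth_pd[OF g(2)] by fastforce
qed (use assms in auto)

text \<open>By the Leibniz rule products alone are not closed under \<open>pd\<close>, while finite
  sums of products of smooth functions are; this is the class for
  \<open>smooth_coinduct\<close>.\<close>

inductive_set prod_span :: "('a::euclidean_space \<Rightarrow> real) set" where
  prod: "smooth f \<Longrightarrow> smooth g \<Longrightarrow> (\<lambda>x. f x * g x) \<in> prod_span"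
| add: "p \<in> prod_span \<Longrightarrow> q \<in> prod_span \<Longrightarrow> (\<lambda>x. p x + q x) \<in> prod_span"

lemma smooth_mult:
  fixes f g :: "'a::euclidean_space \<Rightarrow> real"
  assumes "smooth f" "smooth g"
  shows "smooth (\<lambda>x. f x * g x)"
proof (rule smooth_coinduct[of _ prod_span])
  have *: "(\<forall>x. h differentiable at x) \<and> (\<forall>b\<in>Basis. pd b h \<in> prod_span)" if "h \<in> prod_span" for h :: "'a \<Rightarrow> real"
    using that
  proof induction
    case (prod f g)
    have d: "((\<lambda>x. f x * g x) has_derivative
        (\<lambda>y. f x * frechet_derivative g (at x) y + frechet_derivative f (at x) y * g x)) (at x)" for x
      using prod by (intro has_derivative_mult smooth_has_derivative)
    then have "\<forall>x. (\<lambda>x. f x * g x) differentiable at x" unfolding differentiable_def by blast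
    then show ?case unfolding pd_eqI[OF d] using prod smooth_pd
      by (auto intro!: prod_span.intros)
  next
    case (add p q)
    have d: "((\<lambda>x. p x + q x) has_derivative
        (\<lambda>y. frechet_derivative p (at x) y + frechet_derivative q (at x) y)) (at x)" for x
      using add frechet_derivative_works by (intro has_derivative_add) blast+
    then have "\<forall>x. (\<lambda>x. p x + q x) differentiable at x" unfolding differentiable_def by blast
    then show ?case unfolding pd_eqI[OF d] using add by (auto intro!: prod_span.add)
  qed
  fix h :: "'a \<Rightarrow> real" and x b :: 'a assume h: "h \<in> prod_span"
  show "h differentiable at x" using *[OF h] by simp
  show "pd b h \<in> prod_span" if "b \<in> Basis" using *[OF h] that by simp
qed (use assms in \<open>auto intro: prod_span.prod\<close>)

lemma smooth_prod:
  fixes f :: "'i \<Rightarrow> 'a::euclidean_space \<Rightarrow> real"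
  shows "(\<And>i. i \<in> A \<Longrightarrow> smooth (f i)) \<Longrightarrow> smooth (\<lambda>x. \<Prod>i\<in>A. f i x)"
  by (induction A rule: infinite_finite_induct) (auto intro: smooth_const smooth_mult)

section \<open>Bump functions\<close>

definition flat :: "real poly \<Rightarrow> real \<Rightarrow> real" where
  "flat p x = (if 0 < x then poly p (1 / x) * exp (- (1 / x)) else 0)"

lemma poly_exp_tendsto_0: "((\<lambda>y. poly p y * exp (- y)) \<longlongrightarrow> (0::real)) at_top"
proof -
  have "((\<lambda>y. \<Sum>i\<le>degree p. coeff p i * (y ^ i / exp y)) \<longlongrightarrow> (\<Sum>i\<le>degree p. coeff p i * (0::real))) at_top"
    by (intro tendsto_sum tendsto_mult tendsto_const tendsto_power_div_exp_0)
  then show ?thesis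
    by (simp add: poly_altdef exp_minus divide_inverse sum_distrib_right mult.assoc)
qed

text \<open>With y = 1 / x the function is p(y) exp(-y), and d/dx is -y^2 d/dy, which produces the
  polynomial y^2 (p - p'). At 0 the difference quotient is y p(y) exp(-y) and tends to 0 as y grows.
  The polynomial factor in \<open>flat\<close> is there to make the family closed under
  differentiation.\<close>

lemma flat_DERIV: "(flat p has_real_derivative flat ([:0, 0, 1:] * (p - pderiv p)) x) (at x)"
proof -
  consider "x < 0" | "x = 0" | "0 < x" by linarith
  then show ?thesis
  proof cases
    case 1
    have "(flat p has_real_derivative 0) (at x)"
      by (rule has_field_derivative_transform_within_open[of "\<lambda>_. 0" 0 x "{..<0}"]) (use 1 in \<open>auto simp: flat_def\<close>)
    then show ?thesis using 1 by (simp add: flat_def)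
  next
    case 2
    have "((\<lambda>h. (flat p (0 + h) - flat p 0) / h) \<longlongrightarrow> 0) (at 0)"
    proof -
      have "((\<lambda>h. (flat p (0 + h) - flat p 0) / h) \<longlongrightarrow> 0) (at_left 0)"
      proof (rule tendsto_eventually)
        show "\<forall>\<^sub>F h in at_left 0. (flat p (0 + h) - flat p 0) / h = 0"
          unfolding eventually_at_left_field by (rule exI[of _ "-1"]) (auto simp: flat_def)
      qed
      moreover have "((\<lambda>h. (flat p (0 + h) - flat p 0) / h) \<longlongrightarrow> 0) (at_right 0)"
      proof -
        have "((\<lambda>h. poly (pCons 0 p) (inverse h) * exp (- inverse h)) \<longlongrightarrow> 0) (at_right (0::real))"
          by (rule filterlim_compose[OF poly_exp_tendsto_0 filterlim_inverse_at_top_right])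
        then show ?thesis
        proof (rule Lim_transform_eventually)
          show "\<forall>\<^sub>F h in at_right 0. poly (pCons 0 p) (inverse h) * exp (- inverse h) = (flat p (0 + h) - flat p 0) / h"
            unfolding eventually_at_right_field by (rule exI[of _ 1]) (auto simp: flat_def divide_inverse)
        qed
      qed
      ultimately show ?thesis by (simp add: filterlim_at_split)
    qed
    then show ?thesis using 2 by (simp add: DERIV_def flat_def)
  next
    case 3
    have "((\<lambda>x. poly p (1 / x) * exp (- (1 / x))) has_real_derivative
       poly ([:0, 0, 1:] * (p - pderiv p)) (1 / x) * exp (- (1 / x))) (at x)"
      using 3 by (auto intro!: derivative_eq_intros simp: field_simps power2_eq_square)
    moreover have "\<forall>\<^sub>F y in nhds x. flat p y = poly p (1 / y) * exp (- (1 / y))"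
      using eventually_nhds_in_open[of "{0<..}" x] 3 by (auto simp: flat_def elim!: eventually_mono)
    ultimately show ?thesis using 3
      by (subst DERIV_cong_ev[OF refl]) (auto simp: flat_def)
  qed
qed

lemma smooth_flat:
  fixes b :: "'a::euclidean_space"
  shows "smooth (\<lambda>x. flat p (c * (x \<bullet> b) + d))"
proof (rule smooth_coinduct[of _ "{\<lambda>x. k * flat p (c * (x \<bullet> b) + d) | k p. True}"])
  fix h :: "'a \<Rightarrow> real" and b' :: 'a and x assume "h \<in> {\<lambda>x. k * flat p (c * (x \<bullet> b) + d) | k p. True}"
  then obtain k p where h: "h = (\<lambda>x. k * flat p (c * (x \<bullet> b) + d))" by auto
  let ?q = "[:0, 0, 1:] * (p - pderiv p)"
  have d: "(h has_derivative (\<lambda>y. k * ((c * (y \<bullet> b)) * flat ?q (c * (x \<bullet> b) + d)))) (at x)" for x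
    unfolding h
    by (rule has_derivative_mult_right) (rule has_derivative_compose[OF _ flat_DERIV[unfolded has_field_derivative_def], of _ _ x, THEN has_derivative_eq_rhs],
       auto intro!: derivative_eq_intros simp: mult_ac)
  then show "h differentiable at x" unfolding differentiable_def by blast
  have "pd b' h = (\<lambda>x. (k * (c * (b' \<bullet> b))) * flat ?q (c * (x \<bullet> b) + d))"
    unfolding pd_eqI[OF d] by (simp add: mult_ac)
  then show "pd b' h \<in> {\<lambda>x. k * flat p (c * (x \<bullet> b) + d) | k p. True}" by blast
next
  have "(\<lambda>x. flat p (c * (x \<bullet> b) + d)) = (\<lambda>x. 1 * flat p (c * (x \<bullet> b) + d))" by simp
  then show "(\<lambda>x. flat p (c * (x \<bullet> b) + d)) \<in> {\<lambda>x. k * flat p (c * (x \<bullet> b) + d) | k p. True}" by blast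
qed

text \<open>A smooth approximation from below to the indicator of an open box: \<open>flat 1\<close>
  is exp(-1 / x) for positive x, and the factor \<open>Suc n\<close> drives each exponent to
  0.\<close>

definition box_bump :: "'a::euclidean_space \<Rightarrow> 'a \<Rightarrow> nat \<Rightarrow> 'a \<Rightarrow> real" where
  "box_bump l u n x = (\<Prod>b\<in>Basis. flat 1 (real (Suc n) * (x \<bullet> b - l \<bullet> b)) * flat 1 (real (Suc n) * (u \<bullet> b - x \<bullet> b)))"

lemma flat1: "0 \<le> flat 1 x" "flat 1 x \<le> 1" "flat 1 x \<noteq> 0 \<longleftrightarrow> 0 < x"
  by (auto simp: flat_def)

lemma smooth_box_bump: "smooth (box_bump l u n)"
  unfolding box_bump_def[abs_def]
proof (intro smooth_prod smooth_mult)
  fix b :: 'a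
  show "smooth (\<lambda>x. flat 1 (real (Suc n) * (x \<bullet> b - l \<bullet> b)))"
    using smooth_flat[of 1 "real (Suc n)" b "- real (Suc n) * (l \<bullet> b)"] by (simp add: algebra_simps)
  show "smooth (\<lambda>x. flat 1 (real (Suc n) * (u \<bullet> b - x \<bullet> b)))"
    using smooth_flat[of 1 "- real (Suc n)" b "real (Suc n) * (u \<bullet> b)"] by (simp add: algebra_simps)
qed

lemma box_bump_bounds: "0 \<le> box_bump l u n x" "box_bump l u n x \<le> 1"
  unfolding box_bump_def by (auto intro!: prod_nonneg prod_le_1 mult_nonneg_nonneg mult_le_one flat1)

lemma box_bump_nonzero: "box_bump l u n x \<noteq> 0 \<longleftrightarrow> x \<in> box l u"
proof -
  have "0 < real (Suc n) * t \<longleftrightarrow> 0 < t" for t by (simp add: zero_less_mult_iff)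
  then show ?thesis by (simp add: box_bump_def flat1 mem_box)
qed

lemma box_bump_tendsto: "(\<lambda>n. box_bump l u n x) \<longlonglongrightarrow> indicator (box l u) x"
proof (cases "x \<in> box l u")
  case True
  have f: "(\<lambda>n. flat 1 (real (Suc n) * t)) \<longlonglongrightarrow> 1" if "0 < t" for t
  proof -
    have "(\<lambda>n. exp (- (1 / t * inverse (real (Suc n))))) \<longlonglongrightarrow> exp (- (1 / t * 0))"
      by (intro tendsto_exp tendsto_minus tendsto_mult tendsto_const LIMSEQ_inverse_real_of_nat)
    then show ?thesis using that by (simp add: flat_def divide_inverse mult_ac)
  qed
  have "(\<lambda>n. box_bump l u n x) \<longlonglongrightarrow> (\<Prod>b\<in>(Basis::'a set). 1 * 1)"
    unfolding box_bump_def using True by (intro tendsto_prod tendsto_mult f) (auto simp: mem_box)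
  then show ?thesis using True by simp
next
  case False
  then have "box_bump l u n x = 0" for n using box_bump_nonzero by blast
  then show ?thesis using False by simp
qed

section \<open>Test functions\<close>

lemma test_functionsI:
  assumes "smooth \<phi>" "{x. \<phi> x \<noteq> 0} \<subseteq> K" "compact K" "K \<subseteq> \<Omega>"
  shows "\<phi> \<in> test_functions \<Omega>"
proof -
  have K: "closure {x. \<phi> x \<noteq> 0} \<subseteq> K"
    by (rule closure_minimal[OF assms(2) compact_imp_closed[OF assms(3)]])
  have "bounded {x. \<phi> x \<noteq> 0}"
    by (rule bounded_subset[OF compact_imp_bounded[OF assms(3)] assms(2)])
  with assms(1) subset_trans[OF K assms(4)] show ?thesis
    unfolding test_functions_def by (simp only: mem_Collect_eq compact_closure simp_thms)
qed

lemma test_support: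
  assumes "\<phi> \<in> test_functions \<Omega>"
  shows "\<exists>K. compact K \<and> K \<subseteq> \<Omega> \<and> (\<forall>x. x \<notin> K \<longrightarrow> \<phi> x = 0 \<and> (\<forall>b. pd b \<phi> x = 0))"
proof (intro exI conjI allI impI)
  let ?K = "closure {x. \<phi> x \<noteq> 0}"
  show "compact ?K" "?K \<subseteq> \<Omega>" using assms unfolding test_functions_def by blast+
  have 0: "\<phi> x = 0" if "x \<notin> ?K" for x
    using that subsetD[OF closure_subset, of x "{x. \<phi> x \<noteq> 0}"] by auto
  fix x assume x: "x \<notin> ?K"
  show "\<phi> x = 0" by (rule 0[OF x])
  have "(\<phi> has_derivative (\<lambda>_. 0)) (at x)"
  proof (rule has_derivative_transform_within_open)
    show "((\<lambda>_. 0) has_derivative (\<lambda>_. 0)) (at x)" by simp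
    show "open (- ?K)" "x \<in> - ?K" using x by auto
    show "0 = \<phi> y" if "y \<in> - ?K" for y by (rule 0[OF ComplD[OF that], symmetric])
  qed
  from frechet_derivative_at[OF this] show "pd b \<phi> x = 0" for b by metis
qed

lemma test_smooth: "\<phi> \<in> test_functions \<Omega> \<Longrightarrow> smooth \<phi>"
  by (simp add: test_functions_def)

lemma box_bump_test: "cbox l u \<subseteq> \<Omega> \<Longrightarrow> box_bump l u n \<in> test_functions \<Omega>"
  by (rule test_functionsI[OF smooth_box_bump _ compact_cbox]) (use box_bump_nonzero box_subset_cbox in blast)+

lemma test_pd:
  assumes "\<phi> \<in> test_functions \<Omega>" "b \<in> Basis"
  shows "pd b \<phi> \<in> test_functions \<Omega>"
proof -
  obtain K where "compact K" "K \<subseteq> \<Omega>" "\<And>x. x \<notin> K \<Longrightarrow> pd b \<phi> x = 0"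
    using test_support[OF assms(1)] by blast
  then show ?thesis using test_smooth[OF assms(1)] assms(2)
    by (intro test_functionsI[of _ K] smooth_pd) auto
qed

lemma test_bounded_linear:
  assumes L: "bounded_linear L" and "\<phi> \<in> test_functions \<Omega>"
  shows "(\<lambda>x. L (\<phi> x)) \<in> test_functions \<Omega>"
proof -
  have "L 0 = 0" using L by (simp add: linear_simps)
  obtain K where K: "compact K" "K \<subseteq> \<Omega>" "\<And>x. x \<notin> K \<Longrightarrow> \<phi> x = 0"
    using test_support[OF assms(2)] by blast
  have "{x. L (\<phi> x) \<noteq> 0} \<subseteq> K" using K(3) \<open>L 0 = 0\<close> by fastforce
  from test_functionsI[OF smooth_bounded_linear[OF L test_smooth[OF assms(2)]] this K(1,2)] show ?thesis .
qed

lemma test_mult: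
  fixes f :: "'a::euclidean_space \<Rightarrow> real"
  assumes f: "f \<in> test_functions \<Omega>" and g: "smooth g"
  shows "(\<lambda>x. f x * g x) \<in> test_functions \<Omega>"
proof -
  obtain K where "compact K" "K \<subseteq> \<Omega>" "\<And>x. x \<notin> K \<Longrightarrow> f x = 0"
    using test_support[OF f] by blast
  then show ?thesis using test_smooth[OF f] g by (intro test_functionsI[of _ K] smooth_mult) auto
qed

lemma test_add:
  assumes "f \<in> test_functions \<Omega>" "g \<in> test_functions \<Omega>"
  shows "(\<lambda>x. f x + g x) \<in> test_functions \<Omega>"
proof -
  obtain K where K: "compact K" "K \<subseteq> \<Omega>" "\<And>x. x \<notin> K \<Longrightarrow> f x = 0"
    using test_support[OF assms(1)] by blast
  obtain K' where K': "compact K'" "K' \<subseteq> \<Omega>" "\<And>x. x \<notin> K' \<Longrightarrow> g x = 0"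
    using test_support[OF assms(2)] by blast
  have "{x. f x + g x \<noteq> 0} \<subseteq> K \<union> K'" using K(3) K'(3) by fastforce
  with K K' test_smooth[OF assms(1)] test_smooth[OF assms(2)] show ?thesis
    by (intro test_functionsI[of _ "K \<union> K'"] smooth_add) auto
qed

lemma test_zero: "(\<lambda>x. 0) \<in> test_functions \<Omega>"
  by (rule test_functionsI[of _ "{}"]) (auto intro: smooth_const)

lemma test_sum: "(\<And>i. i \<in> A \<Longrightarrow> f i \<in> test_functions \<Omega>) \<Longrightarrow> (\<lambda>x. \<Sum>i\<in>A. f i x) \<in> test_functions \<Omega>"
  by (induction A rule: infinite_finite_induct) (auto intro: test_zero test_add)

lemma test_scaleR: "f \<in> test_functions \<Omega> \<Longrightarrow> (\<lambda>x. c *\<^sub>R f x) \<in> test_functions \<Omega>"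
  by (rule test_bounded_linear[OF bounded_linear_scaleR_right])

lemma test_bounded:
  assumes "\<phi> \<in> test_functions \<Omega>"
  obtains C where "0 < C" "\<And>x. norm (\<phi> x) \<le> C"
proof -
  obtain K where K: "compact K" "\<And>x. x \<notin> K \<Longrightarrow> \<phi> x = 0"
    using test_support[OF assms] by blast
  have "bounded (\<phi> ` K)"
    using compact_continuous_image[OF smooth_continuous[OF test_smooth[OF assms]] K(1)] compact_imp_bounded by blast
  then obtain C where C: "0 < C" "\<forall>y\<in>\<phi> ` K. norm y \<le> C" using bounded_pos by blast
  then have "norm (\<phi> x) \<le> C" for x using K(2)[of x] by (cases "x \<in> K") auto
  with C show ?thesis using that by blast
qed

text \<open>Open boxes are a generator stable under intersection, so vanishing integrals pass from
  boxes to Borel sets by Dynkin induction and to Lebesgue sets up to null sets; a function all of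
  whose set integrals vanish is 0 almost everywhere. The premise \<open>zero\<close> also records
  that the closed box stays inside, since the bump functions that will verify it need a compact
  support in the domain.\<close>

lemma box_null:
  fixes g :: "'a::euclidean_space \<Rightarrow> 'b::euclidean_space"
  assumes int: "integrable (lebesgue_on (box a b)) g"
    and zero: "\<And>l u. box l u \<subseteq> box a b \<Longrightarrow> cbox l u \<subseteq> cbox a b \<Longrightarrow>
      (LINT x|lebesgue. indicator (box l u) x *\<^sub>R g x) = 0"
  shows "AE x in lebesgue_on (box a b). g x = 0"
proof -
  let ?N = "lebesgue_on (box a b)"
  define f where "f = (\<lambda>x. indicator (box a b) x *\<^sub>R g x)"
  have f: "integrable lebesgue f"
    using int unfolding f_def by (subst (asm) integrable_restrict_space) auto
  have fA: "integrable lebesgue (\<lambda>x. indicator A x *\<^sub>R f x)" if "A \<in> sets lebesgue" for A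
    using that f by (rule integrable_mult_indicator)
  have zero_box: "(LINT x|lebesgue. indicator (box c d) x *\<^sub>R f x) = 0" for c d
  proof -
    let ?l = "\<Sum>i\<in>Basis. max (a \<bullet> i) (c \<bullet> i) *\<^sub>R i" and ?u = "\<Sum>i\<in>Basis. min (b \<bullet> i) (d \<bullet> i) *\<^sub>R i"
    have eq: "box a b \<inter> box c d = box ?l ?u" by (rule box_Int_box)
    have "box ?l ?u \<subseteq> box a b" using eq by blast
    moreover have "cbox ?l ?u \<subseteq> cbox a b" using Int_interval[of a b c d] by blast
    moreover have "(\<lambda>x. indicator (box c d) x *\<^sub>R f x) = (\<lambda>x. indicator (box ?l ?u) x *\<^sub>R g x)"
      unfolding f_def eq[symmetric] by (auto simp: indicator_def fun_eq_iff)
    ultimately show ?thesis using zero[of ?l ?u] by (simp only:)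
  qed
  have f_int: "(LINT x|lebesgue. f x) = 0"
  proof -
    have "(\<lambda>x. indicator (box a b) x *\<^sub>R f x) = f" by (auto simp: f_def indicator_def fun_eq_iff)
    then show ?thesis using zero_box[of a b] by (simp only:)
  qed
  have borel: "(LINT x|lebesgue. indicator A x *\<^sub>R f x) = 0" if "A \<in> sets borel" for A
  proof -
    have A: "A \<in> sigma_sets UNIV (range (\<lambda>(a, b). box a b :: 'a set))"
      using that unfolding borel_eq_box by simp
    have leb: "B \<in> sets lebesgue" if "B \<in> sigma_sets UNIV (range (\<lambda>(a, b). box a b :: 'a set))" for B
      using that borel_eq_box by (metis sets_completionI_sets sets_lborel sets_measure_of top_greatest Pow_UNIV)
    have "Int_stable (range (\<lambda>(a, b). box a b :: 'a set))"
      by (auto simp: Int_stable_def box_Int_box)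
    moreover have "range (\<lambda>(a, b). box a b :: 'a set) \<subseteq> Pow UNIV" by simp
    ultimately show ?thesis using A
    proof (induction rule: sigma_sets_induct_disjoint)
      case (basic A)
      then show ?case using zero_box by auto
    next
      case empty
      then show ?case by simp
    next
      case (compl A)
      have "(\<lambda>x. indicator (UNIV - A) x *\<^sub>R f x) = (\<lambda>x. f x - indicator A x *\<^sub>R f x)"
        by (auto simp: indicator_def fun_eq_iff)
      then have "(LINT x|lebesgue. indicator (UNIV - A) x *\<^sub>R f x) = (LINT x|lebesgue. f x - indicator A x *\<^sub>R f x)"
        by simp
      also have "\<dots> = 0"
        using Bochner_Integration.integral_diff[OF f fA[OF leb[OF compl(1)]]] f_int compl by simp
      finally show ?case .
    next
      case (union A)
      have m: "A i \<in> sets lebesgue" for i using union leb by blast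
      have "(LINT x:(\<Union>i. A i)|lebesgue. f x) = (\<Sum>i. (LINT x:(A i)|lebesgue. f x))"
      proof (rule lebesgue_integral_countable_add)
        show "\<And>i j. i \<noteq> j \<Longrightarrow> A i \<inter> A j = {}" using union(1) by (auto simp: disjoint_family_on_def)
        show "set_integrable lebesgue (\<Union>i. A i) f" unfolding set_integrable_def using m by (intro fA) auto
      qed (rule m)
      then show ?case using union unfolding set_lebesgue_integral_def by simp
    qed
  qed
  have leb: "(LINT x|lebesgue. indicator A x *\<^sub>R f x) = 0" if A: "A \<in> sets lebesgue" for A
  proof -
    obtain S N N' where SN: "A = S \<union> N" "N \<subseteq> N'" "N' \<in> null_sets lborel" "S \<in> sets lborel"
      using A by (rule sets_completionE)
    have S: "S \<in> sets lebesgue" using SN by auto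
    have "AE x in lebesgue. x \<notin> N'"
      by (rule AE_not_in) (use SN null_sets_completionI in blast)
    then have "AE x in lebesgue. indicator A x *\<^sub>R f x = indicator S x *\<^sub>R f x"
      by eventually_elim (use SN in \<open>auto simp: indicator_def\<close>)
    then have "(LINT x|lebesgue. indicator A x *\<^sub>R f x) = (LINT x|lebesgue. indicator S x *\<^sub>R f x)"
      using borel_measurable_integrable[OF fA[OF A]] borel_measurable_integrable[OF fA[OF S]]
      by (intro integral_cong_AE) auto
    then show ?thesis using borel SN by simp
  qed
  interpret N: finite_measure ?N by (rule finite_measure_lebesgue_on) simp
  show ?thesis
  proof (rule N.density_zero[OF int])
    fix A assume "A \<in> sets ?N"
    then have A: "A \<subseteq> box a b" "A \<in> sets lebesgue" by (auto simp: sets_restrict_space_iff)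
    have "set_lebesgue_integral ?N A g = (LINT x|lebesgue. indicator (box a b) x *\<^sub>R (indicator A x *\<^sub>R g x))"
      unfolding set_lebesgue_integral_def by (rule integral_restrict_space) simp
    also have "\<dots> = (LINT x|lebesgue. indicator A x *\<^sub>R f x)"
      by (intro Bochner_Integration.integral_cong) (auto simp: f_def indicator_def)
    finally show "set_lebesgue_integral ?N A g = 0" using leb A by simp
  qed
qed

text \<open>Dominated convergence from bumps to the indicator of a box reduces the claim to
  \<open>box_null\<close>. An open set is a countable union of closed boxes, and their boundaries
  are null sets.\<close>

theorem fundamental_lemma:
  fixes g :: "'a::euclidean_space \<Rightarrow> 'b::euclidean_space"
  assumes \<Omega>: "open \<Omega>" and li: "locally_integrable \<Omega> g"
    and zero: "\<And>\<phi>. \<phi> \<in> test_functions \<Omega> \<Longrightarrow> (LINT x|lebesgue_on \<Omega>. (\<phi> x :: real) *\<^sub>R g x) = 0"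
  shows "AE x in lebesgue_on \<Omega>. g x = 0"
proof -
  have \<Omega>_meas: "\<Omega> \<in> sets lebesgue" using \<Omega> by auto
  have gC: "integrable lebesgue (\<lambda>x. indicator (cbox a b) x *\<^sub>R g x)" if "cbox a b \<subseteq> \<Omega>" for a b
  proof -
    have "g absolutely_integrable_on cbox a b"
      using li that compact_cbox[of a b] unfolding locally_integrable_def by simp
    then show ?thesis unfolding set_integrable_def .
  qed
  have zero_box: "(LINT x|lebesgue. indicator (box l u) x *\<^sub>R g x) = 0" if sub: "cbox l u \<subseteq> \<Omega>" for l u
  proof -
    let ?G = "\<lambda>x. indicator (cbox l u) x *\<^sub>R g x"
    have "(\<lambda>n. LINT x|lebesgue. box_bump l u n x *\<^sub>R ?G x) \<longlonglongrightarrow> (LINT x|lebesgue. indicator (box l u) x *\<^sub>R ?G x)"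
    proof (rule integral_dominated_convergence)
      have Gm: "?G \<in> borel_measurable lebesgue" using gC[OF sub] by auto
      show "(\<lambda>x. indicator (box l u) x *\<^sub>R ?G x) \<in> borel_measurable lebesgue"
        by (rule borel_measurable_integrable, rule integrable_mult_indicator[OF _ gC[OF sub]]) auto
      have "box_bump l u n \<in> borel_measurable lebesgue" for n
        using borel_measurable_continuous_onI[OF smooth_continuous[OF smooth_box_bump[of l u n]]]
        by (simp add: measurable_completion)
      then show "(\<lambda>x. box_bump l u n x *\<^sub>R ?G x) \<in> borel_measurable lebesgue" for n
        by (rule borel_measurable_scaleR[OF _ Gm])
      show "integrable lebesgue (\<lambda>x. norm (?G x))" using gC[OF sub] by (rule integrable_norm)
      show "AE x in lebesgue. (\<lambda>n. box_bump l u n x *\<^sub>R ?G x) \<longlonglongrightarrow> indicator (box l u) x *\<^sub>R ?G x"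
        by (intro AE_I2 tendsto_scaleR box_bump_tendsto tendsto_const)
      show "AE x in lebesgue. norm (box_bump l u n x *\<^sub>R ?G x) \<le> norm (?G x)" for n
      proof (rule AE_I2)
        fix x
        have "norm (box_bump l u n x *\<^sub>R ?G x) = box_bump l u n x * norm (?G x)"
          by (simp only: norm_scaleR abs_of_nonneg[OF box_bump_bounds(1)])
        also have "\<dots> \<le> 1 * norm (?G x)" by (intro mult_right_mono box_bump_bounds) simp
        finally show "norm (box_bump l u n x *\<^sub>R ?G x) \<le> norm (?G x)" by simp
      qed
    qed
    moreover have "(LINT x|lebesgue. box_bump l u n x *\<^sub>R ?G x) = 0" for n
    proof -
      have "(LINT x|lebesgue. box_bump l u n x *\<^sub>R ?G x) = (LINT x|lebesgue. indicator \<Omega> x *\<^sub>R (box_bump l u n x *\<^sub>R g x))"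
      proof (intro Bochner_Integration.integral_cong refl)
        fix x show "box_bump l u n x *\<^sub>R ?G x = indicator \<Omega> x *\<^sub>R (box_bump l u n x *\<^sub>R g x)"
          using box_bump_nonzero[of l u n x] sub box_subset_cbox[of l u] by (auto simp: indicator_def)
      qed
      also have "\<dots> = (LINT x|lebesgue_on \<Omega>. box_bump l u n x *\<^sub>R g x)"
        using \<Omega>_meas by (subst integral_restrict_space) auto
      also have "\<dots> = 0" by (rule zero[OF box_bump_test[OF sub]])
      finally show ?thesis .
    qed
    moreover have "(\<lambda>x. indicator (box l u) x *\<^sub>R ?G x) = (\<lambda>x. indicator (box l u) x *\<^sub>R g x)"
      using box_subset_cbox[of l u] by (auto simp: indicator_def fun_eq_iff)
    ultimately show ?thesis by (simp add: LIMSEQ_const_iff)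
  qed
  have box: "AE x in lebesgue. x \<in> cbox a b \<longrightarrow> g x = 0" if sub: "cbox a b \<subseteq> \<Omega>" for a b
  proof -
    have "integrable (lebesgue_on (box a b)) g"
    proof (subst integrable_restrict_space)
      have "(\<lambda>x. indicator (box a b) x *\<^sub>R g x) = (\<lambda>x. indicator (box a b) x *\<^sub>R (indicator (cbox a b) x *\<^sub>R g x))"
        using box_subset_cbox[of a b] by (auto simp: indicator_def fun_eq_iff)
      then show "integrable lebesgue (\<lambda>x. indicator (box a b) x *\<^sub>R g x)"
        using integrable_mult_indicator[OF _ gC[OF sub], of "box a b"] by simp
    qed simp
    then have "AE x in lebesgue_on (box a b). g x = 0"
      using sub by (intro box_null zero_box) auto
    then have "AE x in lebesgue. x \<in> box a b \<longrightarrow> g x = 0"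
      by (subst (asm) AE_restrict_space_iff) auto
    moreover have "AE x in lebesgue. x \<notin> cbox a b - box a b"
      using negligible_frontier_interval[of a b] by (intro AE_not_in) (simp add: negligible_iff_null_sets)
    ultimately show ?thesis by eventually_elim auto
  qed
  obtain \<D> where D: "countable \<D>" "\<D> \<subseteq> Pow \<Omega>" "\<And>X. X \<in> \<D> \<Longrightarrow> \<exists>a b. X = cbox a b" "\<Union>\<D> = \<Omega>"
    using open_countable_Union_open_cbox[OF \<Omega>] by blast
  have "AE x in lebesgue. \<forall>X\<in>\<D>. x \<in> X \<longrightarrow> g x = 0"
  proof (rule AE_ball_countable')
    fix X assume "X \<in> \<D>"
    then show "AE x in lebesgue. x \<in> X \<longrightarrow> g x = 0" using D box by (metis PowD subsetD)
  qed (rule D)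
  then have "AE x in lebesgue. x \<in> \<Omega> \<longrightarrow> g x = 0" by eventually_elim (use D in blast)
  then show ?thesis using \<Omega>_meas by (subst AE_restrict_space_iff) auto
qed

text \<open>By translation invariance every difference quotient has integral 0. The quotients
  converge to the derivative under a common bound: the mean value inequality gives \<open>C\<close>,
  and steps of length at most 1 keep their supports in a ball of radius \<open>R + 1\<close>. All
  integrations by parts rest on this fact.\<close>

lemma integral_partial_zero:
  fixes f :: "'a::euclidean_space \<Rightarrow> 'b::euclidean_space"
  assumes d: "\<And>x. (f has_derivative f' x) (at x)" and b: "b \<in> Basis"
    and cont: "continuous_on UNIV (\<lambda>x. f' x b)"
    and K: "compact K" "\<And>x. x \<notin> K \<Longrightarrow> f x = 0" "\<And>x. x \<notin> K \<Longrightarrow> f' x b = 0"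
  shows "(LINT x|lborel. f' x b) = 0"
proof -
  let ?D = "\<lambda>x. f' x b"
  have fcont: "continuous_on UNIV f"
    by (meson continuous_at_imp_continuous_on d has_derivative_continuous)
  have "bounded (?D ` K)"
    using compact_continuous_image[OF continuous_on_subset[OF cont] K(1)] compact_imp_bounded by blast
  then obtain C where C: "0 < C" "\<forall>y\<in>?D ` K. norm y \<le> C" using bounded_pos by blast
  have DC: "norm (?D x) \<le> C" for x using C K(3)[of x] by (cases "x \<in> K") auto
  obtain R where R: "\<And>x. x \<in> K \<Longrightarrow> norm x \<le> R"
    using compact_imp_bounded[OF K(1)] bounded_iff by blast
  have lip: "norm (f (x + s *\<^sub>R b) - f x) \<le> C * s" if "0 \<le> s" for x s
  proof -
    have "norm (f (x + s *\<^sub>R b) - f (x + 0 *\<^sub>R b)) \<le> C * norm (s - 0)"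
    proof (rule differentiable_bound[of "{0..s}" "\<lambda>t. f (x + t *\<^sub>R b)" "\<lambda>t u. u *\<^sub>R ?D (x + t *\<^sub>R b)"])
      fix t
      have "((\<lambda>t. f (x + t *\<^sub>R b)) has_derivative (\<lambda>u. f' (x + t *\<^sub>R b) (u *\<^sub>R b))) (at t within {0..s})"
        by (rule has_derivative_compose[OF _ d]) (auto intro!: derivative_eq_intros)
      then show "((\<lambda>t. f (x + t *\<^sub>R b)) has_derivative (\<lambda>u. u *\<^sub>R ?D (x + t *\<^sub>R b))) (at t within {0..s})"
        using linear_cmul[OF has_derivative_linear[OF d]] by simp
      show "onorm (\<lambda>u. u *\<^sub>R ?D (x + t *\<^sub>R b)) \<le> C"
      proof (rule onorm_bound)
        fix u :: real
        show "norm (u *\<^sub>R ?D (x + t *\<^sub>R b)) \<le> C * norm u"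
          using mult_left_mono[OF DC abs_ge_zero, of u] by (simp add: mult.commute)
      qed (use C(1) in simp)
    qed (use that in auto)
    then show ?thesis using that by simp
  qed
  define s where "s = (\<lambda>n. inverse (real (Suc n)))"
  have s: "0 < s n" "s n \<le> 1" for n unfolding s_def by (auto simp: field_simps)
  define g where "g = (\<lambda>n x. (1 / s n) *\<^sub>R (f (x + s n *\<^sub>R b) - f x))"
  have fint: "integrable lborel f"
  proof -
    have "bounded (f ` K)"
      using compact_continuous_image[OF continuous_on_subset[OF fcont] K(1)] compact_imp_bounded by blast
    then obtain C' where C': "\<forall>y\<in>f ` K. norm y \<le> C'" using bounded_iff by blast
    show ?thesis
    proof (rule Bochner_Integration.integrable_bound[of _ "\<lambda>x. indicat_real K x * C'"])
      show "integrable lborel (\<lambda>x. indicat_real K x * C')"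
        using K(1) emeasure_compact_finite[of K] by (auto simp: compact_imp_closed borel_closed)
      show "AE x in lborel. norm (f x) \<le> norm (indicat_real K x * C')"
        using C' K(2) by (intro AE_I2) (auto simp: indicator_def abs_if intro: order_trans)
    qed (use fcont in \<open>auto intro: borel_measurable_continuous_onI\<close>)
  qed
  have trans: "(LINT x|lborel. f (x + c)) = (LINT x|lborel. f x)" "integrable lborel (\<lambda>x. f (x + c))" for c
  proof -
    have m: "f \<in> borel_measurable borel" using fcont by (rule borel_measurable_continuous_onI)
    have "integrable (distr lborel borel ((+) c)) f" using fint by (simp add: lborel_distr_plus)
    then show "integrable lborel (\<lambda>x. f (x + c))"
      using m by (subst (asm) integrable_distr_eq) (auto simp: add.commute)
    have "(LINT x|lborel. f x) = (LINT x|distr lborel borel ((+) c). f x)" by (simp add: lborel_distr_plus)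
    also have "\<dots> = (LINT x|lborel. f (c + x))" using m by (subst integral_distr) auto
    finally show "(LINT x|lborel. f (x + c)) = (LINT x|lborel. f x)" by (simp add: add.commute)
  qed
  have "(\<lambda>n. LINT x|lborel. g n x) \<longlonglongrightarrow> (LINT x|lborel. ?D x)"
  proof (rule integral_dominated_convergence[of _ _ _ "\<lambda>x. indicat_real (cball 0 (R + 1)) x * C"])
    show "?D \<in> borel_measurable lborel" using cont by (simp add: borel_measurable_continuous_onI)
    show "g n \<in> borel_measurable lborel" for n
    proof -
      have "continuous_on UNIV (g n)" unfolding g_def
        by (intro continuous_intros continuous_on_compose2[OF fcont]) auto
      then show ?thesis by (simp add: borel_measurable_continuous_onI)
    qed
    show "integrable lborel (\<lambda>x::'a. indicat_real (cball 0 (R + 1)) x * C)"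
    proof (intro integrable_mult_left integrable_real_indicator)
      show "emeasure lborel (cball (0::'a) (R + 1)) < \<infinity>" by (rule emeasure_compact_finite) simp
    qed simp
    show "AE x in lborel. (\<lambda>n. g n x) \<longlonglongrightarrow> ?D x"
    proof (rule AE_I2)
      fix x
      have "((\<lambda>t. f (x + t *\<^sub>R b)) has_derivative (\<lambda>u. f' (x + 0 *\<^sub>R b) (u *\<^sub>R b))) (at 0)"
        by (rule has_derivative_compose[OF _ d]) (auto intro!: derivative_eq_intros)
      then have "((\<lambda>t. f (x + t *\<^sub>R b)) has_derivative (\<lambda>u. u *\<^sub>R ?D x)) (at 0)"
        using linear_cmul[OF has_derivative_linear[OF d]] by simp
      then have "(\<lambda>t. norm (f (x + (0 + t) *\<^sub>R b) - f (x + 0 *\<^sub>R b) - t *\<^sub>R ?D x) / norm t) \<midarrow>0\<rightarrow> 0"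
        unfolding has_derivative_at by blast
      moreover have "filterlim s (at 0) sequentially"
      proof (rule filterlim_atI)
        show "s \<longlonglongrightarrow> 0" unfolding s_def by (rule LIMSEQ_inverse_real_of_nat)
        show "\<forall>\<^sub>F n in sequentially. s n \<noteq> 0" using s(1) by (intro always_eventually allI) (metis less_irrefl)
      qed
      ultimately have "(\<lambda>n. norm (f (x + (0 + s n) *\<^sub>R b) - f (x + 0 *\<^sub>R b) - s n *\<^sub>R ?D x) / norm (s n)) \<longlonglongrightarrow> 0"
        by (rule filterlim_compose)
      moreover have "norm (f (x + (0 + s n) *\<^sub>R b) - f (x + 0 *\<^sub>R b) - s n *\<^sub>R ?D x) / norm (s n) = norm (g n x - ?D x)" for n
      proof -
        have "g n x - ?D x = (1 / s n) *\<^sub>R (f (x + s n *\<^sub>R b) - f x - s n *\<^sub>R ?D x)"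
          using s(1)[of n] by (simp add: g_def scaleR_diff_right)
        then show ?thesis using s(1)[of n] by simp
      qed
      ultimately have "(\<lambda>n. norm (g n x - ?D x)) \<longlonglongrightarrow> 0" by simp
      then show "(\<lambda>n. g n x) \<longlonglongrightarrow> ?D x" using LIM_zero_iff tendsto_norm_zero_iff by blast
    qed
    show "AE x in lborel. norm (g n x) \<le> indicat_real (cball 0 (R + 1)) x * C" for n
    proof (rule AE_I2)
      fix x
      have "norm (g n x) \<le> C"
      proof -
        have "norm (g n x) = norm (f (x + s n *\<^sub>R b) - f x) / s n"
          unfolding g_def norm_scaleR using s(1)[of n] by simp
        then show ?thesis using lip[of "s n" x] s[of n] by (simp add: pos_divide_le_eq)
      qed
      moreover have "g n x = 0" if "\<not> norm x \<le> R + 1"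
      proof -
        have "x \<notin> K" using R[of x] that by auto
        moreover have "x + s n *\<^sub>R b \<notin> K"
        proof
          assume "x + s n *\<^sub>R b \<in> K"
          then have "norm (x + s n *\<^sub>R b) \<le> R" by (rule R)
          moreover have "norm x \<le> norm (x + s n *\<^sub>R b) + norm (s n *\<^sub>R b)"
            using norm_triangle_ineq4[of "x + s n *\<^sub>R b" "s n *\<^sub>R b"] by simp
          ultimately show False using that s[of n] b by simp
        qed
        ultimately show ?thesis by (simp add: g_def K(2))
      qed
      ultimately show "norm (g n x) \<le> indicat_real (cball 0 (R + 1)) x * C"
        using C(1) by (cases "norm x \<le> R + 1") (auto simp: indicator_def)
    qed
  qed
  moreover have "(LINT x|lborel. g n x) = 0" for n
    unfolding g_def using trans fint by simp
  ultimately show ?thesis by (simp add: LIMSEQ_const_iff)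
qed

lemma integral_partial_zero_on:
  fixes f :: "'a::euclidean_space \<Rightarrow> 'b::euclidean_space"
  assumes \<Omega>: "open \<Omega>" and d: "\<And>x. (f has_derivative f' x) (at x)" and b: "b \<in> Basis"
    and cont: "continuous_on UNIV (\<lambda>x. f' x b)"
    and K: "compact K" "K \<subseteq> \<Omega>" "\<And>x. x \<notin> K \<Longrightarrow> f x = 0" "\<And>x. x \<notin> K \<Longrightarrow> f' x b = 0"
  shows "(LINT x|lebesgue_on \<Omega>. f' x b) = 0"
proof -
  have "(LINT x|lebesgue. f' x b) = 0"
    using integral_partial_zero[OF d b cont K(1,3,4)] cont
    by (subst integral_completion) (auto intro: borel_measurable_continuous_onI)
  moreover have "(\<lambda>x. f' x b) = (\<lambda>x. indicator \<Omega> x *\<^sub>R f' x b)"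
  proof
    fix x show "f' x b = indicator \<Omega> x *\<^sub>R f' x b"
      using K(2) K(4)[of x] by (cases "x \<in> \<Omega>") auto
  qed
  ultimately show ?thesis using \<Omega> by (subst integral_restrict_space) auto
qed

section \<open>Weak derivatives and Sobolev spaces\<close>

text \<open>Completeness of Lebesgue measure. It is used for \<open>weak_deriv\<close>, an arbitrary
  choice that is identified with an L2 function only almost everywhere.\<close>

lemma lebesgue_on_AE_measurable:
  fixes f g :: "'a::euclidean_space \<Rightarrow> 'b::euclidean_space"
  assumes \<Omega>: "\<Omega> \<in> sets lebesgue" and f: "f \<in> borel_measurable (lebesgue_on \<Omega>)"
    and eq: "AE x in lebesgue_on \<Omega>. f x = g x"
  shows "g \<in> borel_measurable (lebesgue_on \<Omega>)"
proof -
  have "(\<lambda>x. indicator \<Omega> x *\<^sub>R f x) \<in> borel_measurable lebesgue"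
    using f \<Omega> by (subst (asm) borel_measurable_restrict_space_iff) auto
  moreover have "AE x in lebesgue. indicator \<Omega> x *\<^sub>R f x = indicator \<Omega> x *\<^sub>R g x"
    using eq \<Omega> by (subst (asm) AE_restrict_space_iff) (auto elim!: AE_mp simp: indicator_def)
  ultimately have "(\<lambda>x. indicator \<Omega> x *\<^sub>R g x) \<in> borel_measurable lebesgue"
    by (rule borel_measurable_AE)
  then show ?thesis using \<Omega> by (subst borel_measurable_restrict_space_iff) auto
qed

lemma L2_locally_integrable:
  fixes f :: "'a::euclidean_space \<Rightarrow> 'b::euclidean_space"
  assumes \<Omega>: "open \<Omega>" and f: "f \<in> L2_space \<Omega>"
  shows "locally_integrable \<Omega> f"
  unfolding locally_integrable_def
proof (intro allI impI)
  fix K assume K: "compact K \<and> K \<subseteq> \<Omega>"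
  have \<Omega>m: "\<Omega> \<in> sets lebesgue" using \<Omega> by auto
  have Km: "K \<in> sets lebesgue" using K lmeasurable_compact[of K] fmeasurableD by blast
  have m: "(\<lambda>x. indicator \<Omega> x *\<^sub>R f x) \<in> borel_measurable lebesgue"
    using L2_measurable[OF f] \<Omega>m by (subst (asm) borel_measurable_restrict_space_iff) auto
  have sq: "integrable lebesgue (\<lambda>x. indicator \<Omega> x *\<^sub>R (norm (f x))\<^sup>2)"
    using L2_sq_integrable[OF f] \<Omega>m by (subst (asm) integrable_restrict_space) auto
  have i1: "integrable lebesgue (indicat_real K)"
    using lmeasurable_compact[of K] K by (intro integrable_real_indicator) (auto simp: fmeasurable_def)
  show "f absolutely_integrable_on K"
    unfolding set_integrable_def
  proof (rule Bochner_Integration.integrable_bound)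
    show "integrable lebesgue (\<lambda>x. indicat_real K x + indicator \<Omega> x *\<^sub>R (norm (f x))\<^sup>2)"
      using i1 sq by auto
    have "(\<lambda>x. indicator K x *\<^sub>R (indicator \<Omega> x *\<^sub>R f x)) \<in> borel_measurable lebesgue"
      by (rule borel_measurable_scaleR[OF _ m]) (use Km in auto)
    moreover have "(\<lambda>x. indicator K x *\<^sub>R (indicator \<Omega> x *\<^sub>R f x)) = (\<lambda>x. indicator K x *\<^sub>R f x)"
      using K by (auto simp: indicator_def fun_eq_iff)
    ultimately show "(\<lambda>x. indicator K x *\<^sub>R f x) \<in> borel_measurable lebesgue" by simp
    have "a \<le> 1 + a\<^sup>2" for a :: real
      using zero_le_power2[of "a - 1"] zero_le_power2[of a] unfolding power2_diff by (simp, linarith?)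
    then show "AE x in lebesgue. norm (indicat_real K x *\<^sub>R f x) \<le> norm (indicat_real K x + indicator \<Omega> x *\<^sub>R (norm (f x))\<^sup>2)"
      using K by (intro AE_I2) (auto simp: indicator_def)
  qed
qed

lemma test_local_integrable:
  fixes g :: "'a::euclidean_space \<Rightarrow> 'b::euclidean_space"
  assumes \<Omega>: "open \<Omega>" and \<phi>: "\<phi> \<in> test_functions \<Omega>" and g: "locally_integrable \<Omega> g"
  shows "integrable (lebesgue_on \<Omega>) (\<lambda>x. (\<phi> x :: real) *\<^sub>R g x)"
proof -
  obtain K where K: "compact K" "K \<subseteq> \<Omega>" "\<And>x. x \<notin> K \<Longrightarrow> \<phi> x = 0"
    using test_support[OF \<phi>] by blast
  obtain C where C: "0 < C" "\<And>x. norm (\<phi> x) \<le> C" using test_bounded[OF \<phi>] by blast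
  have gK: "integrable lebesgue (\<lambda>x. indicator K x *\<^sub>R g x)"
    using g K unfolding locally_integrable_def set_integrable_def by simp
  have \<phi>m: "\<phi> \<in> borel_measurable lebesgue"
    using borel_measurable_continuous_onI[OF smooth_continuous[OF test_smooth[OF \<phi>]]]
    by (simp add: measurable_completion)
  have "integrable lebesgue (\<lambda>x. \<phi> x *\<^sub>R (indicator K x *\<^sub>R g x))"
  proof (rule Bochner_Integration.integrable_bound)
    show "integrable lebesgue (\<lambda>x. C *\<^sub>R (indicator K x *\<^sub>R g x))" by (rule integrable_scaleR_right[OF gK])
    show "(\<lambda>x. \<phi> x *\<^sub>R (indicator K x *\<^sub>R g x)) \<in> borel_measurable lebesgue"
      by (rule borel_measurable_scaleR[OF \<phi>m borel_measurable_integrable[OF gK]])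
    show "AE x in lebesgue. norm (\<phi> x *\<^sub>R (indicator K x *\<^sub>R g x)) \<le> norm (C *\<^sub>R (indicator K x *\<^sub>R g x))"
    proof (rule AE_I2)
      fix x
      have "\<bar>\<phi> x\<bar> * norm (indicator K x *\<^sub>R g x) \<le> \<bar>C\<bar> * norm (indicator K x *\<^sub>R g x)"
        using C by (intro mult_right_mono) auto
      then show "norm (\<phi> x *\<^sub>R (indicator K x *\<^sub>R g x)) \<le> norm (C *\<^sub>R (indicator K x *\<^sub>R g x))"
        by (simp only: norm_scaleR)
    qed
  qed
  moreover have "(\<lambda>x. \<phi> x *\<^sub>R (indicator K x *\<^sub>R g x)) = (\<lambda>x. indicator \<Omega> x *\<^sub>R (\<phi> x *\<^sub>R g x))"
    using K by (auto simp: indicator_def fun_eq_iff)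
  ultimately show ?thesis using \<Omega> by (subst integrable_restrict_space) auto
qed

lemma locally_integrable_add:
  "locally_integrable \<Omega> f \<Longrightarrow> locally_integrable \<Omega> g \<Longrightarrow> locally_integrable \<Omega> (\<lambda>x. f x + g x)"
  unfolding locally_integrable_def by auto

lemma locally_integrable_scale:
  "locally_integrable \<Omega> f \<Longrightarrow> locally_integrable \<Omega> (\<lambda>x. c *\<^sub>R f x)"
  unfolding locally_integrable_def set_integrable_def
  by (auto simp: scaleR_left_commute[of _ c] simp del: scaleR_scaleR)

lemma test_iter_deriv: "\<phi> \<in> test_functions \<Omega> \<Longrightarrow> set bs \<subseteq> Basis \<Longrightarrow> iter_deriv bs \<phi> \<in> test_functions \<Omega>"
  by (induction bs) (auto intro: test_pd)

lemma is_weak_deriv_add: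
  assumes \<Omega>: "open \<Omega>" and bs: "set bs \<subseteq> Basis" and f: "is_weak_deriv \<Omega> bs f f'" and g: "is_weak_deriv \<Omega> bs g g'"
  shows "is_weak_deriv \<Omega> bs (\<lambda>x. f x + g x) (\<lambda>x. f' x + g' x)"
proof -
  have li: "locally_integrable \<Omega> f" "locally_integrable \<Omega> f'" "locally_integrable \<Omega> g" "locally_integrable \<Omega> g'"
    using f g by (auto simp: is_weak_deriv_def)
  show ?thesis unfolding is_weak_deriv_def
  proof (intro conjI ballI locally_integrable_add li)
    fix \<phi> :: "'a \<Rightarrow> real" assume \<phi>: "\<phi> \<in> test_functions \<Omega>"
    have \<phi>': "iter_deriv bs \<phi> \<in> test_functions \<Omega>" by (rule test_iter_deriv[OF \<phi> bs])
    show "(LINT x|lebesgue_on \<Omega>. iter_deriv bs \<phi> x *\<^sub>R (f x + g x)) =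
        (-1) ^ length bs *\<^sub>R (LINT x|lebesgue_on \<Omega>. \<phi> x *\<^sub>R (f' x + g' x))"
      using f g \<phi> test_local_integrable[OF \<Omega> \<phi> li(2)] test_local_integrable[OF \<Omega> \<phi> li(4)]
        test_local_integrable[OF \<Omega> \<phi>' li(1)] test_local_integrable[OF \<Omega> \<phi>' li(3)]
      by (simp add: is_weak_deriv_def scaleR_add_right)
  qed
qed

lemma is_weak_deriv_scale:
  assumes f: "is_weak_deriv \<Omega> bs f f'"
  shows "is_weak_deriv \<Omega> bs (\<lambda>x. c *\<^sub>R f x) (\<lambda>x. c *\<^sub>R f' x)"
  using f unfolding is_weak_deriv_def
  by (auto intro!: locally_integrable_scale simp: scaleR_left_commute[of _ c] simp del: scaleR_scaleR)

lemma is_weak_deriv_unique: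
  assumes \<Omega>: "open \<Omega>" and bs: "set bs \<subseteq> Basis" and g: "is_weak_deriv \<Omega> bs f g" "is_weak_deriv \<Omega> bs f g'"
  shows "AE x in lebesgue_on \<Omega>. g x = g' x"
proof -
  have "is_weak_deriv \<Omega> bs (\<lambda>x. f x + (-1) *\<^sub>R f x) (\<lambda>x. g x + (-1) *\<^sub>R g' x)"
    by (intro is_weak_deriv_add is_weak_deriv_scale \<Omega> bs g)
  then have w: "is_weak_deriv \<Omega> bs (\<lambda>x. 0) (\<lambda>x. g x - g' x)" by simp
  have "AE x in lebesgue_on \<Omega>. g x - g' x = 0"
  proof (rule fundamental_lemma[OF \<Omega>])
    show "locally_integrable \<Omega> (\<lambda>x. g x - g' x)" using w by (simp add: is_weak_deriv_def)
    fix \<phi> :: "'a \<Rightarrow> real" assume "\<phi> \<in> test_functions \<Omega>"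
    with w show "(LINT x|lebesgue_on \<Omega>. \<phi> x *\<^sub>R (g x - g' x)) = 0"
      by (simp add: is_weak_deriv_def)
  qed
  then show ?thesis by eventually_elim simp
qed

lemma weak_deriv_works: "is_weak_deriv \<Omega> bs f g \<Longrightarrow> is_weak_deriv \<Omega> bs f (weak_deriv \<Omega> bs f)"
  unfolding weak_deriv_def by (rule someI[where P = "is_weak_deriv \<Omega> bs f"])

lemma weak_deriv_AE:
  "open \<Omega> \<Longrightarrow> set bs \<subseteq> Basis \<Longrightarrow> is_weak_deriv \<Omega> bs f g \<Longrightarrow> AE x in lebesgue_on \<Omega>. weak_deriv \<Omega> bs f x = g x"
  using is_weak_deriv_unique[OF _ _ weak_deriv_works] by blast

lemma weak_deriv_L2:
  assumes \<Omega>: "open \<Omega>" and bs: "set bs \<subseteq> Basis" and g: "is_weak_deriv \<Omega> bs f g" "g \<in> L2_space \<Omega>"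
  shows "weak_deriv \<Omega> bs f \<in> L2_space \<Omega>"
proof -
  have eq: "AE x in lebesgue_on \<Omega>. g x = weak_deriv \<Omega> bs f x"
    using weak_deriv_AE[OF \<Omega> bs g(1)] by eventually_elim simp
  show ?thesis
    by (rule L2_cong_AE[OF g(2) lebesgue_on_AE_measurable[OF _ L2_measurable[OF g(2)] eq] eq]) (use \<Omega> in auto)
qed

lemma test_L2:
  fixes \<phi> :: "'a::euclidean_space \<Rightarrow> 'b::euclidean_space"
  assumes \<Omega>: "open \<Omega>" and \<phi>: "\<phi> \<in> test_functions \<Omega>"
  shows "\<phi> \<in> L2_space \<Omega>"
proof -
  obtain K where K: "compact K" "K \<subseteq> \<Omega>" "\<And>x. x \<notin> K \<Longrightarrow> \<phi> x = 0"
    using test_support[OF \<phi>] by blast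
  obtain C where C: "0 < C" "\<And>x. norm (\<phi> x) \<le> C" using test_bounded[OF \<phi>] by blast
  have Km: "K \<in> lmeasurable" using K lmeasurable_compact by blast
  have "integrable lebesgue (\<lambda>x. indicat_real \<Omega> x *\<^sub>R (indicat_real K x * C\<^sup>2))"
  proof -
    have "integrable lebesgue (\<lambda>x. indicat_real K x * C\<^sup>2)"
      using Km by (intro integrable_mult_left integrable_real_indicator) (auto simp: fmeasurable_def)
    from integrable_mult_indicator[OF _ this, of \<Omega>] show ?thesis using \<Omega> by auto
  qed
  then have i: "integrable (lebesgue_on \<Omega>) (\<lambda>x. indicat_real K x * C\<^sup>2)"
    using \<Omega> by (subst integrable_restrict_space) auto
  show ?thesis
  proof (rule L2_spaceI_bound[OF _ i])
    show "\<phi> \<in> borel_measurable (lebesgue_on \<Omega>)"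
      by (rule continuous_imp_measurable_on_sets_lebesgue[OF smooth_continuous[OF test_smooth[OF \<phi>]]]) (use \<Omega> in auto)
    show "AE x in lebesgue_on \<Omega>. (norm (\<phi> x))\<^sup>2 \<le> indicat_real K x * C\<^sup>2"
      using K(3) C by (intro AE_I2) (auto simp: indicator_def power_mono)
  qed
qed

text \<open>The product with a test function has compact support, so its partial derivative
  integrates to 0, and the Leibniz rule turns this into integration by parts.\<close>

lemma test_weak_deriv:
  fixes \<psi> :: "'a::euclidean_space \<Rightarrow> 'b::euclidean_space"
  assumes \<Omega>: "open \<Omega>" and \<psi>: "\<psi> \<in> test_functions \<Omega>" and b: "b \<in> Basis"
  shows "is_weak_deriv \<Omega> [b] \<psi> (pd b \<psi>)"
proof -
  have pd: "pd b \<psi> \<in> test_functions \<Omega>" by (rule test_pd[OF \<psi> b])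
  have li: "locally_integrable \<Omega> \<psi>" "locally_integrable \<Omega> (pd b \<psi>)"
    using L2_locally_integrable[OF \<Omega>] test_L2[OF \<Omega>] \<psi> pd by blast+
  show ?thesis unfolding is_weak_deriv_def
  proof (intro conjI ballI li)
    fix \<phi> :: "'a \<Rightarrow> real" assume \<phi>: "\<phi> \<in> test_functions \<Omega>"
    obtain K where K: "compact K" "K \<subseteq> \<Omega>" "\<And>x. x \<notin> K \<Longrightarrow> \<phi> x = 0" "\<And>x. x \<notin> K \<Longrightarrow> pd b \<phi> x = 0"
      using test_support[OF \<phi>] by blast
    let ?f' = "\<lambda>x y. \<phi> x *\<^sub>R frechet_derivative \<psi> (at x) y + frechet_derivative \<phi> (at x) y *\<^sub>R \<psi> x"
    have cont: "continuous_on UNIV (\<lambda>x. ?f' x b)"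
      using smooth_continuous[OF test_smooth[OF \<phi>]] smooth_continuous[OF test_smooth[OF \<psi>]]
        smooth_continuous[OF test_smooth[OF pd]] smooth_continuous[OF test_smooth[OF test_pd[OF \<phi> b]]]
      by (intro continuous_intros)
    have "(LINT x|lebesgue_on \<Omega>. ?f' x b) = 0"
    proof (rule integral_partial_zero_on[where f = "\<lambda>x. \<phi> x *\<^sub>R \<psi> x" and f' = ?f', OF \<Omega> _ b cont K(1,2)])
      show "((\<lambda>x. \<phi> x *\<^sub>R \<psi> x) has_derivative ?f' x) (at x)" for x
        by (intro has_derivative_scaleR smooth_has_derivative[OF test_smooth[OF \<phi>]]
            smooth_has_derivative[OF test_smooth[OF \<psi>]])
    qed (use K in auto)
    moreover have "integrable (lebesgue_on \<Omega>) (\<lambda>x. \<phi> x *\<^sub>R pd b \<psi> x)" "integrable (lebesgue_on \<Omega>) (\<lambda>x. pd b \<phi> x *\<^sub>R \<psi> x)"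
      using test_local_integrable[OF \<Omega> \<phi> li(2)] test_local_integrable[OF \<Omega> test_pd[OF \<phi> b] li(1)] by auto
    ultimately show "(LINT x|lebesgue_on \<Omega>. iter_deriv [b] \<phi> x *\<^sub>R \<psi> x) =
        (-1) ^ length [b] *\<^sub>R (LINT x|lebesgue_on \<Omega>. \<phi> x *\<^sub>R pd b \<psi> x)"
      by (simp add: add_eq_0_iff2)
  qed
qed

lemma L2_bounded_linear:
  fixes f :: "'a::euclidean_space \<Rightarrow> 'b::euclidean_space" and L :: "'b \<Rightarrow> 'c::euclidean_space"
  assumes L: "bounded_linear L" and f: "f \<in> L2_space \<Omega>"
  shows "(\<lambda>x. L (f x)) \<in> L2_space \<Omega>"
proof -
  obtain K where K: "0 < K" "\<And>x. norm (L x) \<le> norm x * K" using bounded_linear.pos_bounded[OF L] by blast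
  have "L \<in> borel_measurable borel"
    using L by (intro borel_measurable_continuous_onI linear_continuous_on)
  then have "(\<lambda>x. L (f x)) \<in> borel_measurable (lebesgue_on \<Omega>)"
    using L2_measurable[OF f] by (rule measurable_compose[rotated])
  then show ?thesis using K by (intro L2_bounded_scale(1)[OF f, of _ K]) (auto simp: mult.commute)
qed

lemma Sobolev_weak_deriv_ex:
  "u \<in> Sobolev \<Omega> m \<Longrightarrow> set bs \<subseteq> Basis \<Longrightarrow> length bs \<le> m \<Longrightarrow> \<exists>g \<in> L2_space \<Omega>. is_weak_deriv \<Omega> bs u g"
  by (simp add: Sobolev_def dir_lists_def)

lemma SobolevI:
  "u \<in> L2_space \<Omega> \<Longrightarrow> (\<And>bs. set bs \<subseteq> Basis \<Longrightarrow> length bs \<le> m \<Longrightarrow> \<exists>g \<in> L2_space \<Omega>. is_weak_deriv \<Omega> bs u g)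
    \<Longrightarrow> u \<in> Sobolev \<Omega> m"
  by (simp add: Sobolev_def dir_lists_def)

lemma Sobolev_L2: "u \<in> Sobolev \<Omega> m \<Longrightarrow> u \<in> L2_space \<Omega>"
  by (simp add: Sobolev_def)

lemma subspace_Sobolev:
  assumes \<Omega>: "open \<Omega>"
  shows "subspace (Sobolev \<Omega> m :: ('a::euclidean_space \<Rightarrow> 'b::euclidean_space) set)"
proof (unfold subspace_def, intro conjI ballI allI)
  have "is_weak_deriv \<Omega> bs (0 :: 'a \<Rightarrow> 'b) 0" for bs
    by (auto simp: is_weak_deriv_def locally_integrable_def zero_fun_def)
  then show "0 \<in> (Sobolev \<Omega> m :: ('a \<Rightarrow> 'b) set)"
    by (intro SobolevI bexI[of _ 0] L2.H_0)
next
  fix u v :: "'a \<Rightarrow> 'b" assume u: "u \<in> Sobolev \<Omega> m" and v: "v \<in> Sobolev \<Omega> m"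
  show "u + v \<in> Sobolev \<Omega> m"
  proof (rule SobolevI)
    show "u + v \<in> L2_space \<Omega>" using u v by (intro L2.H_add Sobolev_L2)
    fix bs :: "'a list" assume bs: "set bs \<subseteq> Basis" "length bs \<le> m"
    obtain g where g: "g \<in> L2_space \<Omega>" "is_weak_deriv \<Omega> bs u g"
      using Sobolev_weak_deriv_ex[OF u bs] by (elim bexE)
    obtain g' where g': "g' \<in> L2_space \<Omega>" "is_weak_deriv \<Omega> bs v g'"
      using Sobolev_weak_deriv_ex[OF v bs] by (elim bexE)
    have "is_weak_deriv \<Omega> bs (u + v) (g + g')"
      using is_weak_deriv_add[OF \<Omega> bs(1) g(2) g'(2)] by (simp only: plus_fun_def)
    then show "\<exists>g \<in> L2_space \<Omega>. is_weak_deriv \<Omega> bs (u + v) g" using g g' by (intro bexI[of _ "g + g'"] L2.H_add)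
  qed
next
  fix c :: real and u :: "'a \<Rightarrow> 'b" assume u: "u \<in> Sobolev \<Omega> m"
  show "c *\<^sub>R u \<in> Sobolev \<Omega> m"
  proof (rule SobolevI)
    show "c *\<^sub>R u \<in> L2_space \<Omega>" using u by (intro L2.H_scale Sobolev_L2)
    fix bs :: "'a list" assume bs: "set bs \<subseteq> Basis" "length bs \<le> m"
    obtain g where g: "g \<in> L2_space \<Omega>" "is_weak_deriv \<Omega> bs u g"
      using Sobolev_weak_deriv_ex[OF u bs] by (elim bexE)
    have "is_weak_deriv \<Omega> bs (c *\<^sub>R u) (c *\<^sub>R g)"
      using is_weak_deriv_scale[OF g(2)] by (simp only: scaleR_fun_def)
    then show "\<exists>g \<in> L2_space \<Omega>. is_weak_deriv \<Omega> bs (c *\<^sub>R u) g" using g by (intro bexI[of _ "c *\<^sub>R g"] L2.H_scale)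
  qed
qed

lemma Sobolev_weak_deriv:
  assumes \<Omega>: "open \<Omega>" and u: "u \<in> Sobolev \<Omega> m" and bs: "set bs \<subseteq> Basis" "length bs \<le> m"
  shows "weak_deriv \<Omega> bs u \<in> L2_space \<Omega>" "is_weak_deriv \<Omega> bs u (weak_deriv \<Omega> bs u)"
proof -
  obtain g where "g \<in> L2_space \<Omega>" "is_weak_deriv \<Omega> bs u g"
    using Sobolev_weak_deriv_ex[OF u bs] by (elim bexE)
  then show "weak_deriv \<Omega> bs u \<in> L2_space \<Omega>" "is_weak_deriv \<Omega> bs u (weak_deriv \<Omega> bs u)"
    using weak_deriv_L2[OF \<Omega> bs(1)] weak_deriv_works by blast+
qed

lemma axis_Basis: "axis i (1::real) \<in> Basis"
  by (auto simp: Basis_vec_def)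

lemma Basis_axis: "(Basis :: (real ^ 'd) set) = range (\<lambda>i. axis i 1)"
  by (auto simp: Basis_vec_def)

lemma bounded_linear_axis: "bounded_linear (\<lambda>y :: 'b::euclidean_space. axis i y)"
proof (rule bounded_linear_intro[of _ 1])
  show "norm (axis i y) \<le> norm y * 1" for y :: 'b
    by (simp add: norm_vec_def L2_set_def axis_def if_distrib if_distribR sum.delta cong: if_cong)
qed (auto simp: axis_def vec_eq_iff)

lemma grad_sum: "grad \<Omega> u x = (\<Sum>i\<in>UNIV. axis i (weak_deriv \<Omega> [axis i 1] u x))"
  by (simp add: grad_def vec_eq_iff axis_def if_distrib sum.delta cong: if_cong)

context
  fixes \<Omega> :: "(real ^ 'd) set"
  assumes \<Omega>: "open \<Omega>"
begin

lemma partial_L2: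
  fixes u :: "real ^ 'd \<Rightarrow> 'b::euclidean_space"
  assumes "u \<in> Sobolev \<Omega> 1"
  shows "weak_deriv \<Omega> [axis i 1] u \<in> L2_space \<Omega>" "is_weak_deriv \<Omega> [axis i 1] u (weak_deriv \<Omega> [axis i 1] u)"
  using Sobolev_weak_deriv[OF \<Omega> assms, of "[axis i 1]"] axis_Basis by auto

lemma grad_L2:
  fixes u :: "real ^ 'd \<Rightarrow> 'b::euclidean_space"
  assumes u: "u \<in> Sobolev \<Omega> 1"
  shows "grad \<Omega> u \<in> L2_space \<Omega>"
proof -
  have "(\<Sum>i\<in>UNIV. (\<lambda>x. axis i (weak_deriv \<Omega> [axis i 1] u x))) \<in> L2_space \<Omega>"
    by (intro subspace_sum[OF subspace_L2] L2_bounded_linear[OF bounded_linear_axis] partial_L2(1)[OF u])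
  moreover have "(\<Sum>i\<in>UNIV. (\<lambda>x. axis i (weak_deriv \<Omega> [axis i 1] u x))) = grad \<Omega> u"
    by (simp add: fun_eq_iff sum_fun_apply grad_sum)
  ultimately show ?thesis by simp
qed

lemma grad_AE_I:
  fixes u :: "real ^ 'd \<Rightarrow> 'b::euclidean_space"
  assumes "\<And>i. is_weak_deriv \<Omega> [axis i 1] u (\<lambda>x. g x $ i)"
  shows "AE x in lebesgue_on \<Omega>. grad \<Omega> u x = g x"
proof -
  have "AE x in lebesgue_on \<Omega>. \<forall>i\<in>UNIV. weak_deriv \<Omega> [axis i 1] u x = g x $ i"
    using weak_deriv_AE[OF \<Omega> _ assms] axis_Basis by (intro AE_finite_allI) auto
  then show ?thesis by eventually_elim (simp add: grad_def vec_eq_iff)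
qed

lemma grad_add:
  fixes u v :: "real ^ 'd \<Rightarrow> 'b::euclidean_space"
  assumes "u \<in> Sobolev \<Omega> 1" "v \<in> Sobolev \<Omega> 1"
  shows "AE x in lebesgue_on \<Omega>. grad \<Omega> (u + v) x = grad \<Omega> u x + grad \<Omega> v x"
proof (rule grad_AE_I)
  fix i
  show "is_weak_deriv \<Omega> [axis i 1] (u + v) (\<lambda>x. (grad \<Omega> u x + grad \<Omega> v x) $ i)"
    using is_weak_deriv_add[OF \<Omega> _ partial_L2(2)[OF assms(1)] partial_L2(2)[OF assms(2)], of i] axis_Basis
    by (simp add: grad_def plus_fun_def)
qed

lemma grad_scale:
  fixes u :: "real ^ 'd \<Rightarrow> 'b::euclidean_space"
  assumes "u \<in> Sobolev \<Omega> 1"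
  shows "AE x in lebesgue_on \<Omega>. grad \<Omega> (c *\<^sub>R u) x = c *\<^sub>R grad \<Omega> u x"
proof (rule grad_AE_I)
  fix i
  show "is_weak_deriv \<Omega> [axis i 1] (c *\<^sub>R u) (\<lambda>x. (c *\<^sub>R grad \<Omega> u x) $ i)"
    using is_weak_deriv_scale[OF partial_L2(2)[OF assms]] by (simp add: grad_def scaleR_fun_def)
qed

lemma grad_inner_add:
  fixes u v w :: "real ^ 'd \<Rightarrow> 'b::euclidean_space"
  assumes "u \<in> Sobolev \<Omega> 1" "v \<in> Sobolev \<Omega> 1" and g: "g \<in> L2_space \<Omega>"
  shows "L2_inner \<Omega> (grad \<Omega> (u + v)) g = L2_inner \<Omega> (grad \<Omega> u) g + L2_inner \<Omega> (grad \<Omega> v) g"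
proof -
  note L = grad_L2[OF assms(1)] grad_L2[OF assms(2)] grad_L2[OF subspace_add[OF subspace_Sobolev[OF \<Omega>] assms(1,2)]]
  have "L2_inner \<Omega> (grad \<Omega> (u + v)) g = L2_inner \<Omega> (grad \<Omega> u + grad \<Omega> v) g"
    using grad_add[OF assms(1,2)] L g by (intro L2_inner_cong_AE L2_measurable L2.H_add) auto
  then show ?thesis using L g by (simp add: L2.ip_lin)
qed

lemma grad_inner_scale:
  fixes u v w :: "real ^ 'd \<Rightarrow> 'b::euclidean_space"
  assumes "u \<in> Sobolev \<Omega> 1" and g: "g \<in> L2_space \<Omega>"
  shows "L2_inner \<Omega> (grad \<Omega> (c *\<^sub>R u)) g = c * L2_inner \<Omega> (grad \<Omega> u) g"
proof -
  note L = grad_L2[OF assms(1)] grad_L2[OF subspace_scale[OF subspace_Sobolev[OF \<Omega>] assms(1)]]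
  have "L2_inner \<Omega> (grad \<Omega> (c *\<^sub>R u)) g = L2_inner \<Omega> (c *\<^sub>R grad \<Omega> u) g"
    using grad_scale[OF assms(1)] L g by (intro L2_inner_cong_AE L2_measurable L2.H_scale) auto
  then show ?thesis using L g by (simp add: L2.ip_lin)
qed

lemma semi_inner_grad:
  "semi_inner (Sobolev \<Omega> 1 :: (real ^ 'd \<Rightarrow> 'b::euclidean_space) set) (\<lambda>u v. L2_inner \<Omega> (grad \<Omega> u) (grad \<Omega> v))"
proof
  show "subspace (Sobolev \<Omega> 1 :: (real ^ 'd \<Rightarrow> 'b) set)" by (rule subspace_Sobolev[OF \<Omega>])
qed (auto simp: grad_inner_add grad_inner_scale grad_L2 L2.nonneg intro: L2.sym)

lemma test_grad:
  fixes \<phi> :: "real ^ 'd \<Rightarrow> 'b::euclidean_space"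
  assumes "\<phi> \<in> test_functions \<Omega>"
  shows "AE x in lebesgue_on \<Omega>. grad \<Omega> \<phi> x = (\<chi> i. pd (axis i 1) \<phi> x)"
  using test_weak_deriv[OF \<Omega> assms] axis_Basis by (intro grad_AE_I) simp

lemma test_Sobolev:
  fixes \<phi> :: "real ^ 'd \<Rightarrow> 'b::euclidean_space"
  assumes \<phi>: "\<phi> \<in> test_functions \<Omega>"
  shows "\<phi> \<in> Sobolev \<Omega> 1"
proof -
  show ?thesis
  proof (rule SobolevI[OF test_L2[OF \<Omega> \<phi>]])
    fix bs :: "(real ^ 'd) list" assume bs: "set bs \<subseteq> Basis" "length bs \<le> 1"
    show "\<exists>g \<in> L2_space \<Omega>. is_weak_deriv \<Omega> bs \<phi> g"
    proof (cases bs)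
      case Nil
      have "is_weak_deriv \<Omega> [] \<phi> \<phi>"
        using L2_locally_integrable[OF \<Omega> test_L2[OF \<Omega> \<phi>]] by (simp add: is_weak_deriv_def)
      then show ?thesis unfolding Nil using test_L2[OF \<Omega> \<phi>] by (intro bexI[of _ \<phi>])
    next
      case (Cons b bs')
      then have b: "bs = [b]" "b \<in> Basis" using bs by auto
      show ?thesis unfolding b(1)
        using test_weak_deriv[OF \<Omega> \<phi> b(2)] test_L2[OF \<Omega> test_pd[OF \<phi> b(2)]] by (intro bexI[of _ "pd b \<phi>"])
    qed
  qed
qed

lemma L2_norm_grad_sq:
  fixes u :: "real ^ 'd \<Rightarrow> 'b::euclidean_space"
  assumes "u \<in> Sobolev \<Omega> 1"
  shows "(L2_norm \<Omega> (grad \<Omega> u))\<^sup>2 = (\<Sum>i\<in>UNIV. (L2_norm \<Omega> (weak_deriv \<Omega> [axis i 1] u))\<^sup>2)"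
proof -
  have "(L2_norm \<Omega> (grad \<Omega> u))\<^sup>2 = (LINT x|lebesgue_on \<Omega>. (\<Sum>i\<in>UNIV. weak_deriv \<Omega> [axis i 1] u x \<bullet> weak_deriv \<Omega> [axis i 1] u x))"
    using grad_L2[OF assms] by (simp add: L2.nrm_sq) (simp add: L2_inner_def inner_vec_def grad_def)
  also have "\<dots> = (\<Sum>i\<in>UNIV. L2_inner \<Omega> (weak_deriv \<Omega> [axis i 1] u) (weak_deriv \<Omega> [axis i 1] u))"
    unfolding L2_inner_def using L2_inner_integrable[OF partial_L2(1)[OF assms] partial_L2(1)[OF assms]]
    by (intro Bochner_Integration.integral_sum) auto
  finally show ?thesis using partial_L2(1)[OF assms] by (simp add: L2.nrm_sq)
qed

lemma Sobolev_norm_1: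
  fixes u :: "real ^ 'd \<Rightarrow> 'b::euclidean_space"
  assumes u: "u \<in> Sobolev \<Omega> 1"
  shows "(Sobolev_norm \<Omega> 1 u)\<^sup>2 = (L2_norm \<Omega> u)\<^sup>2 + (L2_norm \<Omega> (grad \<Omega> u))\<^sup>2"
proof -
  have d0: "dir_lists 0 = {[] :: (real ^ 'd) list}" by (auto simp: dir_lists_def)
  have d1: "dir_lists 1 = (\<lambda>i. [axis i 1 :: real ^ 'd]) ` UNIV"
    unfolding dir_lists_def Basis_axis by (auto simp: length_Suc_conv)
  have w: "is_weak_deriv \<Omega> [] u u"
    using L2_locally_integrable[OF \<Omega> Sobolev_L2[OF u]] by (simp add: is_weak_deriv_def)
  \<comment> \<open>For the empty list \<open>weak_deriv\<close> is still a chosen representative,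
    so it agrees with \<open>u\<close> only almost everywhere.\<close>
  have "L2_norm \<Omega> (weak_deriv \<Omega> [] u) = L2_norm \<Omega> u"
    using weak_deriv_AE[OF \<Omega> _ w] weak_deriv_L2[OF \<Omega> _ w Sobolev_L2[OF u]] Sobolev_L2[OF u]
    by (intro L2_norm_cong_AE) (auto intro: L2_measurable)
  then have 0: "(Sobolev_seminorm \<Omega> 0 u)\<^sup>2 = (L2_norm \<Omega> u)\<^sup>2"
    by (simp add: Sobolev_seminorm_def d0)
  have "(Sobolev_seminorm \<Omega> 1 u)\<^sup>2 = (\<Sum>bs\<in>dir_lists 1. (L2_norm \<Omega> (weak_deriv \<Omega> bs u))\<^sup>2)"
    by (simp add: Sobolev_seminorm_def sum_nonneg)
  also have "\<dots> = (L2_norm \<Omega> (grad \<Omega> u))\<^sup>2"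
    unfolding L2_norm_grad_sq[OF u] d1
    by (subst sum.reindex) (auto simp: inj_on_def axis_eq_axis)
  finally show ?thesis using 0 by (simp add: Sobolev_norm_def)
qed

end

section \<open>The convective form\<close>

locale mhd_domain =
  fixes \<Omega> :: "(real ^ 'd) set" and Cs :: real
  assumes open_\<Omega>: "open \<Omega>" and bounded_\<Omega>: "bounded \<Omega>" and Cs_pos: "0 < Cs"
    and tri_bound_H10: "\<And>x y z. x \<in> H10 \<Omega> \<Longrightarrow> y \<in> H10 \<Omega> \<Longrightarrow> z \<in> H10 \<Omega> \<Longrightarrow>
           \<bar>trilinear \<Omega> x y z\<bar>
             \<le> Cs * L2_norm \<Omega> (grad \<Omega> x) * L2_norm \<Omega> (grad \<Omega> y) * L2_norm \<Omega> (grad \<Omega> z)"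
begin

sublocale S: semi_inner "Sobolev \<Omega> 1 :: 'd vector_field set" "\<lambda>u v. L2_inner \<Omega> (grad \<Omega> u) (grad \<Omega> v)"
  rewrites "semi_inner.nrm (\<lambda>u v :: 'd vector_field. L2_inner \<Omega> (grad \<Omega> u) (grad \<Omega> v)) = (\<lambda>u. L2_norm \<Omega> (grad \<Omega> u))"
proof -
  show si: "semi_inner (Sobolev \<Omega> 1 :: 'd vector_field set) (\<lambda>u v. L2_inner \<Omega> (grad \<Omega> u) (grad \<Omega> v))"
    by (rule semi_inner_grad[OF open_\<Omega>])
  show "semi_inner.nrm (\<lambda>u v :: 'd vector_field. L2_inner \<Omega> (grad \<Omega> u) (grad \<Omega> v)) = (\<lambda>u. L2_norm \<Omega> (grad \<Omega> u))"
    by (rule HOL.ext)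
      (simp only: semi_inner.nrm_def[OF si], simp only: L2_norm_def L2_inner_def power2_norm_eq_inner)
qed

lemma H10_Sobolev: "u \<in> H10 \<Omega> \<Longrightarrow> u \<in> Sobolev \<Omega> 1"
  and H10_L2: "u \<in> H10 \<Omega> \<Longrightarrow> u \<in> L2_space \<Omega>"
  unfolding H10_def by (auto intro: Sobolev_L2)

lemma test_S: "\<phi> \<in> test_functions \<Omega> \<Longrightarrow> \<phi> \<in> Sobolev \<Omega> 1"
  for \<phi> :: "'d vector_field"
  by (rule test_Sobolev[OF open_\<Omega>])

lemma H10_approx:
  assumes u: "u \<in> H10 \<Omega>" and e: "0 < e"
  obtains \<phi> where "\<phi> \<in> test_functions \<Omega>" "L2_norm \<Omega> (u - \<phi>) < e" "L2_norm \<Omega> (grad \<Omega> (u - \<phi>)) < e"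
proof -
  obtain \<phi> where \<phi>: "\<And>n. \<phi> n \<in> test_functions \<Omega>"
    "(\<lambda>n. Sobolev_norm \<Omega> 1 (\<lambda>x. u x - \<phi> n x)) \<longlonglongrightarrow> 0"
    using u unfolding H10_def by auto
  obtain n where n: "norm (Sobolev_norm \<Omega> 1 (\<lambda>x. u x - \<phi> n x) - 0) < e"
    using LIMSEQ_D[OF \<phi>(2) e] by blast
  have S: "u - \<phi> n \<in> Sobolev \<Omega> 1" by (intro S.H_diff test_S \<phi>(1) H10_Sobolev[OF u])
  have "(Sobolev_norm \<Omega> 1 (u - \<phi> n))\<^sup>2 < e\<^sup>2"
    using n e unfolding fun_diff_def by (simp add: abs_square_less_1 power2_strict_mono)
  then have *: "(L2_norm \<Omega> (u - \<phi> n))\<^sup>2 + (L2_norm \<Omega> (grad \<Omega> (u - \<phi> n)))\<^sup>2 < e\<^sup>2"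
    unfolding Sobolev_norm_1[OF open_\<Omega> S] .
  then have "(L2_norm \<Omega> (u - \<phi> n))\<^sup>2 < e\<^sup>2" "(L2_norm \<Omega> (grad \<Omega> (u - \<phi> n)))\<^sup>2 < e\<^sup>2"
    using zero_le_power2[of "L2_norm \<Omega> (u - \<phi> n)"] zero_le_power2[of "L2_norm \<Omega> (grad \<Omega> (u - \<phi> n))"]
    by linarith+
  then have "L2_norm \<Omega> (u - \<phi> n) < e" "L2_norm \<Omega> (grad \<Omega> (u - \<phi> n)) < e"
    using e by (auto intro: power2_less_imp_less)
  then show ?thesis using that \<phi>(1) by blast
qed

lemma H10I:
  assumes u: "u \<in> Sobolev \<Omega> 1"
    and \<phi>: "\<And>e. 0 < e \<Longrightarrow> \<exists>\<phi>\<in>test_functions \<Omega>. L2_norm \<Omega> (u - \<phi>) \<le> e \<and> L2_norm \<Omega> (grad \<Omega> (u - \<phi>)) \<le> e"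
  shows "u \<in> H10 \<Omega>"
proof -
  have "\<forall>n. \<exists>\<phi>. \<phi> \<in> test_functions \<Omega> \<and> L2_norm \<Omega> (u - \<phi>) \<le> inverse (real (Suc n)) \<and> L2_norm \<Omega> (grad \<Omega> (u - \<phi>)) \<le> inverse (real (Suc n))"
    using \<phi> by (intro allI) (metis inverse_positive_iff_positive of_nat_0_less_iff zero_less_Suc)
  then obtain \<phi> where \<phi>: "\<And>n. \<phi> n \<in> test_functions \<Omega>" "\<And>n. L2_norm \<Omega> (u - \<phi> n) \<le> inverse (real (Suc n))"
     "\<And>n. L2_norm \<Omega> (grad \<Omega> (u - \<phi> n)) \<le> inverse (real (Suc n))"
    by metis
  have "(\<lambda>n. Sobolev_norm \<Omega> 1 (u - \<phi> n)) \<longlonglongrightarrow> 0"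
  proof (rule tendsto_sandwich[OF _ _ tendsto_const])
    have 0: "0 \<le> Sobolev_norm \<Omega> 1 (u - \<phi> n)" for n
      unfolding Sobolev_norm_def by (simp add: sum_nonneg)
    then show "\<forall>\<^sub>F n in sequentially. 0 \<le> Sobolev_norm \<Omega> 1 (u - \<phi> n)" by simp
    show "\<forall>\<^sub>F n in sequentially. Sobolev_norm \<Omega> 1 (u - \<phi> n) \<le> 2 * inverse (real (Suc n))"
    proof (intro always_eventually allI)
      fix n
      have S: "u - \<phi> n \<in> Sobolev \<Omega> 1" by (intro S.H_diff test_S \<phi>(1) u)
      have nn: "0 \<le> L2_norm \<Omega> (u - \<phi> n)" "0 \<le> L2_norm \<Omega> (grad \<Omega> (u - \<phi> n))"
        using S.nrm_ge_0[OF S] L2.nrm_ge_0[OF Sobolev_L2[OF S]] by auto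
      have "(Sobolev_norm \<Omega> 1 (u - \<phi> n))\<^sup>2 \<le> (inverse (real (Suc n)))\<^sup>2 + (inverse (real (Suc n)))\<^sup>2"
        unfolding Sobolev_norm_1[OF open_\<Omega> S] using nn \<phi>(2,3) by (intro add_mono power_mono)
      also have "\<dots> \<le> (2 * inverse (real (Suc n)))\<^sup>2" by (simp add: power2_eq_square)
      finally show "Sobolev_norm \<Omega> 1 (u - \<phi> n) \<le> 2 * inverse (real (Suc n))"
        by (rule power2_le_imp_le) simp
    qed
    show "(\<lambda>n. 2 * inverse (real (Suc n))) \<longlonglongrightarrow> 0"
      using tendsto_mult[OF tendsto_const LIMSEQ_inverse_real_of_nat, of 2] by simp
  qed
  then have "\<exists>\<phi>. (\<forall>n. \<phi> n \<in> test_functions \<Omega>) \<and> (\<lambda>n. Sobolev_norm \<Omega> 1 (\<lambda>x. u x - \<phi> n x)) \<longlonglongrightarrow> 0"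
    using \<phi>(1) unfolding fun_diff_def by blast
  then show ?thesis using u unfolding H10_def by simp
qed

lemma test_H10:
  assumes \<phi>: "\<phi> \<in> test_functions \<Omega>" shows "\<phi> \<in> H10 \<Omega>"
proof (rule H10I[OF test_S[OF \<phi>]])
  fix e :: real assume "0 < e"
  then show "\<exists>\<psi>\<in>test_functions \<Omega>. L2_norm \<Omega> (\<phi> - \<psi>) \<le> e \<and> L2_norm \<Omega> (grad \<Omega> (\<phi> - \<psi>)) \<le> e"
    using \<phi> by (intro bexI[of _ \<phi>]) auto
qed

lemma subspace_H10: "subspace (H10 \<Omega>)"
proof (unfold subspace_def, intro conjI ballI allI)
  show "0 \<in> H10 \<Omega>" using test_H10[OF test_zero] by (simp add: zero_fun_def)
next
  fix u v assume u: "u \<in> H10 \<Omega>" and v: "v \<in> H10 \<Omega>"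
  note S = H10_Sobolev[OF u] H10_Sobolev[OF v]
  show "u + v \<in> H10 \<Omega>"
  proof (rule H10I)
    show "u + v \<in> Sobolev \<Omega> 1" by (intro S.H_add S)
    fix e :: real assume e: "0 < e"
    obtain \<phi> where \<phi>: "\<phi> \<in> test_functions \<Omega>" "L2_norm \<Omega> (u - \<phi>) < e / 2" "L2_norm \<Omega> (grad \<Omega> (u - \<phi>)) < e / 2"
      using H10_approx[OF u, of "e / 2"] e by auto
    obtain \<psi> where \<psi>: "\<psi> \<in> test_functions \<Omega>" "L2_norm \<Omega> (v - \<psi>) < e / 2" "L2_norm \<Omega> (grad \<Omega> (v - \<psi>)) < e / 2"
      using H10_approx[OF v, of "e / 2"] e by auto
    have S': "u - \<phi> \<in> Sobolev \<Omega> 1" "v - \<psi> \<in> Sobolev \<Omega> 1" by (intro S.H_diff S test_S \<phi>(1) \<psi>(1))+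
    have eq: "u + v - (\<phi> + \<psi>) = (u - \<phi>) + (v - \<psi>)" by simp
    have "L2_norm \<Omega> (u + v - (\<phi> + \<psi>)) \<le> e"
      unfolding eq using L2.nrm_triangle[OF Sobolev_L2[OF S'(1)] Sobolev_L2[OF S'(2)]] \<phi> \<psi> by linarith
    moreover have "L2_norm \<Omega> (grad \<Omega> (u + v - (\<phi> + \<psi>))) \<le> e"
      unfolding eq using S.nrm_triangle[OF S'] \<phi> \<psi> by linarith
    moreover have "\<phi> + \<psi> \<in> test_functions \<Omega>"
      using test_add[OF \<phi>(1) \<psi>(1)] by (simp add: plus_fun_def)
    ultimately show "\<exists>\<phi>\<in>test_functions \<Omega>. L2_norm \<Omega> (u + v - \<phi>) \<le> e \<and> L2_norm \<Omega> (grad \<Omega> (u + v - \<phi>)) \<le> e"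
      by blast
  qed
next
  fix c and u assume u: "u \<in> H10 \<Omega>"
  note S = H10_Sobolev[OF u]
  show "c *\<^sub>R u \<in> H10 \<Omega>"
  proof (rule H10I)
    show "c *\<^sub>R u \<in> Sobolev \<Omega> 1" by (intro S.H_scale S)
    fix e :: real assume e: "0 < e"
    then have e': "0 < e / (\<bar>c\<bar> + 1)" by simp
    obtain \<phi> where \<phi>: "\<phi> \<in> test_functions \<Omega>" "L2_norm \<Omega> (u - \<phi>) < e / (\<bar>c\<bar> + 1)"
        "L2_norm \<Omega> (grad \<Omega> (u - \<phi>)) < e / (\<bar>c\<bar> + 1)"
      using H10_approx[OF u e'] by auto
    have S': "u - \<phi> \<in> Sobolev \<Omega> 1" by (intro S.H_diff S test_S \<phi>(1))
    have eq: "c *\<^sub>R u - c *\<^sub>R \<phi> = c *\<^sub>R (u - \<phi>)" by (simp add: scaleR_diff_right)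
    have ce: "\<bar>c\<bar> * x \<le> e" if "x < e / (\<bar>c\<bar> + 1)" "0 \<le> x" for x
    proof -
      have "\<bar>c\<bar> * x \<le> (\<bar>c\<bar> + 1) * x" using that by (simp add: distrib_right)
      also have "\<dots> \<le> e" using that by (simp add: field_simps)
      finally show ?thesis .
    qed
    have "L2_norm \<Omega> (c *\<^sub>R u - c *\<^sub>R \<phi>) \<le> e"
      unfolding eq using ce[OF \<phi>(2)] L2.nrm_scale[OF Sobolev_L2[OF S']] L2.nrm_ge_0[OF Sobolev_L2[OF S']] by simp
    moreover have "L2_norm \<Omega> (grad \<Omega> (c *\<^sub>R u - c *\<^sub>R \<phi>)) \<le> e"
      unfolding eq using ce[OF \<phi>(3)] S.nrm_scale[OF S'] S.nrm_ge_0[OF S'] by simp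
    moreover have "c *\<^sub>R \<phi> \<in> test_functions \<Omega>"
      using test_scaleR[OF \<phi>(1)] by (simp add: scaleR_fun_def)
    ultimately show "\<exists>\<phi>\<in>test_functions \<Omega>. L2_norm \<Omega> (c *\<^sub>R u - \<phi>) \<le> e \<and> L2_norm \<Omega> (grad \<Omega> (c *\<^sub>R u - \<phi>)) \<le> e"
      by blast
  qed
qed

lemma norm_sum_scale_le: "norm (\<Sum>i\<in>UNIV. (u $ i) *\<^sub>R (g $ i)) \<le> norm u * norm g"
  for u :: "real ^ 'd" and g :: "'b::euclidean_space ^ 'd"
proof -
  have "norm (\<Sum>i\<in>UNIV. (u $ i) *\<^sub>R (g $ i)) \<le> (\<Sum>i\<in>UNIV. \<bar>u $ i\<bar> * \<bar>norm (g $ i)\<bar>)"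
    by (rule order_trans[OF norm_sum]) simp
  also have "\<dots> \<le> L2_set (\<lambda>i. u $ i) UNIV * L2_set (\<lambda>i. norm (g $ i)) UNIV"
    by (rule L2_set_mult_ineq)
  also have "\<dots> = norm u * norm g"
    by (simp add: norm_vec_def L2_set_def)
  finally show ?thesis .
qed

definition conv :: "'d vector_field \<Rightarrow> 'd vector_field \<Rightarrow> 'd vector_field" where
  "conv u v x = (\<Sum>i\<in>UNIV. (u x $ i) *\<^sub>R (grad \<Omega> v x $ i))"

lemma trilinear_conv: "trilinear \<Omega> u v w = L2_inner \<Omega> (conv u v) w"
  by (simp add: trilinear_def conv_def[abs_def])

lemma norm_conv_le: "norm (conv u v x) \<le> norm (u x) * norm (grad \<Omega> v x)"
  unfolding conv_def by (rule norm_sum_scale_le)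

lemma conv_measurable:
  assumes u: "u \<in> borel_measurable (lebesgue_on \<Omega>)" and v: "v \<in> Sobolev \<Omega> 1"
  shows "conv u v \<in> borel_measurable (lebesgue_on \<Omega>)"
proof -
  have "(\<lambda>x. u x $ i) \<in> borel_measurable (lebesgue_on \<Omega>)" for i
    using u by (rule measurable_compose[OF _ borel_measurable_continuous_onI]) (intro continuous_intros)
  moreover have "(\<lambda>x. grad \<Omega> v x $ i) \<in> borel_measurable (lebesgue_on \<Omega>)" for i
    using L2_measurable[OF partial_L2(1)[OF open_\<Omega> v]] by (simp add: grad_def)
  ultimately show ?thesis unfolding conv_def[abs_def]
    by (intro borel_measurable_sum borel_measurable_scaleR)
qed

text \<open>The third arguments for which \<open>trilinear\<close> is a genuine integral: the
  convective term is a product of two L2 functions, hence integrable, and a bounded factor keeps it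
  so.\<close>

definition ae_bounded :: "'d vector_field \<Rightarrow> bool" where
  "ae_bounded w \<longleftrightarrow> (\<exists>C. AE x in lebesgue_on \<Omega>. norm (w x) \<le> C)"

lemma tri_integrable:
  assumes u: "u \<in> L2_space \<Omega>" and v: "v \<in> Sobolev \<Omega> 1" and w: "w \<in> L2_space \<Omega>" "ae_bounded w"
  shows "integrable (lebesgue_on \<Omega>) (\<lambda>x. conv u v x \<bullet> w x)"
proof -
  obtain C where C: "AE x in lebesgue_on \<Omega>. norm (w x) \<le> C" using w unfolding ae_bounded_def by blast
  show ?thesis
  proof (rule Bochner_Integration.integrable_bound)
    show "integrable (lebesgue_on \<Omega>) (\<lambda>x. \<bar>C\<bar> * (norm (u x) * norm (grad \<Omega> v x)))"
      using L2_prod_integrable[OF u grad_L2[OF open_\<Omega> v]] by simp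
    show "(\<lambda>x. conv u v x \<bullet> w x) \<in> borel_measurable (lebesgue_on \<Omega>)"
      using conv_measurable[OF L2_measurable[OF u] v] L2_measurable[OF w(1)] by measurable
    show "AE x in lebesgue_on \<Omega>. norm (conv u v x \<bullet> w x) \<le> norm (\<bar>C\<bar> * (norm (u x) * norm (grad \<Omega> v x)))"
      using C
    proof eventually_elim
      case (elim x)
      have "norm (conv u v x \<bullet> w x) \<le> norm (conv u v x) * norm (w x)"
        using Cauchy_Schwarz_ineq2 by simp
      also have "\<dots> \<le> (norm (u x) * norm (grad \<Omega> v x)) * \<bar>C\<bar>"
        using elim norm_conv_le by (intro mult_mono) auto
      finally show ?case by (simp add: mult.commute)
    qed
  qed
qed

lemma tri_cong:
  assumes "u \<in> L2_space \<Omega>" "v \<in> Sobolev \<Omega> 1" "w \<in> L2_space \<Omega>"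
    and f: "f \<in> borel_measurable (lebesgue_on \<Omega>)" "AE x in lebesgue_on \<Omega>. conv u v x \<bullet> w x = f x"
  shows "trilinear \<Omega> u v w = (LINT x|lebesgue_on \<Omega>. f x)"
  unfolding trilinear_conv L2_inner_def
  using conv_measurable[OF L2_measurable[OF assms(1)] assms(2)] L2_measurable[OF assms(3)] f
  by (intro integral_cong_AE) auto

lemma tri_add1:
  assumes u: "u \<in> L2_space \<Omega>" "u' \<in> L2_space \<Omega>" and v: "v \<in> Sobolev \<Omega> 1" and w: "w \<in> L2_space \<Omega>" "ae_bounded w"
  shows "trilinear \<Omega> (u + u') v w = trilinear \<Omega> u v w + trilinear \<Omega> u' v w"
  unfolding trilinear_conv L2_inner_def
  using tri_integrable[OF u(1) v w] tri_integrable[OF u(2) v w]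
  by (simp add: conv_def scaleR_add_left sum.distrib inner_add_left)

lemma tri_scale1:
  "trilinear \<Omega> (c *\<^sub>R u) v w = c * trilinear \<Omega> u v w"
proof -
  have "conv (c *\<^sub>R u) v x \<bullet> w x = c * (conv u v x \<bullet> w x)" for x
    by (simp add: conv_def inner_sum_left sum_distrib_left mult.assoc)
  then show ?thesis by (simp add: trilinear_conv L2_inner_def)
qed

lemma tri_add2:
  assumes u: "u \<in> L2_space \<Omega>" and v: "v \<in> Sobolev \<Omega> 1" "v' \<in> Sobolev \<Omega> 1" and w: "w \<in> L2_space \<Omega>" "ae_bounded w"
  shows "trilinear \<Omega> u (v + v') w = trilinear \<Omega> u v w + trilinear \<Omega> u v' w"
proof -
  have "trilinear \<Omega> u (v + v') w = (LINT x|lebesgue_on \<Omega>. conv u v x \<bullet> w x + conv u v' x \<bullet> w x)"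
  proof (rule tri_cong[OF u _ w(1)])
    show "v + v' \<in> Sobolev \<Omega> 1" by (intro S.H_add v)
    show "(\<lambda>x. conv u v x \<bullet> w x + conv u v' x \<bullet> w x) \<in> borel_measurable (lebesgue_on \<Omega>)"
      using tri_integrable[OF u v(1) w] tri_integrable[OF u v(2) w] by auto
    show "AE x in lebesgue_on \<Omega>. conv u (v + v') x \<bullet> w x = conv u v x \<bullet> w x + conv u v' x \<bullet> w x"
      using grad_add[OF open_\<Omega> v]
      by eventually_elim (simp add: conv_def scaleR_add_right sum.distrib inner_add_left)
  qed
  then show ?thesis using tri_integrable[OF u v(1) w] tri_integrable[OF u v(2) w]
    by (simp add: trilinear_conv L2_inner_def)
qed

lemma tri_scale2:
  assumes u: "u \<in> L2_space \<Omega>" and v: "v \<in> Sobolev \<Omega> 1" and w: "w \<in> L2_space \<Omega>" "ae_bounded w"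
  shows "trilinear \<Omega> u (c *\<^sub>R v) w = c * trilinear \<Omega> u v w"
proof -
  have "trilinear \<Omega> u (c *\<^sub>R v) w = (LINT x|lebesgue_on \<Omega>. c * (conv u v x \<bullet> w x))"
  proof (rule tri_cong[OF u _ w(1)])
    show "c *\<^sub>R v \<in> Sobolev \<Omega> 1" by (intro S.H_scale v)
    show "(\<lambda>x. c * (conv u v x \<bullet> w x)) \<in> borel_measurable (lebesgue_on \<Omega>)"
      using tri_integrable[OF u v w] by auto
    show "AE x in lebesgue_on \<Omega>. conv u (c *\<^sub>R v) x \<bullet> w x = c * (conv u v x \<bullet> w x)"
      using grad_scale[OF open_\<Omega> v, of c]
      by eventually_elim (simp add: conv_def inner_sum_left sum_distrib_left mult_ac)
  qed
  then show ?thesis by (simp add: trilinear_conv L2_inner_def)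
qed

lemma tri_add3:
  assumes u: "u \<in> L2_space \<Omega>" and v: "v \<in> Sobolev \<Omega> 1" and w: "w \<in> L2_space \<Omega>" "ae_bounded w" "w' \<in> L2_space \<Omega>" "ae_bounded w'"
  shows "trilinear \<Omega> u v (w + w') = trilinear \<Omega> u v w + trilinear \<Omega> u v w'"
  unfolding trilinear_conv L2_inner_def
  using tri_integrable[OF u v w(1,2)] tri_integrable[OF u v w(3,4)]
  by (simp add: inner_add_right)

end

section \<open>Skew symmetry and the Poincare inequality\<close>

context mhd_domain
begin

definition H1b :: "'d vector_field set" where "H1b = {w \<in> H10 \<Omega>. ae_bounded w}"
definition Hdiv :: "'d vector_field set" where "Hdiv = {w \<in> H10 \<Omega>. div_free \<Omega> w}"

lemma H1bD: "w \<in> H1b \<Longrightarrow> w \<in> H10 \<Omega>" "w \<in> H1b \<Longrightarrow> ae_bounded w" "w \<in> H1b \<Longrightarrow> w \<in> L2_space \<Omega>"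
  "w \<in> H1b \<Longrightarrow> w \<in> Sobolev \<Omega> 1"
  unfolding H1b_def using H10_L2 H10_Sobolev by auto

lemma test_H1b: "\<phi> \<in> test_functions \<Omega> \<Longrightarrow> \<phi> \<in> H1b"
  unfolding H1b_def ae_bounded_def using test_H10 test_bounded by (metis (mono_tags, lifting) AE_I2 mem_Collect_eq)

lemma subspace_H1b: "subspace H1b"
proof (unfold subspace_def, intro conjI ballI allI)
  show "0 \<in> H1b" using test_H1b[OF test_zero] by (simp add: zero_fun_def)
next
  fix u v assume u: "u \<in> H1b" and v: "v \<in> H1b"
  obtain C C' where "AE x in lebesgue_on \<Omega>. norm (u x) \<le> C" "AE x in lebesgue_on \<Omega>. norm (v x) \<le> C'"
    using H1bD(2)[OF u] H1bD(2)[OF v] unfolding ae_bounded_def by auto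
  then have "AE x in lebesgue_on \<Omega>. norm ((u + v) x) \<le> C + C'"
    by eventually_elim (simp add: norm_triangle_mono)
  then show "u + v \<in> H1b" unfolding H1b_def ae_bounded_def
    using subspace_add[OF subspace_H10 H1bD(1)[OF u] H1bD(1)[OF v]] by blast
next
  fix c u assume u: "u \<in> H1b"
  obtain C where "AE x in lebesgue_on \<Omega>. norm (u x) \<le> C"
    using H1bD(2)[OF u] unfolding ae_bounded_def by auto
  then have "AE x in lebesgue_on \<Omega>. norm ((c *\<^sub>R u) x) \<le> \<bar>c\<bar> * C"
    by eventually_elim (simp add: mult_left_mono)
  then show "c *\<^sub>R u \<in> H1b" unfolding H1b_def ae_bounded_def
    using subspace_scale[OF subspace_H10 H1bD(1)[OF u]] by blast
qed

text \<open>The sum is the integral of u against the gradient of the scalar \<open>\<rho>\<close>,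
  the inner product of both fields. As \<open>\<rho>\<close> is a test function, the weak
  derivatives of u turn this into minus the integral of \<open>\<rho>\<close> times the divergence
  of u.\<close>

lemma tri_test_skew:
  assumes u: "u \<in> Hdiv" and \<phi>: "\<phi> \<in> test_functions \<Omega>" and \<psi>: "\<psi> \<in> test_functions \<Omega>"
  shows "trilinear \<Omega> u \<phi> \<psi> + trilinear \<Omega> u \<psi> \<phi> = 0"
proof -
  have uH: "u \<in> H10 \<Omega>" "div_free \<Omega> u" using u by (auto simp: Hdiv_def)
  note uL = H10_L2[OF uH(1)] and uS = H10_Sobolev[OF uH(1)]
  define \<rho> where "\<rho> = (\<lambda>x. \<phi> x \<bullet> \<psi> x)"
  have comp: "(\<lambda>x. f x $ c) \<in> test_functions \<Omega>" if "f \<in> test_functions \<Omega>" for f :: "'d vector_field" and c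
    using test_bounded_linear[OF bounded_linear_vec_nth that] .
  have "(\<lambda>x. \<Sum>c\<in>UNIV. \<phi> x $ c * \<psi> x $ c) \<in> test_functions \<Omega>"
    by (intro test_sum test_mult comp \<phi> test_smooth[OF comp[OF \<psi>]])
  then have \<rho>: "\<rho> \<in> test_functions \<Omega>" by (simp add: \<rho>_def inner_vec_def)
  have pd\<rho>: "pd b \<rho> = (\<lambda>x. \<phi> x \<bullet> pd b \<psi> x + pd b \<phi> x \<bullet> \<psi> x)" for b
    unfolding \<rho>_def
    by (rule pd_eqI, rule has_derivative_inner)
       (rule smooth_has_derivative[OF test_smooth[OF \<phi>]] smooth_has_derivative[OF test_smooth[OF \<psi>]])+
  have int1: "integrable (lebesgue_on \<Omega>) (\<lambda>x. \<rho> x *\<^sub>R weak_deriv \<Omega> [axis i 1] u x)" for i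
    by (rule test_local_integrable[OF open_\<Omega> \<rho> L2_locally_integrable[OF open_\<Omega> partial_L2(1)[OF open_\<Omega> uS]]])
  have int2: "integrable (lebesgue_on \<Omega>) (\<lambda>x. pd (axis i 1) \<rho> x *\<^sub>R u x)" for i
    by (rule test_local_integrable[OF open_\<Omega> test_pd[OF \<rho> axis_Basis] L2_locally_integrable[OF open_\<Omega> uL]])
  have comp_int: "integrable M (\<lambda>x. f x $ i)" "(LINT x|M. f x $ i) = (LINT x|M. f x) $ i" if "integrable M f"
    for f :: "'d vector_field" and i and M :: "(real ^ 'd) measure"
    using integrable_bounded_linear[OF bounded_linear_vec_nth that] integral_bounded_linear[OF bounded_linear_vec_nth that] by auto
  have w: "(LINT x|lebesgue_on \<Omega>. pd (axis i 1) \<rho> x * u x $ i) = - (LINT x|lebesgue_on \<Omega>. \<rho> x * weak_deriv \<Omega> [axis i 1] u x $ i)" for i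
  proof -
    have "(LINT x|lebesgue_on \<Omega>. pd (axis i 1) \<rho> x *\<^sub>R u x) = - (LINT x|lebesgue_on \<Omega>. \<rho> x *\<^sub>R weak_deriv \<Omega> [axis i 1] u x)"
      using partial_L2(2)[OF open_\<Omega> uS, of i] \<rho> unfolding is_weak_deriv_def by simp
    then have "(LINT x|lebesgue_on \<Omega>. pd (axis i 1) \<rho> x *\<^sub>R u x) $ i = - (LINT x|lebesgue_on \<Omega>. \<rho> x *\<^sub>R weak_deriv \<Omega> [axis i 1] u x) $ i"
      by simp
    then show ?thesis unfolding comp_int(2)[OF int1, symmetric] comp_int(2)[OF int2, symmetric] by simp
  qed
  have "trilinear \<Omega> u \<phi> \<psi> + trilinear \<Omega> u \<psi> \<phi>
      = (LINT x|lebesgue_on \<Omega>. conv u \<phi> x \<bullet> \<psi> x + conv u \<psi> x \<bullet> \<phi> x)"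
    unfolding trilinear_conv L2_inner_def
    using tri_integrable[OF uL test_S[OF \<phi>] H1bD(3,2)[OF test_H1b[OF \<psi>]]]
      tri_integrable[OF uL test_S[OF \<psi>] H1bD(3,2)[OF test_H1b[OF \<phi>]]] by simp
  also have "\<dots> = (LINT x|lebesgue_on \<Omega>. (\<Sum>i\<in>UNIV. pd (axis i 1) \<rho> x * u x $ i))"
  proof (rule integral_cong_AE)
    show "AE x in lebesgue_on \<Omega>. conv u \<phi> x \<bullet> \<psi> x + conv u \<psi> x \<bullet> \<phi> x = (\<Sum>i\<in>UNIV. pd (axis i 1) \<rho> x * u x $ i)"
      using test_grad[OF open_\<Omega> \<phi>] test_grad[OF open_\<Omega> \<psi>]
    proof eventually_elim
      case (elim x)
      have "conv u \<phi> x \<bullet> \<psi> x + conv u \<psi> x \<bullet> \<phi> x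
          = (\<Sum>i\<in>UNIV. u x $ i * (pd (axis i 1) \<phi> x \<bullet> \<psi> x) + u x $ i * (pd (axis i 1) \<psi> x \<bullet> \<phi> x))"
        using elim by (simp add: conv_def inner_sum_left sum.distrib)
      also have "\<dots> = (\<Sum>i\<in>UNIV. pd (axis i 1) \<rho> x * u x $ i)"
        using fun_cong[OF pd\<rho>, where x = x]
        by (intro sum.cong refl) (simp add: algebra_simps inner_commute[of "\<phi> x"])
      finally show ?case .
    qed
    show "(\<lambda>x. conv u \<phi> x \<bullet> \<psi> x + conv u \<psi> x \<bullet> \<phi> x) \<in> borel_measurable (lebesgue_on \<Omega>)"
      using tri_integrable[OF uL test_S[OF \<phi>] H1bD(3,2)[OF test_H1b[OF \<psi>]]]
        tri_integrable[OF uL test_S[OF \<psi>] H1bD(3,2)[OF test_H1b[OF \<phi>]]] by auto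
    show "(\<lambda>x. \<Sum>i\<in>UNIV. pd (axis i 1) \<rho> x * u x $ i) \<in> borel_measurable (lebesgue_on \<Omega>)"
      using comp_int(1)[OF int2] by (intro borel_measurable_sum) auto
  qed
  also have "\<dots> = (\<Sum>i\<in>UNIV. LINT x|lebesgue_on \<Omega>. pd (axis i 1) \<rho> x * u x $ i)"
    using comp_int(1)[OF int2] by (intro Bochner_Integration.integral_sum) simp
  also have "\<dots> = - (\<Sum>i\<in>UNIV. LINT x|lebesgue_on \<Omega>. \<rho> x * weak_deriv \<Omega> [axis i 1] u x $ i)"
    unfolding w by (simp add: sum_negf)
  also have "(\<Sum>i\<in>UNIV. LINT x|lebesgue_on \<Omega>. \<rho> x * weak_deriv \<Omega> [axis i 1] u x $ i)
      = (LINT x|lebesgue_on \<Omega>. (\<Sum>i\<in>UNIV. \<rho> x * weak_deriv \<Omega> [axis i 1] u x $ i))"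
    using comp_int(1)[OF int1] by (intro Bochner_Integration.integral_sum[symmetric]) simp
  also have "\<dots> = (LINT x|lebesgue_on \<Omega>. 0)"
  proof (rule integral_cong_AE)
    show "AE x in lebesgue_on \<Omega>. (\<Sum>i\<in>UNIV. \<rho> x * weak_deriv \<Omega> [axis i 1] u x $ i) = 0"
      using uH(2) unfolding div_free_def
      by eventually_elim (simp add: divergence_def grad_def flip: sum_distrib_left)
    show "(\<lambda>x. \<Sum>i\<in>UNIV. \<rho> x * weak_deriv \<Omega> [axis i 1] u x $ i) \<in> borel_measurable (lebesgue_on \<Omega>)"
      using comp_int(1)[OF int1] by (intro borel_measurable_sum) auto
  qed simp
  finally show ?thesis by simp
qed

text \<open>Density of test functions, used for one argument at a time: the defect \<open>g\<close>
  is linear in each argument and bounded in the H1 seminorms on \<open>H1b\<close>, and it vanishes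
  on pairs of test functions. Both fields are taken in \<open>H1b\<close> because each of them
  stands last in one of the two forms.\<close>

lemma tri_skew:
  assumes u: "u \<in> Hdiv" and v: "v \<in> H1b" and w: "w \<in> H1b"
  shows "trilinear \<Omega> u v w = - trilinear \<Omega> u w v"
proof -
  have uH: "u \<in> H10 \<Omega>" using u by (auto simp: Hdiv_def)
  note uL = H10_L2[OF uH]
  let ?b = "trilinear \<Omega> u" and ?n = "\<lambda>x. L2_norm \<Omega> (grad \<Omega> x)"
  define A where "A = Cs * ?n u"
  have A: "0 \<le> A" unfolding A_def using Cs_pos S.nrm_ge_0[OF H10_Sobolev[OF uH]] by simp
  have bd: "\<bar>?b x y\<bar> \<le> A * ?n x * ?n y" if "x \<in> H1b" "y \<in> H1b" for x y
    unfolding A_def using tri_bound_H10[OF uH H1bD(1)[OF that(1)] H1bD(1)[OF that(2)]] .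
  have lin2: "?b (x - y) z = ?b x z - ?b y z" if "x \<in> H1b" "y \<in> H1b" "z \<in> H1b" for x y z
    using tri_add2[OF uL _ _ H1bD(3,2)[OF that(3)], of "x - y" y] S.H_diff H1bD(4)[OF that(1)] H1bD(4)[OF that(2)] by simp
  have lin3: "?b z (x - y) = ?b z x - ?b z y" if "x \<in> H1b" "y \<in> H1b" "z \<in> H1b" for x y z
    using tri_add3[OF uL H1bD(4)[OF that(3)], of "x - y" y] H1bD(2,3)[OF subspace_diff[OF subspace_H1b that(1,2)]]
      H1bD(2,3)[OF that(2)] by simp
  define g where "g x y = ?b x y + ?b y x" for x y
  have g_bd: "\<bar>g x y\<bar> \<le> 2 * A * ?n x * ?n y" if "x \<in> H1b" "y \<in> H1b" for x y
    using bd[OF that] bd[OF that(2,1)] unfolding g_def by (simp add: mult_ac)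
  have g1: "g (x - y) z = g x z - g y z" if "x \<in> H1b" "y \<in> H1b" "z \<in> H1b" for x y z
    unfolding g_def using lin2[OF that] lin3[OF that] by simp
  have g_test: "g \<phi> \<psi> = 0" if "\<phi> \<in> test_functions \<Omega>" "\<psi> \<in> test_functions \<Omega>" for \<phi> \<psi>
    unfolding g_def by (rule tri_test_skew[OF u that])
  have zero: "x = 0" if "\<And>e. 0 < e \<Longrightarrow> \<bar>x\<bar> \<le> B * e" "0 \<le> B" for x B :: real
  proof (rule ccontr)
    assume "x \<noteq> 0"
    then have "0 < \<bar>x\<bar> / (2 * (B + 1))" using that by simp
    from that(1)[OF this] have "\<bar>x\<bar> * (2 * (B + 1)) \<le> B * \<bar>x\<bar>" using that(2) by (simp add: field_simps)
    then have "\<bar>x\<bar> * (B + 2) \<le> 0" by (simp add: algebra_simps)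
    then show False using \<open>x \<noteq> 0\<close> that(2) by (simp add: mult_le_0_iff)
  qed
  have g_half: "g x \<psi> = 0" if x: "x \<in> H1b" and \<psi>: "\<psi> \<in> test_functions \<Omega>" for x \<psi>
  proof (rule zero)
    show "0 \<le> 2 * A * ?n \<psi>" using A S.nrm_ge_0[OF test_S[OF \<psi>]] by simp
    fix e :: real assume "0 < e"
    then obtain \<phi> where \<phi>: "\<phi> \<in> test_functions \<Omega>" "?n (x - \<phi>) < e"
      using H10_approx[OF H1bD(1)[OF x]] by metis
    have "g x \<psi> = g (x - \<phi>) \<psi>" using g1[OF x test_H1b[OF \<phi>(1)] test_H1b[OF \<psi>]] g_test[OF \<phi>(1) \<psi>] by simp
    then have "\<bar>g x \<psi>\<bar> \<le> 2 * A * ?n (x - \<phi>) * ?n \<psi>"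
      using g_bd[OF subspace_diff[OF subspace_H1b x test_H1b[OF \<phi>(1)]] test_H1b[OF \<psi>]] by simp
    also have "\<dots> \<le> 2 * A * e * ?n \<psi>"
      using A \<phi>(2) S.nrm_ge_0[OF test_S[OF \<psi>]] by (intro mult_right_mono mult_left_mono) auto
    finally show "\<bar>g x \<psi>\<bar> \<le> 2 * A * ?n \<psi> * e" by (simp add: mult_ac)
  qed
  have "g w v = 0"
  proof (rule zero)
    show "0 \<le> 2 * A * ?n v" using A S.nrm_ge_0[OF H1bD(4)[OF v]] by simp
    fix e :: real assume "0 < e"
    then obtain \<phi> where \<phi>: "\<phi> \<in> test_functions \<Omega>" "?n (w - \<phi>) < e"
      using H10_approx[OF H1bD(1)[OF w]] by metis
    have "g \<phi> v = 0" using g_half[OF v \<phi>(1)] by (simp add: g_def)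
    then have "g w v = g (w - \<phi>) v" using g1[OF w test_H1b[OF \<phi>(1)] v] by simp
    then have "\<bar>g w v\<bar> \<le> 2 * A * ?n (w - \<phi>) * ?n v"
      using g_bd[OF subspace_diff[OF subspace_H1b w test_H1b[OF \<phi>(1)]] v] by simp
    also have "\<dots> \<le> 2 * A * e * ?n v"
      using A \<phi>(2) S.nrm_ge_0[OF H1bD(4)[OF v]] by (intro mult_right_mono mult_left_mono) auto
    finally show "\<bar>g w v\<bar> \<le> 2 * A * ?n v * e" by (simp add: mult_ac)
  qed
  then show ?thesis by (simp add: g_def)
qed

text \<open>Integrating the derivative, in one coordinate direction, of that coordinate times the
  squared length of \<open>\<phi>\<close> expresses the squared L2 norm as minus twice a pairing of
  \<open>\<phi>b\<close> with a partial derivative. The coordinate is at most R in modulus on the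
  domain.\<close>

lemma poincare_test:
  fixes \<phi> :: "'d vector_field"
  assumes R: "\<And>x. x \<in> \<Omega> \<Longrightarrow> norm x \<le> R" and \<phi>: "\<phi> \<in> test_functions \<Omega>"
  shows "L2_norm \<Omega> \<phi> \<le> 2 * \<bar>R\<bar> * L2_norm \<Omega> (grad \<Omega> \<phi>)"
proof -
  obtain i :: 'd where True by blast
  let ?b = "axis i (1::real)"
  have b: "?b \<in> Basis" by (rule axis_Basis)
  obtain K where K: "compact K" "K \<subseteq> \<Omega>" "\<And>x. x \<notin> K \<Longrightarrow> \<phi> x = 0" "\<And>x. x \<notin> K \<Longrightarrow> pd ?b \<phi> x = 0"
    using test_support[OF \<phi>] by blast
  let ?f' = "\<lambda>x y. (x \<bullet> ?b) * (\<phi> x \<bullet> frechet_derivative \<phi> (at x) y + frechet_derivative \<phi> (at x) y \<bullet> \<phi> x) + (y \<bullet> ?b) * (\<phi> x \<bullet> \<phi> x)"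
  have cont: "continuous_on UNIV (\<lambda>x. ?f' x ?b)"
    using smooth_continuous[OF test_smooth[OF \<phi>]] smooth_continuous[OF test_smooth[OF test_pd[OF \<phi> b]]]
    by (intro continuous_intros)
  have z: "(LINT x|lebesgue_on \<Omega>. ?f' x ?b) = 0"
  proof (rule integral_partial_zero_on[where f = "\<lambda>x. (x \<bullet> ?b) * (\<phi> x \<bullet> \<phi> x)" and f' = ?f', OF open_\<Omega> _ b cont K(1,2)])
    show "((\<lambda>x. (x \<bullet> ?b) * (\<phi> x \<bullet> \<phi> x)) has_derivative ?f' x) (at x)" for x
      by (intro has_derivative_mult has_derivative_inner smooth_has_derivative[OF test_smooth[OF \<phi>]]
          bounded_linear_imp_has_derivative bounded_linear_inner_left)
  qed (use K in auto)
  define \<phi>b where "\<phi>b = (\<lambda>x. (x \<bullet> ?b) *\<^sub>R \<phi> x)"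
  note \<phi>L = test_L2[OF open_\<Omega> \<phi>] and dL = test_L2[OF open_\<Omega> test_pd[OF \<phi> b]]
  have \<phi>b: "\<phi>b \<in> L2_space \<Omega>" "L2_norm \<Omega> \<phi>b \<le> \<bar>R\<bar> * L2_norm \<Omega> \<phi>"
  proof -
    have m: "\<phi>b \<in> borel_measurable (lebesgue_on \<Omega>)"
      unfolding \<phi>b_def
      by (rule continuous_imp_measurable_on_sets_lebesgue)
         (use open_\<Omega> in \<open>auto intro!: continuous_intros smooth_continuous[OF test_smooth[OF \<phi>]]\<close>)
    have "AE x in lebesgue_on \<Omega>. norm (\<phi>b x) \<le> \<bar>R\<bar> * norm (\<phi> x)"
    proof (rule AE_I2)
      fix x assume "x \<in> space (lebesgue_on \<Omega>)"
      then have "\<bar>x \<bullet> ?b\<bar> \<le> \<bar>R\<bar>" using Cauchy_Schwarz_ineq2[of x ?b] R[of x] by simp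
      then show "norm (\<phi>b x) \<le> \<bar>R\<bar> * norm (\<phi> x)" unfolding \<phi>b_def by (simp add: mult_right_mono)
    qed
    from L2_bounded_scale[OF \<phi>L m _ this] show "\<phi>b \<in> L2_space \<Omega>" "L2_norm \<Omega> \<phi>b \<le> \<bar>R\<bar> * L2_norm \<Omega> \<phi>" by auto
  qed
  have "?f' x ?b = 2 * (\<phi>b x \<bullet> pd ?b \<phi> x) + \<phi> x \<bullet> \<phi> x" for x
    by (simp add: \<phi>b_def inner_commute)
  then have "(LINT x|lebesgue_on \<Omega>. 2 * (\<phi>b x \<bullet> pd ?b \<phi> x) + \<phi> x \<bullet> \<phi> x) = 0" using z by (simp only:)
  then have "2 * L2_inner \<Omega> \<phi>b (pd ?b \<phi>) + L2_inner \<Omega> \<phi> \<phi> = 0"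
    unfolding L2_inner_def using L2_inner_integrable[OF \<phi>b(1) dL] L2_inner_integrable[OF \<phi>L \<phi>L] by simp
  then have "(L2_norm \<Omega> \<phi>)\<^sup>2 \<le> 2 * \<bar>L2_inner \<Omega> \<phi>b (pd ?b \<phi>)\<bar>" using L2.nrm_sq[OF \<phi>L] by simp
  also have "\<dots> \<le> 2 * (L2_norm \<Omega> \<phi>b * L2_norm \<Omega> (pd ?b \<phi>))"
    using L2.Cauchy_Schwarz[OF \<phi>b(1) dL] by simp
  also have "\<dots> \<le> 2 * ((\<bar>R\<bar> * L2_norm \<Omega> \<phi>) * L2_norm \<Omega> (grad \<Omega> \<phi>))"
  proof -
    have "L2_norm \<Omega> (pd ?b \<phi>) = L2_norm \<Omega> (weak_deriv \<Omega> [?b] \<phi>)"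
      using weak_deriv_AE[OF open_\<Omega> _ test_weak_deriv[OF open_\<Omega> \<phi> b]] b
        L2_measurable[OF dL] L2_measurable[OF partial_L2(1)[OF open_\<Omega> test_S[OF \<phi>]]]
      by (intro L2_norm_cong_AE[symmetric]) auto
    also have "\<dots> \<le> L2_norm \<Omega> (grad \<Omega> \<phi>)"
    proof (rule power2_le_imp_le)
      show "(L2_norm \<Omega> (weak_deriv \<Omega> [?b] \<phi>))\<^sup>2 \<le> (L2_norm \<Omega> (grad \<Omega> \<phi>))\<^sup>2"
        unfolding L2_norm_grad_sq[OF open_\<Omega> test_S[OF \<phi>]] by (intro member_le_sum) auto
    qed (rule S.nrm_ge_0[OF test_S[OF \<phi>]])
    finally show ?thesis using \<phi>b(2) L2.nrm_ge_0[OF \<phi>L] L2.nrm_ge_0[OF dL]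
      by (intro mult_left_mono mult_mono) auto
  qed
  finally have "L2_norm \<Omega> \<phi> * L2_norm \<Omega> \<phi> \<le> (2 * \<bar>R\<bar> * L2_norm \<Omega> (grad \<Omega> \<phi>)) * L2_norm \<Omega> \<phi>"
    by (simp add: power2_eq_square mult_ac)
  then show ?thesis
    using L2.nrm_ge_0[OF \<phi>L] S.nrm_ge_0[OF test_S[OF \<phi>]]
    by (cases "L2_norm \<Omega> \<phi> = 0") (auto simp: mult_le_cancel_right)
qed

text \<open>Fixed by choice, so that it depends on the domain alone and can be a parameter of the
  sublocale \<open>E\<close>.\<close>

definition CP :: real where "CP = (SOME C. 0 \<le> C \<and> (\<forall>u\<in>H10 \<Omega>. L2_norm \<Omega> u \<le> C * L2_norm \<Omega> (grad \<Omega> u)))"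

lemma CP: "0 \<le> CP" "u \<in> H10 \<Omega> \<Longrightarrow> L2_norm \<Omega> u \<le> CP * L2_norm \<Omega> (grad \<Omega> u)"
proof -
  obtain R where R: "\<And>x. x \<in> \<Omega> \<Longrightarrow> norm x \<le> R" using bounded_\<Omega> bounded_iff by blast
  let ?C = "2 * \<bar>R\<bar>"
  have "L2_norm \<Omega> u \<le> ?C * L2_norm \<Omega> (grad \<Omega> u)" if u: "u \<in> H10 \<Omega>" for u
  proof (rule field_le_epsilon)
    fix e :: real assume e: "0 < e"
    obtain \<phi> where \<phi>: "\<phi> \<in> test_functions \<Omega>" "L2_norm \<Omega> (u - \<phi>) < e / (?C + 1)" "L2_norm \<Omega> (grad \<Omega> (u - \<phi>)) < e / (?C + 1)"
      using H10_approx[OF u, of "e / (?C + 1)"] e by auto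
    note S = H10_Sobolev[OF u] test_S[OF \<phi>(1)]
    have 1: "L2_norm \<Omega> u \<le> L2_norm \<Omega> (u - \<phi>) + L2_norm \<Omega> \<phi>"
      by (rule L2.nrm_triangle_rev[OF Sobolev_L2[OF S(1)] Sobolev_L2[OF S(2)]])
    have 2: "L2_norm \<Omega> \<phi> \<le> ?C * L2_norm \<Omega> (grad \<Omega> \<phi>)" by (rule poincare_test[OF R \<phi>(1)])
    have "L2_norm \<Omega> (grad \<Omega> \<phi>) \<le> L2_norm \<Omega> (grad \<Omega> (u - \<phi>)) + L2_norm \<Omega> (grad \<Omega> u)"
      using S.nrm_triangle_rev[OF S(2,1)] S.nrm_minus_commute[OF S] by linarith
    from mult_left_mono[OF this, of ?C] 1 2
    have "L2_norm \<Omega> u \<le> L2_norm \<Omega> (u - \<phi>) + ?C * (L2_norm \<Omega> (grad \<Omega> (u - \<phi>)) + L2_norm \<Omega> (grad \<Omega> u))"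
      by linarith
    also have "\<dots> \<le> e / (?C + 1) + ?C * (e / (?C + 1) + L2_norm \<Omega> (grad \<Omega> u))"
      using \<phi> by (intro add_mono mult_left_mono) auto
    also have "\<dots> = ?C * L2_norm \<Omega> (grad \<Omega> u) + (?C + 1) * (e / (?C + 1))" by (simp add: algebra_simps add_divide_distrib)
    also have "\<dots> = ?C * L2_norm \<Omega> (grad \<Omega> u) + e" by simp
    finally show "L2_norm \<Omega> u \<le> ?C * L2_norm \<Omega> (grad \<Omega> u) + e" .
  qed
  then have "\<exists>C. 0 \<le> C \<and> (\<forall>u\<in>H10 \<Omega>. L2_norm \<Omega> u \<le> C * L2_norm \<Omega> (grad \<Omega> u))"
    by (intro exI[of _ ?C]) auto
  from someI_ex[OF this] show "0 \<le> CP" "u \<in> H10 \<Omega> \<Longrightarrow> L2_norm \<Omega> u \<le> CP * L2_norm \<Omega> (grad \<Omega> u)"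
    unfolding CP_def by blast+
qed

end

section \<open>Convection terms with the exact solution\<close>

context mhd_domain
begin

lemma semi_inner_subset:
  "semi_inner H ip \<Longrightarrow> subspace H' \<Longrightarrow> H' \<subseteq> H \<Longrightarrow> semi_inner H' ip"
  unfolding semi_inner_def by (meson subsetD)

sublocale E: elsasser_forms "H10 \<Omega>" "L2_inner \<Omega>" "\<lambda>u v. L2_inner \<Omega> (grad \<Omega> u) (grad \<Omega> v)"
  H1b Hdiv "trilinear \<Omega>" Cs CP
  rewrites "semi_inner.nrm (L2_inner \<Omega>) = (L2_norm \<Omega> :: 'd vector_field \<Rightarrow> real)"
    and "semi_inner.nrm (\<lambda>u v :: 'd vector_field. L2_inner \<Omega> (grad \<Omega> u) (grad \<Omega> v)) = (\<lambda>u. L2_norm \<Omega> (grad \<Omega> u))"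
proof -
  have H10: "H10 \<Omega> \<subseteq> L2_space \<Omega>" "H10 \<Omega> \<subseteq> Sobolev \<Omega> 1" using H10_L2 H10_Sobolev by auto
  have s1: "semi_inner (H10 \<Omega>) (L2_inner \<Omega>)"
    by (rule semi_inner_subset[OF L2.semi_inner_axioms subspace_H10 H10(1)])
  have s2: "semi_inner (H10 \<Omega>) (\<lambda>u v. L2_inner \<Omega> (grad \<Omega> u) (grad \<Omega> v))"
    by (rule semi_inner_subset[OF S.semi_inner_axioms subspace_H10 H10(2)])
  show n1: "semi_inner.nrm (L2_inner \<Omega>) = (L2_norm \<Omega> :: 'd vector_field \<Rightarrow> real)"
    by (rule HOL.ext) (simp only: semi_inner.nrm_def[OF s1], simp only: L2_norm_def L2_inner_def power2_norm_eq_inner)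
  show n2: "semi_inner.nrm (\<lambda>u v :: 'd vector_field. L2_inner \<Omega> (grad \<Omega> u) (grad \<Omega> v)) = (\<lambda>u. L2_norm \<Omega> (grad \<Omega> u))"
    by (rule HOL.ext) (simp only: semi_inner.nrm_def[OF s2], simp only: L2_norm_def L2_inner_def power2_norm_eq_inner)
  show "elsasser_forms (H10 \<Omega>) (L2_inner \<Omega>) (\<lambda>u v. L2_inner \<Omega> (grad \<Omega> u) (grad \<Omega> v)) H1b Hdiv (trilinear \<Omega>) Cs CP"
  proof (intro elsasser_forms.intro elsasser_forms_axioms.intro s1 s2, unfold n1 n2)
    show "H1b \<subseteq> H10 \<Omega>" "Hdiv \<subseteq> H10 \<Omega>" by (auto simp: H1b_def Hdiv_def)
    show "trilinear \<Omega> (x + y) z w = trilinear \<Omega> x z w + trilinear \<Omega> y z w"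
      if "x \<in> H10 \<Omega>" "y \<in> H10 \<Omega>" "z \<in> H10 \<Omega>" "w \<in> H1b" for x y z w
      by (rule tri_add1[OF H10_L2[OF that(1)] H10_L2[OF that(2)] H10_Sobolev[OF that(3)] H1bD(3,2)[OF that(4)]])
    show "trilinear \<Omega> (c *\<^sub>R x) z w = c * trilinear \<Omega> x z w" for x z w c by (rule tri_scale1)
    show "trilinear \<Omega> z (x + y) w = trilinear \<Omega> z x w + trilinear \<Omega> z y w"
      if "x \<in> H10 \<Omega>" "y \<in> H10 \<Omega>" "z \<in> H10 \<Omega>" "w \<in> H1b" for x y z w
      by (rule tri_add2[OF H10_L2[OF that(3)] H10_Sobolev[OF that(1)] H10_Sobolev[OF that(2)] H1bD(3,2)[OF that(4)]])
    show "trilinear \<Omega> z (c *\<^sub>R x) w = c * trilinear \<Omega> z x w"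
      if "x \<in> H10 \<Omega>" "z \<in> H10 \<Omega>" "w \<in> H1b" for x z w c
      by (rule tri_scale2[OF H10_L2[OF that(2)] H10_Sobolev[OF that(1)] H1bD(3,2)[OF that(3)]])
    show "\<bar>trilinear \<Omega> x y z\<bar> \<le> Cs * L2_norm \<Omega> (grad \<Omega> x) * L2_norm \<Omega> (grad \<Omega> y) * L2_norm \<Omega> (grad \<Omega> z)"
      if "x \<in> H10 \<Omega>" "y \<in> H10 \<Omega>" "z \<in> H1b" for x y z
      using tri_bound_H10[OF that(1,2) H1bD(1)[OF that(3)]] .
    show "trilinear \<Omega> x y z = - trilinear \<Omega> x z y" if "x \<in> Hdiv" "y \<in> H1b" "z \<in> H1b" for x y z
      by (rule tri_skew[OF that])
    show "L2_norm \<Omega> x \<le> CP * L2_norm \<Omega> (grad \<Omega> x)" if "x \<in> H10 \<Omega>" for x by (rule CP(2)[OF that])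
    show "0 < Cs" "0 \<le> CP" by (rule Cs_pos, rule CP(1))
  qed
qed

abbreviation h1 :: "'d vector_field \<Rightarrow> real" where "h1 u \<equiv> L2_norm \<Omega> (grad \<Omega> u)"

lemma conv_L2_bound:
  assumes u: "u \<in> L2_space \<Omega>" and v: "v \<in> Sobolev \<Omega> 1" and C: "0 \<le> C"
    and b: "(AE x in lebesgue_on \<Omega>. norm (grad \<Omega> v x) \<le> C)"
  shows "conv u v \<in> L2_space \<Omega>" "L2_norm \<Omega> (conv u v) \<le> C * L2_norm \<Omega> u"
proof -
  have "AE x in lebesgue_on \<Omega>. norm (conv u v x) \<le> C * norm (u x)"
    using b
  proof eventually_elim
    case (elim x)
    have "norm (u x) * norm (grad \<Omega> v x) \<le> norm (u x) * C" using elim by (rule mult_left_mono) simp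
    then show ?case using norm_conv_le[of u v x] by (simp add: mult.commute)
  qed
  from L2_bounded_scale[OF u conv_measurable[OF L2_measurable[OF u] v] C this]
  show "conv u v \<in> L2_space \<Omega>" "L2_norm \<Omega> (conv u v) \<le> C * L2_norm \<Omega> u" .
qed

lemma conv_L2_bound':
  assumes u: "u \<in> L2_space \<Omega>" and v: "v \<in> Sobolev \<Omega> 1" and C: "0 \<le> C"
    and b: "(AE x in lebesgue_on \<Omega>. norm (u x) \<le> C)"
  shows "conv u v \<in> L2_space \<Omega>" "L2_norm \<Omega> (conv u v) \<le> C * L2_norm \<Omega> (grad \<Omega> v)"
proof -
  have "AE x in lebesgue_on \<Omega>. norm (conv u v x) \<le> C * norm (grad \<Omega> v x)"
    using b
  proof eventually_elim
    case (elim x)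
    have "norm (u x) * norm (grad \<Omega> v x) \<le> C * norm (grad \<Omega> v x)" using elim by (rule mult_right_mono) simp
    then show ?case using norm_conv_le[of u v x] by linarith
  qed
  from L2_bounded_scale[OF grad_L2[OF open_\<Omega> v] conv_measurable[OF L2_measurable[OF u] v] C this]
  show "conv u v \<in> L2_space \<Omega>" "L2_norm \<Omega> (conv u v) \<le> C * L2_norm \<Omega> (grad \<Omega> v)" .
qed

text \<open>Approximation of \<open>v\<close> by a test function replaces a Sobolev embedding: it makes the
  coefficient of the full \<open>H\<^sup>1\<close> norms arbitrarily small.\<close>

lemma tri_split1:
  assumes v: "v \<in> H10 \<Omega>" and e: "0 < \<epsilon>"
  obtains C where "0 \<le> C" "\<And>v' x w. v' \<in> H10 \<Omega> \<Longrightarrow> Cs * h1 (v' - v) \<le> \<epsilon> \<Longrightarrow> x \<in> H1b \<Longrightarrow> w \<in> H1b \<Longrightarrow>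
    \<bar>trilinear \<Omega> x v' w\<bar> \<le> (2 * \<epsilon> * h1 x + C * L2_norm \<Omega> x) * h1 w"
proof -
  obtain \<phi> where \<phi>: "\<phi> \<in> test_functions \<Omega>" "h1 (v - \<phi>) < \<epsilon> / Cs"
    using H10_approx[OF v, of "\<epsilon> / Cs"] e Cs_pos by auto
  have "\<exists>C. \<forall>x. norm (pd (axis i 1) \<phi> x) \<le> C" for i
    using test_bounded[OF test_pd[OF \<phi>(1) axis_Basis]] by metis
  then obtain c where c: "\<And>i x. norm (pd (axis i 1) \<phi> x) \<le> c i" by metis
  define C where "C = (\<Sum>i\<in>UNIV. c i)"
  have C: "0 \<le> C" unfolding C_def using c by (intro sum_nonneg) (meson norm_ge_zero order_trans)
  have gb: "AE x in lebesgue_on \<Omega>. norm (grad \<Omega> \<phi> x) \<le> C"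
    using test_grad[OF open_\<Omega> \<phi>(1)]
  proof eventually_elim
    case (elim x)
    have "norm (grad \<Omega> \<phi> x) \<le> (\<Sum>i\<in>UNIV. norm (grad \<Omega> \<phi> x $ i))"
      unfolding norm_vec_def by (rule L2_set_le_sum) simp
    also have "\<dots> \<le> C" unfolding C_def elim by (intro sum_mono) (simp add: c)
    finally show ?case .
  qed
  note \<phi>H = test_H10[OF \<phi>(1)]
  show ?thesis
  proof (rule that[of "C * CP"])
    show "0 \<le> C * CP" using C CP(1) by simp
    fix v' x w assume v': "v' \<in> H10 \<Omega>" "Cs * h1 (v' - v) \<le> \<epsilon>" and x: "x \<in> H1b" and w: "w \<in> H1b"
    note xH = H1bD(1)[OF x] and wH = H1bD(1)[OF w]
    have h: "0 \<le> h1 x" "0 \<le> h1 w" "0 \<le> L2_norm \<Omega> x" using xH wH by auto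
    have dH: "v' - v \<in> H10 \<Omega>" "v - \<phi> \<in> H10 \<Omega>" "v' - \<phi> \<in> H10 \<Omega>" using v v' \<phi>H by auto
    have "h1 (v' - \<phi>) \<le> h1 (v' - v) + h1 (v - \<phi>)" using E.G.nrm_triangle[OF dH(1,2)] by simp
    from mult_left_mono[OF this, of Cs] have "Cs * h1 (v' - \<phi>) \<le> 2 * \<epsilon>"
      using v'(2) \<phi>(2) Cs_pos by (simp add: distrib_left pos_less_divide_eq mult.commute)
    then have "(Cs * h1 (v' - \<phi>)) * (h1 x * h1 w) \<le> 2 * \<epsilon> * (h1 x * h1 w)"
      using h by (intro mult_right_mono mult_nonneg_nonneg)
    then have 1: "\<bar>trilinear \<Omega> x (v' - \<phi>) w\<bar> \<le> 2 * \<epsilon> * h1 x * h1 w"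
      using E.tri_bound[OF xH dH(3) w] by (simp add: mult_ac)
    have "\<bar>trilinear \<Omega> x \<phi> w\<bar> \<le> L2_norm \<Omega> (conv x \<phi>) * L2_norm \<Omega> w"
      unfolding trilinear_conv
      by (rule L2.Cauchy_Schwarz[OF conv_L2_bound(1)[OF H10_L2[OF xH] H10_Sobolev[OF \<phi>H] C gb] H10_L2[OF wH]])
    also have "\<dots> \<le> (C * L2_norm \<Omega> x) * (CP * h1 w)"
      using conv_L2_bound(2)[OF H10_L2[OF xH] H10_Sobolev[OF \<phi>H] C gb] CP(2)[OF wH] C h L2.nrm_ge_0[OF H10_L2[OF wH]]
      by (intro mult_mono) auto
    finally have 2: "\<bar>trilinear \<Omega> x \<phi> w\<bar> \<le> C * CP * L2_norm \<Omega> x * h1 w" by (simp add: mult_ac)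
    have "trilinear \<Omega> x v' w = trilinear \<Omega> x (v' - \<phi>) w + trilinear \<Omega> x \<phi> w"
      using E.tri_add2[OF dH(3) \<phi>H xH w] by simp
    with 1 2 show "\<bar>trilinear \<Omega> x v' w\<bar> \<le> (2 * \<epsilon> * h1 x + C * CP * L2_norm \<Omega> x) * h1 w"
      by (simp add: distrib_right)
  qed
qed

text \<open>Skew symmetry moves the derivative from \<open>x\<close> to \<open>w\<close> before
  \<open>v'\<close> is split; the bounded smooth part then leaves only the L2 norm of
  \<open>x\<close>. The exchange is made with \<open>v'\<close>, which is divergence-free, and not
  with its approximation, which in general is not.\<close>

lemma tri_split2:
  assumes v: "v \<in> H10 \<Omega>" and e: "0 < \<epsilon>"
  obtains C where "0 \<le> C" "\<And>v' x w. v' \<in> Hdiv \<Longrightarrow> Cs * h1 (v' - v) \<le> \<epsilon> \<Longrightarrow> x \<in> H1b \<Longrightarrow> w \<in> H1b \<Longrightarrow>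
    \<bar>trilinear \<Omega> v' x w\<bar> \<le> (2 * \<epsilon> * h1 x + C * L2_norm \<Omega> x) * h1 w"
proof -
  obtain \<phi> where \<phi>: "\<phi> \<in> test_functions \<Omega>" "h1 (v - \<phi>) < \<epsilon> / Cs"
    using H10_approx[OF v, of "\<epsilon> / Cs"] e Cs_pos by auto
  obtain C where C: "0 < C" "\<And>x. norm (\<phi> x) \<le> C" using test_bounded[OF \<phi>(1)] by blast
  note \<phi>H = test_H10[OF \<phi>(1)]
  show ?thesis
  proof (rule that[of C])
    show "0 \<le> C" using C by simp
    fix v' x w assume v'd: "v' \<in> Hdiv" and v'e: "Cs * h1 (v' - v) \<le> \<epsilon>" and x: "x \<in> H1b" and w: "w \<in> H1b"
    have v': "v' \<in> H10 \<Omega>" using v'd by (simp add: Hdiv_def)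
    note xH = H1bD(1)[OF x] and wH = H1bD(1)[OF w]
    have h: "0 \<le> h1 x" "0 \<le> h1 w" "0 \<le> L2_norm \<Omega> x" using xH wH by auto
    have dH: "v' - v \<in> H10 \<Omega>" "v - \<phi> \<in> H10 \<Omega>" "v' - \<phi> \<in> H10 \<Omega>" using v v' \<phi>H by auto
    have "h1 (v' - \<phi>) \<le> h1 (v' - v) + h1 (v - \<phi>)" using E.G.nrm_triangle[OF dH(1,2)] by simp
    from mult_left_mono[OF this, of Cs] have "Cs * h1 (v' - \<phi>) \<le> 2 * \<epsilon>"
      using v'e \<phi>(2) Cs_pos by (simp add: distrib_left pos_less_divide_eq mult.commute)
    then have "(Cs * h1 (v' - \<phi>)) * (h1 x * h1 w) \<le> 2 * \<epsilon> * (h1 x * h1 w)"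
      using h by (intro mult_right_mono mult_nonneg_nonneg)
    then have 1: "\<bar>trilinear \<Omega> (v' - \<phi>) w x\<bar> \<le> 2 * \<epsilon> * h1 x * h1 w"
      using E.tri_bound[OF dH(3) wH x] by (simp add: mult_ac)
    have b: "AE x in lebesgue_on \<Omega>. norm (\<phi> x) \<le> C" using C by simp
    have C0: "0 \<le> C" using C by simp
    have "\<bar>trilinear \<Omega> \<phi> w x\<bar> \<le> L2_norm \<Omega> (conv \<phi> w) * L2_norm \<Omega> x"
      unfolding trilinear_conv
      by (rule L2.Cauchy_Schwarz[OF conv_L2_bound'(1)[OF H10_L2[OF \<phi>H] H10_Sobolev[OF wH] C0 b] H10_L2[OF xH]])
    also have "\<dots> \<le> (C * h1 w) * L2_norm \<Omega> x"
      using conv_L2_bound'(2)[OF H10_L2[OF \<phi>H] H10_Sobolev[OF wH] C0 b] h by (intro mult_right_mono)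
    finally have 2: "\<bar>trilinear \<Omega> \<phi> w x\<bar> \<le> C * L2_norm \<Omega> x * h1 w" by (simp add: mult_ac)
    have "trilinear \<Omega> v' x w = - (trilinear \<Omega> (v' - \<phi>) w x + trilinear \<Omega> \<phi> w x)"
      using E.tri_add1[OF dH(3) \<phi>H wH x] tri_skew[OF v'd x w] by simp
    with 1 2 show "\<bar>trilinear \<Omega> v' x w\<bar> \<le> (2 * \<epsilon> * h1 x + C * L2_norm \<Omega> x) * h1 w"
      by (simp add: distrib_right)
  qed
qed

text \<open>One smooth approximation serves a whole neighbourhood of a time, as the solution is
  Lipschitz in time in the H1 seminorm. By compactness of the time interval finitely many suffice,
  and the sum of their constants dominates each of them.\<close>

lemma tri_split_uniform:
  assumes T: "0 < T" and v: "\<And>t. t \<in> {0..T} \<Longrightarrow> v t \<in> Hdiv" and K: "0 \<le> K"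
    and lip: "\<And>s t. s \<in> {0..T} \<Longrightarrow> t \<in> {0..T} \<Longrightarrow> h1 (v t - v s) \<le> K * \<bar>t - s\<bar>" and e: "0 < \<epsilon>"
  shows "\<exists>C\<ge>0. \<forall>t\<in>{0..T}. \<forall>x\<in>H1b. \<forall>w\<in>H1b.
      \<bar>trilinear \<Omega> x (v t) w\<bar> \<le> (\<epsilon> * h1 x + C * L2_norm \<Omega> x) * h1 w \<and>
      \<bar>trilinear \<Omega> (v t) x w\<bar> \<le> (\<epsilon> * h1 x + C * L2_norm \<Omega> x) * h1 w"
proof -
  have vH: "v t \<in> H10 \<Omega>" if "t \<in> {0..T}" for t using v[OF that] by (simp add: Hdiv_def)
  \<comment> \<open>Chosen so that \<open>Cs * ((K + 1) * d) = \<epsilon> / 2\<close>: moving in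
    time and smoothing take up half of \<epsilon> each. The + 1 covers K = 0.\<close>
  define d where "d = \<epsilon> / (2 * Cs * (K + 1))"
  have d: "0 < d" unfolding d_def using e Cs_pos K by simp
  have near: "Cs * h1 (v t - v s) \<le> \<epsilon> / 2" if "s \<in> {0..T}" "t \<in> {0..T}" "\<bar>t - s\<bar> \<le> d" for s t
  proof -
    have "h1 (v t - v s) \<le> (K + 1) * d"
      using lip[OF that(1,2)] mult_mono[of K "K + 1" "\<bar>t - s\<bar>" d] that K by auto
    then have "Cs * h1 (v t - v s) \<le> Cs * ((K + 1) * d)" using Cs_pos by simp
    also have "\<dots> = \<epsilon> / 2"
    proof -
      have "Cs * (q * (\<epsilon> / (2 * Cs * q))) = \<epsilon> / 2" if "0 < q" for q using that Cs_pos by simp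
      note eq = this
      have "0 < K + 1" using K by simp
      from eq[OF this] show ?thesis unfolding d_def .
    qed
    finally show ?thesis .
  qed
  have "\<exists>C\<ge>0. \<forall>t\<in>{0..T}. \<bar>t - s\<bar> \<le> d \<longrightarrow> (\<forall>x\<in>H1b. \<forall>w\<in>H1b.
      \<bar>trilinear \<Omega> x (v t) w\<bar> \<le> (\<epsilon> * h1 x + C * L2_norm \<Omega> x) * h1 w \<and>
      \<bar>trilinear \<Omega> (v t) x w\<bar> \<le> (\<epsilon> * h1 x + C * L2_norm \<Omega> x) * h1 w)" if s: "s \<in> {0..T}" for s
  proof -
    have e2: "0 < \<epsilon> / 2" using e by simp
    obtain C1 where C1: "0 \<le> C1" "\<And>v' x w. v' \<in> H10 \<Omega> \<Longrightarrow> Cs * h1 (v' - v s) \<le> \<epsilon> / 2 \<Longrightarrow> x \<in> H1b \<Longrightarrow> w \<in> H1b \<Longrightarrow>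
      \<bar>trilinear \<Omega> x v' w\<bar> \<le> (2 * (\<epsilon> / 2) * h1 x + C1 * L2_norm \<Omega> x) * h1 w"
      using tri_split1[OF vH[OF s] e2] by blast
    obtain C2 where C2: "0 \<le> C2" "\<And>v' x w. v' \<in> Hdiv \<Longrightarrow> Cs * h1 (v' - v s) \<le> \<epsilon> / 2 \<Longrightarrow> x \<in> H1b \<Longrightarrow> w \<in> H1b \<Longrightarrow>
      \<bar>trilinear \<Omega> v' x w\<bar> \<le> (2 * (\<epsilon> / 2) * h1 x + C2 * L2_norm \<Omega> x) * h1 w"
      using tri_split2[OF vH[OF s] e2] by blast
    have mono: "(2 * (\<epsilon> / 2) * h1 x + C * L2_norm \<Omega> x) * h1 w \<le> (\<epsilon> * h1 x + (C1 + C2) * L2_norm \<Omega> x) * h1 w"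
      if "x \<in> H1b" "w \<in> H1b" "C \<le> C1 + C2" for x w C
      using that H1bD(1,3) by (intro mult_right_mono add_mono) auto
    show ?thesis
    proof (intro exI[of _ "C1 + C2"] conjI ballI impI)
      show "0 \<le> C1 + C2" using C1 C2 by simp
      fix t x w assume t: "t \<in> {0..T}" "\<bar>t - s\<bar> \<le> d" and x: "x \<in> H1b" and w: "w \<in> H1b"
      show "\<bar>trilinear \<Omega> x (v t) w\<bar> \<le> (\<epsilon> * h1 x + (C1 + C2) * L2_norm \<Omega> x) * h1 w"
        using C1(2)[OF vH[OF t(1)] near[OF s t] x w] mono[OF x w, of C1] C2(1) by linarith
      show "\<bar>trilinear \<Omega> (v t) x w\<bar> \<le> (\<epsilon> * h1 x + (C1 + C2) * L2_norm \<Omega> x) * h1 w"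
        using C2(2)[OF v[OF t(1)] near[OF s t] x w] mono[OF x w, of C2] C1(1) by linarith
    qed
  qed
  then obtain Cf where Cf: "\<And>s. s \<in> {0..T} \<Longrightarrow> 0 \<le> Cf s" "\<And>s t x w. s \<in> {0..T} \<Longrightarrow> t \<in> {0..T} \<Longrightarrow> \<bar>t - s\<bar> \<le> d \<Longrightarrow>
      x \<in> H1b \<Longrightarrow> w \<in> H1b \<Longrightarrow>
      \<bar>trilinear \<Omega> x (v t) w\<bar> \<le> (\<epsilon> * h1 x + Cf s * L2_norm \<Omega> x) * h1 w \<and>
      \<bar>trilinear \<Omega> (v t) x w\<bar> \<le> (\<epsilon> * h1 x + Cf s * L2_norm \<Omega> x) * h1 w"
    by metis
  have "{0..T} \<subseteq> (\<Union>s\<in>{0..T}. ball s d)" using d by auto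
  then obtain S where S: "S \<subseteq> {0..T}" "finite S" "{0..T} \<subseteq> (\<Union>s\<in>S. ball s d)"
    by (rule compactE_image[OF compact_Icc open_ball])
  show ?thesis
  proof (intro exI[of _ "\<Sum>s\<in>S. Cf s"] conjI ballI)
    show nn: "0 \<le> (\<Sum>s\<in>S. Cf s)" using Cf(1) S(1) by (intro sum_nonneg) auto
    fix t x w assume t: "t \<in> {0..T}" and x: "x \<in> H1b" and w: "w \<in> H1b"
    obtain s where s: "s \<in> S" "\<bar>t - s\<bar> \<le> d" using S(3) t by (fastforce simp: dist_real_def)
    have "Cf s \<le> (\<Sum>s\<in>S. Cf s)" using Cf(1) S s by (intro member_le_sum) auto
    then have mono: "(\<epsilon> * h1 x + Cf s * L2_norm \<Omega> x) * h1 w \<le> (\<epsilon> * h1 x + (\<Sum>s\<in>S. Cf s) * L2_norm \<Omega> x) * h1 w"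
      using H1bD(1,3)[OF x] H1bD(1)[OF w] by (intro mult_right_mono add_mono) auto
    have "s \<in> {0..T}" using s S by auto
    from Cf(2)[OF this t s(2) x w] mono
    show "\<bar>trilinear \<Omega> x (v t) w\<bar> \<le> (\<epsilon> * h1 x + (\<Sum>s\<in>S. Cf s) * L2_norm \<Omega> x) * h1 w"
      "\<bar>trilinear \<Omega> (v t) x w\<bar> \<le> (\<epsilon> * h1 x + (\<Sum>s\<in>S. Cf s) * L2_norm \<Omega> x) * h1 w" by linarith+
  qed
qed

end

section \<open>Regularity in time\<close>

definition weak_deriv_1d :: "real \<Rightarrow> (real \<Rightarrow> real) \<Rightarrow> (real \<Rightarrow> real) \<Rightarrow> bool" where
  "weak_deriv_1d T g h \<longleftrightarrow> (\<forall>\<psi> \<in> test_functions {0<..<T}.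
     (LINT t|lebesgue_on {0<..<T}. deriv \<psi> t * g t) = - (LINT t|lebesgue_on {0<..<T}. \<psi> t * h t))"

text \<open>Convolution with the integral cut to (0, T); it agrees with the full one at times where
  the support of the kernel stays inside the interval.\<close>

definition tconv :: "real \<Rightarrow> (real \<Rightarrow> real) \<Rightarrow> (real \<Rightarrow> real) \<Rightarrow> real \<Rightarrow> real" where
  "tconv T \<eta> g t = (LINT s|lebesgue_on {0<..<T}. \<eta> (t - s) * g s)"

lemma smooth_DERIV:
  fixes \<eta> :: "real \<Rightarrow> real"
  assumes "smooth \<eta>"
  shows "(\<eta> has_real_derivative pd 1 \<eta> x) (at x)"
proof -
  have d: "(\<eta> has_derivative frechet_derivative \<eta> (at x)) (at x)" by (rule smooth_has_derivative[OF assms])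
  have eq: "frechet_derivative \<eta> (at x) = (*) (frechet_derivative \<eta> (at x) 1)"
  proof
    fix y :: real
    have "frechet_derivative \<eta> (at x) (y *\<^sub>R 1) = y *\<^sub>R frechet_derivative \<eta> (at x) 1"
      by (rule linear_cmul[OF has_derivative_linear[OF d]])
    then show "frechet_derivative \<eta> (at x) y = frechet_derivative \<eta> (at x) 1 * y"
      by (simp add: mult.commute)
  qed
  show ?thesis unfolding has_field_derivative_def by (rule has_derivative_eq_rhs[OF d eq])
qed

lemma smooth_reflect:
  fixes \<eta> :: "real \<Rightarrow> real"
  assumes \<eta>: "smooth \<eta>"
  shows "smooth (\<lambda>s. \<eta> (t - s))"
proof (rule smooth_coinduct[of _ "{\<lambda>s. c * \<eta> (t - s) | c \<eta>. smooth \<eta>}"])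
  fix h :: "real \<Rightarrow> real" and b x :: real assume "h \<in> {\<lambda>s. c * \<eta> (t - s) | c \<eta>. smooth \<eta>}"
  then obtain c \<eta> where h: "h = (\<lambda>s. c * \<eta> (t - s))" and \<eta>: "smooth \<eta>" by auto
  have d: "(h has_real_derivative - c * pd 1 \<eta> (t - x)) (at x)" for x
    unfolding h using \<eta> by (auto intro!: derivative_eq_intros DERIV_chain2[OF smooth_DERIV])
  then show "h differentiable at x" using differentiableI by (meson has_field_derivative_imp_has_derivative)
  assume b: "b \<in> Basis"
  then have "pd b h = (\<lambda>s. - c * pd 1 \<eta> (t - s))"
    by (subst pd_eqI[OF d[unfolded has_field_derivative_def]]) auto
  moreover have "smooth (pd 1 \<eta>)" by (rule smooth_pd[OF \<eta>]) simp
  ultimately show "pd b h \<in> {\<lambda>s. c * \<eta> (t - s) | c \<eta>. smooth \<eta>}"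
    by (intro CollectI exI[of _ "- c"] exI[of _ "pd 1 \<eta>"] conjI)
next
  have "(\<lambda>s. \<eta> (t - s)) = (\<lambda>s. 1 * \<eta> (t - s))" by simp
  then show "(\<lambda>s. \<eta> (t - s)) \<in> {\<lambda>s. c * \<eta> (t - s) | c \<eta>. smooth \<eta>}" using \<eta> by blast
qed

lemma lebesgue_on_integral_HK:
  fixes f :: "real \<Rightarrow> real"
  assumes f: "continuous_on {0..T} f"
  shows "(LINT s|lebesgue_on {0<..<T}. f s) = integral {0..T} f" "integrable (lebesgue_on {0<..<T}) f"
proof -
  have "f absolutely_integrable_on {0..T}"
    using f by (intro absolutely_integrable_continuous_real)
  then have a: "f absolutely_integrable_on {0<..<T}"
    by (rule set_integrable_subset) auto
  then have i: "integrable (lebesgue_on {0<..<T}) f"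
    by (simp add: integrable_restrict_space set_integrable_def)
  then show "integrable (lebesgue_on {0<..<T}) f" .
  have "(LINT s|lebesgue_on {0<..<T}. f s) = integral {0<..<T} f"
    using lebesgue_integral_eq_integral[OF i] by simp
  also have "\<dots> = integral {0..T} f"
    using integral_open_interval[of 0 T f] by (simp add: cbox_interval box_real)
  finally show "(LINT s|lebesgue_on {0<..<T}. f s) = integral {0..T} f" .
qed

lemma tconv_DERIV:
  assumes \<eta>: "smooth \<eta>" and g: "continuous_on {0..T} g"
  shows "(tconv T \<eta> g has_real_derivative tconv T (pd 1 \<eta>) g t) (at t)"
proof -
  have c1: "continuous_on S \<eta>" and c2: "continuous_on S (pd 1 \<eta>)" for S
    using smooth_continuous[OF \<eta>] smooth_continuous[OF smooth_pd[OF \<eta>, of 1]] by auto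
  have i: "continuous_on {0..T} (\<lambda>s. \<eta> (t - s) * g s)" "continuous_on {0..T} (\<lambda>s. pd 1 \<eta> (t - s) * g s)" for t
    by (intro continuous_on_mult g continuous_on_compose2[OF c1[of UNIV]] continuous_on_compose2[OF c2[of UNIV]]
        continuous_intros subset_UNIV)+
  have "((\<lambda>t. integral (cbox 0 T) (\<lambda>s. \<eta> (t - s) * g s)) has_real_derivative
      integral (cbox 0 T) (\<lambda>s. pd 1 \<eta> (t - s) * g s)) (at t within UNIV)"
  proof (rule leibniz_rule_field_derivative)
    show "((\<lambda>t. \<eta> (t - s) * g s) has_real_derivative pd 1 \<eta> (t - s) * g s) (at t within UNIV)" for t s
      by (auto intro!: derivative_eq_intros DERIV_chain2[OF smooth_DERIV[OF \<eta>]])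
    show "(\<lambda>s. \<eta> (t - s) * g s) integrable_on cbox 0 T" for t
      using integrable_continuous_real[OF i(1)] by simp
    have "continuous_on (UNIV \<times> {0..T}) (\<lambda>p. pd 1 \<eta> (fst p - snd p) * g (snd p))"
      by (intro continuous_on_mult continuous_on_compose2[OF c2] continuous_on_compose2[OF g] continuous_intros) auto
    then show "continuous_on (UNIV \<times> cbox 0 T) (\<lambda>(t, s). pd 1 \<eta> (t - s) * g s)"
      by (simp add: case_prod_beta cbox_interval)
  qed auto
  then show ?thesis unfolding tconv_def lebesgue_on_integral_HK(1)[OF i(1)] lebesgue_on_integral_HK(1)[OF i(2)]
    by (simp add: cbox_interval)
qed

text \<open>The reflected kernel \<open>\<lambda>s. \<eta> (t - s)\<close> is a test function when t
  keeps the distance e from both endpoints, and the sign from reflecting it cancels the sign in the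
  weak derivative.\<close>

lemma tconv_weak:
  assumes \<eta>: "smooth \<eta>" "\<And>x. e < \<bar>x\<bar> \<Longrightarrow> \<eta> x = 0" and w: "weak_deriv_1d T g h"
    and t: "e < t" "t < T - e" and e: "0 < e"
  shows "tconv T (pd 1 \<eta>) g t = tconv T \<eta> h t"
proof -
  have "{s. \<eta> (t - s) \<noteq> 0} \<subseteq> {t - e..t + e}"
  proof
    fix s assume "s \<in> {s. \<eta> (t - s) \<noteq> 0}"
    then have "\<not> e < \<bar>t - s\<bar>" using \<eta>(2)[of "t - s"] by auto
    then show "s \<in> {t - e..t + e}" by auto
  qed
  then have "(\<lambda>s. \<eta> (t - s)) \<in> test_functions {0<..<T}"
    by (rule test_functionsI[OF smooth_reflect[OF \<eta>(1)]]) (use t e in auto)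
  moreover have "deriv (\<lambda>s. \<eta> (t - s)) s = - pd 1 \<eta> (t - s)" for s
  proof (rule DERIV_imp_deriv)
    have "((\<lambda>s. \<eta> (t - s)) has_real_derivative pd 1 \<eta> (t - s) * (-1)) (at s)"
      by (rule DERIV_chain2[OF smooth_DERIV[OF \<eta>(1)]]) (auto intro!: derivative_eq_intros)
    then show "((\<lambda>s. \<eta> (t - s)) has_real_derivative - pd 1 \<eta> (t - s)) (at s)" by simp
  qed
  ultimately show ?thesis using w unfolding weak_deriv_1d_def tconv_def by force
qed

section \<open>Mollifiers in time\<close>

definition moll :: "real \<Rightarrow> real \<Rightarrow> real" where
  "moll e x = box_bump (- e) e 0 x / (LINT x|lborel. box_bump (- e) e 0 x)"

lemma box_bump_integral_pos:
  assumes "0 < e"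
  shows "integrable lborel (box_bump (- e) e 0 :: real \<Rightarrow> real)" "0 < (LINT x|lborel. box_bump (- e) (e::real) 0 x)"
proof -
  have c: "continuous_on S (box_bump (- e) e 0)" for S by (rule smooth_continuous[OF smooth_box_bump])
  show i: "integrable lborel (box_bump (- e) e 0 :: real \<Rightarrow> real)"
  proof (rule Bochner_Integration.integrable_bound)
    show "integrable lborel (indicat_real {- e..e})" by (rule integrable_real_indicator) (use assms in \<open>auto simp: emeasure_lborel_Icc_eq\<close>)
    show "AE x in lborel. norm (box_bump (- e) e 0 x) \<le> norm (indicat_real {- e..e} x)"
    proof (rule AE_I2)
      fix x :: real
      have "x \<notin> {- e..e} \<Longrightarrow> box_bump (- e) e 0 x = 0"
        using box_bump_nonzero[of "- e" e 0 x] by (auto simp: box_real)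
      then show "norm (box_bump (- e) e 0 x) \<le> norm (indicat_real {- e..e} x)"
        using box_bump_bounds[of "- e" e 0 x] by (cases "x \<in> {- e..e}") auto
    qed
  qed (use borel_measurable_continuous_onI[OF c] in simp)
  have "(LINT x|lborel. box_bump (- e) e 0 x) \<noteq> 0"
  proof
    assume "(LINT x|lborel. box_bump (- e) e 0 x) = 0"
    then have "AE x in lborel. box_bump (- e) e 0 x = 0"
      using integral_nonneg_eq_0_iff_AE[OF i] box_bump_bounds[of "- e" e 0] by auto
    then have "AE x in lborel. x \<notin> {- e<..<e}"
      using box_bump_nonzero[of "- e" e 0] by (auto simp: box_real elim!: AE_mp)
    then have "emeasure lborel {- e<..<e} = 0"
      by (subst (asm) AE_iff_measurable[of "{- e<..<e}"]) auto
    then show False using assms by (simp add: emeasure_lborel_Ioo)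
  qed
  moreover have "0 \<le> (LINT x|lborel. box_bump (- e) e 0 x)"
    using box_bump_bounds by (intro integral_nonneg_AE AE_I2) auto
  ultimately show "0 < (LINT x|lborel. box_bump (- e) e 0 x)" by linarith
qed

lemma moll_smooth: "smooth (moll e)"
  unfolding moll_def[abs_def] divide_inverse by (intro smooth_mult smooth_const) (rule smooth_box_bump)

lemma moll_props:
  assumes e: "0 < e"
  shows "0 \<le> moll e x" "e \<le> \<bar>x\<bar> \<Longrightarrow> moll e x = 0"
  using box_bump_integral_pos[OF e] box_bump_bounds[of "- e" e 0 x] box_bump_nonzero[of "- e" e 0 x]
  by (auto simp: moll_def box_real)

lemma moll_integral:
  assumes e: "0 < e" and t: "e < t" "t < T - e"
  shows "(LINT s|lebesgue_on {0<..<T}. moll e (t - s)) = 1"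
proof -
  have c: "continuous_on S (moll e)" for S by (rule smooth_continuous[OF moll_smooth])
  have "(LINT s|lebesgue_on {0<..<T}. moll e (t - s)) = (LINT s|lebesgue. indicator {0<..<T} s *\<^sub>R moll e (t - s))"
    by (subst integral_restrict_space) auto
  also have "\<dots> = (LINT s|lebesgue. moll e (t - s))"
  proof (intro Bochner_Integration.integral_cong refl)
    fix s
    have "moll e (t - s) = 0" if "s \<notin> {0<..<T}" by (rule moll_props(2)[OF e]) (use that t in auto)
    then show "indicator {0<..<T} s *\<^sub>R moll e (t - s) = moll e (t - s)" by (auto simp: indicator_def)
  qed
  also have "\<dots> = (LINT s|lborel. moll e (t - s))"
    by (subst integral_completion) (auto intro!: borel_measurable_continuous_onI continuous_on_compose2[OF c] continuous_intros)
  also have "\<dots> = (LINT s|lborel. moll e s)"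
    using lborel_integral_real_affine[of "-1" "moll e" t] by simp
  also have "\<dots> = 1" unfolding moll_def using box_bump_integral_pos[OF e] by simp
  finally show ?thesis .
qed

lemma moll_integrable: "integrable (lebesgue_on {0<..<T}) (\<lambda>s. moll e (t - s))"
  by (rule lebesgue_on_integral_HK(2))
     (intro continuous_on_compose2[OF smooth_continuous[OF moll_smooth]] continuous_intros, auto)

lemma tconv_moll_bound:
  assumes e: "0 < e" and t: "e < t" "t < T - e" and K: "AE s in lebesgue_on {0<..<T}. \<bar>h s\<bar> \<le> K" "0 \<le> K"
  shows "\<bar>tconv T (moll e) h t\<bar> \<le> K"
proof (cases "integrable (lebesgue_on {0<..<T}) (\<lambda>s. moll e (t - s) * h s)")
  case True
  have "\<bar>tconv T (moll e) h t\<bar> \<le> (LINT s|lebesgue_on {0<..<T}. K * moll e (t - s))"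
    unfolding tconv_def
  proof (rule order_trans[OF integral_abs_bound integral_mono_AE])
    show "AE s in lebesgue_on {0<..<T}. \<bar>moll e (t - s) * h s\<bar> \<le> K * moll e (t - s)"
      using K(1)
    proof eventually_elim
      case (elim s)
      from mult_left_mono[OF this moll_props(1)[OF e, of "t - s"]]
      show ?case using moll_props(1)[OF e, of "t - s"] by (simp add: abs_mult mult.commute)
    qed
  qed (use True moll_integrable in \<open>auto intro: integrable_abs\<close>)
  also have "\<dots> = K" using moll_integral[OF e t] by simp
  finally show ?thesis .
next
  \<comment> \<open>Measurability of \<open>h\<close> is not among the assumptions. Without
    integrability the integral has the value 0, which satisfies the bound as well.\<close>
  case False
  then show ?thesis using K by (simp add: tconv_def not_integrable_integral_eq)
qed

lemma tconv_moll_tendsto: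
  assumes g: "continuous_on {0..T} g" and t: "0 < t" "t < T"
  shows "(\<lambda>n. tconv T (moll (inverse (real (Suc n)))) g t) \<longlonglongrightarrow> g t"
proof (rule metric_LIMSEQ_I)
  fix r :: real assume r: "0 < r"
  have "continuous (at t within {0..T}) g" using g t by (auto simp: continuous_on_eq_continuous_within)
  then obtain d where d: "0 < d" "\<And>s. s \<in> {0..T} \<Longrightarrow> \<bar>s - t\<bar> < d \<Longrightarrow> \<bar>g s - g t\<bar> < r / 2"
    using r unfolding continuous_within_eps_delta dist_real_def by (metis half_gt_zero)
  define m where "m = min d (min t (T - t))"
  have m: "0 < m" using d t by (simp add: m_def)
  obtain N where N: "\<And>n. N \<le> n \<Longrightarrow> inverse (real (Suc n)) < m"
    using LIMSEQ_D[OF LIMSEQ_inverse_real_of_nat m] by auto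
  show "\<exists>N. \<forall>n\<ge>N. dist (tconv T (moll (inverse (real (Suc n)))) g t) (g t) < r"
  proof (intro exI allI impI)
    fix n assume "N \<le> n"
    define e where "e = inverse (real (Suc n))"
    have e: "0 < e" "e < t" "t < T - e" "e < d" using N[OF \<open>N \<le> n\<close>] unfolding e_def m_def by auto
    have c: "continuous_on {0..T} (\<lambda>s. moll e (t - s) * g s)"
      by (intro continuous_on_mult g continuous_on_compose2[OF smooth_continuous[OF moll_smooth]] continuous_intros) auto
    have "tconv T (moll e) g t - g t = (LINT s|lebesgue_on {0<..<T}. moll e (t - s) * g s - moll e (t - s) * g t)"
      unfolding tconv_def using moll_integral[OF e(1-3)] lebesgue_on_integral_HK(2)[OF c] moll_integrable by simp
    also have "\<bar>\<dots>\<bar> \<le> (LINT s|lebesgue_on {0<..<T}. (r / 2) * moll e (t - s))"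
    proof (rule order_trans[OF integral_abs_bound integral_mono])
      fix s assume s: "s \<in> space (lebesgue_on {0<..<T})"
      show "\<bar>moll e (t - s) * g s - moll e (t - s) * g t\<bar> \<le> r / 2 * moll e (t - s)"
      proof (cases "\<bar>s - t\<bar> < e")
        case True
        then have "\<bar>g s - g t\<bar> \<le> r / 2" using d(2)[of s] s e by fastforce
        then have "moll e (t - s) * \<bar>g s - g t\<bar> \<le> moll e (t - s) * (r / 2)"
          using moll_props(1)[OF e(1)] by (intro mult_left_mono)
        moreover have "\<bar>moll e (t - s) * g s - moll e (t - s) * g t\<bar> = moll e (t - s) * \<bar>g s - g t\<bar>"
          using moll_props(1)[OF e(1), of "t - s"] by (simp add: abs_mult flip: right_diff_distrib)
        ultimately show ?thesis by (simp add: mult.commute)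
      next
        case False
        then show ?thesis using moll_props(2)[OF e(1), of "t - s"] by simp
      qed
    qed (use lebesgue_on_integral_HK(2)[OF c] moll_integrable in \<open>auto intro: integrable_abs\<close>)
    also have "\<dots> = r / 2" using moll_integral[OF e(1-3)] by simp
    finally show "dist (tconv T (moll (inverse (real (Suc n)))) g t) (g t) < r"
      using r unfolding e_def dist_real_def by simp
  qed
qed

lemma moll_pd_zero:
  assumes e: "0 < e" and x: "e < \<bar>x\<bar>"
  shows "pd 1 (moll e) x = 0"
proof -
  have "(moll e has_derivative (\<lambda>_. 0)) (at x)"
  proof (rule has_derivative_transform_within_open)
    show "((\<lambda>_. 0) has_derivative (\<lambda>_. 0)) (at x)" by simp
    show "open {x. e < \<bar>x\<bar>}" by (intro open_Collect_less continuous_intros)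
    show "x \<in> {x. e < \<bar>x\<bar>}" using x by simp
    show "0 = moll e y" if "y \<in> {x. e < \<bar>x\<bar>}" for y using moll_props(2)[OF e, of y] that by simp
  qed
  from frechet_derivative_at[OF this] show ?thesis by metis
qed

text \<open>Contraction towards the midpoint. Mollification controls interior times only, and
  continuity carries the estimates to the endpoints along these points.\<close>

lemma shrink_limit:
  fixes T :: real
  assumes T: "0 < T" and x: "x \<in> {0..T}"
  shows "(\<lambda>n. T / 2 + (1 - inverse (real (Suc n))) * (x - T / 2)) \<longlonglongrightarrow> x"
    and "0 < n \<Longrightarrow> T / 2 + (1 - inverse (real (Suc n))) * (x - T / 2) \<in> {0<..<T}"
proof -
  have "(\<lambda>n. T / 2 + (1 - inverse (real (Suc n))) * (x - T / 2)) \<longlonglongrightarrow> T / 2 + (1 - 0) * (x - T / 2)"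
    by (intro tendsto_intros LIMSEQ_inverse_real_of_nat)
  then show "(\<lambda>n. T / 2 + (1 - inverse (real (Suc n))) * (x - T / 2)) \<longlonglongrightarrow> x" by simp
  assume n: "0 < n"
  define c where "c = 1 - inverse (real (Suc n))"
  have c: "0 \<le> c" "c < 1" using n by (auto simp: c_def field_simps)
  have "x - T / 2 \<le> T / 2" "- (x - T / 2) \<le> T / 2" using x by auto
  then have "\<bar>x - T / 2\<bar> \<le> T / 2" by (rule abs_leI)
  then have "\<bar>c * (x - T / 2)\<bar> \<le> c * (T / 2)"
    unfolding abs_mult using c by (intro mult_mono) auto
  also have "\<dots> < T / 2" using c T by simp
  finally show "T / 2 + (1 - inverse (real (Suc n))) * (x - T / 2) \<in> {0<..<T}"
    unfolding c_def[symmetric] by auto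
qed

section \<open>Taylor estimates from weak derivatives\<close>

context
  fixes T :: real and g g1 g2 :: "real \<Rightarrow> real"
  assumes T: "0 < T" and g: "continuous_on {0..T} g" and g1: "continuous_on {0..T} g1"
    and w1: "weak_deriv_1d T g g1" and w2: "weak_deriv_1d T g1 g2"
begin

lemma moll_DERIV:
  assumes e: "0 < e" and x: "e < x" "x < T - e"
  shows "(tconv T (moll e) g has_real_derivative tconv T (moll e) g1 x) (at x)"
    and "(tconv T (moll e) g1 has_real_derivative tconv T (pd 1 (moll e)) g1 x) (at x)"
    and "(tconv T (pd 1 (moll e)) g1 has_real_derivative tconv T (pd 1 (pd 1 (moll e))) g1 x) (at x)"
  using tconv_DERIV[OF moll_smooth g, of e x] tconv_weak[OF moll_smooth moll_props(2)[OF e] w1 x e]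
    tconv_DERIV[OF moll_smooth g1, of e x] tconv_DERIV[OF smooth_pd[OF moll_smooth] g1, of 1 e x]
  by auto

lemma interior_limit:
  assumes "t \<in> {0<..<T}"
  shows "(\<lambda>n. tconv T (moll (inverse (real (Suc n)))) g t) \<longlonglongrightarrow> g t"
    and "(\<lambda>n. tconv T (moll (inverse (real (Suc n)))) g1 t) \<longlonglongrightarrow> g1 t"
  using tconv_moll_tendsto[OF g] tconv_moll_tendsto[OF g1] assms by auto

lemma small_inverse:
  assumes "0 < m"
  shows "\<forall>\<^sub>F n in sequentially. inverse (real (Suc n)) < m"
  using order_tendstoD(2)[OF LIMSEQ_inverse_real_of_nat assms] .

text \<open>Mollified functions satisfy the classical Taylor formula, and their second derivative is
  the mollification of \<open>g2\<close>, hence bounded by \<open>K\<close> whatever the width. The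
  width then tends to 0.\<close>

lemma taylor2_interior:
  assumes K: "AE s in lebesgue_on {0<..<T}. \<bar>g2 s\<bar> \<le> K" "0 \<le> K" and t: "t \<in> {0<..<T}" "t' \<in> {0<..<T}"
  shows "\<bar>g t' - g t - g1 t * (t' - t)\<bar> \<le> K * (t' - t)\<^sup>2 / 2"
proof (cases "t = t'")
  case True
  then show ?thesis by simp
next
  case False
  define a where "a = min t t'"
  define b where "b = max t t'"
  have ab: "0 < a" "b < T" "a \<le> t" "t \<le> b" "a \<le> t'" "t' \<le> b" using t by (auto simp: a_def b_def)
  have bound: "\<bar>tconv T (moll e) g t' - tconv T (moll e) g t - tconv T (moll e) g1 t * (t' - t)\<bar> \<le> K * (t' - t)\<^sup>2 / 2"
    if e: "0 < e" "e < a" "b < T - e" for e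
  proof -
    let ?d = "\<lambda>m :: nat. if m = 0 then tconv T (moll e) g else if m = 1 then tconv T (moll e) g1 else tconv T (pd 1 (moll e)) g1"
    have "\<exists>s. (if t' < t then t' < s \<and> s < t else t < s \<and> s < t') \<and>
      tconv T (moll e) g t' = (\<Sum>m<2. (?d m t / fact m) * (t' - t) ^ m) + (?d 2 s / fact 2) * (t' - t) ^ 2"
    proof (rule Taylor[where a = a and b = b])
      show "\<forall>m s. m < 2 \<and> a \<le> s \<and> s \<le> b \<longrightarrow> (?d m has_real_derivative ?d (Suc m) s) (at s)"
      proof (intro allI impI)
        fix m :: nat and s assume s: "m < 2 \<and> a \<le> s \<and> s \<le> b"
        then have "e < s" "s < T - e" using e by auto
        from moll_DERIV(1,2)[OF e(1) this] show "(?d m has_real_derivative ?d (Suc m) s) (at s)"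
          using s by (auto simp: less_2_cases_iff)
      qed
    qed (use ab False in auto)
    then obtain s where s: "(if t' < t then t' < s \<and> s < t else t < s \<and> s < t')"
      and eq: "tconv T (moll e) g t' = (\<Sum>m<2. (?d m t / fact m) * (t' - t) ^ m) + (?d 2 s / fact 2) * (t' - t) ^ 2"
      by blast
    have sab: "e < s" "s < T - e" using s ab e by (auto split: if_splits)
    have "tconv T (moll e) g t' - tconv T (moll e) g t - tconv T (moll e) g1 t * (t' - t) = tconv T (pd 1 (moll e)) g1 s / 2 * (t' - t)\<^sup>2"
      using eq by (simp add: numeral_2_eq_2)
    moreover have "\<bar>tconv T (pd 1 (moll e)) g1 s\<bar> \<le> K"
      using tconv_weak[OF moll_smooth moll_props(2)[OF e(1)] w2 sab e(1)] tconv_moll_bound[OF e(1) sab K] by simp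
    ultimately show ?thesis
      using mult_right_mono[of "\<bar>tconv T (pd 1 (moll e)) g1 s\<bar>" K "(t' - t)\<^sup>2"]
      by (simp only: abs_mult) simp
  qed
  show ?thesis
  proof (rule tendsto_upperbound)
    show "(\<lambda>n. \<bar>tconv T (moll (inverse (real (Suc n)))) g t' - tconv T (moll (inverse (real (Suc n)))) g t
        - tconv T (moll (inverse (real (Suc n)))) g1 t * (t' - t)\<bar>) \<longlonglongrightarrow> \<bar>g t' - g t - g1 t * (t' - t)\<bar>"
      by (intro tendsto_intros interior_limit t)
    show "\<forall>\<^sub>F n in sequentially. \<bar>tconv T (moll (inverse (real (Suc n)))) g t' - tconv T (moll (inverse (real (Suc n)))) g t
        - tconv T (moll (inverse (real (Suc n)))) g1 t * (t' - t)\<bar> \<le> K * (t' - t)\<^sup>2 / 2"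
    proof (rule eventually_mono[OF small_inverse[of "min a (T - b)"]])
      fix n assume n: "inverse (real (Suc n)) < min a (T - b)"
      show "\<bar>tconv T (moll (inverse (real (Suc n)))) g t' - tconv T (moll (inverse (real (Suc n)))) g t
        - tconv T (moll (inverse (real (Suc n)))) g1 t * (t' - t)\<bar> \<le> K * (t' - t)\<^sup>2 / 2"
        by (rule bound) (use n in auto)
    qed (use ab in auto)
  qed simp
qed

lemma taylor2:
  assumes K: "AE s in lebesgue_on {0<..<T}. \<bar>g2 s\<bar> \<le> K" "0 \<le> K" and t: "t \<in> {0..T}" "t' \<in> {0..T}"
  shows "\<bar>g t' - g t - g1 t * (t' - t)\<bar> \<le> K * (t' - t)\<^sup>2 / 2"
proof -
  define \<sigma> where "\<sigma> = (\<lambda>n x. T / 2 + (1 - inverse (real (Suc n))) * (x - T / 2))"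
  have lim: "(\<lambda>n. \<sigma> (Suc n) x) \<longlonglongrightarrow> x" and int: "\<sigma> (Suc n) x \<in> {0<..<T}" if "x \<in> {0..T}" for n x
    using LIMSEQ_Suc[OF shrink_limit(1)[OF T that]] shrink_limit(2)[OF T that, of "Suc n"] unfolding \<sigma>_def by auto
  have cl: "(\<lambda>n. f (\<sigma> (Suc n) x)) \<longlonglongrightarrow> f x" if "x \<in> {0..T}" "continuous_on {0..T} f" for f :: "real \<Rightarrow> real" and x
    using int[OF that(1)] by (intro continuous_on_tendsto_compose[OF that(2) lim[OF that(1)] that(1)] always_eventually allI) (auto simp: less_imp_le)
  show ?thesis
  proof (rule LIMSEQ_le)
    show "(\<lambda>n. \<bar>g (\<sigma> (Suc n) t') - g (\<sigma> (Suc n) t) - g1 (\<sigma> (Suc n) t) * (\<sigma> (Suc n) t' - \<sigma> (Suc n) t)\<bar>)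
        \<longlonglongrightarrow> \<bar>g t' - g t - g1 t * (t' - t)\<bar>"
      by (intro tendsto_intros cl lim t g g1)
    show "(\<lambda>n. K * (\<sigma> (Suc n) t' - \<sigma> (Suc n) t)\<^sup>2 / 2) \<longlonglongrightarrow> K * (t' - t)\<^sup>2 / 2"
      by (intro tendsto_intros lim t) simp
    show "\<exists>N. \<forall>n\<ge>N. \<bar>g (\<sigma> (Suc n) t') - g (\<sigma> (Suc n) t) - g1 (\<sigma> (Suc n) t) * (\<sigma> (Suc n) t' - \<sigma> (Suc n) t)\<bar>
        \<le> K * (\<sigma> (Suc n) t' - \<sigma> (Suc n) t)\<^sup>2 / 2"
      using taylor2_interior[OF K int[OF t(1)] int[OF t(2)]] by blast
  qed
qed

text \<open>Third-order Taylor expansion at the newest point t + d: the weights 3, -4, 1 reproduce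
  the first derivative and cancel the second-order terms, as -4 d^2 + (2 d)^2 = 0. The two
  remainders contribute at most (2 + 4) / 6 times K d^2.\<close>

lemma bdf2_interior:
  assumes w3: "weak_deriv_1d T g2 g3" and K: "AE s in lebesgue_on {0<..<T}. \<bar>g3 s\<bar> \<le> K" "0 \<le> K"
    and t: "0 < t - d" "t + d < T" "0 < d"
  shows "\<bar>g1 (t + d) - (3 * g (t + d) - 4 * g t + g (t - d)) / (2 * d)\<bar> \<le> K * d\<^sup>2"
proof -
  let ?c = "t + d"
  have bound: "\<bar>tconv T (moll e) g1 ?c - (3 * tconv T (moll e) g ?c - 4 * tconv T (moll e) g t + tconv T (moll e) g (t - d)) / (2 * d)\<bar> \<le> K * d\<^sup>2"
    if e: "0 < e" "e < t - d" "t + d < T - e" for e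
  proof -
    let ?d = "\<lambda>m :: nat. if m = 0 then tconv T (moll e) g else if m = 1 then tconv T (moll e) g1
       else if m = 2 then tconv T (pd 1 (moll e)) g1 else tconv T (pd 1 (pd 1 (moll e))) g1"
    have tay: "\<exists>r. \<bar>r\<bar> \<le> K \<and> tconv T (moll e) g y = tconv T (moll e) g ?c + tconv T (moll e) g1 ?c * (y - ?c)
        + tconv T (pd 1 (moll e)) g1 ?c / 2 * (y - ?c)\<^sup>2 + r / 6 * (y - ?c) ^ 3" if y: "t - d \<le> y" "y < ?c" for y
    proof -
      have "\<exists>s. (if y < ?c then y < s \<and> s < ?c else ?c < s \<and> s < y) \<and>
        tconv T (moll e) g y = (\<Sum>m<3. (?d m ?c / fact m) * (y - ?c) ^ m) + (?d 3 s / fact 3) * (y - ?c) ^ 3"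
      proof (rule Taylor[where a = "t - d" and b = ?c])
        show "\<forall>m s. m < 3 \<and> t - d \<le> s \<and> s \<le> ?c \<longrightarrow> (?d m has_real_derivative ?d (Suc m) s) (at s)"
        proof (intro allI impI)
          fix m :: nat and s assume s: "m < 3 \<and> t - d \<le> s \<and> s \<le> ?c"
          then have "e < s" "s < T - e" using e by auto
          note D = moll_DERIV[OF e(1) this]
          have "m = 0 \<or> m = 1 \<or> m = 2" using s by linarith
          then show "(?d m has_real_derivative ?d (Suc m) s) (at s)" using D by (elim disjE) simp_all
        qed
      qed (use y t in auto)
      then obtain s where s: "y < s" "s < ?c"
        and eq: "tconv T (moll e) g y = (\<Sum>m<3. (?d m ?c / fact m) * (y - ?c) ^ m) + (?d 3 s / fact 3) * (y - ?c) ^ 3"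
        using y by auto
      have sab: "e < s" "s < T - e" using s y e by auto
      \<comment> \<open>Derivatives of the kernel are traded for weak derivatives one at a time,
        from \<open>g1\<close> over \<open>g2\<close> to \<open>g3\<close>;
        \<open>moll_pd_zero\<close> supplies the support of the differentiated kernel.\<close>
      have "tconv T (pd 1 (pd 1 (moll e))) g1 s = tconv T (pd 1 (moll e)) g2 s"
        by (rule tconv_weak[OF smooth_pd[OF moll_smooth] moll_pd_zero[OF e(1)] w2 sab e(1)]) simp_all
      also have "\<dots> = tconv T (moll e) g3 s"
        using tconv_weak[OF moll_smooth moll_props(2)[OF e(1)] w3 sab e(1)] by simp
      finally have "\<bar>tconv T (pd 1 (pd 1 (moll e))) g1 s\<bar> \<le> K"
        using tconv_moll_bound[OF e(1) sab K] by simp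
      then show ?thesis using eq
        by (intro exI[of _ "tconv T (pd 1 (pd 1 (moll e))) g1 s"]) (simp add: eval_nat_numeral)
    qed
    obtain r1 where r1: "\<bar>r1\<bar> \<le> K" "tconv T (moll e) g t = tconv T (moll e) g ?c + tconv T (moll e) g1 ?c * (- d)
        + tconv T (pd 1 (moll e)) g1 ?c / 2 * d\<^sup>2 + r1 / 6 * (- d) ^ 3"
      using tay[of t] t by auto
    obtain r2 where r2: "\<bar>r2\<bar> \<le> K" "tconv T (moll e) g (t - d) = tconv T (moll e) g ?c + tconv T (moll e) g1 ?c * (- (2 * d))
        + tconv T (pd 1 (moll e)) g1 ?c / 2 * (2 * d)\<^sup>2 + r2 / 6 * (- (2 * d)) ^ 3"
    proof -
      have "t - d - (t + d) = - (2 * d)" by simp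
      then show ?thesis using tay[of "t - d"] t that by auto
    qed
    define G1 where "G1 = tconv T (moll e) g1 ?c"
    define S where "S = 3 * tconv T (moll e) g ?c - 4 * tconv T (moll e) g t + tconv T (moll e) g (t - d)"
    have "S = 2 * d * G1 + (4 * r1 / 6 - 8 * r2 / 6) * d ^ 3"
      unfolding S_def r1(2) r2(2) G1_def by (simp add: power2_eq_square power3_eq_cube algebra_simps)
    then have "S / (2 * d) = G1 + (2 * r1 - 4 * r2) / 6 * d\<^sup>2"
      using t(3) by (simp add: field_simps power2_eq_square power3_eq_cube)
    then have "\<bar>G1 - S / (2 * d)\<bar> = \<bar>2 * r1 - 4 * r2\<bar> / 6 * d\<^sup>2" by (simp add: abs_mult abs_minus_commute)
    also have "\<dots> \<le> K * d\<^sup>2" using r1(1) r2(1) by (intro mult_right_mono) auto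
    finally show ?thesis unfolding G1_def S_def .
  qed
  show ?thesis
  proof (rule tendsto_upperbound)
    show "(\<lambda>n. \<bar>tconv T (moll (inverse (real (Suc n)))) g1 ?c - (3 * tconv T (moll (inverse (real (Suc n)))) g ?c
        - 4 * tconv T (moll (inverse (real (Suc n)))) g t + tconv T (moll (inverse (real (Suc n)))) g (t - d)) / (2 * d)\<bar>)
        \<longlonglongrightarrow> \<bar>g1 ?c - (3 * g ?c - 4 * g t + g (t - d)) / (2 * d)\<bar>"
      using t by (intro tendsto_intros interior_limit) auto
    show "\<forall>\<^sub>F n in sequentially. \<bar>tconv T (moll (inverse (real (Suc n)))) g1 ?c - (3 * tconv T (moll (inverse (real (Suc n)))) g ?c
        - 4 * tconv T (moll (inverse (real (Suc n)))) g t + tconv T (moll (inverse (real (Suc n)))) g (t - d)) / (2 * d)\<bar> \<le> K * d\<^sup>2"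
    proof (rule eventually_mono[OF small_inverse[of "min (t - d) (T - (t + d))"]])
      fix n assume n: "inverse (real (Suc n)) < min (t - d) (T - (t + d))"
      show "\<bar>tconv T (moll (inverse (real (Suc n)))) g1 ?c - (3 * tconv T (moll (inverse (real (Suc n)))) g ?c
        - 4 * tconv T (moll (inverse (real (Suc n)))) g t + tconv T (moll (inverse (real (Suc n)))) g (t - d)) / (2 * d)\<bar> \<le> K * d\<^sup>2"
        by (rule bound) (use n in auto)
    qed (use t in auto)
  qed simp
qed

lemma bdf2_consistency:
  assumes w3: "weak_deriv_1d T g2 g3" and K: "AE s in lebesgue_on {0<..<T}. \<bar>g3 s\<bar> \<le> K" "0 \<le> K"
    and t: "0 \<le> t - d" "t + d \<le> T" "0 < d"
  shows "\<bar>g1 (t + d) - (3 * g (t + d) - 4 * g t + g (t - d)) / (2 * d)\<bar> \<le> K * d\<^sup>2"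
proof -
  define \<sigma> where "\<sigma> = (\<lambda>n x. T / 2 + (1 - inverse (real (Suc n))) * (x - T / 2))"
  have lim: "(\<lambda>n. \<sigma> (Suc n) x) \<longlonglongrightarrow> x" and int: "\<sigma> (Suc n) x \<in> {0<..<T}" if "x \<in> {0..T}" for n x
    using LIMSEQ_Suc[OF shrink_limit(1)[OF T that]] shrink_limit(2)[OF T that, of "Suc n"] unfolding \<sigma>_def by auto
  have cl: "(\<lambda>n. f (\<sigma> (Suc n) x)) \<longlonglongrightarrow> f x" if "x \<in> {0..T}" "continuous_on {0..T} f" for f :: "real \<Rightarrow> real" and x
    using int[OF that(1)] by (intro continuous_on_tendsto_compose[OF that(2) lim[OF that(1)] that(1)] always_eventually allI) (auto simp: less_imp_le)
  define c where "c = (\<lambda>n. 1 - inverse (real (Suc (Suc n))))"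
  have c: "0 < c n" for n by (auto simp: c_def field_simps)
  have clim: "c \<longlonglongrightarrow> 1"
  proof -
    have "c \<longlonglongrightarrow> 1 - 0" unfolding c_def by (intro tendsto_intros LIMSEQ_Suc[OF LIMSEQ_inverse_real_of_nat])
    then show ?thesis by simp
  qed
  have cd: "(\<lambda>n. c n * d) \<longlonglongrightarrow> d" using tendsto_mult_right[OF clim, of d] by simp
  \<comment> \<open>The contraction sends t + d and t - d to points at the distance
    \<open>c n * d\<close> from the image of t, so the interior estimate applies with a shorter
    step.\<close>
  have \<sigma>: "\<sigma> (Suc n) (t + d) = \<sigma> (Suc n) t + c n * d" "\<sigma> (Suc n) (t - d) = \<sigma> (Suc n) t - c n * d" for n
    by (simp_all add: \<sigma>_def c_def algebra_simps)
  have tT: "t \<in> {0..T}" "t + d \<in> {0..T}" "t - d \<in> {0..T}" using t by auto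
  show ?thesis
  proof (rule LIMSEQ_le)
    show "(\<lambda>n. \<bar>g1 (\<sigma> (Suc n) (t + d)) - (3 * g (\<sigma> (Suc n) (t + d)) - 4 * g (\<sigma> (Suc n) t) + g (\<sigma> (Suc n) (t - d))) / (2 * (c n * d))\<bar>)
        \<longlonglongrightarrow> \<bar>g1 (t + d) - (3 * g (t + d) - 4 * g t + g (t - d)) / (2 * d)\<bar>"
      using t(3) cd by (intro tendsto_intros cl tT g g1) simp_all
    show "(\<lambda>n. K * (c n * d)\<^sup>2) \<longlonglongrightarrow> K * d\<^sup>2"
      by (intro tendsto_intros cd)
    show "\<exists>N. \<forall>n\<ge>N. \<bar>g1 (\<sigma> (Suc n) (t + d)) - (3 * g (\<sigma> (Suc n) (t + d)) - 4 * g (\<sigma> (Suc n) t) + g (\<sigma> (Suc n) (t - d))) / (2 * (c n * d))\<bar> \<le> K * (c n * d)\<^sup>2"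
    proof (intro exI[of _ 0] allI impI)
      fix n
      show "\<bar>g1 (\<sigma> (Suc n) (t + d)) - (3 * g (\<sigma> (Suc n) (t + d)) - 4 * g (\<sigma> (Suc n) t) + g (\<sigma> (Suc n) (t - d))) / (2 * (c n * d))\<bar> \<le> K * (c n * d)\<^sup>2"
        unfolding \<sigma> by (rule bdf2_interior[OF w3 K])
          (use int[OF tT(2), of n] int[OF tT(3), of n] c[of n] t(3) in \<open>auto simp: \<sigma>\<close>)
    qed
  qed
qed

end

section \<open>From scalar pairings to the H1 seminorm\<close>

context mhd_domain
begin

lemma inner_continuous:
  assumes v: "continuous_time_L2 \<Omega> T v" and f: "f \<in> L2_space \<Omega>"
  shows "continuous_on {0..T} (\<lambda>t. L2_inner \<Omega> (v t) f)"
  unfolding continuous_on_def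
proof
  fix t assume t: "t \<in> {0..T}"
  have vL: "v s \<in> L2_space \<Omega>" if "s \<in> {0..T}" for s using v that by (simp add: continuous_time_L2_def)
  have "((\<lambda>s. L2_norm \<Omega> (v s - v t) * L2_norm \<Omega> f) \<longlongrightarrow> 0 * L2_norm \<Omega> f) (at t within {0..T})"
    using v t unfolding continuous_time_L2_def fun_diff_def by (intro tendsto_intros) blast
  then have 0: "((\<lambda>s. L2_norm \<Omega> (v s - v t) * L2_norm \<Omega> f) \<longlongrightarrow> 0) (at t within {0..T})" by simp
  have "((\<lambda>s. L2_inner \<Omega> (v s) f - L2_inner \<Omega> (v t) f) \<longlongrightarrow> 0) (at t within {0..T})"
  proof (rule Lim_null_comparison[OF _ 0])
    show "\<forall>\<^sub>F s in at t within {0..T}. norm (L2_inner \<Omega> (v s) f - L2_inner \<Omega> (v t) f) \<le> L2_norm \<Omega> (v s - v t) * L2_norm \<Omega> f"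
      unfolding eventually_at_filter
    proof (intro always_eventually allI impI)
      fix s assume "s \<noteq> t" "s \<in> {0..T}"
      then show "norm (L2_inner \<Omega> (v s) f - L2_inner \<Omega> (v t) f) \<le> L2_norm \<Omega> (v s - v t) * L2_norm \<Omega> f"
        using L2.Cauchy_Schwarz[OF L2.H_diff[OF vL vL] f, of s t] L2.diff_left[OF vL vL f, of s t] t by simp
    qed
  qed
  then show "((\<lambda>s. L2_inner \<Omega> (v s) f) \<longlongrightarrow> L2_inner \<Omega> (v t) f) (at t within {0..T})"
    by (rule LIM_zero_cancel)
qed

lemma weak_time_deriv_1d:
  assumes "weak_time_deriv \<Omega> T u g" "f \<in> L2_space \<Omega>"
  shows "weak_deriv_1d T (\<lambda>t. L2_inner \<Omega> (u t) f) (\<lambda>t. L2_inner \<Omega> (g t) f)"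
  using assms unfolding weak_time_deriv_def weak_deriv_1d_def by blast

lemma Linf_timeD:
  assumes "Linf_time T S N u"
  obtains B where "0 \<le> B" "AE t in lebesgue_on {0<..<T}. u t \<in> S \<and> N (u t) \<le> B"
proof -
  obtain B where B: "AE t in lebesgue_on {0<..<T}. u t \<in> S" "AE t in lebesgue_on {0<..<T}. N (u t) \<le> B"
    using assms unfolding Linf_time_def by blast
  then have "AE t in lebesgue_on {0<..<T}. u t \<in> S \<and> N (u t) \<le> \<bar>B\<bar>" by eventually_elim auto
  then show ?thesis using that[of "\<bar>B\<bar>"] by simp
qed

text \<open>Weak derivatives are tested with scalar functions, so integration by parts against a
  vector-valued test function is assembled from components.\<close>

lemma inner_pd:
  fixes f \<psi> :: "'d vector_field"
  assumes f: "f \<in> Sobolev \<Omega> 1" and \<psi>: "\<psi> \<in> test_functions \<Omega>"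
  shows "L2_inner \<Omega> f (pd (axis i 1) \<psi>) = - L2_inner \<Omega> (weak_deriv \<Omega> [axis i 1] f) \<psi>"
proof -
  let ?b = "axis i (1::real) :: real ^ 'd"
  let ?f' = "weak_deriv \<Omega> [?b] f"
  note fL = Sobolev_L2[OF f] and f'L = partial_L2(1)[OF open_\<Omega> f, of i]
  have comp: "(\<lambda>x. \<psi> x $ c) \<in> test_functions \<Omega>" for c
    by (rule test_bounded_linear[OF bounded_linear_vec_nth \<psi>])
  have pdc: "pd ?b (\<lambda>x. \<psi> x $ c) = (\<lambda>x. pd ?b \<psi> x $ c)" for c
    by (rule pd_bounded_linear[OF bounded_linear_vec_nth test_smooth[OF \<psi>]])
  have comp_int: "integrable M (\<lambda>x. h x $ c)" "(LINT x|M. h x $ c) = (LINT x|M. h x) $ c" if "integrable M h"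
    for h :: "'d vector_field" and c and M :: "(real ^ 'd) measure"
    using integrable_bounded_linear[OF bounded_linear_vec_nth that] integral_bounded_linear[OF bounded_linear_vec_nth that] by auto
  have i1: "integrable (lebesgue_on \<Omega>) (\<lambda>x. pd ?b (\<lambda>x. \<psi> x $ c) x *\<^sub>R f x)" for c
    by (rule test_local_integrable[OF open_\<Omega> test_pd[OF comp axis_Basis] L2_locally_integrable[OF open_\<Omega> fL]])
  have i2: "integrable (lebesgue_on \<Omega>) (\<lambda>x. \<psi> x $ c *\<^sub>R ?f' x)" for c
    by (rule test_local_integrable[OF open_\<Omega> comp L2_locally_integrable[OF open_\<Omega> f'L]])
  have i1': "integrable (lebesgue_on \<Omega>) (\<lambda>x. f x $ c * pd ?b \<psi> x $ c)" for c
    using comp_int(1)[OF i1, of c c] fun_cong[OF pdc] by (simp add: mult.commute)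
  have i2': "integrable (lebesgue_on \<Omega>) (\<lambda>x. ?f' x $ c * \<psi> x $ c)" for c
    using comp_int(1)[OF i2, of c c] by (simp add: mult.commute)
  have w: "(LINT x|lebesgue_on \<Omega>. f x $ c * pd ?b \<psi> x $ c) = - (LINT x|lebesgue_on \<Omega>. ?f' x $ c * \<psi> x $ c)" for c
  proof -
    have "(LINT x|lebesgue_on \<Omega>. pd ?b (\<lambda>x. \<psi> x $ c) x *\<^sub>R f x) = - (LINT x|lebesgue_on \<Omega>. \<psi> x $ c *\<^sub>R ?f' x)"
      using partial_L2(2)[OF open_\<Omega> f, of i] comp[of c] unfolding is_weak_deriv_def by simp
    then have "(LINT x|lebesgue_on \<Omega>. pd ?b (\<lambda>x. \<psi> x $ c) x *\<^sub>R f x) $ c = - (LINT x|lebesgue_on \<Omega>. \<psi> x $ c *\<^sub>R ?f' x) $ c" by simp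
    then show ?thesis unfolding comp_int(2)[OF i1, symmetric] comp_int(2)[OF i2, symmetric]
      using fun_cong[OF pdc] by (simp add: mult.commute)
  qed
  have "L2_inner \<Omega> f (pd ?b \<psi>) = (\<Sum>c\<in>UNIV. LINT x|lebesgue_on \<Omega>. f x $ c * pd ?b \<psi> x $ c)"
    unfolding L2_inner_def inner_vec_def using i1' by (subst Bochner_Integration.integral_sum) auto
  also have "\<dots> = - (\<Sum>c\<in>UNIV. LINT x|lebesgue_on \<Omega>. ?f' x $ c * \<psi> x $ c)"
    unfolding w by (simp add: sum_negf)
  also have "(\<Sum>c\<in>UNIV. LINT x|lebesgue_on \<Omega>. ?f' x $ c * \<psi> x $ c) = L2_inner \<Omega> ?f' \<psi>"
    unfolding L2_inner_def inner_vec_def using i2' by (subst Bochner_Integration.integral_sum) auto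
  finally show ?thesis .
qed

text \<open>Pairing in L2 with this field is, up to sign, the H1 inner product with \<psi>. This
  brings H1 quantities into the form of scalar L2 pairings, for which weak time derivatives are
  available.\<close>

definition laplace :: "'d vector_field \<Rightarrow> 'd vector_field" where
  "laplace \<psi> = (\<Sum>i\<in>UNIV. pd (axis i 1) (pd (axis i 1) \<psi>))"

lemma laplace_L2: "\<psi> \<in> test_functions \<Omega> \<Longrightarrow> laplace \<psi> \<in> L2_space \<Omega>"
  unfolding laplace_def
  by (intro subspace_sum[OF subspace_L2] test_L2[OF open_\<Omega>] test_pd axis_Basis)

lemma inner_laplace:
  assumes f: "f \<in> Sobolev \<Omega> 1" and \<psi>: "\<psi> \<in> test_functions \<Omega>"
  shows "L2_inner \<Omega> f (laplace \<psi>) = - L2_inner \<Omega> (grad \<Omega> f) (grad \<Omega> \<psi>)"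
proof -
  note fL = Sobolev_L2[OF f]
  have tL: "pd (axis i 1) \<psi> \<in> L2_space \<Omega>" "pd (axis i 1) (pd (axis i 1) \<psi>) \<in> L2_space \<Omega>" for i
    by (intro test_L2[OF open_\<Omega>] test_pd axis_Basis \<psi>)+
  have "L2_inner \<Omega> f (laplace \<psi>) = (\<Sum>i\<in>UNIV. L2_inner \<Omega> f (pd (axis i 1) (pd (axis i 1) \<psi>)))"
    unfolding L2_inner_def laplace_def sum_fun_apply inner_sum_right
    by (rule Bochner_Integration.integral_sum) (rule L2_inner_integrable[OF fL tL(2)])
  also have "\<dots> = - (\<Sum>i\<in>UNIV. L2_inner \<Omega> (weak_deriv \<Omega> [axis i 1] f) (pd (axis i 1) \<psi>))"
    using inner_pd[OF f test_pd[OF \<psi> axis_Basis]] by (simp add: sum_negf)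
  also have "(\<Sum>i\<in>UNIV. L2_inner \<Omega> (weak_deriv \<Omega> [axis i 1] f) (pd (axis i 1) \<psi>))
      = (LINT x|lebesgue_on \<Omega>. (\<Sum>i\<in>UNIV. weak_deriv \<Omega> [axis i 1] f x \<bullet> pd (axis i 1) \<psi> x))"
    unfolding L2_inner_def
    by (rule Bochner_Integration.integral_sum[symmetric]) (rule L2_inner_integrable[OF partial_L2(1)[OF open_\<Omega> f] tL(1)])
  also have "\<dots> = L2_inner \<Omega> (grad \<Omega> f) (grad \<Omega> \<psi>)"
    unfolding L2_inner_def
  proof (rule integral_cong_AE)
    show "(\<lambda>x. \<Sum>i\<in>UNIV. weak_deriv \<Omega> [axis i 1] f x \<bullet> pd (axis i 1) \<psi> x) \<in> borel_measurable (lebesgue_on \<Omega>)"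
      using L2_inner_integrable[OF partial_L2(1)[OF open_\<Omega> f] tL(1)] by (intro borel_measurable_sum) blast
    show "(\<lambda>x. grad \<Omega> f x \<bullet> grad \<Omega> \<psi> x) \<in> borel_measurable (lebesgue_on \<Omega>)"
      using L2_inner_integrable[OF grad_L2[OF open_\<Omega> f] grad_L2[OF open_\<Omega> test_S[OF \<psi>]]] by blast
    show "AE x in lebesgue_on \<Omega>. (\<Sum>i\<in>UNIV. weak_deriv \<Omega> [axis i 1] f x \<bullet> pd (axis i 1) \<psi> x) = grad \<Omega> f x \<bullet> grad \<Omega> \<psi> x"
      using test_grad[OF open_\<Omega> \<psi>] by eventually_elim (simp add: inner_vec_def grad_def)
  qed
  finally show ?thesis .
qed

text \<open>Duality with a dense set: for test functions close to \<open>w\<close> the left-hand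
  side of \<open>le\<close> is close to the squared seminorm of \<open>w\<close>.\<close>

lemma h1_le_by_test:
  assumes w: "w \<in> H10 \<Omega>" and K: "0 \<le> K"
    and le: "\<And>\<psi>. \<psi> \<in> test_functions \<Omega> \<Longrightarrow> \<bar>L2_inner \<Omega> (grad \<Omega> w) (grad \<Omega> \<psi>)\<bar> \<le> K * L2_norm \<Omega> (grad \<Omega> \<psi>)"
  shows "L2_norm \<Omega> (grad \<Omega> w) \<le> K"
proof -
  let ?n = "L2_norm \<Omega> (grad \<Omega> w)"
  note wS = H10_Sobolev[OF w]
  have n0: "0 \<le> ?n" by (rule S.nrm_ge_0[OF wS])
  have "?n * ?n \<le> K * ?n"
  proof (rule field_le_epsilon)
    fix e :: real assume e: "0 < e"
    define r where "r = e / (?n + K + 1)"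
    have r: "0 < r" unfolding r_def using e n0 K by (intro divide_pos_pos) auto
    obtain \<psi> where \<psi>: "\<psi> \<in> test_functions \<Omega>" "L2_norm \<Omega> (grad \<Omega> (w - \<psi>)) < r"
      using H10_approx[OF w r] by metis
    note \<psi>S = test_S[OF \<psi>(1)]
    have "?n * ?n = L2_inner \<Omega> (grad \<Omega> w) (grad \<Omega> w)" using S.nrm_sq[OF wS] by (simp add: power2_eq_square)
    also have "\<dots> = L2_inner \<Omega> (grad \<Omega> w) (grad \<Omega> (w - \<psi>)) + L2_inner \<Omega> (grad \<Omega> w) (grad \<Omega> \<psi>)"
      using S.diff_right[OF wS \<psi>S wS] by simp
    also have "\<dots> \<le> ?n * L2_norm \<Omega> (grad \<Omega> (w - \<psi>)) + K * L2_norm \<Omega> (grad \<Omega> \<psi>)"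
      using S.Cauchy_Schwarz[OF wS S.H_diff[OF wS \<psi>S]] le[OF \<psi>(1)] by linarith
    also have "\<dots> \<le> ?n * r + K * (r + ?n)"
    proof (intro add_mono mult_left_mono n0 K)
      show "L2_norm \<Omega> (grad \<Omega> \<psi>) \<le> r + ?n"
        using S.nrm_triangle_rev[OF \<psi>S wS] S.nrm_minus_commute[OF \<psi>S wS] \<psi>(2) by linarith
    qed (use \<psi>(2) in simp)
    also have "\<dots> = K * ?n + (?n + K) * r" by (simp add: algebra_simps)
    also have "(?n + K) * r \<le> (?n + K + 1) * r" using r by simp
    also have "(?n + K + 1) * r = e" unfolding r_def using n0 K by simp
    finally show "?n * ?n \<le> K * ?n + e" by simp
  qed
  then show ?thesis using n0 K by (cases "?n = 0") (auto simp: mult_le_cancel_right)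
qed

end

context mhd_domain
begin

lemma Sobolev_norm_ge_h1: "u \<in> Sobolev \<Omega> 1 \<Longrightarrow> h1 u \<le> Sobolev_norm \<Omega> 1 u" for u :: "'d vector_field"
proof (rule power2_le_imp_le)
  assume u: "u \<in> Sobolev \<Omega> 1"
  show "(h1 u)\<^sup>2 \<le> (Sobolev_norm \<Omega> 1 u)\<^sup>2" unfolding Sobolev_norm_1[OF open_\<Omega> u] by simp
  show "0 \<le> Sobolev_norm \<Omega> 1 u" unfolding Sobolev_norm_def by (simp add: sum_nonneg)
qed

context
  fixes T :: real and v vt vtt vttt :: "real \<Rightarrow> 'd vector_field"
  assumes T: "0 < T" and vH: "\<And>t. t \<in> {0..T} \<Longrightarrow> v t \<in> H10 \<Omega>"
    and v: "continuous_time_L2 \<Omega> T v" and vt: "continuous_time_L2 \<Omega> T vt"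
    and w1: "weak_time_deriv \<Omega> T v vt" and w2: "weak_time_deriv \<Omega> T vt vtt" and w3: "weak_time_deriv \<Omega> T vtt vttt"
    and Lvtt: "Linf_time T (Sobolev \<Omega> 1) (Sobolev_norm \<Omega> 1) vtt"
    and Lvttt: "Linf_time T (L2_space \<Omega>) (L2_norm \<Omega>) vttt"
begin

text \<open>The first time derivative is known only in L2. Two Taylor expansions at
  \<open>m\<close>, with the weights r - m and m - s, cancel it, so that only the H1 bound of the
  second derivative enters. The H1 estimates in \<open>time_regularity\<close> are instances with
  suitable triples.\<close>

lemma h1_three_point:
  obtains K where "0 \<le> K" "\<And>s m r. 0 \<le> s \<Longrightarrow> s \<le> m \<Longrightarrow> m \<le> r \<Longrightarrow> r \<le> T \<Longrightarrow>
    h1 ((r - m) *\<^sub>R (v s - v m) + (m - s) *\<^sub>R (v r - v m)) \<le> K * ((r - m) * (m - s) * (r - s))"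
proof -
  obtain B where B: "0 \<le> B" "AE t in lebesgue_on {0<..<T}. vtt t \<in> Sobolev \<Omega> 1 \<and> Sobolev_norm \<Omega> 1 (vtt t) \<le> B"
    using Linf_timeD[OF Lvtt] by blast
  show ?thesis
  proof (rule that[of "B / 2"])
    show "0 \<le> B / 2" using B by simp
    fix s m r assume smr: "0 \<le> s" "s \<le> m" "m \<le> r" "r \<le> T"
    define w where "w = (r - m) *\<^sub>R (v s - v m) + (m - s) *\<^sub>R (v r - v m)"
    have H: "v s \<in> H10 \<Omega>" "v m \<in> H10 \<Omega>" "v r \<in> H10 \<Omega>" using vH smr by auto
    then have wH: "w \<in> H10 \<Omega>" unfolding w_def by auto
    have "h1 w \<le> B / 2 * ((r - m) * (m - s) * (r - s))"
    proof (rule h1_le_by_test[OF wH])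
      show "0 \<le> B / 2 * ((r - m) * (m - s) * (r - s))" using B smr by simp
      fix \<psi> :: "'d vector_field" assume \<psi>: "\<psi> \<in> test_functions \<Omega>"
      note \<psi>S = test_S[OF \<psi>] and fL = laplace_L2[OF \<psi>]
      let ?g = "\<lambda>t. L2_inner \<Omega> (v t) (laplace \<psi>)" and ?g1 = "\<lambda>t. L2_inner \<Omega> (vt t) (laplace \<psi>)"
      let ?K = "B * h1 \<psi>"
      have K: "AE t in lebesgue_on {0<..<T}. \<bar>L2_inner \<Omega> (vtt t) (laplace \<psi>)\<bar> \<le> ?K"
        using B(2)
      proof eventually_elim
        case (elim t)
        then have S: "vtt t \<in> Sobolev \<Omega> 1" and le: "h1 (vtt t) \<le> B"
          using Sobolev_norm_ge_h1[of "vtt t"] by auto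
        have "\<bar>L2_inner \<Omega> (vtt t) (laplace \<psi>)\<bar> \<le> h1 (vtt t) * h1 \<psi>"
          using inner_laplace[OF S \<psi>] S.Cauchy_Schwarz[OF S \<psi>S] by simp
        also have "\<dots> \<le> ?K" by (rule mult_right_mono[OF le S.nrm_ge_0[OF \<psi>S]])
        finally show ?case .
      qed
      have K0: "0 \<le> ?K" using B S.nrm_ge_0[OF \<psi>S] by simp
      note tay = taylor2[OF T inner_continuous[OF v fL] inner_continuous[OF vt fL]
          weak_time_deriv_1d[OF w1 fL] weak_time_deriv_1d[OF w2 fL] K K0]
      have 1: "\<bar>?g s - ?g m - ?g1 m * (s - m)\<bar> \<le> ?K * (s - m)\<^sup>2 / 2" by (rule tay) (use smr in auto)
      have 2: "\<bar>?g r - ?g m - ?g1 m * (r - m)\<bar> \<le> ?K * (r - m)\<^sup>2 / 2" by (rule tay) (use smr in auto)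
      have "L2_inner \<Omega> (grad \<Omega> w) (grad \<Omega> \<psi>) = - L2_inner \<Omega> w (laplace \<psi>)"
        using inner_laplace[OF H10_Sobolev[OF wH] \<psi>] by simp
      also have "L2_inner \<Omega> w (laplace \<psi>) = (r - m) * (?g s - ?g m) + (m - s) * (?g r - ?g m)"
        unfolding w_def using H10_L2[OF H(1)] H10_L2[OF H(2)] H10_L2[OF H(3)] fL by (simp add: L2.ip_lin)
      also have "\<dots> = (r - m) * (?g s - ?g m - ?g1 m * (s - m)) + (m - s) * (?g r - ?g m - ?g1 m * (r - m))"
        by (simp add: algebra_simps)
      finally have "\<bar>L2_inner \<Omega> (grad \<Omega> w) (grad \<Omega> \<psi>)\<bar> = \<bar>(r - m) * (?g s - ?g m - ?g1 m * (s - m)) + (m - s) * (?g r - ?g m - ?g1 m * (r - m))\<bar>"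
        by simp
      also have "\<dots> \<le> (r - m) * \<bar>?g s - ?g m - ?g1 m * (s - m)\<bar> + (m - s) * \<bar>?g r - ?g m - ?g1 m * (r - m)\<bar>"
        using smr by (intro order_trans[OF abs_triangle_ineq]) (simp add: abs_mult)
      also have "\<dots> \<le> (r - m) * (?K * (s - m)\<^sup>2 / 2) + (m - s) * (?K * (r - m)\<^sup>2 / 2)"
        using 1 2 smr by (intro add_mono mult_left_mono) auto
      also have "\<dots> = B / 2 * ((r - m) * (m - s) * (r - s)) * h1 \<psi>"
        by (simp add: power2_eq_square field_simps)
      finally show "\<bar>L2_inner \<Omega> (grad \<Omega> w) (grad \<Omega> \<psi>)\<bar> \<le> B / 2 * ((r - m) * (m - s) * (r - s)) * h1 \<psi>" .
    qed
    then show "h1 ((r - m) *\<^sub>R (v s - v m) + (m - s) *\<^sub>R (v r - v m)) \<le> B / 2 * ((r - m) * (m - s) * (r - s))"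
      unfolding w_def .
  qed
qed

lemma time_regularity:
  obtains B where "0 \<le> B" "\<And>t. t \<in> {0..T} \<Longrightarrow> h1 (v t) \<le> B"
    "\<And>s t. s \<in> {0..T} \<Longrightarrow> t \<in> {0..T} \<Longrightarrow> h1 (v t - v s) \<le> B * \<bar>t - s\<bar>"
    "\<And>t d. 0 < d \<Longrightarrow> 0 \<le> t - d \<Longrightarrow> t + d \<le> T \<Longrightarrow> h1 (v (t + d) - 2 *\<^sub>R v t + v (t - d)) \<le> B * d\<^sup>2"
    "\<And>t d f. 0 < d \<Longrightarrow> 0 \<le> t - d \<Longrightarrow> t + d \<le> T \<Longrightarrow> f \<in> L2_space \<Omega> \<Longrightarrow>
      \<bar>L2_inner \<Omega> (vt (t + d)) f - (3 * L2_inner \<Omega> (v (t + d)) f - 4 * L2_inner \<Omega> (v t) f + L2_inner \<Omega> (v (t - d)) f) / (2 * d)\<bar>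
        \<le> B * d\<^sup>2 * L2_norm \<Omega> f"
proof -
  obtain K where K: "0 \<le> K" "\<And>s m r. 0 \<le> s \<Longrightarrow> s \<le> m \<Longrightarrow> m \<le> r \<Longrightarrow> r \<le> T \<Longrightarrow>
    h1 ((r - m) *\<^sub>R (v s - v m) + (m - s) *\<^sub>R (v r - v m)) \<le> K * ((r - m) * (m - s) * (r - s))"
    using h1_three_point by blast
  obtain B3 where B3: "0 \<le> B3" "AE t in lebesgue_on {0<..<T}. vttt t \<in> L2_space \<Omega> \<and> L2_norm \<Omega> (vttt t) \<le> B3"
    using Linf_timeD[OF Lvttt] by blast
  note dH = S.H_diff[OF H10_Sobolev H10_Sobolev]
  define B0 where "B0 = h1 (v 0) + h1 (v T) + K * T\<^sup>2"
  have h0: "0 \<le> h1 (v t)" if "t \<in> {0..T}" for t using vH[OF that] by simp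
  have B0: "0 \<le> B0" unfolding B0_def using h0[of 0] h0[of T] K T by simp
  have b0: "h1 (v t) \<le> B0" if t: "t \<in> {0..T}" for t
  proof -
    have H: "v 0 \<in> H10 \<Omega>" "v t \<in> H10 \<Omega>" "v T \<in> H10 \<Omega>" using vH t T by auto
    define w where "w = (T - t) *\<^sub>R (v 0 - v t) + (t - 0) *\<^sub>R (v T - v t)"
    have wH: "w \<in> H10 \<Omega>" unfolding w_def using H by auto
    have "h1 w \<le> K * ((T - t) * (t - 0) * (T - 0))" unfolding w_def by (rule K(2)) (use t in auto)
    also have "\<dots> \<le> K * (T * T * T)" using t T K by (intro mult_left_mono mult_mono) auto
    finally have w: "h1 w \<le> K * (T * T * T)" .
    have "T *\<^sub>R v t = ((T - t) *\<^sub>R v 0 + t *\<^sub>R v T) - w" by (simp add: w_def algebra_simps)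
    then have "T * h1 (v t) = h1 (((T - t) *\<^sub>R v 0 + t *\<^sub>R v T) - w)"
      using E.G.nrm_scale[OF H(2), of T] T by simp
    also have "\<dots> \<le> h1 ((T - t) *\<^sub>R v 0 + t *\<^sub>R v T) + h1 w"
      using H wH by (intro E.G.nrm_triangle_diff) auto
    also have "h1 ((T - t) *\<^sub>R v 0 + t *\<^sub>R v T) \<le> h1 ((T - t) *\<^sub>R v 0) + h1 (t *\<^sub>R v T)"
      using H by (intro E.G.nrm_triangle) auto
    also have "\<dots> = (T - t) * h1 (v 0) + t * h1 (v T)"
      using E.G.nrm_scale[OF H(1), of "T - t"] E.G.nrm_scale[OF H(3), of t] t by simp
    also have "\<dots> \<le> T * h1 (v 0) + T * h1 (v T)"
      using t h0[of 0] h0[of T] T by (intro add_mono mult_right_mono) auto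
    also have "T * h1 (v 0) + T * h1 (v T) + h1 w \<le> T * h1 (v 0) + T * h1 (v T) + K * (T * T * T)"
      using w by simp
    also have "\<dots> = T * B0" unfolding B0_def by (simp add: power2_eq_square algebra_simps)
    finally show ?thesis using T by simp
  qed
  \<comment> \<open>Solved from T / 4 times \<open>B1\<close> being 2 B0 + K T^2, the outcome when
    the weight in front of the increment is at least T / 4.\<close>
  define B1 where "B1 = 8 * B0 / T + 4 * K * T"
  have B1: "0 \<le> B1" unfolding B1_def using B0 K T by simp
  have lip0: "h1 (v b - v a) \<le> B1 * (b - a)" if ab: "0 \<le> a" "a \<le> b" "b \<le> T" for a b
  proof -
    have H: "v a \<in> H10 \<Omega>" "v b \<in> H10 \<Omega>" "v 0 \<in> H10 \<Omega>" "v T \<in> H10 \<Omega>" using vH ab by auto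
    have d2: "h1 (x - y) \<le> 2 * B0" if "x \<in> H10 \<Omega>" "y \<in> H10 \<Omega>" "h1 x \<le> B0" "h1 y \<le> B0" for x y
      using E.G.nrm_triangle_diff[OF that(1,2)] that(3,4) by linarith
    have fin: "h1 (v b - v a) \<le> B1 * (b - a)"
      if c: "T / 4 \<le> c" and le: "c * h1 (v b - v a) \<le> (b - a) * (2 * B0) + K * (T * (b - a) * T)" for c
    proof -
      have "T / 4 * h1 (v b - v a) \<le> c * h1 (v b - v a)"
        using c E.G.nrm_ge_0[of "v b - v a"] H by (intro mult_right_mono) auto
      also note le
      also have "(b - a) * (2 * B0) + K * (T * (b - a) * T) = T / 4 * (B1 * (b - a))"
        unfolding B1_def using T by (simp add: field_simps)
      finally show ?thesis using T by simp
    qed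
    \<comment> \<open>The third point is T if it is at least T / 4 away from b, or 0 if it is at
      least T / 4 away from a. Otherwise b - a exceeds T / 2 and the uniform bound suffices.\<close>
    consider "b \<le> 3 * T / 4" | "T / 4 \<le> a" | "3 * T / 4 < b" "a < T / 4" by linarith
    then show ?thesis
    proof cases
      case 1
      define w where "w = (T - b) *\<^sub>R (v a - v b) + (b - a) *\<^sub>R (v T - v b)"
      have wH: "w \<in> H10 \<Omega>" unfolding w_def using H by auto
      have "h1 w \<le> K * ((T - b) * (b - a) * (T - a))" unfolding w_def by (rule K(2)) (use ab in auto)
      also have "\<dots> \<le> K * (T * (b - a) * T)" using ab K by (intro mult_left_mono mult_mono) auto
      finally have w: "h1 w \<le> K * (T * (b - a) * T)" .
      have "(T - b) *\<^sub>R (v b - v a) = (b - a) *\<^sub>R (v T - v b) - w" by (simp add: w_def algebra_simps)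
      then have "(T - b) * h1 (v b - v a) = h1 ((b - a) *\<^sub>R (v T - v b) - w)"
        using E.G.nrm_scale[of "v b - v a" "T - b"] H ab by simp
      also have "\<dots> \<le> h1 ((b - a) *\<^sub>R (v T - v b)) + h1 w"
        using H wH by (intro E.G.nrm_triangle_diff) auto
      also have "\<dots> \<le> (b - a) * (2 * B0) + K * (T * (b - a) * T)"
        using E.G.nrm_scale[of "v T - v b" "b - a"] H ab w d2[OF H(4,2) b0 b0] T
        by (intro add_mono) (auto intro: mult_left_mono)
      finally show ?thesis by (intro fin[of "T - b"]) (use 1 in auto)
    next
      case 2
      define w where "w = (b - a) *\<^sub>R (v 0 - v a) + (a - 0) *\<^sub>R (v b - v a)"
      have wH: "w \<in> H10 \<Omega>" unfolding w_def using H by auto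
      have "h1 w \<le> K * ((b - a) * (a - 0) * (b - 0))" unfolding w_def by (rule K(2)) (use ab in auto)
      also have "\<dots> \<le> K * ((b - a) * T * T)" using ab K T by (intro mult_left_mono mult_mono) auto
      finally have w: "h1 w \<le> K * (T * (b - a) * T)" by (simp add: mult_ac)
      have "a *\<^sub>R (v b - v a) = w - (b - a) *\<^sub>R (v 0 - v a)" by (simp add: w_def algebra_simps)
      then have "a * h1 (v b - v a) = h1 (w - (b - a) *\<^sub>R (v 0 - v a))"
        using E.G.nrm_scale[of "v b - v a" a] H ab by simp
      also have "\<dots> \<le> h1 w + h1 ((b - a) *\<^sub>R (v 0 - v a))"
        using H wH by (intro E.G.nrm_triangle_diff) auto
      also have "\<dots> \<le> K * (T * (b - a) * T) + (b - a) * (2 * B0)"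
        using E.G.nrm_scale[of "v 0 - v a" "b - a"] H ab w d2[OF H(3,1) b0 b0] T
        by (intro add_mono) (auto intro: mult_left_mono)
      finally show ?thesis by (intro fin[of a]) (use 2 in auto)
    next
      case 3
      have "c * h1 (v b - v a) \<le> c * (2 * B0)" if "0 \<le> c" for c
        using d2[OF H(2,1) b0 b0] ab that by (intro mult_left_mono) auto
      from this[of "b - a"] have "(b - a) * h1 (v b - v a) \<le> (b - a) * (2 * B0) + K * (T * (b - a) * T)"
        using ab K T by (smt (verit) mult_nonneg_nonneg)
      then show ?thesis by (intro fin[of "b - a"]) (use 3 T in auto)
    qed
  qed
  have lip: "h1 (v t - v s) \<le> B1 * \<bar>t - s\<bar>" if st: "s \<in> {0..T}" "t \<in> {0..T}" for s t
    using lip0[of s t] lip0[of t s] E.G.nrm_minus_commute[OF vH vH, of s t] st by (cases "s \<le> t") auto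
  have d2: "h1 (v (t + d) - 2 *\<^sub>R v t + v (t - d)) \<le> 2 * K * d\<^sup>2" if d: "0 < d" "0 \<le> t - d" "t + d \<le> T" for t d
  proof -
    have H: "v (t + d) - 2 *\<^sub>R v t + v (t - d) \<in> H10 \<Omega>" using vH d by auto
    have "h1 ((t + d - t) *\<^sub>R (v (t - d) - v t) + (t - (t - d)) *\<^sub>R (v (t + d) - v t))
      \<le> K * ((t + d - t) * (t - (t - d)) * (t + d - (t - d)))" by (rule K(2)) (use d in auto)
    also have "(t + d - t) *\<^sub>R (v (t - d) - v t) + (t - (t - d)) *\<^sub>R (v (t + d) - v t)
        = d *\<^sub>R (v (t + d) - 2 *\<^sub>R v t + v (t - d))"
      by (simp only: scaleR_2 algebra_simps add_diff_cancel_left' diff_add_cancel cancel_ab_semigroup_add_class.add_diff_cancel_right' diff_diff_eq2 scaleR_zero_left diff_self)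
    also have "h1 \<dots> = d * h1 (v (t + d) - 2 *\<^sub>R v t + v (t - d))" using E.G.nrm_scale[OF H, of d] d by simp
    also have "K * ((t + d - t) * (t - (t - d)) * (t + d - (t - d))) = d * (2 * K * d\<^sup>2)"
      by (simp add: power2_eq_square)
    finally show ?thesis using d by simp
  qed
  have d3: "\<bar>L2_inner \<Omega> (vt (t + d)) f - (3 * L2_inner \<Omega> (v (t + d)) f - 4 * L2_inner \<Omega> (v t) f + L2_inner \<Omega> (v (t - d)) f) / (2 * d)\<bar>
        \<le> B3 * L2_norm \<Omega> f * d\<^sup>2" if d: "0 < d" "0 \<le> t - d" "t + d \<le> T" and f: "f \<in> L2_space \<Omega>" for t d f
  proof (rule bdf2_consistency[OF T inner_continuous[OF v f] inner_continuous[OF vt f]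
      weak_time_deriv_1d[OF w1 f] weak_time_deriv_1d[OF w2 f] weak_time_deriv_1d[OF w3 f]])
    show "AE s in lebesgue_on {0<..<T}. \<bar>L2_inner \<Omega> (vttt s) f\<bar> \<le> B3 * L2_norm \<Omega> f"
      using B3(2)
    proof eventually_elim
      case (elim s)
      then show ?case
        using L2.Cauchy_Schwarz[of "vttt s" \<Omega> f] f mult_right_mono[of "L2_norm \<Omega> (vttt s)" B3 "L2_norm \<Omega> f"] by force
    qed
  qed (use d f B3 in auto)
  define B where "B = B0 + B1 + 2 * K + B3"
  have le: "B0 \<le> B" "B1 \<le> B" "2 * K \<le> B" "B3 \<le> B" unfolding B_def using B0 B1 K B3 by auto
  show ?thesis
  proof (rule that[of B])
    show "0 \<le> B" using B0 le by linarith
    show "h1 (v t) \<le> B" if "t \<in> {0..T}" for t using b0[OF that] le by linarith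
    show "h1 (v t - v s) \<le> B * \<bar>t - s\<bar>" if "s \<in> {0..T}" "t \<in> {0..T}" for s t
      using lip[OF that] mult_right_mono[OF le(2), of "\<bar>t - s\<bar>"] by simp
    show "h1 (v (t + d) - 2 *\<^sub>R v t + v (t - d)) \<le> B * d\<^sup>2" if "0 < d" "0 \<le> t - d" "t + d \<le> T" for t d
      using d2[OF that] mult_right_mono[OF le(3), of "d\<^sup>2"] by simp
    show "\<bar>L2_inner \<Omega> (vt (t + d)) f - (3 * L2_inner \<Omega> (v (t + d)) f - 4 * L2_inner \<Omega> (v t) f + L2_inner \<Omega> (v (t - d)) f) / (2 * d)\<bar>
        \<le> B * d\<^sup>2 * L2_norm \<Omega> f" if "0 < d" "0 \<le> t - d" "t + d \<le> T" and f: "f \<in> L2_space \<Omega>" for t d f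
    proof -
      have "B3 * L2_norm \<Omega> f * d\<^sup>2 \<le> B * L2_norm \<Omega> f * d\<^sup>2"
        using le(4) f by (intro mult_right_mono) auto
      with d3[OF that] show ?thesis by (simp add: mult_ac)
    qed
  qed
qed

end

end

section \<open>Finite element spaces\<close>

text \<open>Gram-Schmidt by induction on a finite set that spans the image of \<open>r\<close>. The
  map \<open>r\<close> is present because finite element functions are unconstrained off the closure
  of the domain, so their space is not finite-dimensional; \<open>r\<close> will cut them off there,
  and its kernel consists of elements of norm 0.\<close>

lemma (in semi_inner) projection_ex:
  fixes r :: "'v \<Rightarrow> 'w::real_vector"
  assumes "finite B" and "linear r" and "subspace W" and "W \<subseteq> H" and "r ` W \<subseteq> span B"
    and null: "\<And>x. x \<in> W \<Longrightarrow> r x = 0 \<Longrightarrow> nrm x = 0" and u: "u \<in> H"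
  shows "\<exists>p\<in>W. \<forall>\<eta>\<in>W. ip (u - p) \<eta> = 0"
  using assms(1,3-6) u
proof (induction B arbitrary: W u rule: finite_induct)
  case empty
  have "ip (u - 0) \<eta> = 0" if "\<eta> \<in> W" for \<eta>
  proof -
    have "r \<eta> = 0" using empty that by auto
    then have "nrm \<eta> = 0" using empty that by auto
    then show ?thesis using Cauchy_Schwarz[of u \<eta>] empty that by auto
  qed
  then show ?case using subspace_0[OF empty(1)] by blast
next
  case (insert b B)
  interpret r: linear r by (rule assms(2))
  define W0 where "W0 = {w \<in> W. r w \<in> span B}"
  have sub: "subspace W0" unfolding W0_def
    using insert(4) by (auto intro!: subspaceI simp: subspace_0 subspace_add subspace_scale r.add r.scale r.zero span_add span_scale span_zero)
  have W0: "W0 \<subseteq> H" "r ` W0 \<subseteq> span B" "W0 \<subseteq> W" using insert unfolding W0_def by auto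
  have IH: "\<exists>p\<in>W0. \<forall>\<eta>\<in>W0. ip (x - p) \<eta> = 0" if "x \<in> H" for x
    by (rule insert.IH[OF sub W0(1,2) _ that]) (use insert.prems(4) W0(3) in auto)
  obtain p0 where p0: "p0 \<in> W0" "\<And>\<eta>. \<eta> \<in> W0 \<Longrightarrow> ip (u - p0) \<eta> = 0" using IH[OF insert.prems(5)] by blast
  show ?case
  proof (cases "W \<subseteq> W0")
    case True
    then show ?thesis using p0 W0(3) by blast
  next
    case False
    then obtain w1 where w1: "w1 \<in> W" "r w1 \<notin> span B" unfolding W0_def by auto
    have w1H: "w1 \<in> H" using w1 insert.prems by auto
    obtain p1 where p1: "p1 \<in> W0" "\<And>\<eta>. \<eta> \<in> W0 \<Longrightarrow> ip (w1 - p1) \<eta> = 0" using IH[OF w1H] by blast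
    define e where "e = w1 - p1"
    have eW: "e \<in> W" unfolding e_def using w1 p1 W0(3) insert.prems(1) by (auto intro: subspace_diff)
    have eH: "e \<in> H" using eW insert.prems by auto
    \<comment> \<open>If \<open>e\<close> has norm 0, division by zero makes \<open>c\<close> equal
      to 0, and Cauchy-Schwarz makes every pairing with \<open>e\<close> vanish.\<close>
    define c where "c = ip u e / ip e e"
    have p0H: "p0 \<in> H" using p0(1) W0(1) by auto
    have pW: "p0 + c *\<^sub>R e \<in> W"
      using p0(1) W0(3) eW insert.prems(1) by (auto intro: subspace_add subspace_scale)
    have pe: "ip (u - (p0 + c *\<^sub>R e)) e = 0"
    proof (cases "ip e e = 0")
      case True
      then have "nrm e = 0" by (simp add: nrm_def)
      then show ?thesis using Cauchy_Schwarz[of "u - (p0 + c *\<^sub>R e)" e] p0H eH insert.prems(5) by auto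
    next
      case False
      have "ip p0 e = 0" using p1(2)[OF p0(1)] sym[OF eH p0H] by (simp add: e_def)
      then show ?thesis using False p0H eH insert.prems(5) by (simp add: ip_lin c_def)
    qed
    have "ip (u - (p0 + c *\<^sub>R e)) \<eta> = 0" if \<eta>: "\<eta> \<in> W" for \<eta>
    proof -
      obtain m where m: "r \<eta> - m *\<^sub>R b \<in> span B"
        using insert.prems(3) \<eta> span_breakdown_eq[of "r \<eta>" b B] by blast
      obtain m1 where m1: "r w1 - m1 *\<^sub>R b \<in> span B"
        using insert.prems(3) w1(1) span_breakdown_eq[of "r w1" b B] by blast
      have "m1 \<noteq> 0" using m1 w1(2) by auto
      define t where "t = m / m1"
      have "r (\<eta> - t *\<^sub>R w1) = (r \<eta> - m *\<^sub>R b) - t *\<^sub>R (r w1 - m1 *\<^sub>R b)"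
        using \<open>m1 \<noteq> 0\<close> by (simp add: t_def r.diff r.scale scaleR_diff_right)
      also have "\<dots> \<in> span B" by (rule span_diff[OF m span_scale[OF m1]])
      finally have "\<eta> - t *\<^sub>R w1 \<in> W0"
        unfolding W0_def using \<eta> w1(1) insert.prems(1) by (auto intro: subspace_diff subspace_scale)
      \<comment> \<open>A suitable multiple of \<open>w1\<close> removes the component of \<eta>
        along \<open>b\<close>; hence \<eta> is an element of \<open>W0\<close> plus a multiple of
        \<open>e\<close>, and orthogonality to these two is enough.\<close>
      then have z: "\<eta> - t *\<^sub>R w1 + t *\<^sub>R p1 \<in> W0" (is "?z \<in> _")
        using p1(1) sub by (auto intro: subspace_add subspace_scale)
      then have zH: "?z \<in> H" using W0 by auto
      have "ip e ?z = 0" using p1(2)[OF z] by (simp add: e_def)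
      moreover have "ip (u - p0) ?z = 0" by (rule p0(2)[OF z])
      moreover have "u - (p0 + c *\<^sub>R e) = (u - p0) - c *\<^sub>R e" by simp
      ultimately have "ip (u - (p0 + c *\<^sub>R e)) ?z = 0"
        using insert.prems(5) p0H eH zH by (simp only: diff_left scale_left H_diff H_scale)
      moreover have "ip (u - (p0 + c *\<^sub>R e)) \<eta> = ip (u - (p0 + c *\<^sub>R e)) (?z + t *\<^sub>R e)"
        by (simp add: e_def scaleR_diff_right)
      moreover have "\<dots> = ip (u - (p0 + c *\<^sub>R e)) ?z + t * ip (u - (p0 + c *\<^sub>R e)) e"
        using insert.prems(5) p0H eH zH by (simp only: add_right scale_right H_diff H_scale H_add)
      ultimately show ?thesis using pe by simp
    qed
    then show ?thesis using pW by blast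
  qed
qed

lemma finite_exponents: "finite {a :: 'd::finite \<Rightarrow> nat. sum a UNIV \<le> k}"
proof (rule finite_subset)
  show "{a :: 'd \<Rightarrow> nat. sum a UNIV \<le> k} \<subseteq> PiE UNIV (\<lambda>_. {..k})"
  proof
    fix a :: "'d \<Rightarrow> nat" assume "a \<in> {a. sum a UNIV \<le> k}"
    then have "a i \<le> k" for i using member_le_sum[of i UNIV a] by auto
    then show "a \<in> PiE UNIV (\<lambda>_. {..k})" by (auto simp: PiE_def)
  qed
qed (simp add: finite_PiE)

lemma polys_add:
  assumes "p \<in> polys k" "q \<in> polys k"
  shows "(\<lambda>x. p x + q x) \<in> polys k"
proof -
  obtain a b where "\<And>x. p x = (\<Sum>i | sum i UNIV \<le> k. a i * (\<Prod>j\<in>UNIV. (x $ j) ^ i j))"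
    "\<And>x. q x = (\<Sum>i | sum i UNIV \<le> k. b i * (\<Prod>j\<in>UNIV. (x $ j) ^ i j))"
    using assms unfolding polys_def by auto
  then show ?thesis unfolding polys_def
    by (auto intro!: exI[of _ "\<lambda>i. a i + b i"] simp: sum.distrib algebra_simps)
qed

lemma polys_scale:
  assumes "p \<in> polys k"
  shows "(\<lambda>x. c * p x) \<in> polys k"
proof -
  obtain a where "\<And>x. p x = (\<Sum>i | sum i UNIV \<le> k. a i * (\<Prod>j\<in>UNIV. (x $ j) ^ i j))"
    using assms unfolding polys_def by auto
  then show ?thesis unfolding polys_def
    by (auto intro!: exI[of _ "\<lambda>i. c * a i"] simp: sum_distrib_left algebra_simps)
qed

lemma polys_0: "(\<lambda>x. 0) \<in> polys k"
  unfolding polys_def by (auto intro!: exI[of _ "\<lambda>_. 0"])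

lemma convex_polytopal_domainD:
  assumes "convex_polytopal_domain \<Omega>"
  shows "open \<Omega>" "bounded \<Omega>" "\<Omega> \<noteq> {}"
  using assms unfolding convex_polytopal_domain_def
  by (auto intro: bounded_subset[OF _ interior_subset] polytope_imp_bounded)

lemma mesh_size_bounds:
  fixes \<Omega> :: "(real ^ 'd) set"
  assumes "regular_triangulation \<Omega> \<sigma> \<T>" "bounded \<Omega>" "\<Omega> \<noteq> {}"
  shows "0 < mesh_size \<T>" "mesh_size \<T> \<le> diameter (closure \<Omega>)"
proof -
  have fin: "finite \<T>" and Un: "\<Union>\<T> = closure \<Omega>"
    using assms(1) by (auto simp: regular_triangulation_def triangulation_def)
  have bd: "bounded (closure \<Omega>)" by (rule bounded_closure[OF assms(2)])
  have "closure \<Omega> \<noteq> {}" using assms(3) closure_subset[of \<Omega>] by blast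
  then have "\<T> \<noteq> {}" using Un Union_empty by metis
  then obtain K where K: "K \<in> \<T>" by auto
  obtain x \<rho> where \<rho>: "0 < \<rho>" "cball x \<rho> \<subseteq> K"
    using assms(1) K unfolding regular_triangulation_def by blast
  have "bounded K" using K Un by (intro bounded_subset[OF bd]) auto
  then have "diameter (cball x \<rho>) \<le> diameter K" using \<rho> by (intro diameter_subset) auto
  then have "0 < diameter K" using \<rho> by (simp add: diameter_cball)
  also have "diameter K \<le> mesh_size \<T>" unfolding mesh_size_def using fin K by (intro Max_ge) auto
  finally show "0 < mesh_size \<T>" .
  show "mesh_size \<T> \<le> diameter (closure \<Omega>)"
    unfolding mesh_size_def using fin \<open>\<T> \<noteq> {}\<close> Un bd by (auto intro!: Max.boundedI diameter_subset)
qed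

lemma Sobolev_seminorm_le_norm: "Sobolev_seminorm \<Omega> m u \<le> Sobolev_norm \<Omega> m u"
proof -
  have "(Sobolev_seminorm \<Omega> m u)\<^sup>2 \<le> (\<Sum>i\<le>m. (Sobolev_seminorm \<Omega> i u)\<^sup>2)"
    by (rule member_le_sum) auto
  then show ?thesis unfolding Sobolev_norm_def by (rule real_le_rsqrt)
qed

lemma AE_interval_dense:
  fixes T :: real
  assumes P: "AE t in lebesgue_on {0<..<T}. P t" and t: "t \<in> {0..T}" "0 < T" "0 < e"
  shows "\<exists>s\<in>{0<..<T}. \<bar>t - s\<bar> < e \<and> P s"
proof (rule ccontr)
  assume no: "\<not> ?thesis"
  let ?I = "{max 0 (t - e)<..<min T (t + e)}"
  have "AE s in lebesgue. s \<in> {0<..<T} \<longrightarrow> P s"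
    using P by (subst (asm) AE_restrict_space_iff) (auto intro!: sets_completionI_sets borel_open)
  then have "AE s in lebesgue. s \<notin> ?I"
    by eventually_elim (use no in auto)
  then have "negligible ?I"
    by (subst negligible_iff_null_sets) (auto simp: AE_iff_null_sets)
  then show False using open_not_negligible[of ?I] t by (auto simp: max_def min_def split: if_splits)
qed

context mhd_domain
begin

lemma div_free_add:
  assumes "u \<in> Sobolev \<Omega> 1" "v \<in> Sobolev \<Omega> 1" "div_free \<Omega> u" "div_free \<Omega> v"
  shows "div_free \<Omega> (u + v)"
  using grad_add[OF open_\<Omega> assms(1,2)] assms(3,4) unfolding div_free_def
  by eventually_elim (simp add: divergence_def sum.distrib)

lemma div_free_scale:
  assumes "u \<in> Sobolev \<Omega> 1" "div_free \<Omega> u"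
  shows "div_free \<Omega> (c *\<^sub>R u)"
  using grad_scale[OF open_\<Omega> assms(1), of c] assms(2) unfolding div_free_def
  by eventually_elim (simp add: divergence_def sum_distrib_left[symmetric])

lemma div_free_inner: "div_free \<Omega> u \<Longrightarrow> L2_inner \<Omega> (divergence \<Omega> u) q = 0"
  "div_free \<Omega> u \<Longrightarrow> L2_inner \<Omega> q (divergence \<Omega> u) = 0"
  unfolding div_free_def L2_inner_def by (auto intro!: integral_eq_zero_AE elim!: AE_mp)

lemma XhD:
  assumes "u \<in> Xh \<Omega> k \<T>"
  shows "u \<in> H10 \<Omega>" "continuous_on (closure \<Omega>) u"
    "K \<in> \<T> \<Longrightarrow> \<exists>p\<in>polys k. \<forall>x\<in>K. u x $ i = p x"
  using assms by (simp_all add: Xh_def)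

lemma XhI:
  assumes "u \<in> H10 \<Omega>" "continuous_on (closure \<Omega>) u"
    "\<And>K i. K \<in> \<T> \<Longrightarrow> \<exists>p\<in>polys k. \<forall>x\<in>K. u x $ i = p x"
  shows "u \<in> Xh \<Omega> k \<T>"
  using assms by (simp add: Xh_def)

lemma subspace_Xh: "subspace (Xh \<Omega> k \<T>)"
proof (rule subspaceI)
  have "0 \<in> H10 \<Omega>" by (rule subspace_0[OF subspace_H10])
  then show "0 \<in> Xh \<Omega> k \<T>"
    by (rule XhI) (auto intro!: bexI[OF _ polys_0] simp: zero_fun_def)
next
  fix u v assume u: "u \<in> Xh \<Omega> k \<T>" and v: "v \<in> Xh \<Omega> k \<T>"
  have "u + v \<in> H10 \<Omega>" by (intro subspace_add[OF subspace_H10] XhD(1)[OF u] XhD(1)[OF v])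
  moreover have "continuous_on (closure \<Omega>) (u + v)"
    unfolding plus_fun_def by (intro continuous_on_add XhD(2)[OF u] XhD(2)[OF v])
  moreover have "\<exists>p\<in>polys k. \<forall>x\<in>K. (u + v) x $ i = p x" if KT: "K \<in> \<T>" for K i
  proof -
    obtain p where p: "p \<in> polys k" "\<And>x. x \<in> K \<Longrightarrow> u x $ i = p x" using XhD(3)[OF u KT] by blast
    obtain q where q: "q \<in> polys k" "\<And>x. x \<in> K \<Longrightarrow> v x $ i = q x" using XhD(3)[OF v KT] by blast
    show ?thesis by (rule bexI[OF _ polys_add[OF p(1) q(1)]]) (simp add: p q)
  qed
  ultimately show "u + v \<in> Xh \<Omega> k \<T>" by (rule XhI)
next
  fix c u assume u: "u \<in> Xh \<Omega> k \<T>"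
  have "c *\<^sub>R u \<in> H10 \<Omega>" by (intro subspace_scale[OF subspace_H10] XhD(1)[OF u])
  moreover have "continuous_on (closure \<Omega>) (c *\<^sub>R u)"
    unfolding scaleR_fun_def by (intro continuous_on_scaleR continuous_on_const XhD(2)[OF u])
  moreover have "\<exists>p\<in>polys k. \<forall>x\<in>K. (c *\<^sub>R u) x $ i = p x" if KT: "K \<in> \<T>" for K i
  proof -
    obtain p where p: "p \<in> polys k" "\<And>x. x \<in> K \<Longrightarrow> u x $ i = p x" using XhD(3)[OF u KT] by blast
    show ?thesis by (rule bexI[OF _ polys_scale[OF p(1), of c]]) (simp add: p)
  qed
  ultimately show "c *\<^sub>R u \<in> Xh \<Omega> k \<T>" by (rule XhI)
qed

lemma Xh_H1b: "Xh \<Omega> k \<T> \<subseteq> H1b"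
proof
  fix u assume u: "u \<in> Xh \<Omega> k \<T>"
  have "compact (u ` closure \<Omega>)"
    using bounded_\<Omega> by (intro compact_continuous_image XhD(2)[OF u]) (simp add: compact_closure)
  then obtain C where "\<And>x. x \<in> closure \<Omega> \<Longrightarrow> norm (u x) \<le> C"
    using compact_imp_bounded[of "u ` closure \<Omega>"] unfolding bounded_iff by auto
  then have "AE x in lebesgue_on \<Omega>. norm (u x) \<le> C"
    using closure_subset[of \<Omega>] by (intro AE_I2) (auto simp: space_restrict_space)
  then show "u \<in> H1b" using XhD(1)[OF u] unfolding H1b_def ae_bounded_def by auto
qed

text \<open>On one simplex the components are combinations of monomials, and there are finitely many
  simplices, components and exponents.\<close>

lemma Xh_piecewise_span:
  assumes "finite \<T>" "\<Union>\<T> = closure \<Omega>"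
  obtains B :: "(real ^ 'd \<Rightarrow> real ^ 'd) set" where "finite B"
    "\<And>u. u \<in> Xh \<Omega> k \<T> \<Longrightarrow> (\<lambda>x. if x \<in> closure \<Omega> then u x else 0) \<in> span B"
proof (rule that)
  \<comment> \<open>Simplices meet in faces, so cutting off on each of them would count shared
    points several times; one simplex is selected for each point. The choice is immaterial, as the
    polynomial on any simplex containing the point gives the value there.\<close>
  define sel where "sel x = (SOME K. K \<in> \<T> \<and> x \<in> K)" for x
  have sel: "sel x \<in> \<T> \<and> x \<in> sel x" if "x \<in> closure \<Omega>" for x
  proof -
    have "x \<in> \<Union>\<T>" unfolding assms(2) by (rule that)
    then have "\<exists>K. K \<in> \<T> \<and> x \<in> K" by blast
    from someI_ex[OF this] show ?thesis unfolding sel_def .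
  qed
  define E where "E = {a :: 'd \<Rightarrow> nat. sum a UNIV \<le> k}"
  define b where "b = (\<lambda>(K, i, a) x. if x \<in> closure \<Omega> \<and> sel x = K
    then axis i (\<Prod>j\<in>UNIV. (x $ j) ^ a j) else (0 :: real ^ 'd))"
  show "finite (b ` (\<T> \<times> UNIV \<times> E))" unfolding E_def
    by (intro finite_imageI finite_cartesian_product assms(1) finite_exponents finite)
  fix u assume u: "u \<in> Xh \<Omega> k \<T>"
  have "\<exists>c. \<forall>x\<in>K. u x $ i = (\<Sum>a\<in>E. c a * (\<Prod>j\<in>UNIV. (x $ j) ^ a j))" if KT: "K \<in> \<T>" for K i
  proof -
    obtain p where p: "p \<in> polys k" "\<forall>x\<in>K. u x $ i = p x" using XhD(3)[OF u KT] by blast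
    then obtain c where "\<And>x. p x = (\<Sum>a\<in>E. c a * (\<Prod>j\<in>UNIV. (x $ j) ^ a j))"
      unfolding polys_def E_def by auto
    then show ?thesis using p(2) by (intro exI[of _ c]) simp
  qed
  then have "\<exists>c. \<forall>K\<in>\<T>. \<forall>i. \<forall>x\<in>K. u x $ i = (\<Sum>a\<in>E. c K i a * (\<Prod>j\<in>UNIV. (x $ j) ^ a j))"
    by metis
  then obtain c where c: "\<And>K i x. K \<in> \<T> \<Longrightarrow> x \<in> K \<Longrightarrow> u x $ i = (\<Sum>a\<in>E. c K i a * (\<Prod>j\<in>UNIV. (x $ j) ^ a j))"
    by blast
  have "(\<lambda>x. if x \<in> closure \<Omega> then u x else 0) = (\<Sum>K\<in>\<T>. \<Sum>i\<in>UNIV. \<Sum>a\<in>E. c K i a *\<^sub>R b (K, i, a))"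
  proof (rule HOL.ext)
    fix x
    show "(if x \<in> closure \<Omega> then u x else 0) = (\<Sum>K\<in>\<T>. \<Sum>i\<in>UNIV. \<Sum>a\<in>E. c K i a *\<^sub>R b (K, i, a)) x"
    proof (cases "x \<in> closure \<Omega>")
      case True
      have "(\<Sum>K\<in>\<T>. \<Sum>i\<in>UNIV. \<Sum>a\<in>E. c K i a *\<^sub>R b (K, i, a)) x
          = (\<Sum>K\<in>\<T>. if K = sel x then (\<Sum>i\<in>UNIV. \<Sum>a\<in>E. c K i a *\<^sub>R axis i (\<Prod>j\<in>UNIV. (x $ j) ^ a j)) else 0)"
        unfolding sum_fun_apply using True by (intro sum.cong) (auto simp: b_def)
      also have "\<dots> = (\<Sum>i\<in>UNIV. \<Sum>a\<in>E. c (sel x) i a *\<^sub>R axis i (\<Prod>j\<in>UNIV. (x $ j) ^ a j))"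
        using assms(1) sel[OF True] by simp
      also have "\<dots> = u x"
      proof (rule vec_eq_iff[THEN iffD2, rule_format])
        fix m
        have "(\<Sum>i\<in>UNIV. \<Sum>a\<in>E. c (sel x) i a *\<^sub>R axis i (\<Prod>j\<in>UNIV. (x $ j) ^ a j)) $ m
            = (\<Sum>i\<in>UNIV. if i = m then (\<Sum>a\<in>E. c (sel x) i a * (\<Prod>j\<in>UNIV. (x $ j) ^ a j)) else 0)"
          unfolding sum_component by (intro sum.cong) (auto simp: axis_def)
        also have "\<dots> = u x $ m"
          using c[OF sel[OF True, THEN conjunct1] sel[OF True, THEN conjunct2], of m] by simp
        finally show "(\<Sum>i\<in>UNIV. \<Sum>a\<in>E. c (sel x) i a *\<^sub>R axis i (\<Prod>j\<in>UNIV. (x $ j) ^ a j)) $ m = u x $ m" .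
      qed
      finally show ?thesis using True by simp
    qed (simp add: b_def sum_fun_apply)
  qed
  also have "\<dots> \<in> span (b ` (\<T> \<times> UNIV \<times> E))"
    by (intro span_sum span_scale span_base) auto
  finally show "(\<lambda>x. if x \<in> closure \<Omega> then u x else 0) \<in> span (b ` (\<T> \<times> UNIV \<times> E))" .
qed

end

section \<open>The divergence-free space of one mesh and its projection\<close>

locale mhd_mesh = mhd_domain \<Omega> Cs for \<Omega> :: "(real ^ 'd) set" and Cs +
  fixes k :: nat and \<sigma> Ci c :: real and \<T> and Q :: "'d scalar_field set"
  assumes \<Omega>_ne: "\<Omega> \<noteq> {}" and triangulation: "regular_triangulation \<Omega> \<sigma> \<T>"
    and Vh_div: "\<And>v. v \<in> Vh \<Omega> (Xh \<Omega> k \<T>) Q \<Longrightarrow> div_free \<Omega> v"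
    and inv: "inverse_inequality \<Omega> Ci (mesh_size \<T>) (Xh \<Omega> k \<T>)"
    and approx: "approximation_properties \<Omega> k c (mesh_size \<T>) (Xh \<Omega> k \<T>) Q"
begin

abbreviation V where "V \<equiv> Vh \<Omega> (Xh \<Omega> k \<T>) Q"
abbreviation Pr where "Pr \<equiv> L2_proj \<Omega> V"

text \<open>The elements are divergence-free, and conversely an almost everywhere vanishing
  divergence is orthogonal to every pressure.\<close>

lemma V_iff: "v \<in> V \<longleftrightarrow> v \<in> Xh \<Omega> k \<T> \<and> div_free \<Omega> v"
  using Vh_div unfolding Vh_def by (auto simp: div_free_inner)

lemma V_H1b: "v \<in> V \<Longrightarrow> v \<in> H1b" using Xh_H1b by (auto simp: V_iff)

lemma V_H10: "v \<in> V \<Longrightarrow> v \<in> H10 \<Omega>" and V_L2: "v \<in> V \<Longrightarrow> v \<in> L2_space \<Omega>"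
  and V_Sobolev: "v \<in> V \<Longrightarrow> v \<in> Sobolev \<Omega> 1"
  using H1bD[OF V_H1b] by auto

lemma V_Hdiv: "v \<in> V \<Longrightarrow> v \<in> Hdiv"
  using V_H10 V_iff unfolding Hdiv_def by auto

lemma subspace_V: "subspace V"
proof (rule subspaceI)
  have "AE x in lebesgue_on \<Omega>. grad \<Omega> (0 *\<^sub>R (0 :: 'd vector_field)) x = 0 *\<^sub>R grad \<Omega> (0 :: 'd vector_field) x"
    by (rule grad_scale[OF open_\<Omega> S.H_0])
  then have "div_free \<Omega> 0" unfolding div_free_def
    by eventually_elim (simp add: divergence_def)
  then show "0 \<in> V" unfolding V_iff using subspace_0[OF subspace_Xh] by blast
qed (auto simp: V_iff intro!: subspace_add[OF subspace_Xh] subspace_scale[OF subspace_Xh] div_free_add div_free_scale V_Sobolev)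

lemma inverse_V: "v \<in> V \<Longrightarrow> h1 v \<le> Ci / mesh_size \<T> * L2_norm \<Omega> v"
  using inv unfolding inverse_inequality_def V_iff by (auto simp: divide_inverse)

lemma Pr:
  assumes u: "u \<in> L2_space \<Omega>"
  shows Pr_V: "Pr u \<in> V" and Pr_orth: "\<eta> \<in> V \<Longrightarrow> L2_inner \<Omega> (u - Pr u) \<eta> = 0"
proof -
  let ?r = "\<lambda>(u :: 'd vector_field) x. if x \<in> closure \<Omega> then u x else 0"
  have \<T>: "finite \<T>" "\<Union>\<T> = closure \<Omega>"
    using triangulation by (simp_all add: regular_triangulation_def triangulation_def)
  obtain B :: "(real ^ 'd \<Rightarrow> real ^ 'd) set" where B: "finite B" "\<And>u. u \<in> Xh \<Omega> k \<T> \<Longrightarrow> ?r u \<in> span B"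
    by (rule Xh_piecewise_span[OF \<T>, of k]) (rule that)
  have "\<exists>p\<in>V. \<forall>\<eta>\<in>V. L2_inner \<Omega> (u - p) \<eta> = 0"
  proof (rule L2.projection_ex[OF B(1) _ subspace_V _ _ _ u])
    show "linear ?r" by (rule linearI) (auto simp: fun_eq_iff)
    show "V \<subseteq> L2_space \<Omega>" using V_L2 by auto
    show "?r ` V \<subseteq> span B" using B(2) V_iff by auto
    fix v assume "v \<in> V" and 0: "?r v = 0"
    have "v x = 0" if "x \<in> \<Omega>" for x
      using fun_cong[OF 0, of x] that closure_subset[of \<Omega>] by (auto split: if_splits)
    then have "AE x in lebesgue_on \<Omega>. (norm (v x))\<^sup>2 = 0"
      by (intro AE_I2) (simp add: space_restrict_space)
    then show "L2_norm \<Omega> v = 0" unfolding L2_norm_def by (simp add: integral_eq_zero_AE)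
  qed
  then have "\<exists>p. p \<in> V \<and> (\<forall>\<eta>\<in>V. L2_inner \<Omega> (\<lambda>x. u x - p x) \<eta> = 0)" unfolding fun_diff_def by blast
  from someI_ex[OF this] show "Pr u \<in> V" "\<eta> \<in> V \<Longrightarrow> L2_inner \<Omega> (u - Pr u) \<eta> = 0"
    unfolding L2_proj_def fun_diff_def by auto
qed

lemma Pr_contraction:
  assumes u: "u \<in> L2_space \<Omega>" and v: "v \<in> L2_space \<Omega>"
  shows "L2_norm \<Omega> (Pr u - Pr v) \<le> L2_norm \<Omega> (u - v)"
proof -
  let ?e = "Pr u - Pr v"
  have e: "?e \<in> V" using subspace_diff[OF subspace_V Pr_V[OF u] Pr_V[OF v]] .
  note L = V_L2[OF Pr_V[OF u]] V_L2[OF Pr_V[OF v]] V_L2[OF e]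
  have "L2_inner \<Omega> (u - v) ?e = L2_inner \<Omega> ?e ?e"
    using Pr_orth[OF u e] Pr_orth[OF v e] L2.diff_left[OF u L(1) L(3)] L2.diff_left[OF v L(2) L(3)]
      L2.diff_left[OF u v L(3)] L2.diff_left[OF L(1,2,3)] by linarith
  then have "(L2_norm \<Omega> ?e)\<^sup>2 \<le> L2_norm \<Omega> (u - v) * L2_norm \<Omega> ?e"
    using L2.Cauchy_Schwarz[OF L2.H_diff[OF u v] L(3)] L2.nrm_sq[OF L(3)] by linarith
  then show ?thesis
    using L2.nrm_ge_0[OF L(3)] L2.nrm_ge_0[OF L2.H_diff[OF u v]]
    by (cases "L2_norm \<Omega> ?e = 0") (auto simp: power2_eq_square)
qed

lemma mesh_pos: "0 < mesh_size \<T>" and mesh_le: "mesh_size \<T> \<le> diameter (closure \<Omega>)"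
  using mesh_size_bounds[OF triangulation bounded_\<Omega> \<Omega>_ne] by auto

text \<open>The approximation property applies only at the almost all times s where the Sobolev
  bound holds. Such times are dense, and passing from s to t costs
  \<open>L * \<bar>t - s\<bar>\<close>. The constant \<open>L\<close> grows like 1 / h through the
  inverse inequality, which does no harm because s is chosen after the mesh.\<close>

lemma Pr_approx:
  assumes T: "0 < T" and v: "\<And>t. t \<in> {0..T} \<Longrightarrow> v t \<in> Hdiv" and K: "0 \<le> K"
    and lip: "\<And>s t. s \<in> {0..T} \<Longrightarrow> t \<in> {0..T} \<Longrightarrow> h1 (v t - v s) \<le> K * \<bar>t - s\<bar>"
    and reg: "AE t in lebesgue_on {0<..<T}. v t \<in> Sobolev \<Omega> (k + 1) \<and> Sobolev_norm \<Omega> (k + 1) (v t) \<le> B"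
    and t: "t \<in> {0..T}"
  shows "h1 (v t - Pr (v t)) \<le> \<bar>c\<bar> * \<bar>B\<bar> * mesh_size \<T> ^ k"
proof (rule field_le_epsilon)
  fix e :: real assume e: "0 < e"
  have vH: "v s \<in> H10 \<Omega>" "v s \<in> L2_space \<Omega>" "div_free \<Omega> (v s)" if "s \<in> {0..T}" for s
    using v[OF that] H10_L2 by (auto simp: Hdiv_def)
  define L where "L = K + \<bar>Ci\<bar> / mesh_size \<T> * (CP * K)"
  have L: "0 \<le> L" unfolding L_def using K CP(1) mesh_pos by simp
  obtain s where s: "s \<in> {0<..<T}" "\<bar>t - s\<bar> < e / (L + 1)" "v s \<in> Sobolev \<Omega> (k + 1)" "Sobolev_norm \<Omega> (k + 1) (v s) \<le> B"
    using AE_interval_dense[OF reg t T, of "e / (L + 1)"] e L by auto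
  have s': "s \<in> {0..T}" using s by auto
  note H = vH[OF t] vH[OF s']
  note PV = Pr_V[OF H(2)] Pr_V[OF H(5)]
  note PH = V_H10[OF PV(1)] V_H10[OF PV(2)]
  have 1: "h1 (v s - Pr (v s)) \<le> \<bar>c\<bar> * \<bar>B\<bar> * mesh_size \<T> ^ k"
  proof -
    have "h1 (v s - Pr (v s)) \<le> c * mesh_size \<T> ^ k * Sobolev_seminorm \<Omega> (k + 1) (v s)"
      using approx H(4,6) s(3) unfolding approximation_properties_def fun_diff_def by auto
    also have "\<dots> \<le> \<bar>c\<bar> * mesh_size \<T> ^ k * \<bar>B\<bar>"
      using mesh_pos s(4) Sobolev_seminorm_le_norm[of \<Omega> "k + 1" "v s"]
      by (intro mult_mono) (auto simp: Sobolev_seminorm_def sum_nonneg)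
    finally show ?thesis by (simp add: mult_ac)
  qed
  have st: "h1 (v t - v s) \<le> K * \<bar>t - s\<bar>" by (rule lip[OF s' t])
  have "h1 (Pr (v t) - Pr (v s)) \<le> Ci / mesh_size \<T> * L2_norm \<Omega> (Pr (v t) - Pr (v s))"
    by (rule inverse_V[OF subspace_diff[OF subspace_V PV]])
  also have "\<dots> \<le> \<bar>Ci\<bar> / mesh_size \<T> * L2_norm \<Omega> (Pr (v t) - Pr (v s))"
    using mesh_pos L2.nrm_ge_0[OF L2.H_diff[OF V_L2[OF PV(1)] V_L2[OF PV(2)]]]
    by (intro mult_right_mono divide_right_mono) auto
  also have "L2_norm \<Omega> (Pr (v t) - Pr (v s)) \<le> CP * (K * \<bar>t - s\<bar>)"
    using Pr_contraction[OF H(2,5)] CP(2)[OF E.G.H_diff[OF H(1,4)]] mult_left_mono[OF st CP(1)] by linarith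
  finally have 2: "h1 (Pr (v t) - Pr (v s)) \<le> \<bar>Ci\<bar> / mesh_size \<T> * (CP * (K * \<bar>t - s\<bar>))"
    using mesh_pos by (simp add: mult_left_mono divide_right_mono)
  have "h1 (v t - Pr (v t)) = h1 (((v t - v s) + (v s - Pr (v s))) - (Pr (v t) - Pr (v s)))" by simp
  also have "\<dots> \<le> h1 ((v t - v s) + (v s - Pr (v s))) + h1 (Pr (v t) - Pr (v s))"
    using H PH by (intro E.G.nrm_triangle_diff E.G.H_add E.G.H_diff)
  also have "\<dots> \<le> h1 (v t - v s) + h1 (v s - Pr (v s)) + h1 (Pr (v t) - Pr (v s))"
    using H PH by (intro add_right_mono E.G.nrm_triangle E.G.H_diff)
  also have "\<dots> \<le> L * \<bar>t - s\<bar> + \<bar>c\<bar> * \<bar>B\<bar> * mesh_size \<T> ^ k"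
    using 1 2 st unfolding L_def by (simp add: algebra_simps)
  also have "L * \<bar>t - s\<bar> \<le> (L + 1) * \<bar>t - s\<bar>" by (simp add: algebra_simps)
  also have "\<dots> \<le> e" using s(2) L by (simp add: pos_less_divide_eq mult.commute less_imp_le)
  finally show "h1 (v t - Pr (v t)) \<le> \<bar>c\<bar> * \<bar>B\<bar> * mesh_size \<T> ^ k + e" by simp
qed

end

section \<open>Convergence of the scheme\<close>

lemma extrapolation_eq: "extrapolation u n = ext u n"
  by (simp add: fun_eq_iff extrapolation_def ext_def)

lemma ens_mean_eq: "ens_mean J u n = emean J u n"
  by (simp add: fun_eq_iff ens_mean_def emean_def sum_fun_apply extrapolation_eq)

lemma fluctuation_eq: "fluctuation J u j n = fluc J u j n"
  by (simp add: fun_eq_iff fluctuation_def fluc_def extrapolation_eq ens_mean_eq)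

context mhd_domain
begin

text \<open>The locale predicates used below are introduced by hand and mention
  \<open>semi_inner.nrm\<close> of the raw forms; these equations translate it.\<close>

lemma nrm_L2: "semi_inner.nrm (L2_inner \<Omega>) = (L2_norm \<Omega> :: 'd vector_field \<Rightarrow> real)"
  by (rule HOL.ext)
    (simp only: semi_inner.nrm_def[OF E.L.semi_inner_axioms], simp only: L2_norm_def L2_inner_def power2_norm_eq_inner)

lemma nrm_grad: "semi_inner.nrm (\<lambda>u v :: 'd vector_field. L2_inner \<Omega> (grad \<Omega> u) (grad \<Omega> v)) = h1"
  by (rule HOL.ext)
    (simp only: semi_inner.nrm_def[OF E.G.semi_inner_axioms], simp only: L2_norm_def L2_inner_def power2_norm_eq_inner)

text \<open>\<open>L \<epsilon>\<close> is the price of a small factor \<open>\<epsilon>\<close> in front of the \<open>H\<^sup>1\<close> norm in the convection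
  terms.\<close>

definition controlled ::
    "real \<Rightarrow> nat \<Rightarrow> (real \<Rightarrow> 'd vector_field) \<Rightarrow> (real \<Rightarrow> 'd vector_field) \<Rightarrow> real \<Rightarrow> (real \<Rightarrow> real) \<Rightarrow> bool" where
  "controlled T m u ut B L \<longleftrightarrow> 0 \<le> B \<and> (\<forall>\<epsilon>. 0 \<le> L \<epsilon>) \<and>
     (\<forall>t\<in>{0..T}. h1 (u t) \<le> B) \<and>
     (\<forall>s\<in>{0..T}. \<forall>t\<in>{0..T}. h1 (u t - u s) \<le> B * \<bar>t - s\<bar>) \<and>
     (\<forall>t d. 0 < d \<longrightarrow> 0 \<le> t - d \<longrightarrow> t + d \<le> T \<longrightarrow> h1 (u (t + d) - 2 *\<^sub>R u t + u (t - d)) \<le> B * d\<^sup>2) \<and>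
     (\<forall>t d. \<forall>f\<in>L2_space \<Omega>. 0 < d \<longrightarrow> 0 \<le> t - d \<longrightarrow> t + d \<le> T \<longrightarrow>
        \<bar>L2_inner \<Omega> (ut (t + d)) f
          - (3 * L2_inner \<Omega> (u (t + d)) f - 4 * L2_inner \<Omega> (u t) f + L2_inner \<Omega> (u (t - d)) f) / (2 * d)\<bar>
        \<le> B * d\<^sup>2 * L2_norm \<Omega> f) \<and>
     (AE t in lebesgue_on {0<..<T}. u t \<in> Sobolev \<Omega> m \<and> Sobolev_norm \<Omega> m (u t) \<le> B) \<and>
     (\<forall>\<epsilon>>0. \<forall>t\<in>{0..T}. \<forall>x\<in>H1b. \<forall>w\<in>H1b.
        \<bar>trilinear \<Omega> x (u t) w\<bar> \<le> (\<epsilon> * h1 x + L \<epsilon> * L2_norm \<Omega> x) * h1 w \<and>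
        \<bar>trilinear \<Omega> (u t) x w\<bar> \<le> (\<epsilon> * h1 x + L \<epsilon> * L2_norm \<Omega> x) * h1 w)"

lemma controlledD:
  assumes "controlled T m u ut B L"
  shows "0 \<le> B" and "0 \<le> L \<epsilon>" and "t \<in> {0..T} \<Longrightarrow> h1 (u t) \<le> B"
    and "s \<in> {0..T} \<Longrightarrow> t \<in> {0..T} \<Longrightarrow> h1 (u t - u s) \<le> B * \<bar>t - s\<bar>"
    and "0 < d \<Longrightarrow> 0 \<le> t - d \<Longrightarrow> t + d \<le> T \<Longrightarrow> h1 (u (t + d) - 2 *\<^sub>R u t + u (t - d)) \<le> B * d\<^sup>2"
    and "f \<in> L2_space \<Omega> \<Longrightarrow> 0 < d \<Longrightarrow> 0 \<le> t - d \<Longrightarrow> t + d \<le> T \<Longrightarrow>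
        \<bar>L2_inner \<Omega> (ut (t + d)) f
          - (3 * L2_inner \<Omega> (u (t + d)) f - 4 * L2_inner \<Omega> (u t) f + L2_inner \<Omega> (u (t - d)) f) / (2 * d)\<bar>
        \<le> B * d\<^sup>2 * L2_norm \<Omega> f"
    and "AE t in lebesgue_on {0<..<T}. u t \<in> Sobolev \<Omega> m \<and> Sobolev_norm \<Omega> m (u t) \<le> B"
    and "0 < \<epsilon> \<Longrightarrow> t \<in> {0..T} \<Longrightarrow> x \<in> H1b \<Longrightarrow> w \<in> H1b \<Longrightarrow>
        \<bar>trilinear \<Omega> x (u t) w\<bar> \<le> (\<epsilon> * h1 x + L \<epsilon> * L2_norm \<Omega> x) * h1 w"
    and "0 < \<epsilon> \<Longrightarrow> t \<in> {0..T} \<Longrightarrow> x \<in> H1b \<Longrightarrow> w \<in> H1b \<Longrightarrow>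
        \<bar>trilinear \<Omega> (u t) x w\<bar> \<le> (\<epsilon> * h1 x + L \<epsilon> * L2_norm \<Omega> x) * h1 w"
proof -
  note c = assms[unfolded controlled_def]
  note c2 = c[THEN conjunct2] note c3 = c2[THEN conjunct2] note c4 = c3[THEN conjunct2]
  note c5 = c4[THEN conjunct2] note c6 = c5[THEN conjunct2] note c7 = c6[THEN conjunct2] note c8 = c7[THEN conjunct2]
  show "0 \<le> B" by (rule c[THEN conjunct1])
  show "0 \<le> L \<epsilon>" by (rule c2[THEN conjunct1, rule_format])
  show "t \<in> {0..T} \<Longrightarrow> h1 (u t) \<le> B" by (rule c3[THEN conjunct1, rule_format])
  show "s \<in> {0..T} \<Longrightarrow> t \<in> {0..T} \<Longrightarrow> h1 (u t - u s) \<le> B * \<bar>t - s\<bar>"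
    by (rule c4[THEN conjunct1, rule_format])
  show "0 < d \<Longrightarrow> 0 \<le> t - d \<Longrightarrow> t + d \<le> T \<Longrightarrow> h1 (u (t + d) - 2 *\<^sub>R u t + u (t - d)) \<le> B * d\<^sup>2"
    by (rule c5[THEN conjunct1, rule_format])
  show "f \<in> L2_space \<Omega> \<Longrightarrow> 0 < d \<Longrightarrow> 0 \<le> t - d \<Longrightarrow> t + d \<le> T \<Longrightarrow>
        \<bar>L2_inner \<Omega> (ut (t + d)) f
          - (3 * L2_inner \<Omega> (u (t + d)) f - 4 * L2_inner \<Omega> (u t) f + L2_inner \<Omega> (u (t - d)) f) / (2 * d)\<bar>
        \<le> B * d\<^sup>2 * L2_norm \<Omega> f"
    by (rule c6[THEN conjunct1, rule_format])
  show "AE t in lebesgue_on {0<..<T}. u t \<in> Sobolev \<Omega> m \<and> Sobolev_norm \<Omega> m (u t) \<le> B"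
    by (rule c7[THEN conjunct1])
  show "0 < \<epsilon> \<Longrightarrow> t \<in> {0..T} \<Longrightarrow> x \<in> H1b \<Longrightarrow> w \<in> H1b \<Longrightarrow>
        \<bar>trilinear \<Omega> x (u t) w\<bar> \<le> (\<epsilon> * h1 x + L \<epsilon> * L2_norm \<Omega> x) * h1 w"
    by (rule c8[rule_format, THEN conjunct1])
  show "0 < \<epsilon> \<Longrightarrow> t \<in> {0..T} \<Longrightarrow> x \<in> H1b \<Longrightarrow> w \<in> H1b \<Longrightarrow>
        \<bar>trilinear \<Omega> (u t) x w\<bar> \<le> (\<epsilon> * h1 x + L \<epsilon> * L2_norm \<Omega> x) * h1 w"
    by (rule c8[rule_format, THEN conjunct2])
qed

lemma controlled_mono:
  assumes "controlled T m u ut B L" "B \<le> B'" "\<And>\<epsilon>. L \<epsilon> \<le> L' \<epsilon>"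
  shows "controlled T m u ut B' L'"
proof -
  have n: "0 \<le> L2_norm \<Omega> f" for f :: "'d vector_field" unfolding L2_norm_def by simp
  have n': "0 \<le> h1 f" for f :: "'d vector_field" unfolding L2_norm_def by simp
  have s: "B * c \<le> B' * c" if "0 \<le> c" for c by (rule mult_right_mono[OF assms(2) that])
  have l: "(\<epsilon> * h1 x + L \<epsilon> * L2_norm \<Omega> x) * h1 w \<le> (\<epsilon> * h1 x + L' \<epsilon> * L2_norm \<Omega> x) * h1 w"
    for x w :: "'d vector_field" and \<epsilon>
    by (intro mult_right_mono add_left_mono assms(3) n n')
  note c = controlledD[OF assms(1)]
  show ?thesis unfolding controlled_def
  proof (intro conjI allI ballI impI)
    show "0 \<le> B'" using c(1) assms(2) by linarith
    show "0 \<le> L' \<epsilon>" for \<epsilon> by (rule order_trans[OF c(2) assms(3)])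
    show "h1 (u t) \<le> B'" if "t \<in> {0..T}" for t by (rule order_trans[OF c(3)[OF that] assms(2)])
    show "h1 (u t - u s) \<le> B' * \<bar>t - s\<bar>" if "s \<in> {0..T}" "t \<in> {0..T}" for s t
      by (rule order_trans[OF c(4)[OF that] s]) simp
    show "h1 (u (t + d) - 2 *\<^sub>R u t + u (t - d)) \<le> B' * d\<^sup>2" if "0 < d" "0 \<le> t - d" "t + d \<le> T" for t d
      by (rule order_trans[OF c(5)[OF that] s]) simp
    show "\<bar>L2_inner \<Omega> (ut (t + d)) f
          - (3 * L2_inner \<Omega> (u (t + d)) f - 4 * L2_inner \<Omega> (u t) f + L2_inner \<Omega> (u (t - d)) f) / (2 * d)\<bar>
        \<le> B' * d\<^sup>2 * L2_norm \<Omega> f" if "f \<in> L2_space \<Omega>" "0 < d" "0 \<le> t - d" "t + d \<le> T" for t d f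
      by (rule order_trans[OF c(6)[OF that]]) (intro mult_right_mono s n zero_le_power2)
    have "AE t in lebesgue_on {0<..<T}. u t \<in> Sobolev \<Omega> m \<and> Sobolev_norm \<Omega> m (u t) \<le> B" by (rule c(7))
    then show "AE t in lebesgue_on {0<..<T}. u t \<in> Sobolev \<Omega> m \<and> Sobolev_norm \<Omega> m (u t) \<le> B'"
      by eventually_elim (use assms(2) in auto)
    fix \<epsilon> t :: real and x w :: "'d vector_field"
    assume a: "0 < \<epsilon>" "t \<in> {0..T}" "x \<in> H1b" "w \<in> H1b"
    show "\<bar>trilinear \<Omega> x (u t) w\<bar> \<le> (\<epsilon> * h1 x + L' \<epsilon> * L2_norm \<Omega> x) * h1 w"
      by (rule order_trans[OF c(8)[OF a] l])
    show "\<bar>trilinear \<Omega> (u t) x w\<bar> \<le> (\<epsilon> * h1 x + L' \<epsilon> * L2_norm \<Omega> x) * h1 w"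
      by (rule order_trans[OF c(9)[OF a] l])
  qed
qed

lemma controlled_ex:
  assumes T: "0 < T" and v: "\<And>t. t \<in> {0..T} \<Longrightarrow> v t \<in> Hdiv"
    and c: "continuous_time_L2 \<Omega> T v" "continuous_time_L2 \<Omega> T vt" "weak_time_deriv \<Omega> T v vt"
    and r: "regular_solution \<Omega> T m v vt"
  shows "\<exists>B L. controlled T m v vt B L"
proof -
  have vH: "v t \<in> H10 \<Omega>" if "t \<in> {0..T}" for t using v[OF that] by (simp add: Hdiv_def)
  obtain vtt vttt where w: "weak_time_deriv \<Omega> T vt vtt" "weak_time_deriv \<Omega> T vtt vttt"
    "Linf_time T (Sobolev \<Omega> 1) (Sobolev_norm \<Omega> 1) vtt" "Linf_time T (L2_space \<Omega>) (L2_norm \<Omega>) vttt"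
    and S: "Linf_time T (Sobolev \<Omega> m) (Sobolev_norm \<Omega> m) v"
    using r unfolding regular_solution_def by (elim conjE exE)
  obtain B1 where B1: "0 \<le> B1" "AE t in lebesgue_on {0<..<T}. v t \<in> Sobolev \<Omega> m \<and> Sobolev_norm \<Omega> m (v t) \<le> B1"
    by (rule Linf_timeD[OF S])
  show ?thesis
  proof (rule time_regularity[OF T vH c w(1,2) _ _])
    fix B0 assume B0: "0 \<le> B0" "\<And>t. t \<in> {0..T} \<Longrightarrow> h1 (v t) \<le> B0"
      "\<And>s t. s \<in> {0..T} \<Longrightarrow> t \<in> {0..T} \<Longrightarrow> h1 (v t - v s) \<le> B0 * \<bar>t - s\<bar>"
      "\<And>t d. 0 < d \<Longrightarrow> 0 \<le> t - d \<Longrightarrow> t + d \<le> T \<Longrightarrow> h1 (v (t + d) - 2 *\<^sub>R v t + v (t - d)) \<le> B0 * d\<^sup>2"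
      "\<And>t d f. 0 < d \<Longrightarrow> 0 \<le> t - d \<Longrightarrow> t + d \<le> T \<Longrightarrow> f \<in> L2_space \<Omega> \<Longrightarrow>
        \<bar>L2_inner \<Omega> (vt (t + d)) f - (3 * L2_inner \<Omega> (v (t + d)) f - 4 * L2_inner \<Omega> (v t) f + L2_inner \<Omega> (v (t - d)) f) / (2 * d)\<bar>
          \<le> B0 * d\<^sup>2 * L2_norm \<Omega> f"
    define B where "B = B0 + B1"
    have B: "B0 \<le> B" "B1 \<le> B" using B0(1) B1(1) by (auto simp: B_def)
    have s: "B0 * c \<le> B * c" if "0 \<le> c" for c by (rule mult_right_mono[OF B(1) that])
    have n: "0 \<le> L2_norm \<Omega> f" for f :: "'d vector_field" unfolding L2_norm_def by simp
    have "\<exists>C\<ge>0. 0 < \<epsilon> \<longrightarrow> (\<forall>t\<in>{0..T}. \<forall>x\<in>H1b. \<forall>w\<in>H1b.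
        \<bar>trilinear \<Omega> x (v t) w\<bar> \<le> (\<epsilon> * h1 x + C * L2_norm \<Omega> x) * h1 w \<and>
        \<bar>trilinear \<Omega> (v t) x w\<bar> \<le> (\<epsilon> * h1 x + C * L2_norm \<Omega> x) * h1 w)" for \<epsilon>
    proof (cases "0 < \<epsilon>")
      case True
      from tri_split_uniform[OF T v B0(1,3) this] show ?thesis by (simp add: True)
    qed auto
    then obtain L where L: "\<And>\<epsilon>. 0 \<le> L \<epsilon>" "\<And>\<epsilon>. 0 < \<epsilon> \<Longrightarrow> (\<forall>t\<in>{0..T}. \<forall>x\<in>H1b. \<forall>w\<in>H1b.
        \<bar>trilinear \<Omega> x (v t) w\<bar> \<le> (\<epsilon> * h1 x + L \<epsilon> * L2_norm \<Omega> x) * h1 w \<and>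
        \<bar>trilinear \<Omega> (v t) x w\<bar> \<le> (\<epsilon> * h1 x + L \<epsilon> * L2_norm \<Omega> x) * h1 w)"
      by metis
    have "controlled T m v vt B L" unfolding controlled_def
    proof (intro conjI allI ballI impI)
      show "0 \<le> B" using B(1) B0(1) by linarith
      show "h1 (v t) \<le> B" if "t \<in> {0..T}" for t using B0(2)[OF that] B(1) by linarith
      show "h1 (v t - v s) \<le> B * \<bar>t - s\<bar>" if "s \<in> {0..T}" "t \<in> {0..T}" for s t
        by (rule order_trans[OF B0(3)[OF that] s]) simp
      show "h1 (v (t + d) - 2 *\<^sub>R v t + v (t - d)) \<le> B * d\<^sup>2" if "0 < d" "0 \<le> t - d" "t + d \<le> T" for t d
        by (rule order_trans[OF B0(4)[OF that] s]) simp
      show "\<bar>L2_inner \<Omega> (vt (t + d)) f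
          - (3 * L2_inner \<Omega> (v (t + d)) f - 4 * L2_inner \<Omega> (v t) f + L2_inner \<Omega> (v (t - d)) f) / (2 * d)\<bar>
        \<le> B * d\<^sup>2 * L2_norm \<Omega> f" if "f \<in> L2_space \<Omega>" "0 < d" "0 \<le> t - d" "t + d \<le> T" for t d f
        by (rule order_trans[OF B0(5)[OF that(2-4,1)]]) (intro mult_right_mono s n zero_le_power2)
      show "AE t in lebesgue_on {0<..<T}. v t \<in> Sobolev \<Omega> m \<and> Sobolev_norm \<Omega> m (v t) \<le> B"
        using B1(2) by eventually_elim (use B(2) in auto)
      show "0 \<le> L \<epsilon>" for \<epsilon> by (rule L(1))
      fix \<epsilon> t :: real and x w :: "'d vector_field"
      assume a: "0 < \<epsilon>" "t \<in> {0..T}" "x \<in> H1b" "w \<in> H1b"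
      show "\<bar>trilinear \<Omega> x (v t) w\<bar> \<le> (\<epsilon> * h1 x + L \<epsilon> * L2_norm \<Omega> x) * h1 w"
        "\<bar>trilinear \<Omega> (v t) x w\<bar> \<le> (\<epsilon> * h1 x + L \<epsilon> * L2_norm \<Omega> x) * h1 w"
        using L(2)[OF a(1), rule_format, OF a(2-4)] by auto
    qed
    then show ?thesis by blast
  qed (use w in auto)
qed

lemma controlled_uniform:
  assumes "\<And>s j. j \<in> {1..J} \<Longrightarrow> \<exists>B L. controlled T m (u s j) (ut s j) B L"
  obtains B L where "0 \<le> B" "\<And>\<epsilon>. 0 \<le> L \<epsilon>" "\<And>s j. j \<in> {1..J :: nat} \<Longrightarrow> controlled T m (u (s::bool) j) (ut s j) B L"
proof -
  have "\<exists>q. snd p \<in> {1..J} \<longrightarrow> controlled T m (u (fst p) (snd p)) (ut (fst p) (snd p)) (fst q) (snd q)" for p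
    using assms[of "snd p" "fst p"] by (cases "snd p \<in> {1..J}") auto
  then obtain g where g: "\<And>p. snd p \<in> {1..J} \<Longrightarrow>
      controlled T m (u (fst p) (snd p)) (ut (fst p) (snd p)) (fst (g p)) (snd (g p))"
    by metis
  define Bf where "Bf s j = fst (g (s, j))" for s j
  define Lf where "Lf s j = snd (g (s, j))" for s j
  have c: "controlled T m (u s j) (ut s j) (Bf s j) (Lf s j)" if "j \<in> {1..J}" for s j
    using g[of "(s, j)"] that by (simp add: Bf_def Lf_def)
  have nn: "0 \<le> Bf s j" "0 \<le> Lf s j \<epsilon>" if "j \<in> {1..J}" for s j \<epsilon>
    by (rule controlledD(1,2)[OF c[OF that]])+
  show ?thesis
  proof (rule that)
    show "0 \<le> (\<Sum>(s, j)\<in>UNIV \<times> {1..J}. Bf s j)" using nn by (auto intro!: sum_nonneg)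
    show "0 \<le> (\<Sum>(s, j)\<in>UNIV \<times> {1..J}. Lf s j \<epsilon>)" for \<epsilon> using nn by (auto intro!: sum_nonneg)
    show "controlled T m (u s j) (ut s j) (\<Sum>(s, j)\<in>UNIV \<times> {1..J}. Bf s j)
        (\<lambda>\<epsilon>. \<Sum>(s, j)\<in>UNIV \<times> {1..J}. Lf s j \<epsilon>)" if j: "j \<in> {1..J}" for s j
    proof (rule controlled_mono[OF c[OF j]])
      show "Bf s j \<le> (\<Sum>(s, j)\<in>UNIV \<times> {1..J}. Bf s j)"
        using member_le_sum[of "(s, j)" "UNIV \<times> {1..J}" "\<lambda>(s, j). Bf s j"] nn j by auto
      show "Lf s j \<epsilon> \<le> (\<Sum>(s, j)\<in>UNIV \<times> {1..J}. Lf s j \<epsilon>)" for \<epsilon>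
        using member_le_sum[of "(s, j)" "UNIV \<times> {1..J}" "\<lambda>(s, j). Lf s j \<epsilon>"] nn j by auto
    qed
  qed
qed

end

text \<open>Multiplying by the denominator covers the exceptional case: where it vanishes, the
  left-hand side is 0 and \<alpha> h^2 is nonnegative. The maximum serves as
  \<open>X\<close>.\<close>

lemma time_step_conditionD:
  assumes c: "time_step_condition \<Omega> \<alpha> \<nu> \<nu>\<^sub>m Ci Cs h dt M J v w" and n: "n \<in> {1..<M}"
    and \<alpha>: "0 < \<alpha>" and J: "1 \<le> J"
  shows "\<exists>X. (\<forall>j\<in>{1..J}. L2_norm \<Omega> (grad \<Omega> (fluctuation J v j n)) \<le> X \<and> L2_norm \<Omega> (grad \<Omega> (fluctuation J w j n)) \<le> X) \<and>
        dt * (9 * Ci\<^sup>2 * (\<nu> - \<nu>\<^sub>m)\<^sup>2 + 9 * Ci\<^sup>2 * Cs\<^sup>2 * X) \<le> \<alpha> * h\<^sup>2"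
proof -
  let ?S = "\<Union>j\<in>{1..J}. {L2_norm \<Omega> (grad \<Omega> (fluctuation J v j n)), L2_norm \<Omega> (grad \<Omega> (fluctuation J w j n))}"
  have fin: "finite ?S" by simp
  have le: "L2_norm \<Omega> (grad \<Omega> (fluctuation J v j n)) \<le> Max ?S \<and> L2_norm \<Omega> (grad \<Omega> (fluctuation J w j n)) \<le> Max ?S"
    if "j \<in> {1..J}" for j using that by (intro conjI Max_ge[OF fin]) blast+
  have "0 \<le> L2_norm \<Omega> (grad \<Omega> (fluctuation J v 1 n))" by (simp add: L2_norm_def)
  then have M0: "0 \<le> Max ?S" using le[of 1] J by (auto intro: order_trans)
  define den where "den = time_step_denominator \<Omega> \<nu> \<nu>\<^sub>m Ci Cs J v w n"
  have den: "den = 9 * Ci\<^sup>2 * (\<nu> - \<nu>\<^sub>m)\<^sup>2 + 9 * Ci\<^sup>2 * Cs\<^sup>2 * Max ?S" by (simp add: den_def time_step_denominator_def)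
  have "0 \<le> den" unfolding den using M0 by simp
  moreover have "den = 0 \<or> dt \<le> \<alpha> * h\<^sup>2 / den" using c n unfolding time_step_condition_def den_def by blast
  ultimately have "dt * den \<le> \<alpha> * h\<^sup>2"
    using \<alpha> by (cases "den = 0") (auto simp: pos_le_divide_eq)
  then show ?thesis using le unfolding den by blast
qed

context mhd_domain
begin

lemma scheme_stepD:
  assumes s: "scheme_step \<Omega> \<nu> \<nu>\<^sub>m dt J V F v w j n" and \<eta>: "\<eta> \<in> V"
    and V: "V \<subseteq> L2_space \<Omega>" and v: "v j (n + 1) \<in> V" "v j n \<in> V" "v j (n - 1) \<in> V"
  shows "(3 * L2_inner \<Omega> (v j (n + 1)) \<eta> - 4 * L2_inner \<Omega> (v j n) \<eta> + L2_inner \<Omega> (v j (n - 1)) \<eta>) / (2 * dt)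
        + (\<nu> + \<nu>\<^sub>m) / 2 * L2_inner \<Omega> (grad \<Omega> (v j (n + 1))) (grad \<Omega> \<eta>)
        + (\<nu> - \<nu>\<^sub>m) / 2 * L2_inner \<Omega> (grad \<Omega> (ext (w j) n)) (grad \<Omega> \<eta>)
        + trilinear \<Omega> (emean J w n) (v j (n + 1)) \<eta>
        + trilinear \<Omega> (fluc J w j n) (ext (v j) n) \<eta> = F \<eta>"
proof -
  have L: "\<eta> \<in> L2_space \<Omega>" "v j (n + 1) \<in> L2_space \<Omega>" "v j n \<in> L2_space \<Omega>" "v j (n - 1) \<in> L2_space \<Omega>"
    using \<eta> v V by auto
  have "(\<lambda>x. (1 / (2 * dt)) *\<^sub>R (3 *\<^sub>R v j (n + 1) x - 4 *\<^sub>R v j n x + v j (n - 1) x))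
      = (1 / (2 * dt)) *\<^sub>R (3 *\<^sub>R v j (n + 1) - 4 *\<^sub>R v j n + v j (n - 1))"
    by (rule HOL.ext) simp
  then have "L2_inner \<Omega> (\<lambda>x. (1 / (2 * dt)) *\<^sub>R (3 *\<^sub>R v j (n + 1) x - 4 *\<^sub>R v j n x + v j (n - 1) x)) \<eta>
      = (3 * L2_inner \<Omega> (v j (n + 1)) \<eta> - 4 * L2_inner \<Omega> (v j n) \<eta> + L2_inner \<Omega> (v j (n - 1)) \<eta>) / (2 * dt)"
    using L by (simp only: L2.ip_lin L2.H_add L2.H_diff L2.H_scale) simp
  then show ?thesis
    using s \<eta> unfolding scheme_step_def extrapolation_eq ens_mean_eq fluctuation_eq by auto
qed

text \<open>The pressure term drops out because the test field is divergence-free.\<close>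

lemma elsasser_momentumD:
  assumes "elsasser_momentum \<Omega> \<nu> \<nu>\<^sub>m F vt v w q" "\<eta> \<in> H10 \<Omega>" "div_free \<Omega> \<eta>"
  shows "L2_inner \<Omega> vt \<eta> + trilinear \<Omega> w v \<eta> + (\<nu> + \<nu>\<^sub>m) / 2 * L2_inner \<Omega> (grad \<Omega> v) (grad \<Omega> \<eta>)
        + (\<nu> - \<nu>\<^sub>m) / 2 * L2_inner \<Omega> (grad \<Omega> w) (grad \<Omega> \<eta>) = F \<eta>"
  using assms(1)[unfolded elsasser_momentum_def, rule_format, OF assms(2)] div_free_inner(2)[OF assms(3)]
  by simp

lemma scheme_solutionD:
  assumes "scheme_solution \<Omega> \<nu> \<nu>\<^sub>m dt M J V f\<^sub>1 f\<^sub>2 v w" "j \<in> {1..J}"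
  shows "n \<le> max 1 M \<Longrightarrow> v j n \<in> V" "n \<le> max 1 M \<Longrightarrow> w j n \<in> V"
    "n \<in> {1..<M} \<Longrightarrow> scheme_step \<Omega> \<nu> \<nu>\<^sub>m dt J V (f\<^sub>1 j (real (n + 1) * dt)) v w j n"
    "n \<in> {1..<M} \<Longrightarrow> scheme_step \<Omega> \<nu> \<nu>\<^sub>m dt J V (f\<^sub>2 j (real (n + 1) * dt)) w v j n"
  using assms unfolding scheme_solution_def by auto

lemma elsasser_solutionD:
  assumes "elsasser_solution \<Omega> T \<nu> \<nu>\<^sub>m f\<^sub>1 f\<^sub>2 v\<^sub>0 w\<^sub>0 v w v\<^sub>t w\<^sub>t q r"
  shows "t \<in> {0..T} \<Longrightarrow> v t \<in> Hdiv" "t \<in> {0..T} \<Longrightarrow> w t \<in> Hdiv"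
    "continuous_time_L2 \<Omega> T v" "continuous_time_L2 \<Omega> T w"
    "continuous_time_L2 \<Omega> T v\<^sub>t" "continuous_time_L2 \<Omega> T w\<^sub>t"
    "weak_time_deriv \<Omega> T v v\<^sub>t" "weak_time_deriv \<Omega> T w w\<^sub>t"
    "t \<in> {0<..T} \<Longrightarrow> elsasser_momentum \<Omega> \<nu> \<nu>\<^sub>m (f\<^sub>1 t) (v\<^sub>t t) (v t) (w t) (q t)"
    "t \<in> {0<..T} \<Longrightarrow> elsasser_momentum \<Omega> \<nu> \<nu>\<^sub>m (f\<^sub>2 t) (w\<^sub>t t) (w t) (v t) (r t)"
  using assms unfolding elsasser_solution_def Hdiv_def by simp_all

end

lemma initial_accuracyD:
  assumes "initial_accuracy \<Omega> \<alpha> c k h dt J u uh" "j \<in> {1..J}" "n \<in> {0, 1}"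
  shows "(L2_norm \<Omega> (u j (real n * dt) - uh j n))\<^sup>2 + \<alpha> * dt * (L2_norm \<Omega> (grad \<Omega> (u j (real n * dt) - uh j n)))\<^sup>2
        \<le> c * (h ^ (2 * k) + dt ^ 4)"
  using assms unfolding initial_accuracy_def fun_diff_def by blast

text \<open>\<open>C\<close> is solved from K being 2^(J + 2) C / (J^2 \<alpha>). Taking at least 1
  keeps it positive when K is small, and the exponential and the weights \<open>a\<close>,
  \<open>b\<close> only enlarge the right-hand side.\<close>

lemma generic_constant:
  fixes K \<alpha> T a b h t :: real
  assumes "0 < \<alpha>" "1 \<le> J" "0 \<le> T" "1 \<le> a" "1 \<le> b" "0 \<le> h" "0 \<le> t"
    and C: "C = max 1 (K * (real J)\<^sup>2 * \<alpha> / 2 ^ (J + 2))"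
  shows "K * (h + t) \<le> 2 ^ (J + 2) * C / ((real J)\<^sup>2 * \<alpha>) * exp (9 * T * C / \<alpha>) * (a * h + b * t)"
proof -
  have C1: "1 \<le> C" "K * (real J)\<^sup>2 * \<alpha> / 2 ^ (J + 2) \<le> C" unfolding C by auto
  let ?c = "2 ^ (J + 2) * C / ((real J)\<^sup>2 * \<alpha>)"
  have p: "0 < (real J)\<^sup>2 * \<alpha>" using assms by simp
  have *: "K * ((real J)\<^sup>2 * \<alpha>) \<le> 2 ^ (J + 2) * C" using C1(2) by (simp add: pos_divide_le_eq mult_ac)
  have c0: "0 \<le> ?c" using C1 p by (intro divide_nonneg_pos mult_nonneg_nonneg) auto
  have "K \<le> ?c" using * p by (simp only: pos_le_divide_eq)
  then have "K * (h + t) \<le> ?c * (h + t)" using assms by (intro mult_right_mono) auto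
  also have "\<dots> \<le> ?c * exp (9 * T * C / \<alpha>) * (a * h + b * t)"
  proof (rule mult_mono)
    have "0 \<le> 9 * T * C / \<alpha>" using assms C1 by simp
    then have "1 \<le> exp (9 * T * C / \<alpha>)" by simp
    then show "?c \<le> ?c * exp (9 * T * C / \<alpha>)" using mult_left_mono[OF _ c0] by fastforce
    show "h + t \<le> a * h + b * t"
      using mult_right_mono[of 1 a h] mult_right_mono[of 1 b t] assms by linarith
  qed (use assms c0 in auto)
  finally show ?thesis .
qed

theorem theorem3p1:
  fixes \<Omega> :: "(real ^ 'd) set"
    and T \<nu> \<nu>\<^sub>m \<alpha> C\<^sub>s C\<^sub>i \<sigma> \<beta> c :: real
    and J k :: nat
    and Mesh :: "(real ^ 'd) set set set"
    and Qh :: "(real ^ 'd) set set \<Rightarrow> 'd scalar_field set"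
    and f\<^sub>1 f\<^sub>2 :: "nat \<Rightarrow> real \<Rightarrow> 'd vector_field \<Rightarrow> real"
    and v\<^sub>0 w\<^sub>0 :: "nat \<Rightarrow> 'd vector_field"
    and v w v\<^sub>t w\<^sub>t :: "nat \<Rightarrow> real \<Rightarrow> 'd vector_field"
    and q r :: "nat \<Rightarrow> real \<Rightarrow> 'd scalar_field"
  assumes "CARD('d) = 2 \<or> CARD('d) = 3"
    and "convex_polytopal_domain \<Omega>"
    and "0 < T" and "1 \<le> J" and "CARD('d) \<le> k"
    and "\<alpha> = \<nu> + \<nu>\<^sub>m - \<bar>\<nu> - \<nu>\<^sub>m\<bar>" and "0 < \<alpha>"
    and "0 < C\<^sub>s"
    and "\<And>x y z. x \<in> H10 \<Omega> \<Longrightarrow> y \<in> H10 \<Omega> \<Longrightarrow> z \<in> H10 \<Omega> \<Longrightarrow>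
           \<bar>trilinear \<Omega> x y z\<bar>
             \<le> C\<^sub>s * L2_norm \<Omega> (grad \<Omega> x) * L2_norm \<Omega> (grad \<Omega> y) * L2_norm \<Omega> (grad \<Omega> z)"
    and "0 < \<beta>" and "0 < C\<^sub>i" and "fe_family \<Omega> k \<sigma> \<beta> C\<^sub>i c Mesh Qh"
    and "\<And>j. j \<in> {1..J} \<Longrightarrow> Linf_time T (Hm1 \<Omega>) (Hm1_norm \<Omega>) (f\<^sub>1 j)"
    and "\<And>j. j \<in> {1..J} \<Longrightarrow> Linf_time T (Hm1 \<Omega>) (Hm1_norm \<Omega>) (f\<^sub>2 j)"
    and "\<And>j. j \<in> {1..J} \<Longrightarrow>
           elsasser_solution \<Omega> T \<nu> \<nu>\<^sub>m (f\<^sub>1 j) (f\<^sub>2 j) (v\<^sub>0 j) (w\<^sub>0 j)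
             (v j) (w j) (v\<^sub>t j) (w\<^sub>t j) (q j) (r j)"
    and "\<And>j. j \<in> {1..J} \<Longrightarrow> regular_solution \<Omega> T (max 2 (k + 1)) (v j) (v\<^sub>t j)"
    and "\<And>j. j \<in> {1..J} \<Longrightarrow> regular_solution \<Omega> T (max 2 (k + 1)) (w j) (w\<^sub>t j)"
  shows
    "\<forall>C\<^sub>0. \<exists>C>0. \<forall>\<T> \<in> Mesh. \<forall>\<Delta>t M v\<^sub>h w\<^sub>h.
       let h = mesh_size \<T>;
           V = Vh \<Omega> (Xh \<Omega> k \<T>) (Qh \<T>);
           v_true = (\<lambda>j n. v j (real n * \<Delta>t))
       in 0 < \<Delta>t \<longrightarrow> real M * \<Delta>t = T \<longrightarrow>
          scheme_solution \<Omega> \<nu> \<nu>\<^sub>m \<Delta>t M J V f\<^sub>1 f\<^sub>2 v\<^sub>h w\<^sub>h \<longrightarrow>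
          initial_accuracy \<Omega> \<alpha> C\<^sub>0 k h \<Delta>t J v v\<^sub>h \<longrightarrow>
          initial_accuracy \<Omega> \<alpha> C\<^sub>0 k h \<Delta>t J w w\<^sub>h \<longrightarrow>
          time_step_condition \<Omega> \<alpha> \<nu> \<nu>\<^sub>m C\<^sub>i C\<^sub>s h \<Delta>t M J v\<^sub>h w\<^sub>h \<longrightarrow>
          (L2_norm \<Omega> (\<lambda>x. ens_mean J v_true M x - ens_mean J v\<^sub>h M x))\<^sup>2
          + \<alpha> * \<Delta>t * (\<Sum>n=2..M.
              (L2_norm \<Omega> (grad \<Omega> (\<lambda>x. ens_mean J v_true n x - ens_mean J v\<^sub>h n x)))\<^sup>2)
          \<le> 2 ^ (J + 2) * C / ((real J)\<^sup>2 * \<alpha>) * exp (9 * T * C / \<alpha>)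
            * ((\<nu>\<^sup>2 + \<nu>\<^sub>m\<^sup>2 + 1) * h ^ (2 * k) + ((\<nu> - \<nu>\<^sub>m)\<^sup>2 + 1) * \<Delta>t ^ 4)"
proof -
  note dom = convex_polytopal_domainD[OF assms(2)]
  interpret mhd_domain \<Omega> C\<^sub>s by standard (rule dom(1,2) assms(8,9); assumption?)+
  define u where "u s = (if s then v else w)" for s
  define ut where "ut s = (if s then v\<^sub>t else w\<^sub>t)" for s
  define F where "F s = (if s then f\<^sub>1 else f\<^sub>2)" for s
  have k: "2 \<le> k" "max 2 (k + 1) = k + 1" using assms(1,5) by auto
  note sol = elsasser_solutionD[OF assms(15)]
  have uH: "u s j t \<in> Hdiv" if "j \<in> {1..J}" "t \<in> {0..T}" for s j t
    using sol(1,2)[OF that] by (simp add: u_def)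
  have mom: "L2_inner \<Omega> (ut s j t) \<eta> + trilinear \<Omega> (u (\<not> s) j t) (u s j t) \<eta>
      + (\<nu> + \<nu>\<^sub>m) / 2 * L2_inner \<Omega> (grad \<Omega> (u s j t)) (grad \<Omega> \<eta>)
      + (\<nu> - \<nu>\<^sub>m) / 2 * L2_inner \<Omega> (grad \<Omega> (u (\<not> s) j t)) (grad \<Omega> \<eta>) = F s j t \<eta>"
    if "j \<in> {1..J}" "t \<in> {0<..T}" "\<eta> \<in> H1b \<inter> Hdiv" for s j t \<eta>
  proof -
    have \<eta>: "\<eta> \<in> H10 \<Omega>" "div_free \<Omega> \<eta>" using that(3) by (auto simp: Hdiv_def)
    show ?thesis
      using elsasser_momentumD[OF sol(9)[OF that(1,2)] \<eta>] elsasser_momentumD[OF sol(10)[OF that(1,2)] \<eta>]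
      by (cases s) (simp_all add: u_def ut_def F_def)
  qed
  have "\<exists>B L. controlled T (k + 1) (u s j) (ut s j) B L" if j: "j \<in> {1..J}" for s j
  proof (cases s)
    case True
    show ?thesis unfolding u_def ut_def using True
      controlled_ex[OF assms(3) sol(1)[OF j] sol(3)[OF j] sol(5)[OF j] sol(7)[OF j] assms(16)[OF j, unfolded k(2)]] by simp
  next
    case False
    show ?thesis unfolding u_def ut_def using False
      controlled_ex[OF assms(3) sol(2)[OF j] sol(4)[OF j] sol(6)[OF j] sol(8)[OF j] assms(17)[OF j, unfolded k(2)]] by simp
  qed
  then obtain B L where B: "0 \<le> B" and L: "\<And>\<epsilon>. 0 \<le> L \<epsilon>"
    and con: "\<And>s j. j \<in> {1..J} \<Longrightarrow> controlled T (k + 1) (u s j) (ut s j) B L"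
    by (rule controlled_uniform[of J T "k + 1" u ut]) blast+
  note con = controlledD[OF con]
  show ?thesis
  proof (intro allI)
    fix C\<^sub>0 :: real
    \<comment> \<open>\<open>D\<close> bounds the mesh size of every triangulation of the domain,
      and the maximum with 1 makes its positivity immediate. The initial constant is replaced below
      by its maximum with 0, since it ranges over all reals.\<close>
    define D where "D = max 1 (diameter (closure \<Omega>))"
    have data: "elsasser_data (H10 \<Omega>) (L2_inner \<Omega>) (\<lambda>u v. L2_inner \<Omega> (grad \<Omega> u) (grad \<Omega> v)) H1b Hdiv
      (trilinear \<Omega>) C\<^sub>s CP \<nu> \<nu>\<^sub>m \<alpha> T B (\<bar>c\<bar> * \<bar>B\<bar>) D C\<^sub>i (max C\<^sub>0 0) J k u
      (\<lambda>s j t \<eta>. L2_inner \<Omega> (ut s j t) \<eta>) F L"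
    proof (intro elsasser_data.intro[OF E.elsasser_forms_axioms] elsasser_data_axioms.intro, unfold nrm_L2 nrm_grad)
      show "u s j t \<in> H10 \<Omega> \<inter> Hdiv" if "j \<in> {1..J}" "t \<in> {0..T}" for s j t
        using uH[OF that, of s] by (auto simp: Hdiv_def)
      show "\<bar>L2_inner \<Omega> (ut s j (t + d)) f
          - (3 * L2_inner \<Omega> (u s j (t + d)) f - 4 * L2_inner \<Omega> (u s j t) f + L2_inner \<Omega> (u s j (t - d)) f) / (2 * d)\<bar>
        \<le> B * d\<^sup>2 * L2_norm \<Omega> f"
        if "j \<in> {1..J}" "0 < d" "0 \<le> t - d" "t + d \<le> T" "f \<in> H1b" for s j t d f
        by (rule con(6)[OF that(1) H1bD(3)[OF that(5)] that(2-4)])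
      show "\<bar>trilinear \<Omega> \<xi> (u s j t) x\<bar> \<le> (\<epsilon> * h1 \<xi> + L \<epsilon> * L2_norm \<Omega> \<xi>) * h1 x"
        "\<bar>trilinear \<Omega> (u s j t) \<xi> x\<bar> \<le> (\<epsilon> * h1 \<xi> + L \<epsilon> * L2_norm \<Omega> \<xi>) * h1 x"
        if "0 < \<epsilon>" "j \<in> {1..J}" "t \<in> {0..T}" "\<xi> \<in> H1b" "x \<in> H1b" for \<epsilon> s j t \<xi> x
        by (rule con(8)[OF that(2,1,3-5)], rule con(9)[OF that(2,1,3-5)])
    qed (fact assms con mom B L k | simp add: D_def)+
    interpret d: elsasser_data "H10 \<Omega>" "L2_inner \<Omega>" "\<lambda>u v. L2_inner \<Omega> (grad \<Omega> u) (grad \<Omega> v)" H1b Hdiv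
      "trilinear \<Omega>" C\<^sub>s CP \<nu> \<nu>\<^sub>m \<alpha> T B "\<bar>c\<bar> * \<bar>B\<bar>" D C\<^sub>i "max C\<^sub>0 0" J k u
      "\<lambda>s j t \<eta>. L2_inner \<Omega> (ut s j t) \<eta>" F L
      by (rule data)
    \<comment> \<open>\<open>d.Kfinal\<close> is built from the data alone, before a mesh, a step
      size or a discrete solution is introduced; this gives the required order of
      quantifiers.\<close>
    define C where "C = max 1 (d.Kfinal * (real J)\<^sup>2 * \<alpha> / 2 ^ (J + 2))"
    have "0 < C" by (simp add: C_def)
    moreover have "(L2_norm \<Omega> (\<lambda>x. ens_mean J (\<lambda>j n. v j (real n * dt)) M x - ens_mean J v\<^sub>h M x))\<^sup>2
        + \<alpha> * dt * (\<Sum>n=2..M.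
            (L2_norm \<Omega> (grad \<Omega> (\<lambda>x. ens_mean J (\<lambda>j n. v j (real n * dt)) n x - ens_mean J v\<^sub>h n x)))\<^sup>2)
        \<le> 2 ^ (J + 2) * C / ((real J)\<^sup>2 * \<alpha>) * exp (9 * T * C / \<alpha>)
          * ((\<nu>\<^sup>2 + \<nu>\<^sub>m\<^sup>2 + 1) * mesh_size \<T> ^ (2 * k) + ((\<nu> - \<nu>\<^sub>m)\<^sup>2 + 1) * dt ^ 4)"
      if \<T>: "\<T> \<in> Mesh" and dt: "0 < dt" and M: "real M * dt = T"
        and sch: "scheme_solution \<Omega> \<nu> \<nu>\<^sub>m dt M J (Vh \<Omega> (Xh \<Omega> k \<T>) (Qh \<T>)) f\<^sub>1 f\<^sub>2 v\<^sub>h w\<^sub>h"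
        and iv: "initial_accuracy \<Omega> \<alpha> C\<^sub>0 k (mesh_size \<T>) dt J v v\<^sub>h"
        and iw: "initial_accuracy \<Omega> \<alpha> C\<^sub>0 k (mesh_size \<T>) dt J w w\<^sub>h"
        and step: "time_step_condition \<Omega> \<alpha> \<nu> \<nu>\<^sub>m C\<^sub>i C\<^sub>s (mesh_size \<T>) dt M J v\<^sub>h w\<^sub>h"
      for \<T> dt M v\<^sub>h w\<^sub>h
    proof -
      have fe: "regular_triangulation \<Omega> \<sigma> \<T>" "\<forall>v\<in>Vh \<Omega> (Xh \<Omega> k \<T>) (Qh \<T>). div_free \<Omega> v"
        "inverse_inequality \<Omega> C\<^sub>i (mesh_size \<T>) (Xh \<Omega> k \<T>)"
        "approximation_properties \<Omega> k c (mesh_size \<T>) (Xh \<Omega> k \<T>) (Qh \<T>)"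
        using bspec[OF assms(12)[unfolded fe_family_def] \<T>] by simp_all
      interpret m: mhd_mesh \<Omega> C\<^sub>s k \<sigma> C\<^sub>i c \<T> "Qh \<T>"
      proof
        show "\<Omega> \<noteq> {}" by (rule dom(3))
        show "div_free \<Omega> x" if "x \<in> Vh \<Omega> (Xh \<Omega> k \<T>) (Qh \<T>)" for x by (rule bspec[OF fe(2) that])
      qed (fact fe)+
      define uh where "uh s = (if s then v\<^sub>h else w\<^sub>h)" for s
      note schD = scheme_solutionD[OF sch]
      have uhV: "uh s j n \<in> m.V" if "j \<in> {1..J}" "n \<le> max 1 M" for s j n
        using schD(1,2)[OF that] by (simp add: uh_def)
      have VL2: "m.V \<subseteq> L2_space \<Omega>" using m.V_L2 by blast
      have uL2: "u s j t \<in> L2_space \<Omega>" if "j \<in> {1..J}" "t \<in> {0..T}" for s j t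
        using uH[OF that, of s] H10_L2 by (auto simp: Hdiv_def)
      have disc: "elsasser_discrete (H10 \<Omega>) (L2_inner \<Omega>) (\<lambda>u v. L2_inner \<Omega> (grad \<Omega> u) (grad \<Omega> v)) H1b Hdiv
        (trilinear \<Omega>) C\<^sub>s CP \<nu> \<nu>\<^sub>m \<alpha> T B (\<bar>c\<bar> * \<bar>B\<bar>) D C\<^sub>i (max C\<^sub>0 0) J k u
        (\<lambda>s j t \<eta>. L2_inner \<Omega> (ut s j t) \<eta>) F L m.V (mesh_size \<T>) dt M (\<lambda>s j t. m.Pr (u s j t)) uh"
      proof (intro elsasser_discrete.intro[OF data] elsasser_discrete_axioms.intro, unfold nrm_L2 nrm_grad)
        show "subspace m.V" by (rule m.subspace_V)
        show "m.V \<subseteq> H1b" "m.V \<subseteq> Hdiv" using m.V_H1b m.V_Hdiv by auto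
        show "0 < mesh_size \<T>" by (rule m.mesh_pos)
        show "mesh_size \<T> \<le> D" using m.mesh_le by (simp add: D_def)
        show "h1 x \<le> C\<^sub>i / mesh_size \<T> * L2_norm \<Omega> x" if "x \<in> m.V" for x by (rule m.inverse_V[OF that])
        show "m.Pr (u s j t) \<in> m.V" if "j \<in> {1..J}" "t \<in> {0..T}" for s j t
          by (rule m.Pr_V[OF uL2[OF that]])
        show "L2_inner \<Omega> (u s j t - m.Pr (u s j t)) x = 0" if "j \<in> {1..J}" "t \<in> {0..T}" "x \<in> m.V" for s j t x
          by (rule m.Pr_orth[OF uL2[OF that(1,2)] that(3)])
        show "h1 (u s j t - m.Pr (u s j t)) \<le> \<bar>c\<bar> * \<bar>B\<bar> * mesh_size \<T> ^ k" if "j \<in> {1..J}" "t \<in> {0..T}" for s j t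
          by (rule m.Pr_approx[OF assms(3) uH[OF that(1)] B con(4)[OF that(1)] con(7)[OF that(1)] that(2)])
        show "(3 * L2_inner \<Omega> (uh s j (n + 1)) x - 4 * L2_inner \<Omega> (uh s j n) x + L2_inner \<Omega> (uh s j (n - 1)) x) / (2 * dt)
          + (\<nu> + \<nu>\<^sub>m) / 2 * L2_inner \<Omega> (grad \<Omega> (uh s j (n + 1))) (grad \<Omega> x)
          + (\<nu> - \<nu>\<^sub>m) / 2 * L2_inner \<Omega> (grad \<Omega> (ext (uh (\<not> s) j) n)) (grad \<Omega> x)
          + trilinear \<Omega> (emean J (uh (\<not> s)) n) (uh s j (n + 1)) x
          + trilinear \<Omega> (fluc J (uh (\<not> s)) j n) (ext (uh s j) n) x = F s j (real (n + 1) * dt) x"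
          if j: "j \<in> {1..J}" and n: "n \<in> {1..<M}" and x: "x \<in> m.V" for s j n x
        proof -
          have ns: "n + 1 \<le> max 1 M" "n \<le> max 1 M" "n - 1 \<le> max 1 M" using n by auto
          note a = scheme_stepD[OF schD(3)[OF j n] x VL2 schD(1)[OF j ns(1)] schD(1)[OF j ns(2)] schD(1)[OF j ns(3)]]
          note b = scheme_stepD[OF schD(4)[OF j n] x VL2 schD(2)[OF j ns(1)] schD(2)[OF j ns(2)] schD(2)[OF j ns(3)]]
          show ?thesis
          proof (cases s)
            case True
            then show ?thesis using a by (simp only: uh_def F_def if_True if_False not_True_eq_False)
          next
            case False
            then show ?thesis using b by (simp only: uh_def F_def if_True if_False not_False_eq_True)
          qed
        qed
        show "(L2_norm \<Omega> (u s j (real n * dt) - uh s j n))\<^sup>2 + \<alpha> * dt * (h1 (u s j (real n * dt) - uh s j n))\<^sup>2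
          \<le> max C\<^sub>0 0 * (mesh_size \<T> ^ (2 * k) + dt ^ 4)" if "j \<in> {1..J}" "n \<in> {0, 1}" for s j n
        proof (rule order_trans)
          show "(L2_norm \<Omega> (u s j (real n * dt) - uh s j n))\<^sup>2 + \<alpha> * dt * (h1 (u s j (real n * dt) - uh s j n))\<^sup>2
            \<le> C\<^sub>0 * (mesh_size \<T> ^ (2 * k) + dt ^ 4)"
            using initial_accuracyD[OF iv that] initial_accuracyD[OF iw that] by (cases s) (simp_all only: u_def uh_def if_True if_False)
          show "C\<^sub>0 * (mesh_size \<T> ^ (2 * k) + dt ^ 4) \<le> max C\<^sub>0 0 * (mesh_size \<T> ^ (2 * k) + dt ^ 4)"
            using dt m.mesh_pos by (intro mult_right_mono) auto
        qed
        show "\<exists>X. (\<forall>s. \<forall>j\<in>{1..J}. h1 (fluc J (uh s) j n) \<le> X) \<and>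
          dt * (9 * C\<^sub>i\<^sup>2 * (\<nu> - \<nu>\<^sub>m)\<^sup>2 + 9 * C\<^sub>i\<^sup>2 * C\<^sub>s\<^sup>2 * X) \<le> \<alpha> * (mesh_size \<T>)\<^sup>2" if n: "n \<in> {1..<M}" for n
        proof -
          obtain X where X: "\<forall>j\<in>{1..J}. h1 (fluctuation J v\<^sub>h j n) \<le> X \<and> h1 (fluctuation J w\<^sub>h j n) \<le> X"
            "dt * (9 * C\<^sub>i\<^sup>2 * (\<nu> - \<nu>\<^sub>m)\<^sup>2 + 9 * C\<^sub>i\<^sup>2 * C\<^sub>s\<^sup>2 * X) \<le> \<alpha> * (mesh_size \<T>)\<^sup>2"
            using time_step_conditionD[OF step n assms(7,4)] by (elim exE conjE)
          have "h1 (fluc J (uh s) j n) \<le> X" if "j \<in> {1..J}" for s j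
            using X(1)[rule_format, OF that] by (simp add: uh_def fluctuation_eq)
          then show ?thesis using X(2) by (intro exI[of _ X]) simp
        qed
      qed (fact dt M uhV)+
      have "(L2_norm \<Omega> (emean J (\<lambda>j n. v j (real n * dt)) M - emean J v\<^sub>h M))\<^sup>2
          + \<alpha> * dt * (\<Sum>n=2..M. (h1 (emean J (\<lambda>j n. v j (real n * dt)) n - emean J v\<^sub>h n))\<^sup>2)
          \<le> d.Kfinal * (mesh_size \<T> ^ (2 * k) + dt ^ 4)"
      proof -
        have "elsasser_discrete.U u dt True = (\<lambda>j n. v j (real n * dt))"
          by (intro HOL.ext) (simp add: elsasser_discrete.U_def[OF disc] u_def)
        then show ?thesis
          using elsasser_discrete.convergence[OF disc, of True] unfolding nrm_L2 nrm_grad by (simp add: uh_def)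
      qed
      also have "\<dots> \<le> 2 ^ (J + 2) * C / ((real J)\<^sup>2 * \<alpha>) * exp (9 * T * C / \<alpha>)
          * ((\<nu>\<^sup>2 + \<nu>\<^sub>m\<^sup>2 + 1) * mesh_size \<T> ^ (2 * k) + ((\<nu> - \<nu>\<^sub>m)\<^sup>2 + 1) * dt ^ 4)"
        using assms(3) m.mesh_pos by (intro generic_constant[OF assms(7,4) _ _ _ _ _ C_def]) auto
      finally show ?thesis unfolding ens_mean_eq fun_diff_def .
    qed
    ultimately show "\<exists>C>0. \<forall>\<T> \<in> Mesh. \<forall>\<Delta>t M v\<^sub>h w\<^sub>h.
       let h = mesh_size \<T>;
           V = Vh \<Omega> (Xh \<Omega> k \<T>) (Qh \<T>);
           v_true = (\<lambda>j n. v j (real n * \<Delta>t))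
       in 0 < \<Delta>t \<longrightarrow> real M * \<Delta>t = T \<longrightarrow>
          scheme_solution \<Omega> \<nu> \<nu>\<^sub>m \<Delta>t M J V f\<^sub>1 f\<^sub>2 v\<^sub>h w\<^sub>h \<longrightarrow>
          initial_accuracy \<Omega> \<alpha> C\<^sub>0 k h \<Delta>t J v v\<^sub>h \<longrightarrow>
          initial_accuracy \<Omega> \<alpha> C\<^sub>0 k h \<Delta>t J w w\<^sub>h \<longrightarrow>
          time_step_condition \<Omega> \<alpha> \<nu> \<nu>\<^sub>m C\<^sub>i C\<^sub>s h \<Delta>t M J v\<^sub>h w\<^sub>h \<longrightarrow>
          (L2_norm \<Omega> (\<lambda>x. ens_mean J v_true M x - ens_mean J v\<^sub>h M x))\<^sup>2
          + \<alpha> * \<Delta>t * (\<Sum>n=2..M.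
              (L2_norm \<Omega> (grad \<Omega> (\<lambda>x. ens_mean J v_true n x - ens_mean J v\<^sub>h n x)))\<^sup>2)
          \<le> 2 ^ (J + 2) * C / ((real J)\<^sup>2 * \<alpha>) * exp (9 * T * C / \<alpha>)
            * ((\<nu>\<^sup>2 + \<nu>\<^sub>m\<^sup>2 + 1) * h ^ (2 * k) + ((\<nu> - \<nu>\<^sub>m)\<^sup>2 + 1) * \<Delta>t ^ 4)"
      unfolding Let_def by (intro exI[of _ C] conjI ballI allI impI)
  qed
qed

end
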